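(* Suppose $p>0$ a.e. on $(a,b)$ and that $T_0$ is bounded from below by $\gamma_0\in\mathbb R$, $T_0\ge\gamma_0I$. Let $\mu\in\mathbb R$ and let $g_a,g_b$ be functions satisfying $g_a,g_b,g_a^{[1]},g_b^{[1]}\in AC_{\mathrm{loc}}((a,b))$, $g_a>0$ near $a$, $g_b>0$ near $b$, $$\int_a\frac{dx}{p(x)g_a(x)^2}=\int^b\frac{dx}{p(x)g_b(x)^2}=\infty,$$ and $$q\ge\mu r-s\frac{g_a^{[1]}}{g_a}+\frac{(g_a^{[1]})'}{g_a}\ \text{ a.e. near }a,\qquad q\ge\mu r-s\frac{g_b^{[1]}}{g_b}+\frac{(g_b^{[1]})'}{g_b}\ \text{ a.e. near }b.$$ Then the Friedrichs extension $S_F$ of $T_0$ is characterized by $S_Ff=\tau f$ for $$f\in\operatorname{dom}(S_F)=\left\{g\in\operatorname{dom}(T_{\max})\,\middle|\,\int_apg_a^2\left|\left(\frac g{g_a}\right)'\right|^2dx<\infty,\ \int^bpg_b^2\left|\left(\frac g{g_b}\right)'\right|^2dx<\infty\right\}.$$ In particular, for every $f\in\operatorname{dom}(S_F)$, $$\int_a\left|q-\frac{(g_a^{[1]})'}{g_a}+s\frac{g_a^{[1]}}{g_a}\right||f|^2dx<\infty,\qquad\int^b\left|q-\frac{(g_b^{[1]})'}{g_b}+s\frac{g_b^{[1]}}{g_b}\right||f|^2dx<\infty.$$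
   Context: Setting. $(a,b)\subseteq\mathbb R$ is an open interval (possibly unbounded); $p,q,r,s$ are Lebesgue measurable and real-valued a.e. on $(a,b)$, with $p^{-1},q,r,s\in L^1_{\mathrm{loc}}((a,b);dx)$, $r>0$ and $p\neq0$ a.e. For $f\in AC_{\mathrm{loc}}((a,b))$ put $f^{[1]}=p(f'+sf)$, $\mathfrak D_\tau=\{f\in AC_{\mathrm{loc}}((a,b)) : f^{[1]}\in AC_{\mathrm{loc}}((a,b))\}$, and $\tau f=\frac1r\big(-(f^{[1]})'+sf^{[1]}+qf\big)$ for $f\in\mathfrak D_\tau$. In $L^2((a,b);r(x)dx)$ the maximal operator is $T_{\max}f=\tau f$, $\operatorname{dom}(T_{\max})=\{g\in L^2((a,b);r\,dx): g\in\mathfrak D_\tau,\ \tau g\in L^2((a,b);r\,dx)\}$; $T_0$ is the restriction of $T_{\max}$ to functions with compact support in $(a,b)$ (densely defined, symmetric, with $T_0^*=T_{\max}$). The functions $g_a,g_b$ are real-valued. The notations $\int_a$ and $\int^b$ denote integration over a sufficiently small neighborhood $(a,c)$ of $a$, respectively $(d,b)$ of $b$. When $p>0$ a.e., the existence of $\mu,g_a,g_b$ as in the claim is equivalent to $T_0$ being bounded from below. The Friedrichs extension $S_F$ of $T_0$ is the self-adjoint operator associated with the closure of the form $(f,g)\mapsto\langle f,T_0g\rangle$, $f,g\in\operatorname{dom}(T_0)$. *)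

theory Defs
  imports "HOL-Analysis.Analysis"
begin

section \<open>Absolutely continuous functions\<close>

definition abs_continuous_on_Icc :: "real \<Rightarrow> real \<Rightarrow> (real \<Rightarrow> 'a::real_normed_vector) \<Rightarrow> bool" where
  "abs_continuous_on_Icc c d f \<longleftrightarrow>
     (\<forall>\<epsilon>>0. \<exists>\<delta>>0. \<forall>I::(real \<times> real) set.
        finite I \<and> (\<forall>(u, v)\<in>I. c \<le> u \<and> u \<le> v \<and> v \<le> d) \<and>
        pairwise (\<lambda>(u, v) (u', v'). {u<..<v} \<inter> {u'<..<v'} = {}) I \<and>
        (\<Sum>(u, v)\<in>I. v - u) < \<delta>
        \<longrightarrow> (\<Sum>(u, v)\<in>I. norm (f v - f u)) < \<epsilon>)"

definition AC_loc :: "ereal \<Rightarrow> ereal \<Rightarrow> (real \<Rightarrow> 'a::real_normed_vector) set" where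
  "AC_loc a b = {f. \<forall>c d. {c..d} \<subseteq> einterval a b \<longrightarrow> abs_continuous_on_Icc c d f}"

definition L1_loc :: "ereal \<Rightarrow> ereal \<Rightarrow> (real \<Rightarrow> real) set" where
  "L1_loc a b = {f. \<forall>c d. {c..d} \<subseteq> einterval a b \<longrightarrow> f absolutely_integrable_on {c..d}}"

section \<open>Neighbourhoods of a possibly infinite endpoint\<close>

text \<open>Filters on the reals: \<open>\<forall>\<^sub>F c in near_left_end a. P c\<close> says that \<open>P c\<close> holds for
  all real \<open>c > a\<close> sufficiently close to \<open>a\<close> (for all sufficiently negative \<open>c\<close> if
  \<open>a = -\<infinity>\<close>). A property of the integral over a sufficiently small neighbourhood of \<open>a\<close>
  is a property of the integral over \<open>einterval a c\<close> for all such \<open>c\<close>.\<close>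

definition near_left_end :: "ereal \<Rightarrow> real filter" where
  "near_left_end a = filtercomap ereal (at_right a)"

definition near_right_end :: "ereal \<Rightarrow> real filter" where
  "near_right_end b = filtercomap ereal (at_left b)"

section \<open>The Hilbert space of square integrable functions\<close>

definition L2_fun :: "'a measure \<Rightarrow> ('a \<Rightarrow> complex) set" where
  "L2_fun M = {f \<in> borel_measurable M. integrable M (\<lambda>x. (cmod (f x))\<^sup>2)}"

definition L2_inner :: "'a measure \<Rightarrow> ('a \<Rightarrow> complex) \<Rightarrow> ('a \<Rightarrow> complex) \<Rightarrow> complex" where
  "L2_inner M f g = (LINT x|M. cnj (f x) * g x)"

text \<open>The elements of the Hilbert space are the classes \<open>L2_class M f\<close> with \<open>f \<in> L2_fun M\<close>.\<close>

definition L2_class :: "'a measure \<Rightarrow> ('a \<Rightarrow> complex) \<Rightarrow> ('a \<Rightarrow> complex) set" where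
  "L2_class M f = {g \<in> L2_fun M. AE x in M. g x = f x}"

section \<open>Closure of a semibounded form and the associated operator\<close>

text \<open>In this section \<open>t\<close> is a sesquilinear form, antilinear in its first argument, with domain
  given by a linear space \<open>D\<close> of representatives. A sequence \<open>\<phi>\<close> in \<open>D\<close> is
  \<open>t\<close>-convergent to \<open>f\<close> if it converges to \<open>f\<close> in the Hilbert space and
  \<open>t[\<phi> m - \<phi> n] \<longrightarrow> 0\<close> as \<open>m, n \<longrightarrow> \<infinity>\<close>.\<close>

definition form_convergent ::
  "'a measure \<Rightarrow> ('a \<Rightarrow> complex) set \<Rightarrow> (('a \<Rightarrow> complex) \<Rightarrow> ('a \<Rightarrow> complex) \<Rightarrow> complex)
    \<Rightarrow> (nat \<Rightarrow> 'a \<Rightarrow> complex) \<Rightarrow> ('a \<Rightarrow> complex) \<Rightarrow> bool" where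
  "form_convergent M D t \<phi> f \<longleftrightarrow>
     (\<forall>n. \<phi> n \<in> D) \<and> f \<in> L2_fun M \<and>
     (\<lambda>n. LINT x|M. (cmod (\<phi> n x - f x))\<^sup>2) \<longlonglongrightarrow> 0 \<and>
     ((\<lambda>(m, n). t (\<lambda>x. \<phi> m x - \<phi> n x) (\<lambda>x. \<phi> m x - \<phi> n x)) \<longlongrightarrow> 0)
       (sequentially \<times>\<^sub>F sequentially)"

definition form_closure_dom ::
  "'a measure \<Rightarrow> ('a \<Rightarrow> complex) set \<Rightarrow> (('a \<Rightarrow> complex) \<Rightarrow> ('a \<Rightarrow> complex) \<Rightarrow> complex)
    \<Rightarrow> ('a \<Rightarrow> complex) set" where
  "form_closure_dom M D t = {f. \<exists>\<phi>. form_convergent M D t \<phi> f}"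

text \<open>For a closable semibounded form the following limit exists and does not depend on the
  approximating sequences.\<close>

definition form_closure ::
  "'a measure \<Rightarrow> ('a \<Rightarrow> complex) set \<Rightarrow> (('a \<Rightarrow> complex) \<Rightarrow> ('a \<Rightarrow> complex) \<Rightarrow> complex)
    \<Rightarrow> ('a \<Rightarrow> complex) \<Rightarrow> ('a \<Rightarrow> complex) \<Rightarrow> complex" where
  "form_closure M D t f g =
     (THE z. \<forall>\<phi> \<psi>. form_convergent M D t \<phi> f \<and> form_convergent M D t \<psi> g
                  \<longrightarrow> (\<lambda>n. t (\<phi> n) (\<psi> n)) \<longlonglongrightarrow> z)"

text \<open>Graph, as a relation between elements of the Hilbert space, of the operator \<open>S\<close> that the
  first representation theorem associates with the closed form: \<open>f \<in> dom S\<close> and \<open>S f = h\<close> iff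
  \<open>f\<close> is in the form domain and \<open>t g f = \<langle>g, h\<rangle>\<close> for all \<open>g\<close> in the form domain.\<close>

definition form_operator ::
  "'a measure \<Rightarrow> ('a \<Rightarrow> complex) set \<Rightarrow> (('a \<Rightarrow> complex) \<Rightarrow> ('a \<Rightarrow> complex) \<Rightarrow> complex)
    \<Rightarrow> (('a \<Rightarrow> complex) set \<times> ('a \<Rightarrow> complex) set) set" where
  "form_operator M D t =
     {(L2_class M f, L2_class M h) | f h.
        f \<in> form_closure_dom M D t \<and> h \<in> L2_fun M \<and>
        (\<forall>g\<in>form_closure_dom M D t. form_closure M D t g f = L2_inner M g h)}"

section \<open>The differential expression and its operators\<close>

locale sturm_liouville =
  fixes a b :: ereal and p q r s :: "real \<Rightarrow> real"
  assumes interval: "a < b"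
    and measurable:
      "p \<in> borel_measurable (lebesgue_on (einterval a b))"
      "q \<in> borel_measurable (lebesgue_on (einterval a b))"
      "r \<in> borel_measurable (lebesgue_on (einterval a b))"
      "s \<in> borel_measurable (lebesgue_on (einterval a b))"
    and locally_integrable:
      "(\<lambda>x. inverse (p x)) \<in> L1_loc a b" "q \<in> L1_loc a b" "r \<in> L1_loc a b" "s \<in> L1_loc a b"
    and r_pos: "AE x in lebesgue_on (einterval a b). r x > 0"
    and p_nonzero: "AE x in lebesgue_on (einterval a b). p x \<noteq> 0"
begin

text \<open>Functions on \<open>(a,b)\<close> are total functions on the reals whose values outside \<open>(a,b)\<close> are
  irrelevant. The expression \<open>p (f' + s f)\<close> is determined only almost everywhere, so that
  \<open>f\<^sup>[\<^sup>1\<^sup>] \<in> AC\<^sub>l\<^sub>o\<^sub>c\<close> means that it agrees a.e. with an element of \<open>AC_loc a b\<close>; the latter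
  is unique on \<open>(a,b)\<close>. The definitions are polymorphic to cover real-valued and
  complex-valued functions.\<close>

definition is_quasi_deriv :: "(real \<Rightarrow> 'a::real_normed_vector) \<Rightarrow> (real \<Rightarrow> 'a) \<Rightarrow> bool" where
  "is_quasi_deriv f h \<longleftrightarrow> h \<in> AC_loc a b \<and>
     (AE x in lebesgue_on (einterval a b).
        h x = p x *\<^sub>R (vector_derivative f (at x) + s x *\<^sub>R f x))"

definition quasi_deriv :: "(real \<Rightarrow> 'a::real_normed_vector) \<Rightarrow> real \<Rightarrow> 'a" where
  "quasi_deriv f = (SOME h. is_quasi_deriv f h)"

definition D_tau :: "(real \<Rightarrow> 'a::real_normed_vector) set" where
  "D_tau = {f \<in> AC_loc a b. \<exists>h. is_quasi_deriv f h}"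

definition tau :: "(real \<Rightarrow> complex) \<Rightarrow> real \<Rightarrow> complex" where
  "tau f x = (- vector_derivative (quasi_deriv f) (at x) + s x *\<^sub>R quasi_deriv f x + q x *\<^sub>R f x)
               /\<^sub>R r x"

definition rmeas :: "real measure" where
  "rmeas = density (lebesgue_on (einterval a b)) (\<lambda>x. ennreal (r x))"

text \<open>Elements of the domains below are the (on \<open>(a,b)\<close> unique) locally absolutely continuous
  representatives of elements of the Hilbert space.\<close>

definition dom_Tmax :: "(real \<Rightarrow> complex) set" where
  "dom_Tmax = {g \<in> L2_fun rmeas. g \<in> D_tau \<and> tau g \<in> L2_fun rmeas}"

definition dom_T0 :: "(real \<Rightarrow> complex) set" where
  "dom_T0 = {g \<in> dom_Tmax. \<exists>K. compact K \<and> K \<subseteq> einterval a b \<and>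
                              (\<forall>x\<in>einterval a b - K. g x = 0)}"

definition T0_form :: "(real \<Rightarrow> complex) \<Rightarrow> (real \<Rightarrow> complex) \<Rightarrow> complex" where
  "T0_form f g = L2_inner rmeas f (tau g)"

text \<open>The real part only serves to have real numbers to compare: \<open>\<langle>f, T\<^sub>0 f\<rangle>\<close> is real since
  \<open>T\<^sub>0\<close> is symmetric.\<close>

definition T0_bounded_below :: "real \<Rightarrow> bool" where
  "T0_bounded_below \<gamma> \<longleftrightarrow>
     (\<forall>f\<in>dom_T0. \<gamma> * Re (L2_inner rmeas f f) \<le> Re (T0_form f f))"

definition friedrichs_ext :: "((real \<Rightarrow> complex) set \<times> (real \<Rightarrow> complex) set) set" where
  "friedrichs_ext = form_operator rmeas dom_T0 T0_form"

end

end

theory Submission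
  imports Defs
begin

text \<open>Let \<open>\<sigma>\<close> be locally absolutely continuous with \<open>\<sigma> = g\<^sub>a\<^sup>[\<^sup>1\<^sup>] / g\<^sub>a\<close> near \<open>a\<close> and
  \<open>\<sigma> = g\<^sub>b\<^sup>[\<^sup>1\<^sup>] / g\<^sub>b\<close> near \<open>b\<close>, and let \<open>g > 0\<close> solve \<open>g' = g (\<sigma>/p - s)\<close>; then \<open>g\<close> is a
  multiple of \<open>g\<^sub>a\<close> near \<open>a\<close> and of \<open>g\<^sub>b\<close> near \<open>b\<close>. Writing \<open>f = g \<phi>\<close> turns \<open>\<tau> f = k\<close> into the system
  \<open>\<phi>' = \<omega> \<psi>\<close>, \<open>\<psi>' = W \<phi> - R \<kappa>\<close> with \<open>\<omega> = 1/(p g\<^sup>2)\<close>, \<open>R = r g\<^sup>2\<close>, \<open>k = g \<kappa>\<close>, where \<open>W \<ge> \<mu> R\<close> near the ends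
  and \<open>\<integral>\<omega> = \<infinity>\<close> at both ends. The conditions that define the domain say that the energy
  \<open>\<integral>\<omega> |\<psi>|\<^sup>2\<close> is finite.

  The form of \<open>T\<^sub>0\<close> controls the energy, the integral of \<open>(W - \<mu> R) |\<phi>|\<^sup>2\<close> near the ends and the norm, and
  all three are lower semicontinuous, so elements of \<open>dom S\<^sub>F\<close> have finite energy. Conversely, the
  operator on the functions of finite energy is symmetric: two such functions satisfy
  \<open>|\<phi>|\<^sup>2 \<le> D (1 + \<theta>)\<close> with \<open>\<theta> = \<integral>\<omega>\<close>, so if their Wronskian stayed away from \<open>0\<close> at an end, then
  \<open>\<omega> / (1 + \<theta>)\<close> would be integrable there, contradicting \<open>ln (1 + \<theta>) \<longrightarrow> \<infinity>\<close>. Since \<open>S\<^sub>F\<close>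
  is self-adjoint, it has no proper symmetric extension.\<close>

section \<open>Absolute continuity\<close>

text \<open>\<open>g\<^sub>a\<close> and \<open>g\<^sub>b\<close> may vanish away from their ends,
  so they cannot be glued to a positive g. Their logarithmic derivatives can, linearly in between,
  at the cost of a potential without sign on a compact interval. There W is harmless: sup |\<phi>|^2
  over a compact interval is at most an arbitrarily small multiple of the energy plus a large
  multiple of the norm. Near a, the Riccati equation of \<sigma> turns W into g^2 times q -
  (g_a^[1])'/g_a + s g_a^[1]/g_a, the function in the last claim; the assumed inequality is W \<ge>
  \<mu> R. Solutions of (S_F + C) u = k are found as limits of minimizing sequences of t[v] + C
  |v|^2 - 2 Re <k, v> on dom T_0. A sequence that is Cauchy in the shifted form converges locally
  uniformly, so its limit is a concrete function; it lies in the maximal domain because T_0^*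
  \<subseteq> T_max, which is shown by testing with compactly supported solutions. Absolute
  continuity is the \<epsilon>-\<delta> notion, so the fundamental theorem of calculus comes
  first.\<close>

definition interval_family :: "real \<Rightarrow> real \<Rightarrow> (real \<times> real) set \<Rightarrow> bool" where
  "interval_family c d I \<longleftrightarrow> finite I \<and> (\<forall>(u, v)\<in>I. c \<le> u \<and> u \<le> v \<and> v \<le> d) \<and>
     pairwise (\<lambda>(u, v) (u', v'). {u<..<v} \<inter> {u'<..<v'} = {}) I"

lemma abs_continuous_on_Icc_iff:
  "abs_continuous_on_Icc c d f \<longleftrightarrow>
     (\<forall>\<epsilon>>0. \<exists>\<delta>>0. \<forall>I. interval_family c d I \<and> (\<Sum>(u, v)\<in>I. v - u) < \<delta>
        \<longrightarrow> (\<Sum>(u, v)\<in>I. norm (f v - f u)) < \<epsilon>)"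
  unfolding abs_continuous_on_Icc_def interval_family_def by (simp add: conj_assoc)

lemma interval_familyD:
  assumes "interval_family c d I"
  shows "finite I" "(u, v) \<in> I \<Longrightarrow> c \<le> u" "(u, v) \<in> I \<Longrightarrow> u \<le> v" "(u, v) \<in> I \<Longrightarrow> v \<le> d"
    and "(u, v) \<in> I \<Longrightarrow> (u', v') \<in> I \<Longrightarrow> (u, v) \<noteq> (u', v') \<Longrightarrow> {u<..<v} \<inter> {u'<..<v'} = {}"
  using assms unfolding interval_family_def pairwise_def by fast+

lemma interval_family_integral_le:
  fixes h :: "real \<Rightarrow> real"
  assumes I: "interval_family c d I" and h: "h integrable_on {c..d}"
    and nonneg: "\<And>x. x \<in> {c..d} \<Longrightarrow> 0 \<le> h x"
  shows "(\<Sum>(u, v)\<in>I. integral {u..v} h) \<le> integral {c..d} h"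
proof -
  \<comment> \<open>Degenerate intervals carry no integral. Without them the closed intervals form a
    division of their union, and the integral of a nonnegative function grows with the set.\<close>
  define J where "J = {x \<in> I. fst x < snd x}"
  define K where "K = (\<lambda>x. {fst x..snd x}) ` J"
  have fin: "finite J" using interval_familyD(1)[OF I] by (simp add: J_def)
  have inj: "inj_on (\<lambda>x. {fst x..snd x}) J"
    by (auto simp: inj_on_def J_def)
  have sub: "{u..v} \<subseteq> {c..d}" if "(u, v) \<in> I" for u v
    using interval_familyD(2,4)[OF I that] by auto
  have K: "K division_of \<Union>K"
  proof (rule division_ofI)
    show "finite K" using fin by (simp add: K_def)
    fix S assume S: "S \<in> K"
    then show "S \<subseteq> \<Union>K" by auto
    from S show "S \<noteq> {}" "\<exists>a b. S = cbox a b" by (auto simp: K_def J_def)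
    fix T assume T: "T \<in> K" "S \<noteq> T"
    from S T(1) obtain u v u' v' where "S = {u..v}" "T = {u'..v'}" "(u, v) \<in> I" "(u', v') \<in> I"
      unfolding K_def J_def by (metis (no_types, lifting) image_iff mem_Collect_eq prod.collapse)
    with T show "interior S \<inter> interior T = {}"
      using interval_familyD(5)[OF I, of u v u' v'] by (auto simp: interior_atLeastAtMost_real)
  qed auto
  have subK: "\<Union>K \<subseteq> {c..d}" using sub by (auto simp: K_def J_def) fastforce+
  have intS: "h integrable_on S" if "S \<in> K" for S
  proof -
    from that obtain u v where "S = {u..v}" "(u, v) \<in> I" by (auto simp: K_def J_def)
    then show ?thesis using integrable_subinterval_real[OF h] sub by auto
  qed
  have "(\<Sum>(u, v)\<in>I. integral {u..v} h) = (\<Sum>x\<in>J. integral {fst x..snd x} h)"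
  proof (rule sum.mono_neutral_cong_right)
    show "\<forall>i\<in>I - J. (case i of (u, v) \<Rightarrow> integral {u..v} h) = 0"
    proof
      fix i assume "i \<in> I - J"
      then obtain u v where i: "i = (u, v)" and "(u, v) \<in> I" and "(u, v) \<notin> J" by (cases i) auto
      then have "u = v" using interval_familyD(3)[OF I, of u v] by (auto simp: J_def)
      then show "(case i of (u, v) \<Rightarrow> integral {u..v} h) = 0" by (simp add: i)
    qed
  qed (use interval_familyD(1)[OF I] in \<open>auto simp: J_def split: prod.splits\<close>)
  also have "\<dots> = (\<Sum>S\<in>K. integral S h)"
    unfolding K_def by (subst sum.reindex[OF inj]) simp
  also have "\<dots> = integral (\<Union>K) h"
    by (rule integral_combine_division_bottomup[OF K, symmetric]) (use intS in auto)
  also have "\<dots> \<le> integral {c..d} h"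
    by (intro integral_subset_le subK h integrable_combine_division[OF K]) (use intS nonneg in auto)
  finally show ?thesis .
qed

lemma interval_family_length_le:
  assumes "interval_family c d I" "c \<le> d"
  shows "(\<Sum>(u, v)\<in>I. v - u) \<le> d - c"
proof -
  have "(\<Sum>(u, v)\<in>I. v - u) = (\<Sum>(u, v)\<in>I. integral {u..v} (\<lambda>x. 1))"
    using interval_familyD(3)[OF assms(1)] by (intro sum.cong) auto
  also have "\<dots> \<le> integral {c..d} (\<lambda>x. 1)"
    by (rule interval_family_integral_le) (use assms in auto)
  finally show ?thesis using assms(2) by simp
qed

lemma interval_family_Un:
  assumes "interval_family c x I" "interval_family x d J" "c \<le> x" "x \<le> d"
  shows "interval_family c d (I \<union> J)"
  unfolding interval_family_def
proof (intro conjI)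
  show "finite (I \<union> J)" using assms(1,2) by (auto simp: interval_family_def)
  show "\<forall>(u, v)\<in>I \<union> J. c \<le> u \<and> u \<le> v \<and> v \<le> d"
    using assms by (fastforce simp: interval_family_def)
  have *: "{u<..<v} \<inter> {u'<..<v'} = {}" if "(u, v) \<in> I" "(u', v') \<in> J" for u v u' v'
    using interval_familyD(4)[OF assms(1) that(1)] interval_familyD(2)[OF assms(2) that(2)] by auto
  show "pairwise (\<lambda>(u, v) (u', v'). {u<..<v} \<inter> {u'<..<v'} = {}) (I \<union> J)"
  proof (rule pairwiseI)
    fix x y assume xy: "x \<in> I \<union> J" "y \<in> I \<union> J" "x \<noteq> y"
    obtain u v u' v' where eq: "x = (u, v)" "y = (u', v')" by (metis surj_pair)
    consider "x \<in> I" "y \<in> I" | "x \<in> J" "y \<in> J" | "x \<in> I" "y \<in> J" | "x \<in> J" "y \<in> I"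
      using xy by blast
    then have "{u<..<v} \<inter> {u'<..<v'} = {}"
    proof cases
      case 1 then show ?thesis using interval_familyD(5)[OF assms(1)] xy(3) eq by blast
    next
      case 2 then show ?thesis using interval_familyD(5)[OF assms(2)] xy(3) eq by blast
    next
      case 3 then show ?thesis using * eq by blast
    next
      case 4 then show ?thesis using *[of u' v' u v] eq by blast
    qed
    then show "(case x of (u, v) \<Rightarrow> \<lambda>(u', v'). {u<..<v} \<inter> {u'<..<v'} = {}) y" by (simp add: eq)
  qed
qed

text \<open>Degenerate intervals are the only source of collisions, here and when a family is cut at a
  point, and they do not contribute.\<close>

lemma variation_Un:
  fixes F :: "real \<Rightarrow> 'a::real_normed_vector"
  assumes "interval_family c x I" "interval_family x d J"
  shows "(\<Sum>(u, v)\<in>I \<union> J. norm (F v - F u)) =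
    (\<Sum>(u, v)\<in>I. norm (F v - F u)) + (\<Sum>(u, v)\<in>J. norm (F v - F u))"
proof (rule sum.union_inter_neutral)
  show "\<forall>i\<in>I \<inter> J. (case i of (u, v) \<Rightarrow> norm (F v - F u)) = 0"
  proof
    fix i assume "i \<in> I \<inter> J"
    then obtain u v where i: "i = (u, v)" and "(u, v) \<in> I" and "(u, v) \<in> J" by (cases i) auto
    then have "u = v"
      using interval_familyD(3,4)[OF assms(1), of u v] interval_familyD(2)[OF assms(2), of u v] by auto
    then show "(case i of (u, v) \<Rightarrow> norm (F v - F u)) = 0" by (simp add: i)
  qed
qed (use assms in \<open>auto simp: interval_family_def\<close>)

lemma interval_family_cut:
  fixes F :: "real \<Rightarrow> 'a::real_normed_vector"
  assumes I: "interval_family c d I" and h: "mono h" "\<And>x. x \<in> {c..d} \<Longrightarrow> h x \<in> {c'..d'}"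
    and expand: "\<And>x y. h x < h y \<Longrightarrow> {h x<..<h y} \<subseteq> {x<..<y}"
  shows "interval_family c' d' ((\<lambda>(u, v). (h u, h v)) ` I)"
    and "(\<Sum>(u, v)\<in>(\<lambda>(u, v). (h u, h v)) ` I. norm (F v - F u)) = (\<Sum>(u, v)\<in>I. norm (F (h v) - F (h u)))"
proof -
  have dis: "{h u<..<h v} \<inter> {h u'<..<h v'} = {}"
    if "(u, v) \<in> I" "(u', v') \<in> I" "(u, v) \<noteq> (u', v')" for u v u' v'
  proof (cases "h u < h v \<and> h u' < h v'")
    case True
    then show ?thesis
      using interval_familyD(5)[OF I that] expand[of u v] expand[of u' v'] by blast
  qed auto
  show "interval_family c' d' ((\<lambda>(u, v). (h u, h v)) ` I)"
    unfolding interval_family_def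
  proof (intro conjI)
    show "finite ((\<lambda>(u, v). (h u, h v)) ` I)" using interval_familyD(1)[OF I] by simp
    show "\<forall>(u, v)\<in>(\<lambda>(u, v). (h u, h v)) ` I. c' \<le> u \<and> u \<le> v \<and> v \<le> d'"
    proof (clarsimp)
      fix u v assume "(u, v) \<in> I"
      then have "u \<in> {c..d}" "v \<in> {c..d}" "u \<le> v"
        using interval_familyD(2-4)[OF I, of u v] by auto
      then show "c' \<le> h u \<and> h u \<le> h v \<and> h v \<le> d'"
        using h(2)[of u] h(2)[of v] monoD[OF h(1), of u v] by auto
    qed
    show "pairwise (\<lambda>(u, v) (u', v'). {u<..<v} \<inter> {u'<..<v'} = {}) ((\<lambda>(u, v). (h u, h v)) ` I)"
    proof (rule pairwiseI)
      fix x y assume "x \<in> (\<lambda>(u, v). (h u, h v)) ` I" "y \<in> (\<lambda>(u, v). (h u, h v)) ` I" and ne: "x \<noteq> y"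
      then obtain u v u' v' where "(u, v) \<in> I" "(u', v') \<in> I" and xy: "x = (h u, h v)" "y = (h u', h v')"
        by auto
      from dis[OF this(1,2)] ne show "(case x of (u, v) \<Rightarrow> \<lambda>(u', v'). {u<..<v} \<inter> {u'<..<v'} = {}) y"
        by (auto simp: xy)
    qed
  qed
  show "(\<Sum>(u, v)\<in>(\<lambda>(u, v). (h u, h v)) ` I. norm (F v - F u)) = (\<Sum>(u, v)\<in>I. norm (F (h v) - F (h u)))"
  proof (subst sum.reindex_nontrivial)
    show "finite I" using interval_familyD(1)[OF I] .
    fix x y assume xy: "x \<in> I" "y \<in> I" "x \<noteq> y" "(case x of (u, v) \<Rightarrow> (h u, h v)) = (case y of (u, v) \<Rightarrow> (h u, h v))"
    obtain u v u' v' where eq: "x = (u, v)" "y = (u', v')" by (metis surj_pair)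
    have "{h u<..<h v} = {}" using dis[of u v u' v'] xy eq by auto
    moreover have "h u \<le> h v" using interval_familyD(3)[OF I, of u v] xy(1) eq monoD[OF h(1), of u v] by blast
    ultimately have "h u = h v" by auto
    then show "(case case x of (u, v) \<Rightarrow> (h u, h v) of (u, v) \<Rightarrow> norm (F v - F u)) = 0"
      by (simp add: eq)
  qed (simp add: case_prod_unfold)
qed

section \<open>Total variation of absolutely continuous functions\<close>

definition variation :: "(real \<Rightarrow> 'a::real_normed_vector) \<Rightarrow> real \<Rightarrow> real \<Rightarrow> real" where
  "variation F c d = (SUP I\<in>Collect (interval_family c d). \<Sum>(u, v)\<in>I. norm (F v - F u))"

text \<open>Clamping with min(.,x) and max(.,x) moves every interval to the two sides of x. An
  increment of F is the sum of its two clamped increments, one of which vanishes unless x lies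
  strictly inside, so only the triangle inequality is lost.\<close>

lemma interval_family_split:
  fixes F :: "real \<Rightarrow> 'a::real_normed_vector"
  assumes I: "interval_family c d I" and x: "c \<le> x" "x \<le> d"
  obtains I1 I2 where "interval_family c x I1" "interval_family x d I2"
    "(\<Sum>(u, v)\<in>I. norm (F v - F u)) \<le> (\<Sum>(u, v)\<in>I1. norm (F v - F u)) + (\<Sum>(u, v)\<in>I2. norm (F v - F u))"
proof -
  let ?h1 = "\<lambda>y. min y x" and ?h2 = "\<lambda>y. max y x"
  have m: "mono ?h1" "mono ?h2" by (auto simp: mono_def)
  have r: "y \<in> {c..d} \<Longrightarrow> min y x \<in> {c..x}" "y \<in> {c..d} \<Longrightarrow> max y x \<in> {x..d}" for y
    using x by auto
  have e1: "min y x < min z x \<Longrightarrow> {min y x<..<min z x} \<subseteq> {y<..<z}" for y z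
    by (cases "y \<le> x"; cases "z \<le> x"; auto)
  have e2: "max y x < max z x \<Longrightarrow> {max y x<..<max z x} \<subseteq> {y<..<z}" for y z
    by (cases "y \<le> x"; cases "z \<le> x"; auto)
  note cut1 = interval_family_cut[OF I m(1) r(1) e1]
  note cut2 = interval_family_cut[OF I m(2) r(2) e2]
  have A: "interval_family c x ((\<lambda>(u, v). (?h1 u, ?h1 v)) ` I)"
    by (rule cut1)
  have B: "interval_family x d ((\<lambda>(u, v). (?h2 u, ?h2 v)) ` I)"
    by (rule cut2)
  have "(\<Sum>(u, v)\<in>I. norm (F v - F u)) \<le>
    (\<Sum>(u, v)\<in>I. norm (F (?h1 v) - F (?h1 u)) + norm (F (?h2 v) - F (?h2 u)))"
  proof (rule sum_mono, clarify)
    fix u v assume "(u, v) \<in> I"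
    have "F v - F u = (F (?h1 v) - F (?h1 u)) + (F (?h2 v) - F (?h2 u))"
      by (auto simp: min_def max_def)
    then show "norm (F v - F u) \<le> norm (F (?h1 v) - F (?h1 u)) + norm (F (?h2 v) - F (?h2 u))"
      by (simp only: norm_triangle_ineq)
  qed
  also have "\<dots> = (\<Sum>(u, v)\<in>(\<lambda>(u, v). (?h1 u, ?h1 v)) ` I. norm (F v - F u)) +
      (\<Sum>(u, v)\<in>(\<lambda>(u, v). (?h2 u, ?h2 v)) ` I. norm (F v - F u))"
  proof -
    have 1: "(\<Sum>(u, v)\<in>(\<lambda>(u, v). (?h1 u, ?h1 v)) ` I. norm (F v - F u)) = (\<Sum>(u, v)\<in>I. norm (F (?h1 v) - F (?h1 u)))"
      by (rule cut1)
    have 2: "(\<Sum>(u, v)\<in>(\<lambda>(u, v). (?h2 u, ?h2 v)) ` I. norm (F v - F u)) = (\<Sum>(u, v)\<in>I. norm (F (?h2 v) - F (?h2 u)))"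
      by (rule cut2)
    show ?thesis unfolding 1 2 by (simp add: sum.distrib case_prod_unfold)
  qed
  finally show thesis by (rule that[OF A B])
qed

lemma abs_continuous_on_Icc_subset:
  assumes "abs_continuous_on_Icc c d F" "c \<le> c'" "d' \<le> d"
  shows "abs_continuous_on_Icc c' d' F"
proof -
  have "interval_family c' d' I \<Longrightarrow> interval_family c d I" for I
    using assms(2,3) unfolding interval_family_def by fastforce
  then show ?thesis using assms(1) unfolding abs_continuous_on_Icc_iff by meson
qed

text \<open>A family on an interval shorter than \<delta> contributes less than 1, so stepping
  through [c,d] by \<delta>/2 bounds every family by the number of steps. This makes the supremum in
  \<open>variation\<close> a genuine one; its families need not cover [c,d], exactly as in the
  definition of absolute continuity.\<close>

lemma variation_bounded:
  fixes F :: "real \<Rightarrow> 'a::real_normed_vector"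
  assumes F: "abs_continuous_on_Icc c d F"
  shows "bdd_above ((\<lambda>I. \<Sum>(u, v)\<in>I. norm (F v - F u)) ` Collect (interval_family c d))"
proof -
  obtain \<delta> where \<delta>: "\<delta> > 0" "\<And>I. interval_family c d I \<Longrightarrow> (\<Sum>(u, v)\<in>I. v - u) < \<delta> \<Longrightarrow>
      (\<Sum>(u, v)\<in>I. norm (F v - F u)) < 1"
    using F unfolding abs_continuous_on_Icc_iff by (metis zero_less_one)
  have step: "(\<Sum>(u, v)\<in>I. norm (F v - F u)) \<le> real n"
    if "interval_family c y I" "c \<le> y" "y \<le> d" "y - c \<le> real n * (\<delta> / 2)" for n y I
    using that
  proof (induction n arbitrary: y I)
    case 0
    then have "y = c" by simp
    then have "(u, v) \<in> I \<Longrightarrow> u = v" for u v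
      using interval_familyD(2-4)[OF 0(1), of u v] by force
    then have "(\<Sum>(u, v)\<in>I. norm (F v - F u)) = 0" by (intro sum.neutral) fastforce
    then show ?case by simp
  next
    case (Suc n)
    \<comment> \<open>Half of \<delta>, because the length condition is strict; \<open>max\<close>
      keeps x in [c,y] when less than half of \<delta> is left.\<close>
    define x where "x = max c (y - \<delta> / 2)"
    have x: "c \<le> x" "x \<le> y" "y - x \<le> \<delta> / 2" "x - c \<le> real n * (\<delta> / 2)"
      using Suc.prems \<delta>(1) by (auto simp: x_def max_def field_simps)
    obtain I1 I2 where I12: "interval_family c x I1" "interval_family x y I2"
      "(\<Sum>(u, v)\<in>I. norm (F v - F u)) \<le> (\<Sum>(u, v)\<in>I1. norm (F v - F u)) + (\<Sum>(u, v)\<in>I2. norm (F v - F u))"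
      using interval_family_split[OF Suc.prems(1) x(1,2)] by metis
    have "interval_family c d I2" using I12(2) x Suc.prems unfolding interval_family_def by fastforce
    moreover have "(\<Sum>(u, v)\<in>I2. v - u) < \<delta>"
      using interval_family_length_le[OF I12(2)] x \<delta>(1) by linarith
    ultimately have "(\<Sum>(u, v)\<in>I2. norm (F v - F u)) < 1" using \<delta>(2) by blast
    moreover have "(\<Sum>(u, v)\<in>I1. norm (F v - F u)) \<le> real n"
      using Suc.IH[OF I12(1)] x Suc.prems by auto
    ultimately show ?case using I12(3) by simp
  qed
  show ?thesis
  proof (cases "c \<le> d")
    case True
    obtain n :: nat where "(d - c) / (\<delta> / 2) \<le> real n" using real_arch_simple by blast
    then have "d - c \<le> real n * (\<delta> / 2)" using \<delta>(1) by (simp add: field_simps)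
    then show ?thesis using step[of d _ n] True by (intro bdd_aboveI[of _ "real n"]) auto
  next
    case False
    then have "interval_family c d I \<Longrightarrow> I = {}" for I
      using interval_familyD(2-4)[of c d I] by fastforce
    then have "Collect (interval_family c d) \<subseteq> {{}}" by blast
    then have "finite (Collect (interval_family c d))" by (rule finite_subset) simp
    then show ?thesis by (intro bdd_above_finite finite_imageI)
  qed
qed

lemma variation_upper:
  fixes F :: "real \<Rightarrow> 'a::real_normed_vector"
  assumes "abs_continuous_on_Icc c d F" "interval_family c d I"
  shows "(\<Sum>(u, v)\<in>I. norm (F v - F u)) \<le> variation F c d"
  unfolding variation_def using assms by (intro cSUP_upper variation_bounded) auto

lemma interval_family_empty: "interval_family c d {}"
  by (simp add: interval_family_def)

lemma variation_subadditive:
  fixes F :: "real \<Rightarrow> 'a::real_normed_vector"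
  assumes F: "abs_continuous_on_Icc c d F" and x: "c \<le> x" "x \<le> d"
  shows "variation F c d \<le> variation F c x + variation F x d"
  unfolding variation_def[of F c d]
proof (rule cSUP_least)
  show "Collect (interval_family c d) \<noteq> {}" using interval_family_empty by blast
  fix I assume "I \<in> Collect (interval_family c d)"
  then have I: "interval_family c d I" by simp
  obtain I1 I2 where *: "interval_family c x I1" "interval_family x d I2"
    "(\<Sum>(u, v)\<in>I. norm (F v - F u)) \<le> (\<Sum>(u, v)\<in>I1. norm (F v - F u)) + (\<Sum>(u, v)\<in>I2. norm (F v - F u))"
    using interval_family_split[OF I x] by metis
  have "abs_continuous_on_Icc c x F" "abs_continuous_on_Icc x d F"
    using abs_continuous_on_Icc_subset[OF F] x by auto
  from variation_upper[OF this(1) *(1)] variation_upper[OF this(2) *(2)] *(3)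
  show "(\<Sum>(u, v)\<in>I. norm (F v - F u)) \<le> variation F c x + variation F x d"
    by linarith
qed

text \<open>The single interval (x,d) extends any family on [c,x] to one on [c,d]. Keeping the
  increment of F makes both the variation and its difference with F monotone.\<close>

lemma variation_superadditive:
  fixes F :: "real \<Rightarrow> 'a::real_normed_vector"
  assumes F: "abs_continuous_on_Icc c d F" and x: "c \<le> x" "x \<le> d"
  shows "variation F c x + norm (F d - F x) \<le> variation F c d"
proof -
  have "variation F c x \<le> variation F c d - norm (F d - F x)"
    unfolding variation_def[of F c x]
  proof (rule cSUP_least)
    show "Collect (interval_family c x) \<noteq> {}" using interval_family_empty by blast
    fix I assume "I \<in> Collect (interval_family c x)"
    then have I: "interval_family c x I" by simp
    have J: "interval_family x d {(x, d)}" using x by (simp add: interval_family_def)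
    show "(\<Sum>(u, v)\<in>I. norm (F v - F u)) \<le> variation F c d - norm (F d - F x)"
      using variation_upper[OF F interval_family_Un[OF I J x]] variation_Un[OF I J, of F] by simp
  qed
  then show ?thesis by simp
qed

text \<open>Each interval of a short family is replaced by a nearly optimal family inside it. The
  union of these is again a family, of no greater length, so the \<delta> that F has for
  \<epsilon>/2 also works for the variation.\<close>

lemma abs_continuous_variation:
  fixes F :: "real \<Rightarrow> 'a::real_normed_vector"
  assumes F: "abs_continuous_on_Icc c d F"
  shows "abs_continuous_on_Icc c d (variation F c)"
  unfolding abs_continuous_on_Icc_iff
proof (intro allI impI)
  fix \<epsilon> :: real assume \<epsilon>: "\<epsilon> > 0"
  then obtain \<delta> where \<delta>: "\<delta> > 0" "\<And>I. interval_family c d I \<Longrightarrow> (\<Sum>(u, v)\<in>I. v - u) < \<delta> \<Longrightarrow>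
      (\<Sum>(u, v)\<in>I. norm (F v - F u)) < \<epsilon> / 2"
    using F unfolding abs_continuous_on_Icc_iff by (metis half_gt_zero)
  show "\<exists>\<delta>>0. \<forall>I. interval_family c d I \<and> (\<Sum>(u, v)\<in>I. v - u) < \<delta> \<longrightarrow>
      (\<Sum>(u, v)\<in>I. norm (variation F c v - variation F c u)) < \<epsilon>"
  proof (intro exI[of _ \<delta>] conjI allI impI \<delta>(1), elim conjE)
    fix K assume K: "interval_family c d K" and len: "(\<Sum>(u, v)\<in>K. v - u) < \<delta>"
    have acs: "abs_continuous_on_Icc u v F" if "(u, v) \<in> K" for u v
      using abs_continuous_on_Icc_subset[OF F, of u v] interval_familyD(2,4)[OF K that] by simp
    \<comment> \<open>The errors add up to card K * e \<le> \<epsilon>/2; the 1 covers an empty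
      K.\<close>
    define e where "e = \<epsilon> / (2 * (real (card K) + 1))"
    have e: "e > 0" using \<epsilon> by (simp add: e_def)
    define Q where "Q k J \<longleftrightarrow> interval_family (fst k) (snd k) J \<and> (\<forall>(u, v)\<in>J. u < v) \<and>
        variation F (fst k) (snd k) - e < (\<Sum>(u, v)\<in>J. norm (F v - F u))" for k J
    have "\<forall>k\<in>K. \<exists>J. Q k J"
    proof
      fix k assume k: "k \<in> K"
      have "\<exists>J\<in>Collect (interval_family (fst k) (snd k)).
          variation F (fst k) (snd k) - e < (\<Sum>(u, v)\<in>J. norm (F v - F u))"
      proof (rule less_cSUP_iff[THEN iffD1])
        show "Collect (interval_family (fst k) (snd k)) \<noteq> {}" using interval_family_empty by blast
        show "bdd_above ((\<lambda>I. \<Sum>(u, v)\<in>I. norm (F v - F u)) ` Collect (interval_family (fst k) (snd k)))"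
          by (rule variation_bounded) (use acs[of "fst k" "snd k"] k in simp)
        show "variation F (fst k) (snd k) - e < (SUP J\<in>Collect (interval_family (fst k) (snd k)). \<Sum>(u, v)\<in>J. norm (F v - F u))"
          using e by (simp add: variation_def)
      qed
      then obtain J where J: "interval_family (fst k) (snd k) J"
        "variation F (fst k) (snd k) - e < (\<Sum>(u, v)\<in>J. norm (F v - F u))" by auto
      \<comment> \<open>Without degenerate members the families chosen for different intervals are
        disjoint as sets, so their sums add up over the union.\<close>
      let ?J = "{(u, v)\<in>J. u < v}"
      have "interval_family (fst k) (snd k) ?J"
        unfolding interval_family_def
      proof (intro conjI)
        show "finite ?J" using interval_familyD(1)[OF J(1)] by (rule rev_finite_subset) auto
        show "\<forall>(u, v)\<in>?J. fst k \<le> u \<and> u \<le> v \<and> v \<le> snd k"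
          using interval_familyD(2-4)[OF J(1)] by blast
        show "pairwise (\<lambda>(u, v) (u', v'). {u<..<v} \<inter> {u'<..<v'} = {}) ?J"
          using J(1) unfolding interval_family_def by (auto intro: pairwise_mono)
      qed
      moreover have "(\<Sum>(u, v)\<in>J. norm (F v - F u)) = (\<Sum>(u, v)\<in>?J. norm (F v - F u))"
      proof (rule sum.mono_neutral_right)
        show "finite J" using interval_familyD(1)[OF J(1)] .
        show "\<forall>i\<in>J - ?J. (case i of (u, v) \<Rightarrow> norm (F v - F u)) = 0"
        proof
          fix i assume "i \<in> J - ?J"
          then obtain u v where i: "i = (u, v)" and "(u, v) \<in> J" and "\<not> u < v" by (cases i) auto
          then have "u = v" using interval_familyD(3)[OF J(1), of u v] by simp
          then show "(case i of (u, v) \<Rightarrow> norm (F v - F u)) = 0" by (simp add: i)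
        qed
      qed auto
      ultimately have "Q k ?J" using J(2) by (auto simp: Q_def)
      then show "\<exists>J. Q k J" ..
    qed
    from bchoice[OF this] obtain J where Q: "\<forall>k\<in>K. Q k (J k)" ..
    have J: "interval_family (fst k) (snd k) (J k)"
      "(u, v) \<in> J k \<Longrightarrow> u < v"
      "variation F (fst k) (snd k) - e < (\<Sum>(u, v)\<in>J k. norm (F v - F u))" if "k \<in> K" for k u v
      using bspec[OF Q that] by (auto simp: Q_def)
    have fin: "finite K" "\<And>k. k \<in> K \<Longrightarrow> finite (J k)"
      using interval_familyD(1)[OF K] interval_familyD(1)[OF J(1)] by simp_all
    have sub: "{u<..<v} \<subseteq> {fst k<..<snd k}" if "k \<in> K" "(u, v) \<in> J k" for k u v
      using interval_familyD(2,4)[OF J(1)[OF that(1)] that(2)] by auto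
    have dis: "{u<..<v} \<inter> {u'<..<v'} = {}"
      if "k \<in> K" "l \<in> K" "k \<noteq> l" "(u, v) \<in> J k" "(u', v') \<in> J l" for k l u v u' v'
    proof -
      have "{fst k<..<snd k} \<inter> {fst l<..<snd l} = {}"
        by (rule interval_familyD(5)[OF K]) (use that in auto)
      then show ?thesis using sub[OF that(1,4)] sub[OF that(2,5)] by blast
    qed
    have disJ: "J k \<inter> J l = {}" if "k \<in> K" "l \<in> K" "k \<noteq> l" for k l
    proof (rule equals0I)
      fix x assume "x \<in> J k \<inter> J l"
      then have x: "(fst x, snd x) \<in> J k" "(fst x, snd x) \<in> J l" by auto
      have "fst x < snd x" using J(2)[OF that(1) x(1)] .
      with dis[OF that x] show False by simp
    qed
    let ?U = "\<Union>k\<in>K. J k"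
    have U: "interval_family c d ?U"
      unfolding interval_family_def
    proof (intro conjI)
      show "finite ?U" using fin by auto
      show "\<forall>(u, v)\<in>?U. c \<le> u \<and> u \<le> v \<and> v \<le> d"
      proof (clarsimp)
        fix u v k1 k2 assume *: "(k1, k2) \<in> K" "(u, v) \<in> J (k1, k2)"
        show "c \<le> u \<and> u \<le> v \<and> v \<le> d"
          using interval_familyD(2-4)[OF K *(1)] interval_familyD(2-4)[OF J(1)[OF *(1)] *(2)] by auto
      qed
      show "pairwise (\<lambda>(u, v) (u', v'). {u<..<v} \<inter> {u'<..<v'} = {}) ?U"
      proof (rule pairwiseI)
        fix x y assume xy: "x \<in> ?U" "y \<in> ?U" "x \<noteq> y"
        obtain k l where kl: "k \<in> K" "l \<in> K" "x \<in> J k" "y \<in> J l" using xy by blast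
        obtain u v u' v' where eq: "x = (u, v)" "y = (u', v')" by (metis surj_pair)
        have "{u<..<v} \<inter> {u'<..<v'} = {}"
        proof (cases "k = l")
          case True
          with xy kl eq show ?thesis using interval_familyD(5)[OF J(1)[OF kl(1)], of u v u' v'] by simp
        next
          case False
          then show ?thesis using dis[OF kl(1,2)] kl(3,4) eq by simp
        qed
        then show "(case x of (u, v) \<Rightarrow> \<lambda>(u', v'). {u<..<v} \<inter> {u'<..<v'} = {}) y" by (simp add: eq)
      qed
    qed
    have sumU: "(\<Sum>x\<in>?U. G x) = (\<Sum>k\<in>K. \<Sum>x\<in>J k. G x)" for G :: "real \<times> real \<Rightarrow> real"
      by (rule sum.UNION_disjoint) (use fin disJ in auto)
    have "(\<Sum>(u, v)\<in>?U. v - u) = (\<Sum>k\<in>K. \<Sum>(u, v)\<in>J k. v - u)" by (rule sumU)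
    also have "\<dots> \<le> (\<Sum>k\<in>K. snd k - fst k)"
      using interval_family_length_le[OF J(1)] interval_familyD(3)[OF K]
      by (intro sum_mono) (simp add: case_prod_unfold)
    finally have "(\<Sum>(u, v)\<in>?U. norm (F v - F u)) < \<epsilon> / 2"
      using \<delta>(2)[OF U] len by (simp add: case_prod_unfold)
    then have small: "(\<Sum>k\<in>K. \<Sum>(u, v)\<in>J k. norm (F v - F u)) < \<epsilon> / 2" by (simp add: sumU)
    have "(\<Sum>(u, v)\<in>K. norm (variation F c v - variation F c u)) \<le>
      (\<Sum>k\<in>K. e + (\<Sum>(u, v)\<in>J k. norm (F v - F u)))"
      unfolding case_prod_unfold
    proof (rule sum_mono)
      fix k assume k: "k \<in> K"
      have uv: "c \<le> fst k" "fst k \<le> snd k" "snd k \<le> d"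
        using interval_familyD(2-4)[OF K, of "fst k" "snd k"] k by auto
      have ac: "abs_continuous_on_Icc c (snd k) F"
        using abs_continuous_on_Icc_subset[OF F] uv by auto
      show "norm (variation F c (snd k) - variation F c (fst k)) \<le> e + (\<Sum>p\<in>J k. norm (F (snd p) - F (fst p)))"
        using variation_subadditive[OF ac uv(1,2)] variation_superadditive[OF ac uv(1,2)] J(3)[OF k]
          norm_ge_zero[of "F (snd k) - F (fst k)"]
        by (simp add: case_prod_unfold del: norm_ge_zero)
    qed
    also have "\<dots> = real (card K) * e + (\<Sum>k\<in>K. \<Sum>(u, v)\<in>J k. norm (F v - F u))"
      by (simp add: sum.distrib)
    also have "real (card K) * e \<le> \<epsilon> / 2" using \<epsilon> by (simp add: e_def field_simps)
    finally show "(\<Sum>(u, v)\<in>K. norm (variation F c v - variation F c u)) < \<epsilon>" using small by simp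
  qed
qed

text \<open>The working notion of absolute continuity: the function is kept together with a density.
  On an open interval this amounts to membership in \<open>AC_loc\<close>
  (\<open>primitive_on_AC_loc\<close>, \<open>AC_loc_primitive\<close>), and it turns the
  differential equations into integral equations, which survive limits and changes on null
  sets.\<close>

definition primitive_on :: "real set \<Rightarrow> (real \<Rightarrow> 'a::euclidean_space) \<Rightarrow> (real \<Rightarrow> 'a) \<Rightarrow> bool" where
  "primitive_on S F f \<longleftrightarrow>
     (\<forall>c d. c \<le> d \<and> {c..d} \<subseteq> S \<longrightarrow> f absolutely_integrable_on {c..d} \<and> integral {c..d} f = F d - F c)"

lemma primitive_onD:
  assumes "primitive_on S F f" "c \<le> d" "{c..d} \<subseteq> S"
  shows "f absolutely_integrable_on {c..d}" "integral {c..d} f = F d - F c" "f integrable_on {c..d}"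
proof -
  have "f absolutely_integrable_on {c..d} \<and> integral {c..d} f = F d - F c"
    using assms unfolding primitive_on_def by blast
  then show "f absolutely_integrable_on {c..d}" "integral {c..d} f = F d - F c" "f integrable_on {c..d}"
    by (simp_all add: set_lebesgue_integral_eq_integral(1))
qed

lemma primitive_on_subset: "primitive_on S F f \<Longrightarrow> T \<subseteq> S \<Longrightarrow> primitive_on T F f"
  unfolding primitive_on_def by blast

lemma primitive_on_diff:
  assumes "primitive_on S F f" "primitive_on S G g"
  shows "primitive_on S (\<lambda>x. F x - G x) (\<lambda>x. f x - g x)"
  unfolding primitive_on_def
proof (intro allI impI)
  fix c d assume cd: "c \<le> d \<and> {c..d} \<subseteq> S"
  note f = primitive_onD[OF assms(1), of c d] and g = primitive_onD[OF assms(2), of c d]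
  show "(\<lambda>x. f x - g x) absolutely_integrable_on {c..d} \<and>
      integral {c..d} (\<lambda>x. f x - g x) = F d - G d - (F c - G c)"
    using f g cd by (auto simp: set_integral_diff(1) integral_diff)
qed

section \<open>The fundamental theorem of calculus for absolutely continuous functions\<close>

lemma abs_continuous_on_Icc_continuous:
  assumes F: "abs_continuous_on_Icc c d F"
  shows "continuous_on {c..d} F"
  unfolding continuous_on_iff
proof (intro ballI allI impI)
  fix x \<epsilon> :: real assume x: "x \<in> {c..d}" and "\<epsilon> > 0"
  then obtain \<delta> where \<delta>: "\<delta> > 0" "\<And>I. interval_family c d I \<Longrightarrow> (\<Sum>(u, v)\<in>I. v - u) < \<delta> \<Longrightarrow>
      (\<Sum>(u, v)\<in>I. norm (F v - F u)) < \<epsilon>"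
    using F unfolding abs_continuous_on_Icc_iff by meson
  have *: "norm (F v - F u) < \<epsilon>" if "c \<le> u" "u \<le> v" "v \<le> d" "v - u < \<delta>" for u v
    using \<delta>(2)[of "{(u, v)}"] that by (simp add: interval_family_def)
  show "\<exists>\<delta>>0. \<forall>y\<in>{c..d}. dist y x < \<delta> \<longrightarrow> dist (F y) (F x) < \<epsilon>"
  proof (intro exI conjI ballI impI, rule \<delta>(1))
    fix y assume "y \<in> {c..d}" "dist y x < \<delta>"
    then show "dist (F y) (F x) < \<epsilon>"
      using *[of x y] *[of y x] x by (cases "x \<le> y") (auto simp: dist_norm norm_minus_commute)
  qed
qed

text \<open>One criterion for components, differences, products and compositions; a product is what
  calls for two dominating functions.\<close>

lemma abs_continuous_on_Icc_dominated:
  assumes F: "abs_continuous_on_Icc c d F" and G: "abs_continuous_on_Icc c d G"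
    and dom: "\<And>u v. c \<le> u \<Longrightarrow> u \<le> v \<Longrightarrow> v \<le> d \<Longrightarrow>
      norm (H v - H u) \<le> K * (norm (F v - F u) + norm (G v - G u))"
  shows "abs_continuous_on_Icc c d H"
  unfolding abs_continuous_on_Icc_iff
proof (intro allI impI)
  fix \<epsilon> :: real assume \<epsilon>: "\<epsilon> > 0"
  \<comment> \<open>K may be zero or negative; m is positive and strictly larger than |K|.\<close>
  define m where "m = \<bar>K\<bar> + 1"
  have m: "m > 0" "\<bar>K\<bar> < m" by (simp_all add: m_def)
  define e where "e = \<epsilon> / (2 * m)"
  have e: "e > 0" using \<epsilon> m by (simp add: e_def)
  obtain \<delta>1 where \<delta>1: "\<delta>1 > 0" "\<And>I. interval_family c d I \<Longrightarrow> (\<Sum>(u, v)\<in>I. v - u) < \<delta>1 \<Longrightarrow>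
      (\<Sum>(u, v)\<in>I. norm (F v - F u)) < e"
    using F e unfolding abs_continuous_on_Icc_iff by meson
  obtain \<delta>2 where \<delta>2: "\<delta>2 > 0" "\<And>I. interval_family c d I \<Longrightarrow> (\<Sum>(u, v)\<in>I. v - u) < \<delta>2 \<Longrightarrow>
      (\<Sum>(u, v)\<in>I. norm (G v - G u)) < e"
    using G e unfolding abs_continuous_on_Icc_iff by meson
  show "\<exists>\<delta>>0. \<forall>I. interval_family c d I \<and> (\<Sum>(u, v)\<in>I. v - u) < \<delta> \<longrightarrow> (\<Sum>(u, v)\<in>I. norm (H v - H u)) < \<epsilon>"
  proof (intro exI[of _ "min \<delta>1 \<delta>2"] conjI allI impI, use \<delta>1(1) \<delta>2(1) in simp, elim conjE)
    fix I assume I: "interval_family c d I" and len: "(\<Sum>(u, v)\<in>I. v - u) < min \<delta>1 \<delta>2"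
    have "(\<Sum>(u, v)\<in>I. norm (H v - H u)) \<le> (\<Sum>(u, v)\<in>I. \<bar>K\<bar> * (norm (F v - F u) + norm (G v - G u)))"
    proof (rule sum_mono, clarify)
      fix u v assume "(u, v) \<in> I"
      then have "norm (H v - H u) \<le> K * (norm (F v - F u) + norm (G v - G u))"
        using dom interval_familyD(2-4)[OF I] by blast
      also have "\<dots> \<le> \<bar>K\<bar> * (norm (F v - F u) + norm (G v - G u))"
        by (intro mult_right_mono) auto
      finally show "norm (H v - H u) \<le> \<bar>K\<bar> * (norm (F v - F u) + norm (G v - G u))" .
    qed
    also have "\<dots> = \<bar>K\<bar> * ((\<Sum>(u, v)\<in>I. norm (F v - F u)) + (\<Sum>(u, v)\<in>I. norm (G v - G u)))"
      by (simp add: sum_distrib_left sum.distrib case_prod_unfold distrib_left)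
    also have "\<dots> \<le> \<bar>K\<bar> * (e + e)"
      using \<delta>1(2)[OF I] \<delta>2(2)[OF I] len by (intro mult_left_mono) auto
    also have "\<dots> < m * (e + e)" using e m by (intro mult_strict_right_mono) auto
    also have "\<dots> = \<epsilon>" using m(1) unfolding e_def by (simp add: field_simps)
    finally show "(\<Sum>(u, v)\<in>I. norm (H v - H u)) < \<epsilon>" .
  qed
qed

text \<open>The Stieltjes measure of v vanishes on Lebesgue null sets: a null set is covered by
  intervals of small total length, over which absolute continuity makes the increments of v small.
  Radon-Nikodym then supplies the density.\<close>

lemma abs_continuous_mono_primitive:
  fixes v :: "real \<Rightarrow> real"
  assumes ac: "abs_continuous_on_Icc c d v" and mono: "mono_on {c..d} v" and cd: "c \<le> d"
  obtains f where "primitive_on {c..d} v f"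
proof -
  \<comment> \<open>Constant continuation beyond [c,d] gives a monotone continuous function on the
    line, for which \<open>interval_measure\<close> is available.\<close>
  define w where "w x = v (max c (min d x))" for x
  have clamp: "max c (min d x) \<in> {c..d}" for x using cd by auto
  have w: "w x = v x" if "x \<in> {c..d}" for x using that by (simp add: w_def)
  have w_mono: "w x \<le> w y" if "x \<le> y" for x y
    unfolding w_def by (rule mono_onD[OF mono clamp clamp]) (use that in auto)
  have w_cont: "continuous_on UNIV w"
    unfolding w_def
  proof (rule continuous_on_compose2[OF abs_continuous_on_Icc_continuous[OF ac]])
    show "continuous_on UNIV (\<lambda>x. max c (min d x))" by (intro continuous_intros)
    show "(\<lambda>x. max c (min d x)) ` UNIV \<subseteq> {c..d}" using clamp by blast
  qed
  define N where "N = interval_measure w"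
  have sN: "sets N = sets borel" by (simp add: N_def)
  have eN: "emeasure N {x..y} = ennreal (w y - w x)" if "x \<le> y" for x y
    unfolding N_def by (rule emeasure_interval_measure_Icc[OF that w_mono w_cont])
  \<comment> \<open>After restriction to [c,d] only the part of a null set inside [c,d] has to be
    covered.\<close>
  define N' where "N' = density N (indicator {c..d})"
  have sN': "sets N' = sets lborel" by (simp add: N'_def sN)
  have eN': "emeasure N' A = emeasure N ({c..d} \<inter> A)" if "A \<in> sets borel" for A
    unfolding N'_def using that sN by (intro emeasure_restricted) auto
  have ac': "absolutely_continuous lborel N'"
    unfolding absolutely_continuous_def
  proof
    fix Z :: "real set" assume Z: "Z \<in> null_sets lborel"
    then have Zb: "Z \<in> sets borel" by auto
    have "emeasure N ({c..d} \<inter> Z) \<le> ennreal \<epsilon>" if \<epsilon>: "\<epsilon> > 0" for \<epsilon> :: real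
    proof -
      obtain \<delta> where \<delta>: "\<delta> > 0" "\<And>I. interval_family c d I \<Longrightarrow> (\<Sum>(u, v)\<in>I. v - u) < \<delta> \<Longrightarrow>
        (\<Sum>(x, y)\<in>I. norm (v y - v x)) < \<epsilon>"
        using ac \<epsilon> unfolding abs_continuous_on_Icc_iff by meson
      have "Z \<in> null_sets lebesgue" using Z by (rule null_sets_completionI)
      then have null: "{c..d} \<inter> Z \<in> null_sets lebesgue" by (intro null_set_Int1) auto
      then have "{c..d} \<inter> Z \<in> lmeasurable" "measure lebesgue ({c..d} \<inter> Z) = 0"
        by (auto simp: fmeasurable_def null_sets_def measure_def)
      moreover have "{c..d} \<inter> Z \<subseteq> cbox c d" by auto
      \<comment> \<open>Countably many nonoverlapping intervals; their total length must be strictly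
        below \<delta>, hence \<delta>/2.\<close>
      ultimately obtain D where D: "countable D"
        "\<And>K. K \<in> D \<Longrightarrow> K \<subseteq> cbox c d \<and> K \<noteq> {} \<and> (\<exists>x y. K = cbox x y)"
        "pairwise (\<lambda>A B. interior A \<inter> interior B = {}) D"
        "{c..d} \<inter> Z \<subseteq> \<Union>D" "\<Union>D \<in> lmeasurable" "measure lebesgue (\<Union>D) \<le> \<delta> / 2"
      proof -
        assume *: "{c..d} \<inter> Z \<in> lmeasurable" "measure lebesgue ({c..d} \<inter> Z) = 0" "{c..d} \<inter> Z \<subseteq> cbox c d"
        show thesis
        proof (rule measurable_outer_intervals_bounded[OF *(1,3) half_gt_zero[OF \<delta>(1)]])
          fix D assume "countable D" "\<And>K. K \<in> D \<Longrightarrow> K \<subseteq> cbox c d \<and> K \<noteq> {} \<and> (\<exists>c d. K = cbox c d)"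
            "pairwise (\<lambda>A B. interior A \<inter> interior B = {}) D"
            "{c..d} \<inter> Z \<subseteq> \<Union>D" "\<Union>D \<in> lmeasurable"
            "measure lebesgue (\<Union>D) \<le> measure lebesgue ({c..d} \<inter> Z) + \<delta> / 2"
          then show thesis by (intro that[of D]) (simp_all add: *)
        qed
      qed
      have Dint: "\<exists>x y. c \<le> x \<and> x \<le> y \<and> y \<le> d \<and> K = {x..y}" if K: "K \<in> D" for K
      proof -
        obtain x y where "K = cbox x y" using D(2)[OF K] by auto
        then show ?thesis using D(2)[OF K] by (intro exI[of _ x] exI[of _ y]) auto
      qed
      have DN: "K \<in> sets N" if KD: "K \<in> D" for K
      proof -
        obtain x y where "K = {x..y}" using Dint[OF KD] by blast
        then show ?thesis by (simp add: sN)
      qed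
      \<comment> \<open>A finite subfamily is an admissible interval family. The whole union follows
        by continuity of the measure from below.\<close>
      have fin: "emeasure N (\<Union>E) \<le> ennreal \<epsilon>" if E: "finite E" "E \<subseteq> D" for E
      proof -
        let ?g = "\<lambda>K::real set. (Inf K, Sup K)"
        have K: "K = {fst (?g K)..snd (?g K)}" "c \<le> fst (?g K)" "fst (?g K) \<le> snd (?g K)" "snd (?g K) \<le> d" if "K \<in> E" for K
        proof -
          have "K \<in> D" using that E(2) by (rule rev_subsetD)
          then obtain x y where "c \<le> x" "x \<le> y" "y \<le> d" "K = {x..y}"
            using Dint by metis
          then show "K = {fst (?g K)..snd (?g K)}" "c \<le> fst (?g K)" "fst (?g K) \<le> snd (?g K)" "snd (?g K) \<le> d"
            by simp_all
        qed
        have dis: "{fst (?g K)<..<snd (?g K)} \<inter> {fst (?g L)<..<snd (?g L)} = {}" if "K \<in> E" "L \<in> E" "K \<noteq> L" for K L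
        proof -
          have "interior K \<inter> interior L = {}" using D(3) E that by (auto simp: pairwise_def)
          then show ?thesis
            by (subst (asm) K(1)[OF that(1)], subst (asm) K(1)[OF that(2)]) (simp only: interior_atLeastAtMost_real)
        qed
        have inj: "inj_on ?g E"
        proof (rule inj_onI)
          fix K L assume "K \<in> E" "L \<in> E" "?g K = ?g L"
          then show "K = L" using K(1)[of K] K(1)[of L] by simp
        qed
        have I: "interval_family c d (?g ` E)"
          unfolding interval_family_def
        proof (intro conjI)
          show "pairwise (\<lambda>(u, v) (u', v'). {u<..<v} \<inter> {u'<..<v'} = {}) (?g ` E)"
          proof (rule pairwiseI)
            fix x y assume "x \<in> ?g ` E" "y \<in> ?g ` E" and ne: "x \<noteq> y"
            then obtain K L where "K \<in> E" "L \<in> E" and xy: "x = ?g K" "y = ?g L" by auto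
            with dis[OF this(1,2)] ne show "(case x of (u, v) \<Rightarrow> \<lambda>(u', v'). {u<..<v} \<inter> {u'<..<v'} = {}) y"
              by auto
          qed
        qed (use E K(2-4) in auto)
        have meas: "E \<subseteq> lmeasurable"
        proof
          fix K assume "K \<in> E"
          then show "K \<in> lmeasurable" by (subst K(1)) simp_all
        qed
        have "(\<Sum>(u, v)\<in>?g ` E. v - u) = (\<Sum>K\<in>E. Sup K - Inf K)" by (simp add: sum.reindex[OF inj])
        also have "\<dots> = (\<Sum>K\<in>E. measure lebesgue K)"
        proof (rule sum.cong[OF refl])
          fix K assume "K \<in> E"
          then have "measure lebesgue K = measure lebesgue {Inf K..Sup K}" using K(1)[of K] by simp
          then show "Sup K - Inf K = measure lebesgue K" using K(3)[OF \<open>K \<in> E\<close>] by simp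
        qed
        also have "\<dots> = measure lebesgue (\<Union>E)"
        proof (rule measure_negligible_finite_Union[symmetric])
          show "pairwise (\<lambda>S T. negligible (S \<inter> T)) E"
          proof (rule pairwiseI)
            fix K L assume KL: "K \<in> E" "L \<in> E" "K \<noteq> L"
            have "K \<inter> L = {fst (?g K)..snd (?g K)} \<inter> {fst (?g L)..snd (?g L)}"
              using K(1)[OF KL(1)] K(1)[OF KL(2)] by simp
            also have "\<dots> = cbox (max (Inf K) (Inf L)) (min (Sup K) (Sup L))"
              by simp
            moreover have "box (max (Inf K) (Inf L)) (min (Sup K) (Sup L)) = {}"
              using dis[OF KL] by simp
            ultimately show "negligible (K \<inter> L)" by (simp only: negligible_interval)
          qed
        qed (use E meas in auto)
        also have "\<dots> \<le> measure lebesgue (\<Union>D)"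
        proof (rule measure_mono_fmeasurable)
          show "\<Union>E \<in> sets lebesgue" using E(1) meas by (intro sets.finite_Union) auto
        qed (use E D(5) in auto)
        also have "\<dots> < \<delta>" using D(6) \<delta>(1) by linarith
        finally have "(\<Sum>(x, y)\<in>?g ` E. norm (v y - v x)) < \<epsilon>" by (rule \<delta>(2)[OF I])
        then have small: "(\<Sum>K\<in>E. norm (v (Sup K) - v (Inf K))) < \<epsilon>" by (simp add: sum.reindex[OF inj])
        have "emeasure N (\<Union>E) = emeasure N (\<Union>K\<in>E. K)" by simp
        also have "\<dots> \<le> (\<Sum>K\<in>E. emeasure N K)"
          by (rule emeasure_subadditive_finite) (use E DN in auto)
        also have "\<dots> = (\<Sum>K\<in>E. ennreal (norm (v (Sup K) - v (Inf K))))"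
        proof (rule sum.cong[OF refl])
          fix K assume KE: "K \<in> E"
          have "emeasure N K = emeasure N {Inf K..Sup K}" using K(1)[OF KE] by simp
          also have "\<dots> = ennreal (v (Sup K) - v (Inf K))" using eN[of "Inf K" "Sup K"] K[OF KE] by (simp add: w)
          also have "v (Sup K) - v (Inf K) = norm (v (Sup K) - v (Inf K))"
            using mono_onD[OF mono, of "Inf K" "Sup K"] K(2-4)[OF KE] by simp
          finally show "emeasure N K = ennreal (norm (v (Sup K) - v (Inf K)))" .
        qed
        also have "\<dots> \<le> ennreal \<epsilon>" using small by (simp add: sum_ennreal ennreal_leI)
        finally show ?thesis .
      qed
      show ?thesis
      proof (cases "D = {}")
        case True then show ?thesis using D(4) by simp
      next
        case False
        let ?A = "\<lambda>n. \<Union>(from_nat_into D ` {..n})"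
        have "emeasure N ({c..d} \<inter> Z) \<le> emeasure N (\<Union>D)"
          by (rule emeasure_mono[OF D(4)]) (use D(1) DN in \<open>auto intro: sets.countable_Union\<close>)
        also have "\<Union>D = (\<Union>n. ?A n)"
        proof -
          have "(\<Union>n. \<Union>(f ` {..n})) = \<Union>(range f)" for f :: "nat \<Rightarrow> real set" by blast
          then show ?thesis using range_from_nat_into[OF False D(1)] by simp
        qed
        also have "emeasure N (\<Union>n. ?A n) = (SUP n. emeasure N (?A n))"
        proof (rule SUP_emeasure_incseq[symmetric])
          show "range ?A \<subseteq> sets N" using DN from_nat_into[OF False] by (auto intro!: sets.finite_UN)
          show "incseq ?A" unfolding incseq_def by (intro allI impI Union_mono image_mono) auto
        qed
        also have "\<dots> \<le> ennreal \<epsilon>" by (rule SUP_least, rule fin) (use from_nat_into[OF False] in auto)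
        finally show ?thesis .
      qed
    qed
    then have "emeasure N ({c..d} \<inter> Z) = 0"
      by (metis ennreal_le_epsilon add_0 le_zero_eq zero_le)
    then show "Z \<in> null_sets N'" using eN'[OF Zb] Zb sN' by (auto simp: null_sets_def)
  qed
  obtain f where f: "f \<in> borel_measurable lborel" "density lborel f = N'"
    using sigma_finite_measure.Radon_Nikodym[OF lborel.sigma_finite_measure_axioms ac' sN'] by auto
  have nn: "(\<integral>\<^sup>+z. f z * indicator {x..y} z \<partial>lborel) = ennreal (v y - v x)" if "c \<le> x" "x \<le> y" "y \<le> d" for x y
  proof -
    have "(\<integral>\<^sup>+z. f z * indicator {x..y} z \<partial>lborel) = emeasure N' {x..y}"
      using f by (metis atLeastAtMost_borel emeasure_density sets_lborel)
    also have "\<dots> = emeasure N ({c..d} \<inter> {x..y})" by (rule eN') simp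
    also have "{c..d} \<inter> {x..y} = {x..y}" using that by auto
    finally show ?thesis using eN[OF that(2)] that by (simp add: w)
  qed
  \<comment> \<open>The density is finite almost everywhere on [c,d] because its integral there is,
    so \<open>enn2real\<close> loses nothing.\<close>
  have "AE z in lborel. f z * indicator {c..d} z \<noteq> \<infinity>"
    using f(1) nn[of c d] cd by (intro nn_integral_noteq_infinite) auto
  then have fin: "AE z in lborel. z \<in> {c..d} \<longrightarrow> f z \<noteq> \<infinity>"
    by eventually_elim (auto split: split_indicator_asm)
  define g where "g z = enn2real (f z)" for z
  have g: "(g has_integral (v y - v x)) {x..y}" if xy: "c \<le> x" "x \<le> y" "y \<le> d" for x y
  proof -
    have "(\<integral>\<^sup>+z. ennreal (g z * indicator {x..y} z) \<partial>lborel) = (\<integral>\<^sup>+z. f z * indicator {x..y} z \<partial>lborel)"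
    proof (rule nn_integral_cong_AE, use fin in eventually_elim)
      fix z assume "z \<in> {c..d} \<longrightarrow> f z \<noteq> \<infinity>"
      then show "ennreal (g z * indicator {x..y} z) = f z * indicator {x..y} z"
        using xy by (auto simp: g_def ennreal_enn2real_if top.not_eq_extremum split: split_indicator)
    qed
    with nn[OF xy] have "(\<integral>\<^sup>+z. ennreal (g z * indicator {x..y} z) \<partial>lborel) = ennreal (v y - v x)" by simp
    then have "((\<lambda>z. g z * indicator {x..y} z) has_integral (v y - v x)) UNIV"
      using f(1) mono_onD[OF mono, of x y] xy
      by (intro nn_integral_has_integral) (auto simp: g_def)
    moreover have "(\<lambda>z. g z * indicator {x..y} z) = (\<lambda>z. if z \<in> {x..y} then g z else 0)"
      by (auto simp: fun_eq_iff indicator_def)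
    ultimately show ?thesis by (simp only: has_integral_restrict_UNIV)
  qed
  have "primitive_on {c..d} v g"
    unfolding primitive_on_def
  proof (intro allI impI)
    fix x y assume xy: "x \<le> y \<and> {x..y} \<subseteq> {c..d}"
    then have "(g has_integral (v y - v x)) {x..y}" by (intro g) auto
    then show "g absolutely_integrable_on {x..y} \<and> integral {x..y} g = v y - v x"
      by (auto intro!: nonnegative_absolutely_integrable_1 simp: has_integral_integrable integral_unique g_def)
  qed
  then show thesis by (rule that)
qed

text \<open>Jordan decomposition: F is the difference of the monotone functions v and v - F, where v
  is its variation.\<close>

lemma abs_continuous_real_primitive:
  fixes F :: "real \<Rightarrow> real"
  assumes F: "abs_continuous_on_Icc c d F" and cd: "c \<le> d"
  obtains f where "primitive_on {c..d} F f"
proof -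
  let ?v = "variation F c"
  have sub: "?v x + norm (F y - F x) \<le> ?v y" if "c \<le> x" "x \<le> y" "y \<le> d" for x y
    by (rule variation_superadditive) (use abs_continuous_on_Icc_subset[OF F, of c y] that in auto)
  have v: "abs_continuous_on_Icc c d ?v" by (rule abs_continuous_variation[OF F])
  have "mono_on {c..d} ?v"
  proof (rule mono_onI)
    fix x y assume "x \<in> {c..d}" "y \<in> {c..d}" "x \<le> y"
    then show "?v x \<le> ?v y" using sub[of x y] norm_ge_zero[of "F y - F x"] by simp
  qed
  then obtain f1 where f1: "primitive_on {c..d} ?v f1" using abs_continuous_mono_primitive[OF v _ cd] by blast
  have "abs_continuous_on_Icc c d (\<lambda>x. ?v x - F x)"
    by (rule abs_continuous_on_Icc_dominated[OF v F, of _ 1]) (simp add: abs_real_def)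
  moreover have "mono_on {c..d} (\<lambda>x. ?v x - F x)"
  proof (rule mono_onI)
    fix x y assume "x \<in> {c..d}" "y \<in> {c..d}" "x \<le> y"
    then show "?v x - F x \<le> ?v y - F y" using sub[of x y] by (simp add: abs_real_def split: if_splits)
  qed
  ultimately obtain f2 where f2: "primitive_on {c..d} (\<lambda>x. ?v x - F x) f2"
    using abs_continuous_mono_primitive[OF _ _ cd] by blast
  have "primitive_on {c..d} (\<lambda>x. ?v x - (?v x - F x)) (\<lambda>x. f1 x - f2 x)"
    by (rule primitive_on_diff[OF f1 f2])
  then show thesis by (intro that) simp
qed

lemma primitive_on_componentwise:
  assumes "\<And>i. i \<in> Basis \<Longrightarrow> primitive_on S (\<lambda>x. F x \<bullet> i) (\<lambda>x. f x \<bullet> i)"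
  shows "primitive_on S F f"
  unfolding primitive_on_def
proof (intro allI impI)
  fix c d assume cd: "c \<le> d \<and> {c..d} \<subseteq> S"
  have ai: "f absolutely_integrable_on {c..d}"
  proof (rule absolutely_integrable_componentwise)
    fix i :: 'a assume i: "i \<in> Basis"
    show "(\<lambda>x. f x \<bullet> i) absolutely_integrable_on {c..d}"
      using primitive_onD(1)[OF assms[OF i]] cd by simp
  qed
  moreover have "integral {c..d} f = F d - F c"
  proof (rule euclidean_eqI)
    fix i :: 'a assume i: "i \<in> Basis"
    have "integral {c..d} f \<bullet> i = integral {c..d} (\<lambda>x. f x \<bullet> i)"
      using ai by (simp add: absolutely_integrable_on_def integral_component_eq)
    then show "integral {c..d} f \<bullet> i = (F d - F c) \<bullet> i"
      using primitive_onD(2)[OF assms[OF i]] cd by (simp add: inner_diff_left)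
  qed
  ultimately show "f absolutely_integrable_on {c..d} \<and> integral {c..d} f = F d - F c" ..
qed

lemma abs_continuous_primitive:
  fixes F :: "real \<Rightarrow> 'a::euclidean_space"
  assumes F: "abs_continuous_on_Icc c d F" and cd: "c \<le> d"
  obtains f where "primitive_on {c..d} F f"
proof -
  have "\<exists>f. primitive_on {c..d} (\<lambda>x. F x \<bullet> i) f" if i: "i \<in> Basis" for i
  proof -
    have "abs_continuous_on_Icc c d (\<lambda>x. F x \<bullet> i)"
    proof (rule abs_continuous_on_Icc_dominated[OF F F, of _ 1])
      fix u v
      show "norm (F v \<bullet> i - F u \<bullet> i) \<le> 1 * (norm (F v - F u) + norm (F v - F u))"
        using Basis_le_norm[OF i, of "F v - F u"] by (simp add: inner_diff_left)
    qed
    then show ?thesis using abs_continuous_real_primitive[OF _ cd] by metis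
  qed
  then obtain f where f: "\<And>i. i \<in> Basis \<Longrightarrow> primitive_on {c..d} (\<lambda>x. F x \<bullet> i) (f i)" by metis
  have "primitive_on {c..d} F (\<lambda>x. \<Sum>i\<in>Basis. f i x *\<^sub>R i)"
    by (rule primitive_on_componentwise) (simp add: f)
  then show thesis by (rule that)
qed

text \<open>Truncation at a height n: the excess over n has a small integral over [c,d], and the
  truncated part contributes at most n times the length of the family.\<close>

lemma absolute_continuity_integral:
  fixes g :: "real \<Rightarrow> real"
  assumes g: "g absolutely_integrable_on {c..d}" and nonneg: "\<And>x. 0 \<le> g x" and \<epsilon>: "\<epsilon> > 0"
  obtains \<delta> where "\<delta> > 0" "\<And>I. interval_family c d I \<Longrightarrow> (\<Sum>(u, v)\<in>I. v - u) < \<delta> \<Longrightarrow>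
    (\<Sum>(u, v)\<in>I. integral {u..v} g) < \<epsilon>"
proof -
  have gi: "g integrable_on {c..d}" using g by (simp add: absolutely_integrable_on_def)
  let ?t = "\<lambda>n x. min (g x) (real n)"
  have ti: "?t n integrable_on {c..d}" for n
    by (intro set_lebesgue_integral_eq_integral(1) absolutely_integrable_min_1 g) simp
  have "(\<lambda>n. integral {c..d} (\<lambda>x. g x - ?t n x)) \<longlonglongrightarrow> integral {c..d} (\<lambda>x. 0)"
  proof (rule dominated_convergence(2))
    show "(\<lambda>x. g x - ?t n x) integrable_on {c..d}" for n by (intro integrable_diff gi ti)
    show "g integrable_on {c..d}" by (rule gi)
    show "norm (g x - ?t n x) \<le> g x" for n x using nonneg[of x] by auto
    show "(\<lambda>n. g x - ?t n x) \<longlonglongrightarrow> 0" for x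
    proof (rule tendsto_eventually)
      obtain N :: nat where N: "g x \<le> real N" using real_arch_simple by blast
      show "eventually (\<lambda>n. g x - ?t n x = 0) sequentially"
        using eventually_ge_at_top[of N]
      proof eventually_elim
        case (elim n)
        then have "g x \<le> real n" using N by linarith
        then show ?case by simp
      qed
    qed
  qed
  then have "(\<lambda>n. integral {c..d} (\<lambda>x. g x - ?t n x)) \<longlonglongrightarrow> 0" by simp
  then have "eventually (\<lambda>n. integral {c..d} (\<lambda>x. g x - ?t n x) < \<epsilon> / 2) sequentially"
    by (rule order_tendstoD) (use \<epsilon> in simp)
  then obtain n where n: "integral {c..d} (\<lambda>x. g x - ?t n x) < \<epsilon> / 2"
    by (auto simp: eventually_sequentially)
  show thesis
  \<comment> \<open>n times this length is at most \<epsilon>/2, also for n = 0.\<close>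
  proof (rule that[of "\<epsilon> / (2 * (real n + 1))"])
    show "\<epsilon> / (2 * (real n + 1)) > 0" using \<epsilon> by simp
    fix I assume I: "interval_family c d I" and len: "(\<Sum>(u, v)\<in>I. v - u) < \<epsilon> / (2 * (real n + 1))"
    have "(\<Sum>(u, v)\<in>I. integral {u..v} g) \<le>
        (\<Sum>(u, v)\<in>I. integral {u..v} (\<lambda>x. g x - ?t n x) + real n * (v - u))"
    proof (rule sum_mono, clarify)
      fix u v assume uv: "(u, v) \<in> I"
      then have sub: "{u..v} \<subseteq> {c..d}" "u \<le> v" using interval_familyD(2-4)[OF I uv] by auto
      have "integral {u..v} g - integral {u..v} (\<lambda>x. g x - ?t n x) = integral {u..v} (?t n)"
        using integral_diff[OF integrable_subinterval_real[OF gi sub(1)] integrable_subinterval_real[OF ti[of n] sub(1)]] by simp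
      also have "\<dots> \<le> integral {u..v} (\<lambda>x. real n)"
        by (rule integral_le) (use integrable_subinterval_real[OF ti[of n] sub(1)] in auto)
      finally show "integral {u..v} g \<le> integral {u..v} (\<lambda>x. g x - ?t n x) + real n * (v - u)"
        using sub(2) by (simp add: algebra_simps)
    qed
    also have "\<dots> = (\<Sum>(u, v)\<in>I. integral {u..v} (\<lambda>x. g x - ?t n x)) + real n * (\<Sum>(u, v)\<in>I. v - u)"
      by (simp add: sum.distrib sum_distrib_left case_prod_unfold)
    also have "(\<Sum>(u, v)\<in>I. integral {u..v} (\<lambda>x. g x - ?t n x)) \<le> integral {c..d} (\<lambda>x. g x - ?t n x)"
      by (rule interval_family_integral_le[OF I]) (auto intro!: integrable_diff gi ti)
    also have "real n * (\<Sum>(u, v)\<in>I. v - u) \<le> real n * (\<epsilon> / (2 * (real n + 1)))"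
      using len by (intro mult_left_mono) auto
    also have "\<dots> \<le> \<epsilon> / 2" using \<epsilon> by (simp add: field_simps)
    finally show "(\<Sum>(u, v)\<in>I. integral {u..v} g) < \<epsilon>" using n by simp
  qed
qed

lemma primitive_on_abs_continuous:
  assumes F: "primitive_on S F f" and cd: "{c..d} \<subseteq> S"
  shows "abs_continuous_on_Icc c d F"
proof (cases "c \<le> d")
  case False
  then have "interval_family c d I \<Longrightarrow> I = {}" for I
    using interval_familyD(2-4)[of c d I] by fastforce
  then show ?thesis unfolding abs_continuous_on_Icc_iff by (metis sum.empty zero_less_one)
next
  case True
  have fi: "f absolutely_integrable_on {c..d}" by (rule primitive_onD(1)[OF F True cd])
  then have gi: "(\<lambda>x. norm (f x)) absolutely_integrable_on {c..d}"
    by (simp add: absolutely_integrable_on_def)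
  show ?thesis unfolding abs_continuous_on_Icc_iff
  proof (intro allI impI)
    fix \<epsilon> :: real assume "\<epsilon> > 0"
    then obtain \<delta> where \<delta>: "\<delta> > 0" "\<And>I. interval_family c d I \<Longrightarrow> (\<Sum>(u, v)\<in>I. v - u) < \<delta> \<Longrightarrow>
      (\<Sum>(u, v)\<in>I. integral {u..v} (\<lambda>x. norm (f x))) < \<epsilon>"
      using absolute_continuity_integral[OF gi] by (metis norm_ge_zero)
    have "(\<Sum>(u, v)\<in>I. norm (F v - F u)) \<le> (\<Sum>(u, v)\<in>I. integral {u..v} (\<lambda>x. norm (f x)))"
      if I: "interval_family c d I" for I
    proof (rule sum_mono, clarify)
      fix u v assume uv: "(u, v) \<in> I"
      then have sub: "{u..v} \<subseteq> {c..d}" "u \<le> v" using interval_familyD(2-4)[OF I uv] by auto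
      have "norm (integral {u..v} f) \<le> integral {u..v} (\<lambda>x. norm (f x))"
        using absolutely_integrable_on_subinterval[OF fi sub(1)]
        by (intro Henstock_Kurzweil_Integration.integral_norm_bound_integral) (auto simp: absolutely_integrable_on_def)
      then show "norm (F v - F u) \<le> integral {u..v} (\<lambda>x. norm (f x))"
        using primitive_onD(2)[OF F sub(2)] sub(1) cd by simp
    qed
    then show "\<exists>\<delta>>0. \<forall>I. interval_family c d I \<and> (\<Sum>(u, v)\<in>I. v - u) < \<delta> \<longrightarrow> (\<Sum>(u, v)\<in>I. norm (F v - F u)) < \<epsilon>"
      using \<delta> by (meson le_less_trans)
  qed
qed

lemma primitive_on_AC_loc: "primitive_on (einterval a b) F f \<Longrightarrow> F \<in> AC_loc a b"
  by (auto simp: AC_loc_def primitive_on_abs_continuous)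

section \<open>Null sets and differentiation of primitives almost everywhere\<close>

lemma AE_lebesgue_on_negligible:
  assumes "AE x in lebesgue_on S. P x" "S \<in> sets lebesgue"
  obtains N where "negligible N" "\<And>x. x \<in> S \<Longrightarrow> x \<notin> N \<Longrightarrow> P x"
proof -
  have "AE x in lebesgue. x \<in> S \<longrightarrow> P x" using assms by (simp add: AE_restrict_space_iff)
  then obtain N where "N \<in> null_sets lebesgue" "\<And>x. x \<in> S \<Longrightarrow> x \<notin> N \<Longrightarrow> P x" by (auto elim!: AE_E3)
  then show ?thesis by (intro that[of N]) (auto simp: negligible_iff_null_sets)
qed

lemma integral_cong_AE_lebesgue_on:
  assumes "AE x in lebesgue_on S. f x = g x" "{c..d} \<subseteq> S" "S \<in> sets lebesgue"
  shows "integral {c..d} f = integral {c..d} g"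
proof -
  obtain N where N: "negligible N" "\<And>x. x \<in> S \<Longrightarrow> x \<notin> N \<Longrightarrow> f x = g x"
    by (rule AE_lebesgue_on_negligible[OF assms(1,3)]) (rule that; assumption)
  show ?thesis by (rule integral_spike[OF N(1)]) (use N(2) assms(2) in force)
qed

lemma primitive_on_cong_AE:
  assumes F: "primitive_on S F f" and f: "AE x in lebesgue_on S. f x = g x" and FG: "\<And>x. x \<in> S \<Longrightarrow> F x = G x"
    and S: "S \<in> sets lebesgue"
  shows "primitive_on S G g"
  unfolding primitive_on_def
proof (intro allI impI, elim conjE)
  fix c d assume cd: "c \<le> d" "{c..d} \<subseteq> S"
  obtain N where N: "negligible N" "\<And>x. x \<in> S \<Longrightarrow> x \<notin> N \<Longrightarrow> f x = g x"
    by (rule AE_lebesgue_on_negligible[OF f S]) (rule that; assumption)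
  have "g absolutely_integrable_on {c..d}"
    by (rule absolutely_integrable_spike[OF primitive_onD(1)[OF F cd] N(1)]) (use N(2) cd(2) in force)
  moreover have "integral {c..d} g = integral {c..d} f"
    by (rule integral_cong_AE_lebesgue_on[OF f cd(2) S, symmetric])
  moreover have "F c = G c" "F d = G d" using FG cd by auto
  ultimately show "g absolutely_integrable_on {c..d} \<and> integral {c..d} g = G d - G c"
    using primitive_onD(2)[OF F cd] by simp
qed

text \<open>\<open>integrable_ccontinuous_explicit\<close> averages over cubes with x as lower
  corner, which on the line gives a right derivative only. The left derivative comes from
  reflection.\<close>

lemma primitive_on_right_derivative:
  fixes F :: "real \<Rightarrow> 'a::euclidean_space"
  assumes F: "primitive_on {c..d} F f"
  obtains N where "negligible N" "\<And>x e. x \<in> {c<..<d} \<Longrightarrow> x \<notin> N \<Longrightarrow> 0 < e \<Longrightarrow>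
    \<exists>\<delta>>0. \<forall>y. x < y \<and> y < x + \<delta> \<longrightarrow> norm (F y - F x - (y - x) *\<^sub>R f x) \<le> e * (y - x)"
proof (cases "c \<le> d")
  case False
  then show ?thesis using that[of "{}"] by auto
next
  case True
  \<comment> \<open>Extension by zero, since the differentiation theorem asks for integrability on
    every box.\<close>
  define g where "g x = (if x \<in> {c..d} then f x else 0)" for x
  have "f integrable_on {c..d}" by (rule primitive_onD(3)[OF F True]) simp
  moreover have "g = (\<lambda>x. if x \<in> {c..d} then f x else 0)" by (auto simp: g_def fun_eq_iff)
  ultimately have "g integrable_on UNIV" by (simp only: integrable_restrict_UNIV)
  then have "\<And>u v. g integrable_on cbox u v" by (rule integrable_on_subcbox) simp
  then obtain N where N: "negligible N"
    "\<And>x e. \<lbrakk>x \<notin> N; 0 < e\<rbrakk> \<Longrightarrow> \<exists>\<delta>>0. \<forall>h. 0 < h \<and> h < \<delta> \<longrightarrow>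
        norm (integral (cbox x (x + h *\<^sub>R One)) g /\<^sub>R h ^ DIM(real) - g x) < e"
    using integrable_ccontinuous_explicit[of g] by metis
  show ?thesis
  proof (rule that[OF N(1)])
    fix x e assume x: "x \<in> {c<..<d}" "x \<notin> N" and e: "(0::real) < e"
    obtain \<delta> where \<delta>: "\<delta> > 0" "\<And>h. 0 < h \<Longrightarrow> h < \<delta> \<Longrightarrow> norm (integral {x..x + h} g /\<^sub>R h - g x) < e"
      using N(2)[OF x(2) e] by auto
    show "\<exists>\<delta>>0. \<forall>y. x < y \<and> y < x + \<delta> \<longrightarrow> norm (F y - F x - (y - x) *\<^sub>R f x) \<le> e * (y - x)"
    proof (intro exI[of _ "min \<delta> (d - x)"] conjI allI impI)
      show "0 < min \<delta> (d - x)" using \<delta>(1) x by auto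
      fix y assume "x < y \<and> y < x + min \<delta> (d - x)"
      then have y: "x < y" "y - x < \<delta>" "y < d" by auto
      have sub: "{x..y} \<subseteq> {c..d}" using x y by auto
      have "integral {x..y} g = integral {x..y} f"
        by (rule integral_cong) (use sub in \<open>auto simp: g_def\<close>)
      also have "\<dots> = F y - F x" using primitive_onD(2)[OF F _ sub] y by simp
      finally have "integral {x..x + (y - x)} g = F y - F x" by simp
      moreover have "g x = f x" using x by (simp add: g_def)
      ultimately have "norm ((F y - F x) /\<^sub>R (y - x) - f x) < e" using \<delta>(2)[of "y - x"] y by simp
      then have "(y - x) * norm ((F y - F x) /\<^sub>R (y - x) - f x) \<le> (y - x) * e"
        using y by (intro mult_left_mono) auto
      moreover have "(y - x) * norm ((F y - F x) /\<^sub>R (y - x) - f x) = norm ((y - x) *\<^sub>R ((F y - F x) /\<^sub>R (y - x) - f x))"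
        using y by simp
      moreover have "(y - x) *\<^sub>R ((F y - F x) /\<^sub>R (y - x) - f x) = F y - F x - (y - x) *\<^sub>R f x"
        using y by (simp add: scaleR_diff_right)
      ultimately show "norm (F y - F x - (y - x) *\<^sub>R f x) \<le> e * (y - x)"
        by (simp add: mult.commute)
    qed
  qed
qed

text \<open>Carries right-hand results to the left: here for derivatives, later for the left
  endpoint.\<close>

lemma primitive_on_reflect:
  fixes F :: "real \<Rightarrow> 'a::euclidean_space"
  assumes F: "primitive_on S F f"
  shows "primitive_on (uminus ` S) (\<lambda>x. F (- x)) (\<lambda>x. - f (- x))"
  unfolding primitive_on_def
proof (intro allI impI, elim conjE)
  fix c d :: real assume cd: "c \<le> d" "{c..d} \<subseteq> uminus ` S"
  then have sub: "- d \<le> - c" "{- d..- c} \<subseteq> S" by (auto simp: subset_iff image_iff) (metis minus_minus neg_le_iff_le)+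
  have ai: "(\<lambda>x. f (- x)) absolutely_integrable_on {c..d}"
    using primitive_onD(1)[OF F sub] unfolding absolutely_integrable_on_def
    using Henstock_Kurzweil_Integration.integrable_reflect_real[where a = "- d" and b = "- c" and f = f]
      Henstock_Kurzweil_Integration.integrable_reflect_real[where a = "- d" and b = "- c" and f = "\<lambda>x. norm (f x)"]
    by simp
  have "integral {c..d} (\<lambda>x. f (- x)) = integral {- d..- c} f"
    using Henstock_Kurzweil_Integration.integral_reflect_real[where a = "- d" and b = "- c" and f = f] by simp
  also have "\<dots> = F (- c) - F (- d)" by (rule primitive_onD(2)[OF F sub])
  finally show "(\<lambda>x. - f (- x)) absolutely_integrable_on {c..d} \<and>
      integral {c..d} (\<lambda>x. - f (- x)) = F (- d) - F (- c)"
    using ai by (auto simp: absolutely_integrable_on_def intro: integrable_neg)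
qed

lemma negligible_uminus: "negligible N \<Longrightarrow> negligible (uminus ` N :: real set)"
  by (rule negligible_differentiable_image_negligible) (auto simp: differentiable_on_def)

lemma primitive_on_Icc_has_vector_derivative:
  fixes F :: "real \<Rightarrow> 'a::euclidean_space"
  assumes F: "primitive_on {c..d} F f"
  obtains N where "negligible N" "\<And>x. x \<in> {c<..<d} \<Longrightarrow> x \<notin> N \<Longrightarrow> (F has_vector_derivative f x) (at x)"
proof -
  obtain N1 where N1: "negligible N1" "\<And>x e. x \<in> {c<..<d} \<Longrightarrow> x \<notin> N1 \<Longrightarrow> 0 < e \<Longrightarrow>
    \<exists>\<delta>>0. \<forall>y. x < y \<and> y < x + \<delta> \<longrightarrow> norm (F y - F x - (y - x) *\<^sub>R f x) \<le> e * (y - x)"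
    using primitive_on_right_derivative[OF F] by metis
  have "primitive_on {- d..- c} (\<lambda>x. F (- x)) (\<lambda>x. - f (- x))"
    using primitive_on_reflect[OF F] by simp
  then obtain N2 where N2: "negligible N2" "\<And>x e. x \<in> {- d<..<- c} \<Longrightarrow> x \<notin> N2 \<Longrightarrow> 0 < e \<Longrightarrow>
    \<exists>\<delta>>0. \<forall>y. x < y \<and> y < x + \<delta> \<longrightarrow> norm (F (- y) - F (- x) - (y - x) *\<^sub>R (- f (- x))) \<le> e * (y - x)"
    using primitive_on_right_derivative by metis
  show thesis
  proof (rule that[of "N1 \<union> uminus ` N2"])
    show "negligible (N1 \<union> uminus ` N2)" using N1(1) N2(1) negligible_uminus by auto
    fix x assume x: "x \<in> {c<..<d}" "x \<notin> N1 \<union> uminus ` N2"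
    have "\<exists>\<delta>>0. \<forall>y. norm (y - x) < \<delta> \<longrightarrow> norm (F y - F x - (y - x) *\<^sub>R f x) \<le> e * norm (y - x)"
      if e: "e > 0" for e
    proof -
      obtain \<delta>1 where \<delta>1: "\<delta>1 > 0" "\<And>y. x < y \<Longrightarrow> y < x + \<delta>1 \<Longrightarrow> norm (F y - F x - (y - x) *\<^sub>R f x) \<le> e * (y - x)"
        using N1(2)[of x e] x e by auto
      have "- x \<in> {- d<..<- c}" "- x \<notin> N2" using x by (auto simp: image_iff)
      then obtain \<delta>2 where \<delta>2: "\<delta>2 > 0" "\<And>y. - x < y \<Longrightarrow> y < - x + \<delta>2 \<Longrightarrow>
          norm (F (- y) - F (- (- x)) - (y - (- x)) *\<^sub>R (- f (- (- x)))) \<le> e * (y - (- x))"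
        using N2(2)[of "- x" e] e by auto
      show ?thesis
      proof (intro exI[of _ "min \<delta>1 \<delta>2"] conjI allI impI)
        show "0 < min \<delta>1 \<delta>2" using \<delta>1(1) \<delta>2(1) by simp
        fix y assume y: "norm (y - x) < min \<delta>1 \<delta>2"
        consider "x < y" | "y = x" | "y < x" by linarith
        then show "norm (F y - F x - (y - x) *\<^sub>R f x) \<le> e * norm (y - x)"
        proof cases
          case 1 then show ?thesis using \<delta>1(2)[of y] y by simp
        next
          case 2 then show ?thesis by simp
        next
          case 3
          then have "norm (F y - F x - (- y + x) *\<^sub>R (- f x)) \<le> e * (- y + x)" using \<delta>2(2)[of "- y"] y by simp
          moreover have "(- y + x) *\<^sub>R (- f x) = (y - x) *\<^sub>R f x" by (simp add: algebra_simps)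
          ultimately have "norm (F y - F x - (y - x) *\<^sub>R f x) \<le> e * (- y + x)" by (simp only:)
          then show ?thesis using 3 by simp
        qed
      qed
    qed
    then show "(F has_vector_derivative f x) (at x)"
      unfolding has_vector_derivative_def has_derivative_at_alt
      by (auto intro: bounded_linear_scaleR_left)
  qed
qed

text \<open>Countably many intervals with rational endpoints cover the open set, so the exceptional
  sets of the compact intervals unite to a null set.\<close>

lemma primitive_on_open_has_vector_derivative:
  fixes F :: "real \<Rightarrow> 'a::euclidean_space"
  assumes F: "primitive_on S F f" and S: "open S"
  shows "AE x in lebesgue_on S. (F has_vector_derivative f x) (at x)"
proof -
  let ?P = "{(c, d). c \<in> \<rat> \<and> d \<in> \<rat> \<and> {c..d} \<subseteq> S}"
  define Q where "Q p N \<longleftrightarrow> negligible N \<and> (\<forall>x. x \<in> {fst p<..<snd p} \<longrightarrow> x \<notin> N \<longrightarrow> (F has_vector_derivative f x) (at x))"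
    for p :: "real \<times> real" and N
  have "\<forall>p\<in>?P. \<exists>N. Q p N"
  proof
    fix p assume p: "p \<in> ?P"
    have "{fst p..snd p} \<subseteq> S" using p by auto
    then obtain N where "negligible N" "\<And>x. x \<in> {fst p<..<snd p} \<Longrightarrow> x \<notin> N \<Longrightarrow> (F has_vector_derivative f x) (at x)"
      using primitive_on_Icc_has_vector_derivative[OF primitive_on_subset[OF F]] by metis
    then have "Q p N" by (simp add: Q_def)
    then show "\<exists>N. Q p N" ..
  qed
  from bchoice[OF this] obtain N where Q: "\<forall>p\<in>?P. Q p (N p)" ..
  have N: "negligible (N p)"
    "x \<in> {fst p<..<snd p} \<Longrightarrow> x \<notin> N p \<Longrightarrow> (F has_vector_derivative f x) (at x)" if "p \<in> ?P" for p x
    using bspec[OF Q that] by (auto simp: Q_def)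
  have "countable (\<rat> \<times> \<rat> :: (real \<times> real) set)" by (intro countable_SIGMA countable_rat)
  then have "countable ?P" by (rule countable_subset[rotated]) auto
  then have neg: "negligible (\<Union>(N ` ?P))" using N(1) by (intro negligible_countable_Union) auto
  have der: "(F has_vector_derivative f x) (at x)" if x: "x \<in> S" "x \<notin> \<Union>(N ` ?P)" for x
  proof -
    obtain e where e: "e > 0" "cball x e \<subseteq> S" using S x(1) by (meson open_contains_cball)
    obtain c where c: "c \<in> \<rat>" "x - e < c" "c < x" using Rats_dense_in_real[of "x - e" x] e by auto
    obtain d where d: "d \<in> \<rat>" "x < d" "d < x + e" using Rats_dense_in_real[of x "x + e"] e by auto
    have "{c..d} \<subseteq> cball x e" using c d by (auto simp: dist_real_def)
    then have "(c, d) \<in> ?P" using c d e by auto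
    then show ?thesis using N(2)[of "(c, d)" x] x c d by auto
  qed
  then have "AE x in lebesgue. x \<in> S \<longrightarrow> (F has_vector_derivative f x) (at x)"
  proof (intro AE_I'[of "\<Union>(N ` ?P)"])
    show "\<Union>(N ` ?P) \<in> null_sets lebesgue" using neg by (simp only: negligible_iff_null_sets)
    show "{x \<in> space lebesgue. \<not> (x \<in> S \<longrightarrow> (F has_vector_derivative f x) (at x))} \<subseteq> \<Union>(N ` ?P)"
    proof (intro subsetI, elim CollectE conjE)
      fix x assume "\<not> (x \<in> S \<longrightarrow> (F has_vector_derivative f x) (at x))"
      with der[of x] show "x \<in> \<Union>(N ` ?P)" by meson
    qed
  qed
  then show ?thesis using S by (simp add: AE_restrict_space_iff)
qed

lemma einterval_Icc_subset:
  assumes "c \<in> einterval a b" "d \<in> einterval a b"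
  shows "{c..d} \<subseteq> einterval a b"
  using assms by (auto simp: einterval_iff) (metis ereal_less_eq(3) less_le_trans, metis ereal_less_eq(3) le_less_trans)

text \<open>Links the definitions, which speak of \<open>AC_loc\<close> and
  \<open>vector_derivative\<close>, to primitives.\<close>

lemma AC_loc_primitive:
  fixes F :: "real \<Rightarrow> 'a::euclidean_space"
  assumes F: "F \<in> AC_loc a b"
  shows "primitive_on (einterval a b) F (\<lambda>x. vector_derivative F (at x))"
  unfolding primitive_on_def
proof (intro allI impI, elim conjE)
  fix c d assume cd: "c \<le> d" "{c..d} \<subseteq> einterval a b"
  have cI: "c \<in> einterval a b" and dI: "d \<in> einterval a b" using cd by auto
  obtain e1 where e1: "e1 > 0" "cball c e1 \<subseteq> einterval a b" using cI by (meson open_contains_cball open_einterval)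
  obtain e2 where e2: "e2 > 0" "cball d e2 \<subseteq> einterval a b" using dI by (meson open_contains_cball open_einterval)
  \<comment> \<open>A larger interval has c and d in its interior, so the derivative exists on [c,d]
    outside the null set N alone.\<close>
  define c' d' where "c' = c - e1" and "d' = d + e2"
  have c': "c' < c" "c' \<in> einterval a b" using e1 by (auto simp: c'_def dist_real_def intro!: subsetD[OF e1(2)])
  have d': "d < d'" "d' \<in> einterval a b" using e2 by (auto simp: d'_def dist_real_def intro!: subsetD[OF e2(2)])
  have "{c'..d'} \<subseteq> einterval a b" by (rule einterval_Icc_subset[OF c'(2) d'(2)])
  then have "abs_continuous_on_Icc c' d' F" using F by (auto simp: AC_loc_def)
  then obtain f where f: "primitive_on {c'..d'} F f"
    using abs_continuous_primitive[of c' d' F] c' d' cd by (metis less_eq_real_def order_trans)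
  obtain N where N: "negligible N" "\<And>x. x \<in> {c'<..<d'} \<Longrightarrow> x \<notin> N \<Longrightarrow> (F has_vector_derivative f x) (at x)"
    using primitive_on_Icc_has_vector_derivative[OF f] by metis
  have eq: "vector_derivative F (at x) = f x" if "x \<in> {c..d} - N" for x
    using N(2)[of x] that c' d' by (intro vector_derivative_at) auto
  have sub: "{c..d} \<subseteq> {c'..d'}" using c' d' by auto
  have "(\<lambda>x. vector_derivative F (at x)) absolutely_integrable_on {c..d}"
    by (rule absolutely_integrable_spike[OF primitive_onD(1)[OF f cd(1) sub] N(1) eq])
  moreover have "integral {c..d} (\<lambda>x. vector_derivative F (at x)) = integral {c..d} f"
    by (rule integral_spike[OF N(1)]) (use eq in simp)
  ultimately show "(\<lambda>x. vector_derivative F (at x)) absolutely_integrable_on {c..d} \<and>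
      integral {c..d} (\<lambda>x. vector_derivative F (at x)) = F d - F c"
    using primitive_onD(2)[OF f cd(1) sub] by simp
qed

text \<open>Splits each rule of calculus into absolute continuity of the result and the pointwise
  rule almost everywhere.\<close>

lemma AC_loc_primitiveI:
  fixes F :: "real \<Rightarrow> 'a::euclidean_space"
  assumes F: "F \<in> AC_loc a b" and f: "AE x in lebesgue_on (einterval a b). (F has_vector_derivative f x) (at x)"
  shows "primitive_on (einterval a b) F f"
proof (rule primitive_on_cong_AE[OF AC_loc_primitive[OF F]])
  show "AE x in lebesgue_on (einterval a b). vector_derivative F (at x) = f x"
    using f by eventually_elim (rule vector_derivative_at)
qed auto

section \<open>Product and chain rules for primitives\<close>

lemma primitive_on_continuous:
  fixes F :: "real \<Rightarrow> 'a::euclidean_space"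
  assumes F: "primitive_on S F f" and S: "open S"
  shows "continuous_on S F"
proof -
  have "isCont F x" if x: "x \<in> S" for x
  proof -
    obtain e where e: "e > 0" "cball x e \<subseteq> S" using S x by (meson open_contains_cball)
    have "continuous_on {x - e..x + e} F"
      using primitive_on_abs_continuous[OF F] e by (intro abs_continuous_on_Icc_continuous) (simp add: cball_eq_atLeastAtMost)
    then have "continuous_on {x - e<..<x + e} F" by (rule continuous_on_subset) auto
    then show ?thesis using e by (simp add: continuous_on_eq_continuous_at)
  qed
  then show ?thesis by (simp add: continuous_at_imp_continuous_on)
qed

text \<open>Bilinearity covers real, complex and scalar products at once. Both factors are bounded
  on compact intervals, so the increments of the product are dominated by those of the
  factors.\<close>

lemma primitive_on_bilinear:
  fixes F :: "real \<Rightarrow> 'a::euclidean_space" and G :: "real \<Rightarrow> 'b::euclidean_space"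
    and prod :: "'a \<Rightarrow> 'b \<Rightarrow> 'c::euclidean_space"
  assumes bil: "bounded_bilinear prod"
    and F: "primitive_on (einterval a b) F f" and G: "primitive_on (einterval a b) G g"
  shows "primitive_on (einterval a b) (\<lambda>x. prod (F x) (G x)) (\<lambda>x. prod (F x) (g x) + prod (f x) (G x))"
proof (rule AC_loc_primitiveI)
  interpret bounded_bilinear prod by (rule bil)
  obtain K where K: "K > 0" "\<And>x y. norm (prod x y) \<le> norm x * norm y * K" using pos_bounded by blast
  show "(\<lambda>x. prod (F x) (G x)) \<in> AC_loc a b"
    unfolding AC_loc_def
  proof (clarify)
    fix c d assume cd: "{c..d} \<subseteq> einterval a b"
    have acF: "abs_continuous_on_Icc c d F" and acG: "abs_continuous_on_Icc c d G"
      using primitive_on_abs_continuous F G cd by blast+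
    have "bounded (F ` {c..d})" "bounded (G ` {c..d})"
      using abs_continuous_on_Icc_continuous[OF acF] abs_continuous_on_Icc_continuous[OF acG]
      by (auto intro!: compact_imp_bounded compact_continuous_image)
    then obtain B1 B2 where B: "\<And>x. x \<in> {c..d} \<Longrightarrow> norm (F x) \<le> B1" "\<And>x. x \<in> {c..d} \<Longrightarrow> norm (G x) \<le> B2"
      unfolding bounded_iff by blast
    show "abs_continuous_on_Icc c d (\<lambda>x. prod (F x) (G x))"
    proof (rule abs_continuous_on_Icc_dominated[OF acF acG])
      fix u v assume uv: "c \<le> u" "u \<le> v" "v \<le> d"
      have "prod (F v) (G v) - prod (F u) (G u) = prod (F v - F u) (G v) + prod (F u) (G v - G u)"
        by (simp add: diff_left diff_right)
      then have "norm (prod (F v) (G v) - prod (F u) (G u)) \<le> norm (F v - F u) * norm (G v) * K + norm (F u) * norm (G v - G u) * K"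
        using K(2)[of "F v - F u" "G v"] K(2)[of "F u" "G v - G u"] by (simp only:) (rule norm_triangle_mono)
      also have "\<dots> \<le> norm (F v - F u) * max B1 B2 * K + max B1 B2 * norm (G v - G u) * K"
        using B(1)[of u] B(2)[of v] uv K(1) by (intro add_mono mult_right_mono mult_left_mono) auto
      finally show "norm (prod (F v) (G v) - prod (F u) (G u)) \<le> (max B1 B2 * K) * (norm (F v - F u) + norm (G v - G u))"
        by (simp add: algebra_simps)
    qed
  qed
  show "AE x in lebesgue_on (einterval a b). ((\<lambda>x. prod (F x) (G x)) has_vector_derivative (prod (F x) (g x) + prod (f x) (G x))) (at x)"
    using primitive_on_open_has_vector_derivative[OF F open_einterval] primitive_on_open_has_vector_derivative[OF G open_einterval]
    by eventually_elim (rule has_vector_derivative)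
qed

text \<open>On a compact interval h is Lipschitz on the range of F: h' is bounded there, and the
  range is an interval, so the mean value bound applies.\<close>

lemma primitive_on_compose:
  fixes F :: "real \<Rightarrow> real"
  assumes F: "primitive_on (einterval a b) F f"
    and h: "\<And>y. y \<in> F ` einterval a b \<Longrightarrow> (h has_real_derivative h' y) (at y)"
    and h': "continuous_on (F ` einterval a b) h'"
  shows "primitive_on (einterval a b) (\<lambda>x. h (F x)) (\<lambda>x. h' (F x) * f x)"
proof (rule AC_loc_primitiveI)
  show "(\<lambda>x. h (F x)) \<in> AC_loc a b"
    unfolding AC_loc_def
  proof (clarify)
    fix c d assume cd: "{c..d} \<subseteq> einterval a b"
    have ac: "abs_continuous_on_Icc c d F" using primitive_on_abs_continuous F cd by blast
    then have cont: "continuous_on {c..d} F" by (rule abs_continuous_on_Icc_continuous)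
    have sub: "F ` {c..d} \<subseteq> F ` einterval a b" using cd by auto
    have "compact (F ` {c..d})" using cont by (intro compact_continuous_image) auto
    then have "bounded (h' ` F ` {c..d})"
      using continuous_on_subset[OF h' sub] by (blast intro: compact_imp_bounded compact_continuous_image)
    then obtain B where B: "\<And>y. y \<in> F ` {c..d} \<Longrightarrow> norm (h' y) \<le> B" unfolding bounded_iff by blast
    have "connected (F ` {c..d})" using cont by (intro connected_continuous_image) auto
    then have conv: "convex (F ` {c..d})" by (metis is_interval_connected_1 is_interval_convex_1)
    show "abs_continuous_on_Icc c d (\<lambda>x. h (F x))"
    proof (rule abs_continuous_on_Icc_dominated[OF ac ac])
      fix u v assume uv: "c \<le> u" "u \<le> v" "v \<le> d"
      have "norm (h (F v) - h (F u)) \<le> B * norm (F v - F u)"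
        by (rule field_differentiable_bound[OF conv _ B])
          (use sub h uv in \<open>auto intro: has_field_derivative_at_within\<close>)
      then show "norm (h (F v) - h (F u)) \<le> (B / 2) * (norm (F v - F u) + norm (F v - F u))" by simp
    qed
  qed
  have "AE x in lebesgue_on (einterval a b). x \<in> einterval a b"
    by (rule AE_I2) simp
  with primitive_on_open_has_vector_derivative[OF F open_einterval]
  show "AE x in lebesgue_on (einterval a b). ((\<lambda>x. h (F x)) has_vector_derivative (h' (F x) * f x)) (at x)"
  proof eventually_elim
    case (elim x)
    have "(h has_real_derivative h' (F x)) (at (F x))" using h elim(2) by blast
    moreover have "(F has_real_derivative f x) (at x)" using elim(1) by (simp add: has_real_derivative_iff_has_vector_derivative)
    ultimately have "((\<lambda>x. h (F x)) has_real_derivative h' (F x) * f x) (at x)" by (rule DERIV_chain2)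
    then show ?case by (simp add: has_real_derivative_iff_has_vector_derivative)
  qed
qed

section \<open>Locally integrable functions and their primitives\<close>

definition loc_integrable_on :: "real set \<Rightarrow> (real \<Rightarrow> 'a::euclidean_space) \<Rightarrow> bool" where
  "loc_integrable_on S f \<longleftrightarrow> (\<forall>c d. {c..d} \<subseteq> S \<longrightarrow> f absolutely_integrable_on {c..d})"

lemma L1_loc_iff: "f \<in> L1_loc a b \<longleftrightarrow> loc_integrable_on (einterval a b) f"
  by (simp add: L1_loc_def loc_integrable_on_def)

lemma loc_integrable_onD:
  assumes "loc_integrable_on S f" "{c..d} \<subseteq> S"
  shows "f absolutely_integrable_on {c..d}" "f integrable_on {c..d}"
  using assms by (auto simp: loc_integrable_on_def absolutely_integrable_on_def)

lemma primitive_on_loc_integrable: "primitive_on S F f \<Longrightarrow> loc_integrable_on S f"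
  unfolding primitive_on_def loc_integrable_on_def
  by (metis atLeastatMost_empty_iff2 absolutely_integrable_on_def integrable_on_empty)

lemma loc_integrable_on_add:
  assumes "loc_integrable_on S f" "loc_integrable_on S g"
  shows "loc_integrable_on S (\<lambda>x. f x + g x)"
  using assms unfolding loc_integrable_on_def by (auto intro!: set_integral_add(1))

lemma loc_integrable_on_diff:
  assumes "loc_integrable_on S f" "loc_integrable_on S g"
  shows "loc_integrable_on S (\<lambda>x. f x - g x)"
  using assms unfolding loc_integrable_on_def by (auto intro!: set_integral_diff(1))

lemma loc_integrable_on_norm:
  "loc_integrable_on S f \<Longrightarrow> loc_integrable_on S (\<lambda>x. norm (f x))"
  unfolding loc_integrable_on_def by (simp add: absolutely_integrable_on_def)

lemma loc_integrable_on_subset: "loc_integrable_on S f \<Longrightarrow> T \<subseteq> S \<Longrightarrow> loc_integrable_on T f"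
  unfolding loc_integrable_on_def by blast

lemma loc_integrable_on_bilinear:
  fixes prod :: "'a::euclidean_space \<Rightarrow> 'b::euclidean_space \<Rightarrow> 'c::euclidean_space"
  assumes "bounded_bilinear prod" and f: "loc_integrable_on S f" and g: "continuous_on S g"
  shows "loc_integrable_on S (\<lambda>x. prod (f x) (g x))"
  unfolding loc_integrable_on_def
proof (intro allI impI)
  fix c d assume cd: "{c..d} \<subseteq> S"
  have g': "continuous_on {c..d} g" by (rule continuous_on_subset[OF g cd])
  have "g \<in> borel_measurable (lebesgue_on {c..d})"
    by (rule continuous_imp_measurable_on_sets_lebesgue[OF g']) simp
  moreover have "bounded (g ` {c..d})"
    using g' by (intro compact_imp_bounded compact_continuous_image) auto
  ultimately show "(\<lambda>x. prod (f x) (g x)) absolutely_integrable_on {c..d}"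
    using absolutely_integrable_bounded_measurable_product[of "\<lambda>x y. prod y x" g "{c..d}" f]
      bounded_bilinear.flip[OF assms(1)] bilinear_conv_bounded_bilinear[of "\<lambda>x y. prod y x"]
      loc_integrable_onD(1)[OF f cd] by simp
qed

lemmas loc_integrable_on_scaleR = loc_integrable_on_bilinear[OF bounded_bilinear_scaleR]
lemmas loc_integrable_on_mult = loc_integrable_on_bilinear[OF bounded_bilinear_mult]

text \<open>Pointwise limit of the restrictions to an exhausting sequence of compact
  intervals.\<close>

lemma loc_integrable_on_measurable:
  assumes f: "loc_integrable_on (einterval a b) f" and ab: "a < b"
  shows "f \<in> borel_measurable (lebesgue_on (einterval a b))"
proof -
  obtain u l where ul: "einterval a b = (\<Union>i. {l i .. u i :: real})" "incseq u" "decseq l"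
    using einterval_Icc_approximation[OF ab] by metis
  have mono: "{l i..u i} \<subseteq> {l j..u j}" if "i \<le> j" for i j
    using incseqD[OF ul(2) that] decseqD[OF ul(3) that] by auto
  have "(\<lambda>x. indicator (einterval a b) x *\<^sub>R f x) \<in> borel_measurable lebesgue"
  proof (rule borel_measurable_LIMSEQ_metric)
    show "(\<lambda>x. indicator {l i..u i} x *\<^sub>R f x) \<in> borel_measurable lebesgue" for i
    proof -
      have "{l i..u i} \<subseteq> einterval a b" using ul(1) by auto
      from loc_integrable_onD(1)[OF f this] show ?thesis
        unfolding set_integrable_def by (rule borel_measurable_integrable)
    qed
    fix x
    show "(\<lambda>i. indicator {l i..u i} x *\<^sub>R f x) \<longlonglongrightarrow> indicator (einterval a b) x *\<^sub>R f x"
    proof (cases "x \<in> einterval a b")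
      case True
      then obtain i where "x \<in> {l i..u i}" using ul(1) by auto
      then have "x \<in> {l j..u j}" if "i \<le> j" for j using mono[OF that] by blast
      then have "eventually (\<lambda>j. x \<in> {l j..u j}) sequentially"
        unfolding eventually_sequentially by blast
      then have "eventually (\<lambda>j. indicator {l j..u j} x *\<^sub>R f x = indicator (einterval a b) x *\<^sub>R f x) sequentially"
        by eventually_elim (use True in simp)
      then show ?thesis by (rule tendsto_eventually)
    next
      case False
      then have "x \<notin> {l i..u i}" for i using ul(1) by blast
      then have "indicator {l i..u i} x = (0::real)" for i by (rule indicator_simps(2))
      with False show ?thesis by simp
    qed
  qed
  then show ?thesis by (subst borel_measurable_restrict_space_iff) auto
qed

lemma primitive_on_exists:
  assumes f: "loc_integrable_on (einterval a b) f" and x0: "x0 \<in> einterval a b"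
  obtains F where "primitive_on (einterval a b) F f" "F x0 = y0"
proof -
  define F where "F x = y0 + (if x0 \<le> x then integral {x0..x} f else - integral {x..x0} f)" for x
  have "primitive_on (einterval a b) F f"
    unfolding primitive_on_def
  proof (intro allI impI, elim conjE)
    fix c d assume cd: "c \<le> d" "{c..d} \<subseteq> einterval a b"
    have int: "f integrable_on {u..v}" if "u \<in> einterval a b" "v \<in> einterval a b" for u v
      using loc_integrable_onD(2)[OF f] einterval_Icc_subset[OF that] .
    have cI: "c \<in> einterval a b" "d \<in> einterval a b" using cd by auto
    have "integral {c..d} f = F d - F c"
    proof -
      consider "x0 \<le> c" | "c < x0" "x0 \<le> d" | "d < x0" by linarith
      then show ?thesis
      proof cases
        case 1
        then show ?thesis using Henstock_Kurzweil_Integration.integral_combine[OF 1 cd(1) int[OF x0 cI(2)]] cd by (simp add: F_def algebra_simps)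
      next
        case 2
        then show ?thesis using Henstock_Kurzweil_Integration.integral_combine[of c x0 d f] int[OF cI] by (simp add: F_def algebra_simps)
      next
        case 3
        then show ?thesis using Henstock_Kurzweil_Integration.integral_combine[of c d x0 f] int[OF cI(1) x0] cd by (simp add: F_def algebra_simps)
      qed
    qed
    then show "f absolutely_integrable_on {c..d} \<and> integral {c..d} f = F d - F c"
      using loc_integrable_onD(1)[OF f cd(2)] by simp
  qed
  moreover have "F x0 = y0" by (simp add: F_def)
  ultimately show thesis by (rule that)
qed

lemma primitive_on_add:
  assumes "primitive_on S F f" "primitive_on S G g"
  shows "primitive_on S (\<lambda>x. F x + G x) (\<lambda>x. f x + g x)"
  unfolding primitive_on_def
proof (intro allI impI)
  fix c d assume cd: "c \<le> d \<and> {c..d} \<subseteq> S"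
  note f = primitive_onD[OF assms(1), of c d] and g = primitive_onD[OF assms(2), of c d]
  show "(\<lambda>x. f x + g x) absolutely_integrable_on {c..d} \<and>
      integral {c..d} (\<lambda>x. f x + g x) = F d + G d - (F c + G c)"
    using f g cd by (auto simp: set_integral_add(1) integral_add)
qed

lemma primitive_on_linear:
  assumes L: "bounded_linear L" and F: "primitive_on S F f"
  shows "primitive_on S (\<lambda>x. L (F x)) (\<lambda>x. L (f x))"
  unfolding primitive_on_def
proof (intro allI impI)
  fix c d assume cd: "c \<le> d \<and> {c..d} \<subseteq> S"
  note f = primitive_onD[OF F, of c d]
  have "(L \<circ> f) absolutely_integrable_on {c..d}" using f(1) cd by (intro absolutely_integrable_linear L) auto
  moreover have "integral {c..d} (L \<circ> f) = L (integral {c..d} f)" using f(3) cd by (intro integral_linear L) auto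
  ultimately show "(\<lambda>x. L (f x)) absolutely_integrable_on {c..d} \<and>
      integral {c..d} (\<lambda>x. L (f x)) = L (F d) - L (F c)"
    using f(2) cd by (simp add: o_def linear_diff[OF bounded_linear.linear[OF L]])
qed

lemma primitive_on_const: "primitive_on S (\<lambda>x. c) (\<lambda>x. 0)"
  by (simp add: primitive_on_def)

lemma primitive_on_eqI:
  assumes "primitive_on (einterval a b) F f" "primitive_on (einterval a b) G f" "x0 \<in> einterval a b" "F x0 = G x0"
    "x \<in> einterval a b"
  shows "F x = G x"
proof -
  have "F x - F x0 = G x - G x0"
  proof (cases "x0 \<le> x")
    case True
    then show ?thesis
      using primitive_onD(2)[OF assms(1) True einterval_Icc_subset] primitive_onD(2)[OF assms(2) True einterval_Icc_subset] assms(3,5) by simp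
  next
    case False
    then have "x \<le> x0" by simp
    from primitive_onD(2)[OF assms(1) this einterval_Icc_subset] primitive_onD(2)[OF assms(2) this einterval_Icc_subset] assms(3,5)
    have "F x0 - F x = G x0 - G x" by simp
    then show ?thesis by (metis minus_diff_eq)
  qed
  then show ?thesis using assms(4) by simp
qed

section \<open>Existence of solutions\<close>

text \<open>The weight \<open>exp (2 * \<bar>M x\<bar>)\<close> makes the Picard iteration contract by the factor \<open>1/2\<close>.\<close>

lemma weighted_primitive_bound:
  fixes f :: "real \<Rightarrow> real"
  assumes M: "primitive_on (einterval a b) M m" "M x0 = 0" and m: "\<And>x. 0 \<le> m x"
    and F: "primitive_on (einterval a b) F f" "F x0 = 0"
    and f: "\<And>x. x \<in> einterval a b \<Longrightarrow> \<bar>f x\<bar> \<le> K * (m x * exp (2 * \<bar>M x\<bar>))"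
    and K0: "0 \<le> K" and x0: "x0 \<in> einterval a b" and x: "x \<in> einterval a b"
  shows "\<bar>F x\<bar> \<le> K / 2 * exp (2 * \<bar>M x\<bar>)"
proof -
  have mono: "M u \<le> M v" if "u \<le> v" "{u..v} \<subseteq> einterval a b" for u v
  proof -
    have "0 \<le> integral {u..v} m"
      by (rule integral_nonneg) (use primitive_onD(3)[OF M(1) that] m in auto)
    then show ?thesis using primitive_onD(2)[OF M(1) that] by simp
  qed
  \<comment> \<open>The sign \<sigma> is 1 to the right of x0 and -1 to the left, so that |M x| =
    \<sigma> M x on the side in question.\<close>
  have G: "primitive_on (einterval a b) (\<lambda>x. exp (\<sigma> * 2 * M x)) (\<lambda>x. (\<sigma> * 2 * exp (\<sigma> * 2 * M x)) * m x)" for \<sigma> :: real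
    by (rule primitive_on_compose[OF M(1), of "\<lambda>y. exp (\<sigma> * 2 * y)"])
      (auto intro!: derivative_eq_intros continuous_intros)
  show ?thesis
  proof (cases "x0 \<le> x")
    case True
    have sub: "{x0..x} \<subseteq> einterval a b" by (rule einterval_Icc_subset[OF x0 x])
    have Mpos: "0 \<le> M t" if "t \<in> {x0..x}" for t
      using mono[of x0 t] order_trans[OF _ sub, of "{x0..t}"] that M(2) by auto
    have "\<bar>F x\<bar> = \<bar>integral {x0..x} f\<bar>" using primitive_onD(2)[OF F(1) True sub] F(2) by simp
    also have "\<dots> \<le> integral {x0..x} (\<lambda>t. (K / 2) * ((1 * 2 * exp (1 * 2 * M t)) * m t))"
      unfolding real_norm_def[symmetric]
    proof (rule Henstock_Kurzweil_Integration.integral_norm_bound_integral)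
      show "f integrable_on {x0..x}" by (rule primitive_onD(3)[OF F(1) True sub])
      show "(\<lambda>t. (K / 2) * ((1 * 2 * exp (1 * 2 * M t)) * m t)) integrable_on {x0..x}"
        using primitive_onD(3)[OF G[of 1] True sub] by (rule integrable_on_mult_right)
      fix t assume t: "t \<in> {x0..x}"
      then show "norm (f t) \<le> (K / 2) * ((1 * 2 * exp (1 * 2 * M t)) * m t)"
        using f[of t] Mpos[OF t] sub by (auto simp: algebra_simps)
    qed
    also have "\<dots> = (K / 2) * (exp (2 * M x) - 1)"
      using primitive_onD(2)[OF G[of 1] True sub] M(2) by (simp only: integral_mult_right) simp
    also have "\<dots> \<le> K / 2 * exp (2 * \<bar>M x\<bar>)" using K0 Mpos[of x] True by (intro mult_left_mono) auto
    finally show ?thesis .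
  next
    case False
    then have le: "x \<le> x0" by simp
    have sub: "{x..x0} \<subseteq> einterval a b" by (rule einterval_Icc_subset[OF x x0])
    have Mneg: "M t \<le> 0" if "t \<in> {x..x0}" for t
      using mono[of t x0] order_trans[OF _ sub, of "{t..x0}"] that M(2) by auto
    have "\<bar>F x\<bar> = \<bar>integral {x..x0} f\<bar>" using primitive_onD(2)[OF F(1) le sub] F(2) by simp
    also have "\<dots> \<le> integral {x..x0} (\<lambda>t. (- K / 2) * ((- 1 * 2 * exp (- 1 * 2 * M t)) * m t))"
      unfolding real_norm_def[symmetric]
    proof (rule Henstock_Kurzweil_Integration.integral_norm_bound_integral)
      show "f integrable_on {x..x0}" by (rule primitive_onD(3)[OF F(1) le sub])
      show "(\<lambda>t. (- K / 2) * ((- 1 * 2 * exp (- 1 * 2 * M t)) * m t)) integrable_on {x..x0}"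
        using primitive_onD(3)[OF G[of "- 1"] le sub] by (rule integrable_on_mult_right)
      fix t assume t: "t \<in> {x..x0}"
      then show "norm (f t) \<le> (- K / 2) * ((- 1 * 2 * exp (- 1 * 2 * M t)) * m t)"
        using f[of t] Mneg[OF t] sub by (auto simp: algebra_simps)
    qed
    also have "\<dots> = (- K / 2) * (1 - exp (- 2 * M x))"
      using primitive_onD(2)[OF G[of "- 1"] le sub] M(2) by (simp only: integral_mult_right) simp
    also have "\<dots> \<le> K / 2 * exp (2 * \<bar>M x\<bar>)" using K0 Mneg[of x] le by (simp add: algebra_simps)
    finally show ?thesis .
  qed
qed

text \<open>Picard iteration for integral equations with locally integrable coefficients. The weight
  of \<open>weighted_primitive_bound\<close> gives convergence on the whole interval at once instead
  of on short pieces.\<close>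

lemma linear_system_solution:
  fixes \<omega> W :: "real \<Rightarrow> real"
  assumes \<omega>: "loc_integrable_on (einterval a b) \<omega>" and W: "loc_integrable_on (einterval a b) W"
    and x0: "x0 \<in> einterval a b"
  obtains y z where "primitive_on (einterval a b) y (\<lambda>x. \<omega> x * z x)"
    "primitive_on (einterval a b) z (\<lambda>x. W x * y x)" "y x0 = y0" "z x0 = z0"
proof -
  let ?I = "einterval a b"
  \<comment> \<open>\<open>P f v\<close> integrates f from x0 with value v there; as a function it
    can be used in the recursion.\<close>
  define P where "P f v = (SOME F. primitive_on ?I F f \<and> F x0 = v)" for f :: "real \<Rightarrow> real" and v
  have P: "primitive_on ?I (P f v) f" "P f v x0 = v" if "loc_integrable_on ?I f" for f v
  proof -
    have "\<exists>F. primitive_on ?I F f \<and> F x0 = v"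
      using primitive_on_exists[OF that x0, of v] by metis
    from someI_ex[OF this] show "primitive_on ?I (P f v) f" "P f v x0 = v" unfolding P_def by auto
  qed
  define Y where "Y = rec_nat (\<lambda>x::real. y0, \<lambda>x::real. z0)
    (\<lambda>_ (y, z). (P (\<lambda>x. \<omega> x * z x) y0, P (\<lambda>x. W x * y x) z0))"
  define y z where "y n = fst (Y n)" and "z n = snd (Y n)" for n
  have Y0: "y 0 = (\<lambda>x. y0)" "z 0 = (\<lambda>x. z0)" by (auto simp: y_def z_def Y_def)
  have YS: "y (Suc n) = P (\<lambda>x. \<omega> x * z n x) y0" "z (Suc n) = P (\<lambda>x. W x * y n x) z0" for n
    by (auto simp: y_def z_def Y_def case_prod_unfold)
  have cont: "continuous_on ?I (y n) \<and> continuous_on ?I (z n)" for n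
  proof (induction n)
    case 0 then show ?case by (simp add: Y0)
  next
    case (Suc n)
    then show ?case
      using P(1)[of "\<lambda>x. \<omega> x * z n x" y0] P(1)[of "\<lambda>x. W x * y n x" z0] loc_integrable_on_mult \<omega> W
      unfolding YS by (blast intro: primitive_on_continuous open_einterval)
  qed
  have li: "loc_integrable_on ?I (\<lambda>x. \<omega> x * z n x)" "loc_integrable_on ?I (\<lambda>x. W x * y n x)" for n
    using cont[of n] \<omega> W by (auto intro: loc_integrable_on_mult)
  have prim: "primitive_on ?I (y (Suc n)) (\<lambda>x. \<omega> x * z n x)" "primitive_on ?I (z (Suc n)) (\<lambda>x. W x * y n x)"
    and init: "y n x0 = y0" "z n x0 = z0" for n
    using P[OF li(1)[of n]] P[OF li(2)[of n]] P(2)[OF li(1)] P(2)[OF li(2)]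
    by (simp_all add: YS) (cases n; simp add: Y0 YS)+
  define m where "m x = \<bar>\<omega> x\<bar> + \<bar>W x\<bar>" for x
  have "loc_integrable_on ?I m"
    unfolding m_def using \<omega> W by (intro loc_integrable_on_add) (auto dest: loc_integrable_on_norm)
  then obtain M where M: "primitive_on ?I M m" "M x0 = 0" using primitive_on_exists[OF _ x0] by metis
  have m0: "0 \<le> m x" for x by (simp add: m_def)
  define e where "e x = exp (2 * \<bar>M x\<bar>)" for x
  have e1: "1 \<le> e x" for x by (simp add: e_def)
  \<comment> \<open>Dominates the constants in the integrands of the first step, which are \<omega>
    z0 and W y0.\<close>
  define K where "K = \<bar>y0\<bar> + \<bar>z0\<bar>"
  have bound: "\<bar>y (Suc n) x - y n x\<bar> \<le> K * (1 / 2) ^ n * e x \<and> \<bar>z (Suc n) x - z n x\<bar> \<le> K * (1 / 2) ^ n * e x"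
    if x: "x \<in> ?I" for n x
    using x
  proof (induction n arbitrary: x)
    case 0
    have "\<bar>y (Suc 0) x - y 0 x\<bar> \<le> K / 2 * exp (2 * \<bar>M x\<bar>)"
    proof (rule weighted_primitive_bound[OF M m0 _ _ _ _ x0 0])
      show "primitive_on ?I (\<lambda>x. y (Suc 0) x - y 0 x) (\<lambda>x. \<omega> x * z 0 x - 0)"
        unfolding Y0(1) by (rule primitive_on_diff[OF prim(1) primitive_on_const])
      fix t
      have "\<bar>\<omega> t\<bar> * \<bar>z0\<bar> \<le> m t * (K * e t)"
        using e1[of t] by (intro mult_mono) (auto simp: m_def K_def intro: order_trans[OF _ mult_left_mono[of 1 "e t" "\<bar>y0\<bar> + \<bar>z0\<bar>"]])
      then show "\<bar>\<omega> t * z 0 t - 0\<bar> \<le> K * (m t * exp (2 * \<bar>M t\<bar>))"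
        by (simp add: Y0 abs_mult e_def algebra_simps)
    qed (auto simp: init K_def)
    moreover have "\<bar>z (Suc 0) x - z 0 x\<bar> \<le> K / 2 * exp (2 * \<bar>M x\<bar>)"
    proof (rule weighted_primitive_bound[OF M m0 _ _ _ _ x0 0])
      show "primitive_on ?I (\<lambda>x. z (Suc 0) x - z 0 x) (\<lambda>x. W x * y 0 x - 0)"
        unfolding Y0(2) by (rule primitive_on_diff[OF prim(2) primitive_on_const])
      fix t
      have "\<bar>W t\<bar> * \<bar>y0\<bar> \<le> m t * (K * e t)"
        using e1[of t] by (intro mult_mono) (auto simp: m_def K_def intro: order_trans[OF _ mult_left_mono[of 1 "e t" "\<bar>y0\<bar> + \<bar>z0\<bar>"]])
      then show "\<bar>W t * y 0 t - 0\<bar> \<le> K * (m t * exp (2 * \<bar>M t\<bar>))"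
        by (simp add: Y0 abs_mult e_def algebra_simps)
    qed (auto simp: init K_def)
    moreover have "K / 2 * exp (2 * \<bar>M x\<bar>) \<le> K * e x" by (simp add: e_def K_def)
    ultimately show ?case by simp
  next
    case (Suc n)
    have est: "\<bar>w t * v\<bar> \<le> K * (1 / 2) ^ n * (m t * exp (2 * \<bar>M t\<bar>))"
      if "\<bar>w t\<bar> \<le> m t" "\<bar>v\<bar> \<le> K * (1 / 2) ^ n * e t" for w t v
    proof -
      have "\<bar>w t\<bar> * \<bar>v\<bar> \<le> m t * (K * (1 / 2) ^ n * e t)" using that by (intro mult_mono m0) auto
      then show ?thesis by (simp add: abs_mult e_def algebra_simps)
    qed
    have "\<bar>y (Suc (Suc n)) x - y (Suc n) x\<bar> \<le> K * (1 / 2) ^ n / 2 * exp (2 * \<bar>M x\<bar>)"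
    proof (rule weighted_primitive_bound[OF M m0 _ _ _ _ x0 Suc.prems])
      show "primitive_on ?I (\<lambda>x. y (Suc (Suc n)) x - y (Suc n) x) (\<lambda>x. \<omega> x * z (Suc n) x - \<omega> x * z n x)"
        by (rule primitive_on_diff[OF prim(1) prim(1)])
      fix t assume t: "t \<in> ?I"
      show "\<bar>\<omega> t * z (Suc n) t - \<omega> t * z n t\<bar> \<le> K * (1 / 2) ^ n * (m t * exp (2 * \<bar>M t\<bar>))"
        using est[of \<omega> t "z (Suc n) t - z n t"] Suc.IH[OF t] by (simp add: m_def right_diff_distrib)
    qed (auto simp: init K_def)
    moreover have "\<bar>z (Suc (Suc n)) x - z (Suc n) x\<bar> \<le> K * (1 / 2) ^ n / 2 * exp (2 * \<bar>M x\<bar>)"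
    proof (rule weighted_primitive_bound[OF M m0 _ _ _ _ x0 Suc.prems])
      show "primitive_on ?I (\<lambda>x. z (Suc (Suc n)) x - z (Suc n) x) (\<lambda>x. W x * y (Suc n) x - W x * y n x)"
        by (rule primitive_on_diff[OF prim(2) prim(2)])
      fix t assume t: "t \<in> ?I"
      show "\<bar>W t * y (Suc n) t - W t * y n t\<bar> \<le> K * (1 / 2) ^ n * (m t * exp (2 * \<bar>M t\<bar>))"
        using est[of W t "y (Suc n) t - y n t"] Suc.IH[OF t] by (simp add: m_def right_diff_distrib)
    qed (auto simp: init K_def)
    ultimately show ?case by (simp add: e_def)
  qed
  \<comment> \<open>Increments of size B/2^n have total at most 2 B; this gives the limit and a
    bound uniform in n.\<close>
  have lim: "\<exists>l. (\<lambda>n. f n) \<longlonglongrightarrow> l \<and> (\<forall>n. \<bar>f n\<bar> \<le> \<bar>f 0\<bar> + 2 * B)"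
    if "\<And>n. \<bar>f (Suc n) - f n\<bar> \<le> B * (1 / 2) ^ n" for f :: "nat \<Rightarrow> real" and B
  proof -
    have B0: "0 \<le> B" using that[of 0] by simp
    have g: "(\<lambda>n. B * (1 / 2) ^ n) sums (B * 2)" using geometric_sums[of "1/2::real"] by (intro sums_mult) simp
    have s: "summable (\<lambda>n. f (Suc n) - f n)"
      by (rule summable_comparison_test'[OF sums_summable[OF g]]) (use that in auto)
    have eq: "f n = f 0 + (\<Sum>i<n. f (Suc i) - f i)" for n by (simp add: sum_lessThan_telescope)
    have "(\<lambda>n. f 0 + (\<Sum>i<n. f (Suc i) - f i)) \<longlonglongrightarrow> f 0 + suminf (\<lambda>n. f (Suc n) - f n)"
      by (intro tendsto_intros summable_LIMSEQ s)
    then have "f \<longlonglongrightarrow> f 0 + suminf (\<lambda>n. f (Suc n) - f n)" by (simp only: eq[symmetric])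
    moreover have "\<bar>f n\<bar> \<le> \<bar>f 0\<bar> + 2 * B" for n
    proof -
      have "\<bar>\<Sum>i<n. f (Suc i) - f i\<bar> \<le> (\<Sum>i<n. B * (1 / 2) ^ i)"
        by (rule order_trans[OF sum_abs sum_mono]) (use that in auto)
      also have "\<dots> \<le> B * 2" using sum_le_suminf[OF sums_summable[OF g], of "{..<n}"] sums_unique[OF g] B0 by simp
      finally show ?thesis using eq[of n] by linarith
    qed
    ultimately show ?thesis by blast
  qed
  have limY: "\<exists>l. (\<lambda>n. y n x) \<longlonglongrightarrow> l \<and> (\<forall>n. \<bar>y n x\<bar> \<le> \<bar>y 0 x\<bar> + 2 * (K * e x))"
    and limZ: "\<exists>l. (\<lambda>n. z n x) \<longlonglongrightarrow> l \<and> (\<forall>n. \<bar>z n x\<bar> \<le> \<bar>z 0 x\<bar> + 2 * (K * e x))" if "x \<in> ?I" for x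
  proof -
    have "\<bar>y (Suc n) x - y n x\<bar> \<le> K * e x * (1 / 2) ^ n" "\<bar>z (Suc n) x - z n x\<bar> \<le> K * e x * (1 / 2) ^ n" for n
      using bound[OF that, of n] by (simp_all add: algebra_simps)
    then show "\<exists>l. (\<lambda>n. y n x) \<longlonglongrightarrow> l \<and> (\<forall>n. \<bar>y n x\<bar> \<le> \<bar>y 0 x\<bar> + 2 * (K * e x))"
      "\<exists>l. (\<lambda>n. z n x) \<longlonglongrightarrow> l \<and> (\<forall>n. \<bar>z n x\<bar> \<le> \<bar>z 0 x\<bar> + 2 * (K * e x))"
      by (intro lim; simp)+
  qed
  define y' z' where "y' x = lim (\<lambda>n. y n x)" and "z' x = lim (\<lambda>n. z n x)" for x
  \<comment> \<open>3 = 1 + 2: the initial value is at most K e x, and the increments sum to at most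
    2 K e x.\<close>
  have y': "(\<lambda>n. y n x) \<longlonglongrightarrow> y' x" "\<bar>y n x\<bar> \<le> 3 * (K * e x)" and z': "(\<lambda>n. z n x) \<longlonglongrightarrow> z' x" "\<bar>z n x\<bar> \<le> 3 * (K * e x)"
    if x: "x \<in> ?I" for n x
  proof -
    have "\<bar>y0\<bar> + \<bar>z0\<bar> \<le> K * e x" using mult_left_mono[OF e1[of x], of K] by (simp add: K_def)
    then have "\<bar>y0\<bar> \<le> K * e x" "\<bar>z0\<bar> \<le> K * e x" by linarith+
    moreover obtain l where l: "(\<lambda>n. y n x) \<longlonglongrightarrow> l" "\<And>n. \<bar>y n x\<bar> \<le> \<bar>y 0 x\<bar> + 2 * (K * e x)" using limY[OF x] by blast
    moreover obtain k where k: "(\<lambda>n. z n x) \<longlonglongrightarrow> k" "\<And>n. \<bar>z n x\<bar> \<le> \<bar>z 0 x\<bar> + 2 * (K * e x)" using limZ[OF x] by blast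
    ultimately show "\<bar>y n x\<bar> \<le> 3 * (K * e x)" "\<bar>z n x\<bar> \<le> 3 * (K * e x)"
      using l(2)[of n] k(2)[of n] unfolding Y0 by linarith+
    show "(\<lambda>n. y n x) \<longlonglongrightarrow> y' x" "(\<lambda>n. z n x) \<longlonglongrightarrow> z' x"
      using l(1) k(1) unfolding y'_def z'_def by (simp_all add: limI)
  qed
  have e_cont: "continuous_on ?I e"
    unfolding e_def by (intro continuous_intros primitive_on_continuous[OF M(1)]) simp
  \<comment> \<open>Dominated convergence in the integral equation, with the uniform bound as
    majorant. The same argument serves both components.\<close>
  have pass: "primitive_on ?I F (\<lambda>x. w x * v x)"
    if F: "\<And>n. primitive_on ?I (F' (Suc n)) (\<lambda>x. w x * v' n x)" "\<And>x. x \<in> ?I \<Longrightarrow> (\<lambda>n. F' n x) \<longlonglongrightarrow> F x"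
      and v: "\<And>x. x \<in> ?I \<Longrightarrow> (\<lambda>n. v' n x) \<longlonglongrightarrow> v x" "\<And>n x. x \<in> ?I \<Longrightarrow> \<bar>v' n x\<bar> \<le> 3 * (K * e x)"
      and w: "loc_integrable_on ?I w" for F v w :: "real \<Rightarrow> real" and F' v' :: "nat \<Rightarrow> real \<Rightarrow> real"
    unfolding primitive_on_def
  proof (intro allI impI, elim conjE)
    fix c d assume cd: "c \<le> d" "{c..d} \<subseteq> ?I"
    have mem: "c \<in> ?I" "d \<in> ?I" using cd by auto
    have h: "(\<lambda>x. norm (w x) * (3 * (K * e x))) integrable_on {c..d}"
      by (intro loc_integrable_onD(2)[OF loc_integrable_on_mult cd(2)] loc_integrable_on_norm w continuous_intros e_cont)
    have bd: "norm (w x * v' n x) \<le> norm (w x) * (3 * (K * e x))" if "x \<in> {c..d}" for n x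
      using v(2)[of x n] that cd(2) by (auto simp: abs_mult intro!: mult_left_mono)
    have lim: "(\<lambda>n. w x * v' n x) \<longlonglongrightarrow> w x * v x" if "x \<in> {c..d}" for x
      using v(1)[of x] that cd(2) by (intro tendsto_intros) auto
    have int: "(\<lambda>x. w x * v' n x) integrable_on {c..d}" for n by (rule primitive_onD(3)[OF F(1) cd])
    have "(\<lambda>x. w x * v x) integrable_on {c..d}"
      by (rule dominated_convergence(1)[OF int h bd lim])
    moreover have "norm (w x * v x) \<le> norm (w x) * (3 * (K * e x))" if "x \<in> {c..d}" for x
      by (rule LIMSEQ_le_const2[OF tendsto_norm[OF lim[OF that]]]) (use bd[OF that] in auto)
    ultimately have ai: "(\<lambda>x. w x * v x) absolutely_integrable_on {c..d}"
      using h by (intro absolutely_integrable_integrable_bound[of "{c..d}" _ "\<lambda>x. norm (w x) * (3 * (K * e x))"]) auto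
    have "(\<lambda>n. integral {c..d} (\<lambda>x. w x * v' n x)) \<longlonglongrightarrow> integral {c..d} (\<lambda>x. w x * v x)"
      by (rule dominated_convergence(2)[OF int h bd lim])
    moreover have "integral {c..d} (\<lambda>x. w x * v' n x) = F' (Suc n) d - F' (Suc n) c" for n
      by (rule primitive_onD(2)[OF F(1) cd])
    moreover have "(\<lambda>n. F' (Suc n) d - F' (Suc n) c) \<longlonglongrightarrow> F d - F c"
      by (intro tendsto_diff LIMSEQ_Suc F(2) mem)
    ultimately show "(\<lambda>x. w x * v x) absolutely_integrable_on {c..d} \<and> integral {c..d} (\<lambda>x. w x * v x) = F d - F c"
      using ai LIMSEQ_unique by auto
  qed
  show thesis
  proof (rule that)
    show "primitive_on ?I y' (\<lambda>x. \<omega> x * z' x)" by (rule pass[where F' = y and v' = z, OF prim(1) y'(1) z'(1) z'(2) \<omega>])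
    show "primitive_on ?I z' (\<lambda>x. W x * y' x)" by (rule pass[where F' = z and v' = y, OF prim(2) z'(1) y'(1) y'(2) W])
    show "y' x0 = y0" "z' x0 = z0" using y'(1)[OF x0] z'(1)[OF x0] by (simp_all add: init LIMSEQ_const_iff)
  qed
qed

section \<open>Integrals over the whole interval and over compact subintervals\<close>

lemma absolutely_integrable_on_iff_integrable:
  "S \<in> sets lebesgue \<Longrightarrow> f absolutely_integrable_on S \<longleftrightarrow> integrable (lebesgue_on S) f"
  by (simp add: set_integrable_def integrable_restrict_space)

lemma integrable_loc_integrable_on:
  assumes "integrable (lebesgue_on S) f" "S \<in> sets lebesgue"
  shows "loc_integrable_on S f"
  unfolding loc_integrable_on_def
proof (intro allI impI)
  fix c d assume "{c..d} \<subseteq> S"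
  moreover have "f absolutely_integrable_on S" using assms absolutely_integrable_on_iff_integrable by blast
  ultimately show "f absolutely_integrable_on {c..d}" by (intro absolutely_integrable_on_subinterval)
qed

text \<open>Bridge between the Lebesgue integral over (a,b), used for the Hilbert space, and the
  Henstock-Kurzweil integral over compact intervals, used for primitives.\<close>

lemma supported_integral:
  fixes f :: "real \<Rightarrow> 'a::euclidean_space"
  assumes cd: "{c..d} \<subseteq> einterval a b" and f: "\<And>x. x \<in> einterval a b \<Longrightarrow> x \<notin> {c..d} \<Longrightarrow> f x = 0"
  shows "integrable (lebesgue_on (einterval a b)) f \<longleftrightarrow> f absolutely_integrable_on {c..d}"
    and "f absolutely_integrable_on {c..d} \<Longrightarrow> integral\<^sup>L (lebesgue_on (einterval a b)) f = integral {c..d} f"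
proof -
  have eq: "(\<lambda>x. indicator (einterval a b) x *\<^sub>R f x) = (\<lambda>x. indicator {c..d} x *\<^sub>R f x)"
    using cd f by (auto simp: fun_eq_iff indicator_def)
  show "integrable (lebesgue_on (einterval a b)) f \<longleftrightarrow> f absolutely_integrable_on {c..d}"
    unfolding set_integrable_def eq[symmetric] by (simp add: integrable_restrict_space)
  assume ai: "f absolutely_integrable_on {c..d}"
  have "integral\<^sup>L (lebesgue_on (einterval a b)) f = (LINT x:{c..d}|lebesgue. f x)"
    unfolding set_lebesgue_integral_def eq[symmetric] by (simp add: integral_restrict_space)
  then show "integral\<^sup>L (lebesgue_on (einterval a b)) f = integral {c..d} f"
    using set_lebesgue_integral_eq_integral(2)[OF ai] by simp
qed

lemma AE_lebesgue_on_subset: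
  assumes "AE x in lebesgue_on S. P x" "T \<subseteq> S" "S \<in> sets lebesgue" "T \<in> sets lebesgue"
  shows "AE x in lebesgue_on T. P x"
proof -
  have "AE x in lebesgue. x \<in> S \<longrightarrow> P x" using assms(1,3) by (simp add: AE_restrict_space_iff)
  then have "AE x in lebesgue. x \<in> T \<longrightarrow> P x" by eventually_elim (use assms(2) in blast)
  then show ?thesis using assms(4) by (simp add: AE_restrict_space_iff)
qed

lemma continuous_AE_zero:
  fixes f :: "real \<Rightarrow> 'a::real_normed_vector"
  assumes f: "continuous_on S f" "open S" and 0: "AE x in lebesgue_on S. f x = 0" and x: "x \<in> S"
  shows "f x = 0"
proof -
  let ?U = "S \<inter> f -` (- {0})"
  have "open ?U" by (rule continuous_open_preimage[OF f]) auto
  moreover have "negligible ?U"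
  proof -
    have "S \<in> sets lebesgue" using f(2) by simp
    from AE_lebesgue_on_negligible[OF 0 this] obtain N where N: "negligible N" "\<And>x. x \<in> S \<Longrightarrow> x \<notin> N \<Longrightarrow> f x = 0"
      by (metis (full_types))
    then have "?U \<subseteq> N" by auto
    then show ?thesis using N(1) negligible_subset by blast
  qed
  ultimately have "?U = {}" using open_not_negligible by blast
  then show ?thesis using x by auto
qed

lemma continuous_AE_eq:
  fixes f g :: "real \<Rightarrow> 'a::real_normed_vector"
  assumes "continuous_on S f" "continuous_on S g" "open S" "AE x in lebesgue_on S. f x = g x" "x \<in> S"
  shows "f x = g x"
  using continuous_AE_zero[of S "\<lambda>x. f x - g x" x] assms by (auto intro: continuous_on_diff)

section \<open>The first-order system\<close>

text \<open>Positivity holds only almost everywhere here; \<open>sl_ends\<close> adds pointwise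
  positivity and the behaviour at the ends.\<close>

locale sl_core =
  fixes a b :: ereal and \<omega> W R :: "real \<Rightarrow> real"
  assumes ab: "a < b"
    and \<omega>_loc: "loc_integrable_on (einterval a b) \<omega>"
    and W_loc: "loc_integrable_on (einterval a b) W"
    and R_loc: "loc_integrable_on (einterval a b) R"
    and \<omega>_pos: "AE x in lebesgue_on (einterval a b). \<omega> x > 0"
    and R_pos: "AE x in lebesgue_on (einterval a b). R x > 0"
begin

abbreviation "I \<equiv> einterval a b"
abbreviation "\<Lambda> \<equiv> lebesgue_on (einterval a b)"

definition slc :: "(real \<Rightarrow> complex) \<Rightarrow> (real \<Rightarrow> complex) \<Rightarrow> (real \<Rightarrow> complex) \<Rightarrow> bool" where
  "slc \<phi> \<psi> \<kappa> \<longleftrightarrow> primitive_on I \<phi> (\<lambda>x. \<omega> x *\<^sub>R \<psi> x) \<and>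
     primitive_on I \<psi> (\<lambda>x. W x *\<^sub>R \<phi> x - R x *\<^sub>R \<kappa> x)"

lemma slcD:
  assumes "slc \<phi> \<psi> \<kappa>"
  shows "primitive_on I \<phi> (\<lambda>x. \<omega> x *\<^sub>R \<psi> x)" "primitive_on I \<psi> (\<lambda>x. W x *\<^sub>R \<phi> x - R x *\<^sub>R \<kappa> x)"
    "continuous_on I \<phi>" "continuous_on I \<psi>"
  using assms unfolding slc_def by (auto intro: primitive_on_continuous)

lemma meas: "\<omega> \<in> borel_measurable \<Lambda>" "W \<in> borel_measurable \<Lambda>" "R \<in> borel_measurable \<Lambda>"
  using \<omega>_loc W_loc R_loc ab by (auto intro: loc_integrable_on_measurable)

lemma continuous_measurable: "continuous_on I f \<Longrightarrow> f \<in> borel_measurable \<Lambda>"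
  for f :: "real \<Rightarrow> 'b::euclidean_space"
  by (rule continuous_imp_measurable_on_sets_lebesgue) auto

text \<open>The terms with \<omega> and W cancel because both coefficients are real. What remains is
  the integrand of <k1,f2> - <f1,k2> in the original variables.\<close>

lemma lagrange_identity:
  assumes 1: "slc \<phi>1 \<psi>1 \<kappa>1" and 2: "slc \<phi>2 \<psi>2 \<kappa>2"
  shows "primitive_on I (\<lambda>x. cnj (\<phi>1 x) * \<psi>2 x - cnj (\<psi>1 x) * \<phi>2 x)
    (\<lambda>x. R x *\<^sub>R (cnj (\<kappa>1 x) * \<phi>2 x - cnj (\<phi>1 x) * \<kappa>2 x))"
proof -
  have "primitive_on I (\<lambda>x. cnj (\<phi>1 x) * \<psi>2 x - cnj (\<psi>1 x) * \<phi>2 x)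
    (\<lambda>x. (cnj (\<phi>1 x) * (W x *\<^sub>R \<phi>2 x - R x *\<^sub>R \<kappa>2 x) + cnj (\<omega> x *\<^sub>R \<psi>1 x) * \<psi>2 x)
      - (cnj (\<psi>1 x) * (\<omega> x *\<^sub>R \<psi>2 x) + cnj (W x *\<^sub>R \<phi>1 x - R x *\<^sub>R \<kappa>1 x) * \<phi>2 x))"
    by (intro primitive_on_diff primitive_on_bilinear[OF bounded_bilinear_mult]
        primitive_on_linear[OF bounded_linear_cnj] slcD(1,2)[OF 1] slcD(1,2)[OF 2])
  also have "(\<lambda>x. (cnj (\<phi>1 x) * (W x *\<^sub>R \<phi>2 x - R x *\<^sub>R \<kappa>2 x) + cnj (\<omega> x *\<^sub>R \<psi>1 x) * \<psi>2 x)
      - (cnj (\<psi>1 x) * (\<omega> x *\<^sub>R \<psi>2 x) + cnj (W x *\<^sub>R \<phi>1 x - R x *\<^sub>R \<kappa>1 x) * \<phi>2 x)) =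
    (\<lambda>x. R x *\<^sub>R (cnj (\<kappa>1 x) * \<phi>2 x - cnj (\<phi>1 x) * \<kappa>2 x))"
    by (simp add: fun_eq_iff scaleR_conv_of_real algebra_simps)
  finally show ?thesis .
qed

text \<open>For compactly supported \<phi> the boundary terms vanish, and this expresses the
  quadratic form of T_0 by energy and potential.\<close>

lemma energy_identity:
  assumes 1: "slc \<phi> \<psi> \<kappa>"
  shows "primitive_on I (\<lambda>x. cnj (\<phi> x) * \<psi> x)
    (\<lambda>x. of_real (\<omega> x * (cmod (\<psi> x))\<^sup>2 + W x * (cmod (\<phi> x))\<^sup>2) - R x *\<^sub>R (cnj (\<phi> x) * \<kappa> x))"
proof -
  have "primitive_on I (\<lambda>x. cnj (\<phi> x) * \<psi> x)
    (\<lambda>x. cnj (\<phi> x) * (W x *\<^sub>R \<phi> x - R x *\<^sub>R \<kappa> x) + cnj (\<omega> x *\<^sub>R \<psi> x) * \<psi> x)"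
    by (intro primitive_on_bilinear[OF bounded_bilinear_mult]
        primitive_on_linear[OF bounded_linear_cnj] slcD(1,2)[OF 1])
  also have "(\<lambda>x. cnj (\<phi> x) * (W x *\<^sub>R \<phi> x - R x *\<^sub>R \<kappa> x) + cnj (\<omega> x *\<^sub>R \<psi> x) * \<psi> x) =
    (\<lambda>x. of_real (\<omega> x * (cmod (\<psi> x))\<^sup>2 + W x * (cmod (\<phi> x))\<^sup>2) - R x *\<^sub>R (cnj (\<phi> x) * \<kappa> x))"
    by (simp add: fun_eq_iff scaleR_conv_of_real complex_norm_square algebra_simps del: of_real_power)
  finally show ?thesis .
qed

text \<open>Where y vanishes identically, \<omega> z = 0 almost everywhere, so z = 0 by positivity
  of \<omega> and continuity of z.\<close>

lemma derivative_zero: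
  fixes y z :: "real \<Rightarrow> 'b::euclidean_space"
  assumes y: "primitive_on I y (\<lambda>x. \<omega> x *\<^sub>R z x)" and z: "continuous_on I z"
    and uv: "{u<..<v} \<subseteq> I" and 0: "\<And>x. x \<in> {u<..<v} \<Longrightarrow> y x = 0" and x: "x \<in> {u<..<v}"
  shows "z x = 0"
proof (rule continuous_AE_zero[OF _ _ _ x])
  show "continuous_on {u<..<v} z" by (rule continuous_on_subset[OF z uv])
  have "AE x in lebesgue_on {u<..<v}. (y has_vector_derivative \<omega> x *\<^sub>R z x) (at x)"
    by (rule primitive_on_open_has_vector_derivative[OF primitive_on_subset[OF y uv]]) simp
  moreover have "AE x in lebesgue_on {u<..<v}. \<omega> x > 0"
    by (rule AE_lebesgue_on_subset[OF \<omega>_pos uv]) auto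
  moreover have "AE x in lebesgue_on {u<..<v}. x \<in> {u<..<v}" by (rule AE_I2) simp
  ultimately show "AE x in lebesgue_on {u<..<v}. z x = 0"
  proof eventually_elim
    case (elim x)
    have "((\<lambda>x. 0) has_vector_derivative \<omega> x *\<^sub>R z x) (at x)"
      by (rule has_vector_derivative_transform_within_open[OF elim(1), of "{u<..<v}"]) (use elim(3) 0 in auto)
    then have "\<omega> x *\<^sub>R z x = 0" using vector_derivative_unique_at has_vector_derivative_const by blast
    then show ?case using elim(2) by simp
  qed
qed simp

lemma slc_support:
  assumes s: "slc \<phi> \<psi> \<kappa>" and \<phi>: "\<And>x. x \<in> I \<Longrightarrow> x \<notin> {c..d} \<Longrightarrow> \<phi> x = 0"
    and x: "x \<in> I" "x \<notin> {c..d}"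
  shows "\<psi> x = 0"
proof -
  have "open (I - {c..d})" by (intro open_Diff) auto
  then obtain e where e: "e > 0" "ball x e \<subseteq> I - {c..d}" using x by (meson DiffI openE)
  have ball: "{x - e<..<x + e} = ball x e" by (auto simp: ball_def dist_real_def)
  show ?thesis
    by (rule derivative_zero[OF slcD(1,4)[OF s], of "x - e" "x + e"]) (use e \<phi> ball in auto)
qed

text \<open>From |\<kappa>| \<le> 1 + |\<kappa>|^2. Square integrable right-hand sides are therefore
  admissible in the system.\<close>

lemma weighted_loc_integrable:
  assumes "\<kappa> \<in> borel_measurable \<Lambda>" "integrable \<Lambda> (\<lambda>x. R x * (cmod (\<kappa> x))\<^sup>2)"
  shows "loc_integrable_on I (\<lambda>x. R x *\<^sub>R \<kappa> x)"
  unfolding loc_integrable_on_def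
proof (intro allI impI)
  fix c d assume cd: "{c..d} \<subseteq> I"
  have "loc_integrable_on I (\<lambda>x. norm (R x) + norm (R x * (cmod (\<kappa> x))\<^sup>2))"
    by (intro loc_integrable_on_add loc_integrable_on_norm R_loc integrable_loc_integrable_on assms(2)) simp
  from loc_integrable_onD(2)[OF this cd]
  show "(\<lambda>x. R x *\<^sub>R \<kappa> x) absolutely_integrable_on {c..d}"
  proof (rule measurable_bounded_by_integrable_imp_absolutely_integrable[rotated 2])
    have "(\<lambda>x. R x *\<^sub>R \<kappa> x) \<in> borel_measurable \<Lambda>" using assms(1) meas(3) by measurable
    then show "(\<lambda>x. R x *\<^sub>R \<kappa> x) \<in> borel_measurable (lebesgue_on {c..d})"
      using cd by (metis (no_types, lifting) measurable_restrict_mono)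
    fix x
    have "cmod (\<kappa> x) * 1 \<le> 1 + (cmod (\<kappa> x))\<^sup>2"
    proof -
      have "2 * cmod (\<kappa> x) \<le> (cmod (\<kappa> x))\<^sup>2 + 1" using sum_squares_bound[of "cmod (\<kappa> x)" 1] by simp
      then show ?thesis using norm_ge_zero[of "\<kappa> x"] by linarith
    qed
    then have "\<bar>R x\<bar> * cmod (\<kappa> x) \<le> \<bar>R x\<bar> * (1 + (cmod (\<kappa> x))\<^sup>2)" by (intro mult_left_mono) auto
    then show "norm (R x *\<^sub>R \<kappa> x) \<le> norm (R x) + norm (R x * (cmod (\<kappa> x))\<^sup>2)"
      by (simp add: abs_mult distrib_left)
  qed simp
qed

lemma weighted_norm_zero:
  fixes k :: "real \<Rightarrow> 'b::real_normed_vector"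
  assumes ai: "(\<lambda>x. R x * (norm (k x))\<^sup>2) absolutely_integrable_on {c..d}" and cd: "{c..d} \<subseteq> I"
    and 0: "integral {c..d} (\<lambda>x. R x * (norm (k x))\<^sup>2) = 0"
  shows "AE x in lebesgue_on {c..d}. k x = 0"
proof -
  have i: "integrable (lebesgue_on {c..d}) (\<lambda>x. R x * (norm (k x))\<^sup>2)"
    using ai by (simp add: absolutely_integrable_on_iff_integrable)
  have Rp: "AE x in lebesgue_on {c..d}. R x > 0"
    by (rule AE_lebesgue_on_subset[OF R_pos cd]) auto
  have "integral\<^sup>L (lebesgue_on {c..d}) (\<lambda>x. R x * (norm (k x))\<^sup>2) = 0"
    using 0 lebesgue_integral_eq_integral[OF i] by simp
  moreover have "AE x in lebesgue_on {c..d}. 0 \<le> R x * (norm (k x))\<^sup>2"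
    using Rp by eventually_elim simp
  ultimately have "AE x in lebesgue_on {c..d}. R x * (norm (k x))\<^sup>2 = 0"
    using integral_nonneg_eq_0_iff_AE[OF i] by simp
  with Rp show ?thesis by eventually_elim simp
qed

text \<open>Variation of constants. The initial values of \<alpha> and \<beta> are free, which later
  makes a solution vanish to the left of a given interval.\<close>

lemma inhomogeneous_solution:
  fixes y1 z1 y2 z2 :: "real \<Rightarrow> real"
  assumes 1: "primitive_on I y1 (\<lambda>x. \<omega> x * z1 x)" "primitive_on I z1 (\<lambda>x. W x * y1 x)"
    and 2: "primitive_on I y2 (\<lambda>x. \<omega> x * z2 x)" "primitive_on I z2 (\<lambda>x. W x * y2 x)"
    and wronskian: "\<And>x. x \<in> I \<Longrightarrow> y1 x * z2 x - z1 x * y2 x = 1"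
    and \<alpha>: "primitive_on I \<alpha> (\<lambda>x. y2 x *\<^sub>R (R x *\<^sub>R \<kappa> x))"
    and \<beta>: "primitive_on I \<beta> (\<lambda>x. y1 x *\<^sub>R (R x *\<^sub>R \<kappa> x))"
  shows "slc (\<lambda>x. y1 x *\<^sub>R \<alpha> x - y2 x *\<^sub>R \<beta> x) (\<lambda>x. z1 x *\<^sub>R \<alpha> x - z2 x *\<^sub>R \<beta> x) \<kappa>"
  unfolding slc_def
proof
  have "primitive_on I (\<lambda>x. y1 x *\<^sub>R \<alpha> x - y2 x *\<^sub>R \<beta> x)
    (\<lambda>x. (y1 x *\<^sub>R y2 x *\<^sub>R (R x *\<^sub>R \<kappa> x) + (\<omega> x * z1 x) *\<^sub>R \<alpha> x) - (y2 x *\<^sub>R y1 x *\<^sub>R (R x *\<^sub>R \<kappa> x) + (\<omega> x * z2 x) *\<^sub>R \<beta> x))"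
    by (intro primitive_on_diff primitive_on_bilinear[OF bounded_bilinear_scaleR] 1 2 \<alpha> \<beta>)
  then show "primitive_on I (\<lambda>x. y1 x *\<^sub>R \<alpha> x - y2 x *\<^sub>R \<beta> x) (\<lambda>x. \<omega> x *\<^sub>R (z1 x *\<^sub>R \<alpha> x - z2 x *\<^sub>R \<beta> x))"
    by (rule primitive_on_cong_AE) (auto simp: algebra_simps)
  have "primitive_on I (\<lambda>x. z1 x *\<^sub>R \<alpha> x - z2 x *\<^sub>R \<beta> x)
    (\<lambda>x. (z1 x *\<^sub>R y2 x *\<^sub>R (R x *\<^sub>R \<kappa> x) + (W x * y1 x) *\<^sub>R \<alpha> x) - (z2 x *\<^sub>R y1 x *\<^sub>R (R x *\<^sub>R \<kappa> x) + (W x * y2 x) *\<^sub>R \<beta> x))"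
    by (intro primitive_on_diff primitive_on_bilinear[OF bounded_bilinear_scaleR] 1 2 \<alpha> \<beta>)
  then show "primitive_on I (\<lambda>x. z1 x *\<^sub>R \<alpha> x - z2 x *\<^sub>R \<beta> x) (\<lambda>x. W x *\<^sub>R (y1 x *\<^sub>R \<alpha> x - y2 x *\<^sub>R \<beta> x) - R x *\<^sub>R \<kappa> x)"
  proof (rule primitive_on_cong_AE)
    have "(z1 x *\<^sub>R y2 x *\<^sub>R (R x *\<^sub>R \<kappa> x) + (W x * y1 x) *\<^sub>R \<alpha> x) - (z2 x *\<^sub>R y1 x *\<^sub>R (R x *\<^sub>R \<kappa> x) + (W x * y2 x) *\<^sub>R \<beta> x)
      = W x *\<^sub>R (y1 x *\<^sub>R \<alpha> x - y2 x *\<^sub>R \<beta> x) - R x *\<^sub>R \<kappa> x" if "x \<in> I" for x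
    proof -
      have "(y1 x * z2 x - z1 x * y2 x) *\<^sub>R (R x *\<^sub>R \<kappa> x) = R x *\<^sub>R \<kappa> x" using wronskian[OF that] by simp
      then show ?thesis by (simp add: algebra_simps)
    qed
    then show "AE x in \<Lambda>. (z1 x *\<^sub>R y2 x *\<^sub>R (R x *\<^sub>R \<kappa> x) + (W x * y1 x) *\<^sub>R \<alpha> x) - (z2 x *\<^sub>R y1 x *\<^sub>R (R x *\<^sub>R \<kappa> x) + (W x * y2 x) *\<^sub>R \<beta> x)
      = W x *\<^sub>R (y1 x *\<^sub>R \<alpha> x - y2 x *\<^sub>R \<beta> x) - R x *\<^sub>R \<kappa> x"
      by (intro AE_I2) simp
  qed auto
qed

end

section \<open>The adjoint of the operator on compactly supported functions\<close>

context sl_core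
begin

text \<open>The two solutions start from the unit vectors at x0, and their Wronskian has derivative
  zero.\<close>

lemma fundamental_system:
  assumes x0: "x0 \<in> I"
  obtains y1 z1 y2 z2 :: "real \<Rightarrow> real" where
    "primitive_on I y1 (\<lambda>x. \<omega> x * z1 x)" "primitive_on I z1 (\<lambda>x. W x * y1 x)"
    "primitive_on I y2 (\<lambda>x. \<omega> x * z2 x)" "primitive_on I z2 (\<lambda>x. W x * y2 x)"
    "\<And>x. x \<in> I \<Longrightarrow> y1 x * z2 x - z1 x * y2 x = 1"
proof -
  obtain y1 z1 where 1: "primitive_on I y1 (\<lambda>x. \<omega> x * z1 x)" "primitive_on I z1 (\<lambda>x. W x * y1 x)" "y1 x0 = 1" "z1 x0 = 0"
    using linear_system_solution[OF \<omega>_loc W_loc x0] by metis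
  obtain y2 z2 where 2: "primitive_on I y2 (\<lambda>x. \<omega> x * z2 x)" "primitive_on I z2 (\<lambda>x. W x * y2 x)" "y2 x0 = 0" "z2 x0 = 1"
    using linear_system_solution[OF \<omega>_loc W_loc x0] by metis
  have "primitive_on I (\<lambda>x. y1 x * z2 x - z1 x * y2 x)
    (\<lambda>x. (y1 x * (W x * y2 x) + \<omega> x * z1 x * z2 x) - (z1 x * (\<omega> x * z2 x) + W x * y1 x * y2 x))"
    by (intro primitive_on_diff primitive_on_bilinear[OF bounded_bilinear_mult] 1 2)
  then have "primitive_on I (\<lambda>x. y1 x * z2 x - z1 x * y2 x) (\<lambda>x. 0)"
    by (rule primitive_on_cong_AE) auto
  from primitive_on_eqI[OF this primitive_on_const[of I 1] x0] 1 2
  have "y1 x * z2 x - z1 x * y2 x = 1" if "x \<in> I" for x using that by simp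
  then show thesis using that 1 2 by blast
qed

text \<open>If the norm were zero, y and hence z would vanish inside (c,d), contradicting Wronskian
  1. This makes the Gram-Schmidt step of \<open>adjoint_on_Icc\<close> possible.\<close>

lemma solution_norm_pos:
  fixes y z y' z' :: "real \<Rightarrow> real"
  assumes y: "primitive_on I y (\<lambda>x. \<omega> x * z x)" and z: "continuous_on I z"
    and nz: "\<And>x. x \<in> I \<Longrightarrow> y x * z' x - z x * y' x = 1"
    and cd: "{c..d} \<subseteq> I" "c < d"
  shows "0 < integral {c..d} (\<lambda>x. R x * (y x * y x))"
proof -
  have yc: "continuous_on I y" by (rule primitive_on_continuous[OF y]) simp
  have "loc_integrable_on I (\<lambda>x. R x * (y x * y x))"
    by (intro loc_integrable_on_mult R_loc continuous_intros yc)
  then have ai: "(\<lambda>x. R x * (norm (y x))\<^sup>2) absolutely_integrable_on {c..d}"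
    using cd by (simp add: loc_integrable_on_def power2_eq_square)
  have Rp: "AE x in lebesgue_on {c..d}. R x > 0"
    by (rule AE_lebesgue_on_subset[OF R_pos cd(1)]) auto
  have i: "integrable (lebesgue_on {c..d}) (\<lambda>x. R x * (norm (y x))\<^sup>2)"
    using ai by (simp add: absolutely_integrable_on_iff_integrable)
  have "0 \<le> integral\<^sup>L (lebesgue_on {c..d}) (\<lambda>x. R x * (norm (y x))\<^sup>2)"
    by (rule integral_nonneg_AE) (use Rp in eventually_elim, simp)
  then have "0 \<le> integral {c..d} (\<lambda>x. R x * (norm (y x))\<^sup>2)"
    using lebesgue_integral_eq_integral[OF i] by simp
  moreover have "integral {c..d} (\<lambda>x. R x * (norm (y x))\<^sup>2) \<noteq> 0"
  proof
    assume "integral {c..d} (\<lambda>x. R x * (norm (y x))\<^sup>2) = 0"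
    from weighted_norm_zero[OF ai cd(1) this]
    have "AE x in lebesgue_on {c<..<d}. y x = 0" by (rule AE_lebesgue_on_subset) auto
    moreover have sub: "{c<..<d} \<subseteq> I" using cd(1) greaterThanLessThan_subseteq_atLeastAtMost_iff by blast
    ultimately have y0: "y x = 0" if "x \<in> {c<..<d}" for x
      using continuous_AE_zero[OF continuous_on_subset[OF yc sub] _ _ that] by simp
    obtain t where t: "t \<in> {c<..<d}" using cd(2) dense by auto
    have "z t = 0"
      by (rule derivative_zero[of y z, OF _ z sub y0 t]) (use y in simp)
    then show False using nz[of t] y0[OF t] t sub by auto
  qed
  ultimately show ?thesis by (simp add: power2_eq_square)
qed

lemma weighted_square_bound:
  fixes f g :: "real \<Rightarrow> complex"
  assumes "f \<in> borel_measurable \<Lambda>" "integrable \<Lambda> (\<lambda>x. R x * (cmod (f x))\<^sup>2)" "continuous_on I g" "{c..d} \<subseteq> I"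
  shows "(\<lambda>x. R x * (cmod (f x - g x))\<^sup>2) absolutely_integrable_on {c..d}"
proof -
  have 1: "loc_integrable_on I (\<lambda>x. R x * (cmod (f x))\<^sup>2)"
    by (rule integrable_loc_integrable_on[OF assms(2)]) simp
  have 2: "loc_integrable_on I (\<lambda>x. R x * (cmod (g x))\<^sup>2)"
    by (intro loc_integrable_on_mult R_loc continuous_intros assms)
  have 3: "loc_integrable_on I (\<lambda>x. (2::real) * norm (R x * (cmod (f x))\<^sup>2) + 2 * norm (R x * (cmod (g x))\<^sup>2))"
    using loc_integrable_on_add[OF loc_integrable_on_mult[OF loc_integrable_on_norm[OF 1], of "\<lambda>_. 2"]
        loc_integrable_on_mult[OF loc_integrable_on_norm[OF 2], of "\<lambda>_. 2"]] by (simp add: mult.commute)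
  show ?thesis
  proof (rule measurable_bounded_by_integrable_imp_absolutely_integrable[OF _ _ loc_integrable_onD(2)[OF 3 assms(4)]])
    have "(\<lambda>x. R x * (cmod (f x - g x))\<^sup>2) \<in> borel_measurable \<Lambda>"
      using assms(1) meas(3) continuous_measurable[OF assms(3)] by measurable
    then show "(\<lambda>x. R x * (cmod (f x - g x))\<^sup>2) \<in> borel_measurable (lebesgue_on {c..d})"
      using assms(4) by (metis (no_types, lifting) measurable_restrict_mono)
    fix x
    have "(cmod (f x - g x))\<^sup>2 \<le> (cmod (f x) + cmod (g x))\<^sup>2"
      by (intro power_mono norm_triangle_ineq4) simp
    also have "\<dots> \<le> 2 * (cmod (f x))\<^sup>2 + 2 * (cmod (g x))\<^sup>2"
      using sum_squares_bound[of "cmod (f x)" "cmod (g x)"] by (simp add: power2_sum)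
    finally have "\<bar>R x\<bar> * (cmod (f x - g x))\<^sup>2 \<le> \<bar>R x\<bar> * (2 * (cmod (f x))\<^sup>2 + 2 * (cmod (g x))\<^sup>2)"
      by (intro mult_left_mono) auto
    then show "norm (R x * (cmod (f x - g x))\<^sup>2) \<le> 2 * norm (R x * (cmod (f x))\<^sup>2) + 2 * norm (R x * (cmod (g x))\<^sup>2)"
      by (simp add: abs_mult algebra_simps)
  qed simp
qed

text \<open>The test functions are the solutions of the inhomogeneous equation with right-hand sides
  orthogonal to the homogeneous solutions on a compact interval; they vanish outside of it.\<close>

lemma adjoint_on_Icc:
  fixes y1 z1 y2 z2 :: "real \<Rightarrow> real"
  assumes u: "u \<in> borel_measurable \<Lambda>" "integrable \<Lambda> (\<lambda>x. R x * (cmod (u x))\<^sup>2)"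
    and test: "\<And>\<phi> \<psi> k c d. slc \<phi> \<psi> k \<Longrightarrow> {c..d} \<subseteq> I \<Longrightarrow> (\<And>x. x \<in> I \<Longrightarrow> x \<notin> {c..d} \<Longrightarrow> \<phi> x = 0) \<Longrightarrow>
      k \<in> borel_measurable \<Lambda> \<Longrightarrow> integrable \<Lambda> (\<lambda>x. R x * (cmod (k x))\<^sup>2) \<Longrightarrow>
      (LINT x|\<Lambda>. R x *\<^sub>R (cnj (k x) * u x)) = (LINT x|\<Lambda>. R x *\<^sub>R (cnj (\<phi> x) * h x))"
    and hloc: "loc_integrable_on I (\<lambda>x. R x *\<^sub>R h x)"
    and w: "slc w w' h"
    and 1: "primitive_on I y1 (\<lambda>x. \<omega> x * z1 x)" "primitive_on I z1 (\<lambda>x. W x * y1 x)"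
    and 2: "primitive_on I y2 (\<lambda>x. \<omega> x * z2 x)" "primitive_on I z2 (\<lambda>x. W x * y2 x)"
    and wr: "\<And>x. x \<in> I \<Longrightarrow> y1 x * z2 x - z1 x * y2 x = 1"
    and cd: "{c..d} \<subseteq> I" "c < d"
  obtains c1 c2 :: complex where "AE x in lebesgue_on {c..d}. u x = w x + y1 x *\<^sub>R c1 + y2 x *\<^sub>R c2"
proof -
  have cI: "c \<in> I" "d \<in> I" using cd by auto
  have cont: "continuous_on I y1" "continuous_on I y2" "continuous_on I z1" "continuous_on I z2" "continuous_on I w"
    using 1 2 slcD(3)[OF w] by (auto intro: primitive_on_continuous)
  \<comment> \<open>Gram-Schmidt for the inner product with weight R on [c,d]: y3 is y2 minus its
    projection onto y1.\<close>
  define B where "B = integral {c..d} (\<lambda>x. R x * (y1 x * y2 x)) / integral {c..d} (\<lambda>x. R x * (y1 x * y1 x))"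
  define y3 z3 where "y3 x = y2 x - y1 x * B" and "z3 x = z2 x - z1 x * B" for x
  have y3: "primitive_on I y3 (\<lambda>x. \<omega> x * z3 x)"
  proof -
    have "primitive_on I (\<lambda>x. y2 x - y1 x * B) (\<lambda>x. \<omega> x * z2 x - \<omega> x * z1 x * B)"
      by (intro primitive_on_diff 2 primitive_on_linear[OF bounded_linear_mult_left] 1)
    then show ?thesis unfolding y3_def z3_def by (simp add: algebra_simps)
  qed
  have cont3: "continuous_on I y3" "continuous_on I z3"
    unfolding y3_def z3_def by (intro continuous_intros cont)+
  have wr3: "y1 x * z3 x - z1 x * y3 x = 1" if "x \<in> I" for x
    using wr[OF that] by (simp add: y3_def z3_def algebra_simps)
  have wr3': "y3 x * (- z1 x) - z3 x * (- y1 x) = 1" if "x \<in> I" for x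
    using wr3[OF that] by (simp add: algebra_simps)
  define G where "G f g = integral {c..d} (\<lambda>x. R x * (f x * g x))" for f g :: "real \<Rightarrow> real"
  have Gi: "(\<lambda>x. R x * (f x * g x)) integrable_on {c..d}" if "continuous_on I f" "continuous_on I g" for f g :: "real \<Rightarrow> real"
    by (intro loc_integrable_onD(2)[OF loc_integrable_on_mult cd(1)] R_loc continuous_intros that)
  have A: "0 < G y1 y1" unfolding G_def by (rule solution_norm_pos[OF 1(1) cont(3) wr cd])
  have D: "0 < G y3 y3" unfolding G_def by (rule solution_norm_pos[OF y3 cont3(2) wr3' cd])
  have G13: "G y1 y3 = 0"
  proof -
    have "G y1 y3 = integral {c..d} (\<lambda>x. R x * (y1 x * y2 x) - B * (R x * (y1 x * y1 x)))"
      unfolding G_def y3_def by (simp add: algebra_simps)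
    also have "\<dots> = G y1 y2 - B * G y1 y1"
      unfolding G_def by (subst integral_diff) (auto intro!: Gi cont integrable_on_mult_right)
    finally show ?thesis using A by (simp add: B_def G_def)
  qed
  \<comment> \<open>w solves the equation with right-hand side h, so it remains to show that v = u -
    w agrees with a homogeneous solution.\<close>
  define v where "v x = u x - w x" for x
  have vloc: "loc_integrable_on I (\<lambda>x. R x *\<^sub>R v x)"
  proof -
    have "loc_integrable_on I (\<lambda>x. R x *\<^sub>R u x - R x *\<^sub>R w x)"
      by (intro loc_integrable_on_diff weighted_loc_integrable u loc_integrable_on_scaleR R_loc cont)
    then show ?thesis by (simp add: v_def scaleR_diff_right)
  qed
  define ip where "ip f = integral {c..d} (\<lambda>x. f x *\<^sub>R (R x *\<^sub>R v x))" for f :: "real \<Rightarrow> real"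
  have flip: "loc_integrable_on I (\<lambda>x. f x *\<^sub>R g x)" if "loc_integrable_on I g" "continuous_on I f"
    for f :: "real \<Rightarrow> real" and g :: "real \<Rightarrow> complex"
    using loc_integrable_on_bilinear[OF bounded_bilinear.flip[OF bounded_bilinear_scaleR] that] .
  have ipi: "(\<lambda>x. f x *\<^sub>R (R x *\<^sub>R v x)) integrable_on {c..d}" if "continuous_on I f" for f :: "real \<Rightarrow> real"
    by (rule loc_integrable_onD(2)[OF flip[OF vloc that] cd(1)])
  define c1 c3 where "c1 = ip y1 /\<^sub>R G y1 y1" and "c3 = ip y3 /\<^sub>R G y3 y3"
  \<comment> \<open>The part of v orthogonal to y1 and y3. Cut off outside (c,d) it becomes the
    right-hand side of a test function; the goal is k = 0.\<close>
  define k0 where "k0 x = v x - (y1 x *\<^sub>R c1 + y3 x *\<^sub>R c3)" for x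
  define k where "k x = (if x \<in> {c<..<d} then k0 x else 0)" for x
  have kk0: "k x = k0 x" if "x \<in> {c..d} - {c, d}" for x using that by (auto simp: k_def)
  have neg: "negligible {c, d}" by simp
  have orth: "integral {c..d} (\<lambda>x. f x *\<^sub>R (R x *\<^sub>R k x)) = ip f - G f y1 *\<^sub>R c1 - G f y3 *\<^sub>R c3"
    and orthi: "(\<lambda>x. f x *\<^sub>R (R x *\<^sub>R k x)) integrable_on {c..d}"
    if f: "continuous_on I f" for f
  proof -
    have eq: "f x *\<^sub>R (R x *\<^sub>R k0 x) = f x *\<^sub>R (R x *\<^sub>R v x) - (R x * (f x * y1 x)) *\<^sub>R c1 - (R x * (f x * y3 x)) *\<^sub>R c3" for x
      by (simp add: k0_def algebra_simps)
    have "((\<lambda>x. (R x * (f x * g x)) *\<^sub>R e) has_integral G f g *\<^sub>R e) {c..d}"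
      if "continuous_on I g" for g and e :: complex
      unfolding G_def using Gi[OF f that] by (intro has_integral_scaleR_left) (rule integrable_integral)
    then have "((\<lambda>x. f x *\<^sub>R (R x *\<^sub>R k0 x)) has_integral ip f - G f y1 *\<^sub>R c1 - G f y3 *\<^sub>R c3) {c..d}"
      unfolding eq using ipi[OF f] cont(1) cont3(1) unfolding ip_def
      by (intro has_integral_diff) (auto intro: integrable_integral)
    then have "((\<lambda>x. f x *\<^sub>R (R x *\<^sub>R k x)) has_integral ip f - G f y1 *\<^sub>R c1 - G f y3 *\<^sub>R c3) {c..d}"
      by (rule has_integral_spike[OF neg, rotated]) (simp add: kk0)
    then show "integral {c..d} (\<lambda>x. f x *\<^sub>R (R x *\<^sub>R k x)) = ip f - G f y1 *\<^sub>R c1 - G f y3 *\<^sub>R c3"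
      "(\<lambda>x. f x *\<^sub>R (R x *\<^sub>R k x)) integrable_on {c..d}"
      by (auto simp: has_integral_integrable_integral)
  qed
  have o1: "integral {c..d} (\<lambda>x. y1 x *\<^sub>R (R x *\<^sub>R k x)) = 0"
    using A orth[OF cont(1)] by (simp add: G13 c1_def)
  have G31: "G y3 y1 = 0" using G13 by (simp add: G_def mult.commute)
  have o3: "integral {c..d} (\<lambda>x. y3 x *\<^sub>R (R x *\<^sub>R k x)) = 0"
    using D orth[OF cont3(1)] by (simp add: G31 c3_def)
  \<comment> \<open>\<alpha> and \<beta> below involve y1 and y2, so orthogonality has to be passed
    to y2 = y3 + B y1.\<close>
  have o2: "integral {c..d} (\<lambda>x. y2 x *\<^sub>R (R x *\<^sub>R k x)) = 0"
  proof -
    have "(\<lambda>x. y2 x *\<^sub>R (R x *\<^sub>R k x)) = (\<lambda>x. y3 x *\<^sub>R (R x *\<^sub>R k x) + B *\<^sub>R (y1 x *\<^sub>R (R x *\<^sub>R k x)))"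
      by (simp add: fun_eq_iff y3_def algebra_simps)
    then show ?thesis
      using orthi[OF cont3(1)] orthi[OF cont(1)] o1 o3
      by (simp add: integral_add integrable_cmul del: scaleR_scaleR)
  qed
  have umeas: "k \<in> borel_measurable \<Lambda>"
  proof -
    have "k0 \<in> borel_measurable \<Lambda>"
      unfolding k0_def v_def
      using u(1) continuous_measurable[OF cont(1)] continuous_measurable[OF cont(5)] continuous_measurable[OF cont3(1)]
      by measurable
    moreover have "{c<..<d} \<inter> I \<in> sets \<Lambda>" by (simp add: sets_restrict_space_iff)
    moreover have "(\<lambda>x. if x \<in> {c<..<d} \<inter> I then k0 x else 0) \<in> borel_measurable \<Lambda>"
      using calculation by (intro measurable_If_set) auto
    moreover have "(\<lambda>x. if x \<in> {c<..<d} \<inter> I then k0 x else 0) x = k x" if "x \<in> space \<Lambda>" for x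
      using that by (simp add: k_def)
    ultimately show ?thesis using measurable_cong[of \<Lambda> "\<lambda>x. if x \<in> {c<..<d} \<inter> I then k0 x else 0" k borel] by blast
  qed
  have k2ai: "(\<lambda>x. R x * (cmod (k x))\<^sup>2) absolutely_integrable_on {c..d}"
  proof -
    have "(\<lambda>x. R x * (cmod (u x - (w x + (y1 x *\<^sub>R c1 + y3 x *\<^sub>R c3))))\<^sup>2) absolutely_integrable_on {c..d}"
      by (intro weighted_square_bound u continuous_intros cont cont3 cd)
    then have "(\<lambda>x. R x * (cmod (k0 x))\<^sup>2) absolutely_integrable_on {c..d}"
      by (simp add: k0_def v_def algebra_simps)
    then show ?thesis by (rule absolutely_integrable_spike[OF _ neg]) (simp add: kk0)
  qed
  have k2i: "integrable \<Lambda> (\<lambda>x. R x * (cmod (k x))\<^sup>2)"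
  proof (rule supported_integral(1)[OF cd(1), THEN iffD2, OF _ k2ai])
    fix x assume "x \<notin> {c..d}"
    then have "k x = 0" by (auto simp: k_def)
    then show "R x * (cmod (k x))\<^sup>2 = 0" by simp
  qed
  have kloc: "loc_integrable_on I (\<lambda>x. R x *\<^sub>R k x)" by (rule weighted_loc_integrable[OF umeas k2i])
  obtain \<alpha> where \<alpha>: "primitive_on I \<alpha> (\<lambda>x. y2 x *\<^sub>R (R x *\<^sub>R k x))" "\<alpha> c = 0"
    using primitive_on_exists[OF flip[OF kloc cont(2)] cI(1)] by metis
  obtain \<beta> where \<beta>: "primitive_on I \<beta> (\<lambda>x. y1 x *\<^sub>R (R x *\<^sub>R k x))" "\<beta> c = 0"
    using primitive_on_exists[OF flip[OF kloc cont(1)] cI(1)] by metis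
  \<comment> \<open>To the left of c the integrand is zero; to the right of d the value stays at the
    integral over [c,d], which orthogonality makes zero.\<close>
  have vanish: "F x = 0" if F: "primitive_on I F (\<lambda>x. f x *\<^sub>R (R x *\<^sub>R k x))" "F c = 0"
    and 0: "integral {c..d} (\<lambda>x. f x *\<^sub>R (R x *\<^sub>R k x)) = 0" and x: "x \<in> I" "x \<notin> {c<..<d}" for F f x
  proof (cases "x \<le> c")
    case True
    have "integral {x..c} (\<lambda>x. f x *\<^sub>R (R x *\<^sub>R k x)) = integral {x..c} (\<lambda>x. 0)"
      by (rule integral_cong) (auto simp: k_def)
    then show ?thesis using primitive_onD(2)[OF F(1) True einterval_Icc_subset[OF x(1) cI(1)]] F(2) by simp
  next
    case False
    then have "d \<le> x" using x(2) by auto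
    have "integral {d..x} (\<lambda>x. f x *\<^sub>R (R x *\<^sub>R k x)) = integral {d..x} (\<lambda>x. 0)"
      by (rule integral_cong) (auto simp: k_def)
    then have "F x = F d"
      using primitive_onD(2)[OF F(1) \<open>d \<le> x\<close> einterval_Icc_subset[OF cI(2) x(1)]] by simp
    then show ?thesis using primitive_onD(2)[OF F(1) less_imp_le[OF cd(2)] cd(1)] 0 F(2) by simp
  qed
  define \<phi> \<psi> where "\<phi> x = y1 x *\<^sub>R \<alpha> x - y2 x *\<^sub>R \<beta> x" and "\<psi> x = z1 x *\<^sub>R \<alpha> x - z2 x *\<^sub>R \<beta> x" for x
  have s: "slc \<phi> \<psi> k"
    unfolding \<phi>_def \<psi>_def by (rule inhomogeneous_solution[OF 1 2 wr \<alpha>(1) \<beta>(1)])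
  have s0: "\<phi> x = 0" "\<psi> x = 0" if "x \<in> I" "x \<notin> {c<..<d}" for x
    using vanish[OF \<alpha> o2 that] vanish[OF \<beta> o1 that] by (simp_all add: \<phi>_def \<psi>_def)
  \<comment> \<open>Testing gives <k,u> = <\<phi>,h>, while Green's identity gives <k,w> =
    <\<phi>,h>. So k is orthogonal to u - w, which on (c,d) is k plus a homogeneous solution. As k
    is orthogonal to the latter too, its norm is 0.\<close>
  have t: "(LINT x|\<Lambda>. R x *\<^sub>R (cnj (k x) * u x)) = (LINT x|\<Lambda>. R x *\<^sub>R (cnj (\<phi> x) * h x))"
    by (rule test[OF s cd(1) _ umeas k2i]) (use s0(1) in auto)
  have kyloc: "loc_integrable_on I (\<lambda>x. R x *\<^sub>R (cnj (k x) * f x))" if "continuous_on I f" for f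
  proof -
    have "loc_integrable_on I (\<lambda>x. cnj (R x *\<^sub>R k x))"
      using absolutely_integrable_linear[OF _ bounded_linear_cnj] kloc unfolding loc_integrable_on_def o_def by blast
    from loc_integrable_on_mult[OF this that] show ?thesis by simp
  qed
  have \<phi>hloc: "loc_integrable_on I (\<lambda>x. R x *\<^sub>R (cnj (\<phi> x) * h x))"
    using loc_integrable_on_mult[OF hloc continuous_on_cnj[OF slcD(3)[OF s]]] by (simp add: mult.commute)
  have kv_eq: "R x *\<^sub>R (cnj (k x) * u x) = (of_real (R x * (cmod (k x))\<^sup>2) + R x *\<^sub>R (cnj (k x) * (y1 x *\<^sub>R c1 + y3 x *\<^sub>R c3))) + R x *\<^sub>R (cnj (k x) * w x)" for x
  proof (cases "x \<in> {c<..<d}")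
    case True
    then have "u x = k x + (y1 x *\<^sub>R c1 + y3 x *\<^sub>R c3) + w x" by (simp add: k_def k0_def v_def)
    then have "R x *\<^sub>R (cnj (k x) * u x) = R x *\<^sub>R (cnj (k x) * k x) + R x *\<^sub>R (cnj (k x) * (y1 x *\<^sub>R c1 + y3 x *\<^sub>R c3)) + R x *\<^sub>R (cnj (k x) * w x)"
      by (simp only: distrib_left scaleR_add_right)
    moreover have "R x *\<^sub>R (cnj (k x) * k x) = of_real (R x * (cmod (k x))\<^sup>2)"
      by (simp add: scaleR_conv_of_real complex_norm_square mult.commute del: of_real_power)
    ultimately show ?thesis by simp
  next
    case False
    then have "k x = 0" unfolding k_def by (rule if_not_P)
    then show ?thesis by simp
  qed
  have c13: "continuous_on I (\<lambda>x. y1 x *\<^sub>R c1 + y3 x *\<^sub>R c3)" by (intro continuous_intros cont cont3)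
  have k2c: "(\<lambda>x. complex_of_real (R x * (cmod (k x))\<^sup>2)) absolutely_integrable_on {c..d}"
    using absolutely_integrable_linear[OF k2ai bounded_linear_of_real] by (simp add: o_def)
  have ai: "(\<lambda>x. R x *\<^sub>R (cnj (k x) * u x)) absolutely_integrable_on {c..d}"
    unfolding kv_eq
    by (intro set_integral_add(1) k2c loc_integrable_onD(1)[OF kyloc cd(1)] c13 cont)
  have L: "(LINT x|\<Lambda>. R x *\<^sub>R (cnj (k x) * u x)) = integral {c..d} (\<lambda>x. R x *\<^sub>R (cnj (k x) * u x))"
    by (rule supported_integral(2)[OF cd(1) _ ai]) (auto simp: k_def)
  have Rr: "(LINT x|\<Lambda>. R x *\<^sub>R (cnj (\<phi> x) * h x)) = integral {c..d} (\<lambda>x. R x *\<^sub>R (cnj (\<phi> x) * h x))"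
    by (rule supported_integral(2)[OF cd(1) _ loc_integrable_onD(1)[OF \<phi>hloc cd(1)]]) (use s0(1) in auto)
  have green: "integral {c..d} (\<lambda>x. R x *\<^sub>R (cnj (k x) * w x) - R x *\<^sub>R (cnj (\<phi> x) * h x)) = 0"
    using primitive_onD(2)[OF lagrange_identity[OF s w] less_imp_le[OF cd(2)] cd(1)] s0 cI
    by (simp add: scaleR_diff_right)
  have kw: "(\<lambda>x. R x *\<^sub>R (cnj (k x) * w x)) integrable_on {c..d}"
    by (rule loc_integrable_onD(2)[OF kyloc[OF cont(5)] cd(1)])
  have "integral {c..d} (\<lambda>x. R x *\<^sub>R (cnj (k x) * w x)) = integral {c..d} (\<lambda>x. R x *\<^sub>R (cnj (\<phi> x) * h x))"
    using green integral_diff[OF kw loc_integrable_onD(2)[OF \<phi>hloc cd(1)]] by simp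
  then have eq1: "integral {c..d} (\<lambda>x. R x *\<^sub>R (cnj (k x) * u x)) = integral {c..d} (\<lambda>x. R x *\<^sub>R (cnj (k x) * w x))"
    using t L Rr by simp
  have k13: "(\<lambda>x. R x *\<^sub>R (cnj (k x) * (y1 x *\<^sub>R c1 + y3 x *\<^sub>R c3))) integrable_on {c..d}"
    by (rule loc_integrable_onD(2)[OF kyloc[OF c13] cd(1)])
  have k2i': "(\<lambda>x. complex_of_real (R x * (cmod (k x))\<^sup>2)) integrable_on {c..d}"
    using k2c by (rule set_lebesgue_integral_eq_integral(1))
  have "integral {c..d} (\<lambda>x. R x *\<^sub>R (cnj (k x) * u x)) =
      integral {c..d} (\<lambda>x. complex_of_real (R x * (cmod (k x))\<^sup>2)) + integral {c..d} (\<lambda>x. R x *\<^sub>R (cnj (k x) * (y1 x *\<^sub>R c1 + y3 x *\<^sub>R c3)))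
      + integral {c..d} (\<lambda>x. R x *\<^sub>R (cnj (k x) * w x))"
    unfolding kv_eq by (simp only: integral_add integrable_add k2i' k13 kw)
  with eq1 have sum0: "integral {c..d} (\<lambda>x. complex_of_real (R x * (cmod (k x))\<^sup>2)) + integral {c..d} (\<lambda>x. R x *\<^sub>R (cnj (k x) * (y1 x *\<^sub>R c1 + y3 x *\<^sub>R c3))) = 0"
    by simp
  have oc: "integral {c..d} (\<lambda>x. cnj (f x *\<^sub>R (R x *\<^sub>R k x)) * e) = 0 \<and> (\<lambda>x. cnj (f x *\<^sub>R (R x *\<^sub>R k x)) * e) integrable_on {c..d}"
    if f: "continuous_on I f" and 0: "integral {c..d} (\<lambda>x. f x *\<^sub>R (R x *\<^sub>R k x)) = 0" for f :: "real \<Rightarrow> real" and e :: complex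
  proof -
    have bl: "bounded_linear (\<lambda>z. cnj z * e)"
      by (rule bounded_linear_compose[OF bounded_linear_mult_left bounded_linear_cnj])
    show ?thesis
      using integral_linear[OF orthi[OF f] bl] integrable_linear[OF orthi[OF f] bl] 0 by (simp add: o_def)
  qed
  have "(\<lambda>x. R x *\<^sub>R (cnj (k x) * (y1 x *\<^sub>R c1 + y3 x *\<^sub>R c3))) =
      (\<lambda>x. cnj (y1 x *\<^sub>R (R x *\<^sub>R k x)) * c1 + cnj (y3 x *\<^sub>R (R x *\<^sub>R k x)) * c3)"
    by (simp add: fun_eq_iff scaleR_conv_of_real algebra_simps)
  then have "integral {c..d} (\<lambda>x. R x *\<^sub>R (cnj (k x) * (y1 x *\<^sub>R c1 + y3 x *\<^sub>R c3))) = 0"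
    using oc[OF cont(1) o1, of c1] oc[OF cont3(1) o3, of c3] by (simp add: integral_add)
  with sum0 have "integral {c..d} (\<lambda>x. complex_of_real (R x * (cmod (k x))\<^sup>2)) = 0" by simp
  moreover have "integral {c..d} (\<lambda>x. complex_of_real (R x * (cmod (k x))\<^sup>2)) = of_real (integral {c..d} (\<lambda>x. R x * (cmod (k x))\<^sup>2))"
  proof -
    have "bounded_linear complex_of_real" by (rule bounded_linear_of_real)
    from integral_linear[OF set_lebesgue_integral_eq_integral(1)[OF k2ai] this] show ?thesis by (simp add: o_def)
  qed
  ultimately have "integral {c..d} (\<lambda>x. R x * (cmod (k x))\<^sup>2) = 0" by simp
  from weighted_norm_zero[OF k2ai cd(1) this] have kz: "AE x in lebesgue_on {c..d}. k x = 0" .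
  have "AE x in lebesgue_on {c..d}. x \<notin> {c, d}"
    using neg by (auto simp: AE_restrict_space_iff negligible_iff_null_sets intro!: AE_I'[of "{c, d}"])
  moreover have "AE x in lebesgue_on {c..d}. x \<in> {c..d}" by (rule AE_I2) simp
  \<comment> \<open>Expressing y3 by y2 and y1 changes the coefficient of y1 to c1 - B c3.\<close>
  ultimately have "AE x in lebesgue_on {c..d}. u x = w x + y1 x *\<^sub>R (c1 - B *\<^sub>R c3) + y2 x *\<^sub>R c3"
    using kz
  proof eventually_elim
    case (elim x)
    then have "k0 x = 0" using kk0 by auto
    then show ?case by (simp add: k0_def v_def y3_def algebra_simps)
  qed
  then show thesis by (rule that)
qed

text \<open>This is T_0^* \<subseteq> T_max for the system: a weak solution agrees almost everywhere
  with a true one. On compact intervals it is \<open>adjoint_on_Icc\<close>, with constants that may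
  depend on the interval.\<close>

theorem adjoint_solution:
  assumes u: "u \<in> borel_measurable \<Lambda>" "integrable \<Lambda> (\<lambda>x. R x * (cmod (u x))\<^sup>2)"
    and h: "h \<in> borel_measurable \<Lambda>" "integrable \<Lambda> (\<lambda>x. R x * (cmod (h x))\<^sup>2)"
    and test: "\<And>\<phi> \<psi> k c d. slc \<phi> \<psi> k \<Longrightarrow> {c..d} \<subseteq> I \<Longrightarrow> (\<And>x. x \<in> I \<Longrightarrow> x \<notin> {c..d} \<Longrightarrow> \<phi> x = 0) \<Longrightarrow>
      k \<in> borel_measurable \<Lambda> \<Longrightarrow> integrable \<Lambda> (\<lambda>x. R x * (cmod (k x))\<^sup>2) \<Longrightarrow>
      (LINT x|\<Lambda>. R x *\<^sub>R (cnj (k x) * u x)) = (LINT x|\<Lambda>. R x *\<^sub>R (cnj (\<phi> x) * h x))"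
  obtains \<phi> \<psi> where "slc \<phi> \<psi> h" "AE x in \<Lambda>. u x = \<phi> x"
proof -
  have hloc: "loc_integrable_on I (\<lambda>x. R x *\<^sub>R h x)" by (rule weighted_loc_integrable[OF h])
  obtain U L where ul: "I = (\<Union>i. {L i .. U i :: real})" "\<And>i::nat. L i < U i" "incseq U" "decseq L"
    by (rule einterval_Icc_approximation[OF ab]) (rule that; assumption)
  have sub: "{L i..U i} \<subseteq> I" for i unfolding ul(1) by blast
  have sub0: "{L 0..U 0} \<subseteq> {L i..U i}" for i
    using incseqD[OF ul(3), of 0 i] decseqD[OF ul(4), of 0 i] by auto
  have "L 0 \<in> {L 0..U 0}" using ul(2)[of 0] by simp
  then have x0: "L 0 \<in> I" using sub by blast
  obtain y1 z1 y2 z2 :: "real \<Rightarrow> real" where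
    1: "primitive_on I y1 (\<lambda>x. \<omega> x * z1 x)" "primitive_on I z1 (\<lambda>x. W x * y1 x)" and
    2: "primitive_on I y2 (\<lambda>x. \<omega> x * z2 x)" "primitive_on I z2 (\<lambda>x. W x * y2 x)" and
    wr: "\<And>x. x \<in> I \<Longrightarrow> y1 x * z2 x - z1 x * y2 x = 1"
    by (rule fundamental_system[OF x0]) (rule that; assumption)
  have cont: "continuous_on I y1" "continuous_on I y2" "continuous_on I z1" "continuous_on I z2"
    using 1 2 by (auto intro: primitive_on_continuous)
  have flip: "loc_integrable_on I (\<lambda>x. f x *\<^sub>R g x)" if "loc_integrable_on I g" "continuous_on I f"
    for f :: "real \<Rightarrow> real" and g :: "real \<Rightarrow> complex"
    using loc_integrable_on_bilinear[OF bounded_bilinear.flip[OF bounded_bilinear_scaleR] that] .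
  obtain \<alpha> where \<alpha>: "primitive_on I \<alpha> (\<lambda>x. y2 x *\<^sub>R (R x *\<^sub>R h x))"
    using primitive_on_exists[OF flip[OF hloc cont(2)] x0] by metis
  obtain \<beta> where \<beta>: "primitive_on I \<beta> (\<lambda>x. y1 x *\<^sub>R (R x *\<^sub>R h x))"
    using primitive_on_exists[OF flip[OF hloc cont(1)] x0] by metis
  define w w' where "w x = y1 x *\<^sub>R \<alpha> x - y2 x *\<^sub>R \<beta> x" and "w' x = z1 x *\<^sub>R \<alpha> x - z2 x *\<^sub>R \<beta> x" for x
  have w: "slc w w' h" unfolding w_def w'_def by (rule inhomogeneous_solution[OF 1 2 wr \<alpha> \<beta>])
  have "\<exists>c1 c2. AE x in lebesgue_on {L i..U i}. u x = w x + y1 x *\<^sub>R c1 + y2 x *\<^sub>R c2" for i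
    by (rule adjoint_on_Icc[OF u test hloc w 1 2 wr sub ul(2)]) blast+
  then obtain C1 C2 where C: "\<And>i. AE x in lebesgue_on {L i..U i}. u x = w x + y1 x *\<^sub>R C1 i + y2 x *\<^sub>R C2 i"
    by metis
  \<comment> \<open>The constants are the same for all i: on the smallest interval the difference of
    two representations is a homogeneous solution that vanishes, so its coefficients are
    zero.\<close>
  have C0: "C1 i = C1 0 \<and> C2 i = C2 0" for i
  proof -
    let ?y = "\<lambda>x. y1 x *\<^sub>R (C1 i - C1 0) + y2 x *\<^sub>R (C2 i - C2 0)"
    let ?z = "\<lambda>x. z1 x *\<^sub>R (C1 i - C1 0) + z2 x *\<^sub>R (C2 i - C2 0)"
    let ?J = "{L 0<..<U 0}"
    have J: "?J \<subseteq> {L 0..U 0}" "?J \<subseteq> {L i..U i}" "?J \<subseteq> I" using sub0[of i] sub[of 0] by auto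
    have p: "primitive_on I ?y (\<lambda>x. \<omega> x *\<^sub>R ?z x)"
    proof -
      have "primitive_on I ?y (\<lambda>x. (\<omega> x * z1 x) *\<^sub>R (C1 i - C1 0) + (\<omega> x * z2 x) *\<^sub>R (C2 i - C2 0))"
        by (intro primitive_on_add primitive_on_linear[OF bounded_linear_scaleR_left] 1 2)
      then show ?thesis by (simp add: scaleR_add_right)
    qed
    have zc: "continuous_on I ?z" by (intro continuous_intros cont)
    have "AE x in lebesgue_on ?J. ?y x = 0"
    proof -
      have "AE x in lebesgue_on ?J. u x = w x + y1 x *\<^sub>R C1 0 + y2 x *\<^sub>R C2 0"
        by (rule AE_lebesgue_on_subset[OF C J(1)]) auto
      moreover have "AE x in lebesgue_on ?J. u x = w x + y1 x *\<^sub>R C1 i + y2 x *\<^sub>R C2 i"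
        by (rule AE_lebesgue_on_subset[OF C J(2)]) auto
      ultimately show ?thesis
      proof eventually_elim
        case (elim x)
        then have "y1 x *\<^sub>R C1 0 + y2 x *\<^sub>R C2 0 = y1 x *\<^sub>R C1 i + y2 x *\<^sub>R C2 i" by (simp add: add.assoc)
        then show ?case by (simp add: scaleR_diff_right algebra_simps)
      qed
    qed
    then have y0: "?y x = 0" if "x \<in> ?J" for x
      using continuous_AE_zero[OF continuous_on_subset[OF primitive_on_continuous[OF p] J(3)] _ _ that] by simp
    obtain t where t: "t \<in> ?J" using ul(2)[of 0] dense by auto
    have tI: "t \<in> I" using t J by blast
    have z0: "?z t = 0" by (rule derivative_zero[OF p zc J(3) y0 t])
    \<comment> \<open>Cramer's rule with determinant 1 recovers the coefficients from the values ?y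
      t and ?z t.\<close>
    have "(y1 t * z2 t - z1 t * y2 t) *\<^sub>R (C1 i - C1 0) = z2 t *\<^sub>R ?y t - y2 t *\<^sub>R ?z t"
      by (simp add: algebra_simps)
    moreover have "(y1 t * z2 t - z1 t * y2 t) *\<^sub>R (C2 i - C2 0) = y1 t *\<^sub>R ?z t - z1 t *\<^sub>R ?y t"
      by (simp add: algebra_simps)
    ultimately have "1 *\<^sub>R (C1 i - C1 0) = z2 t *\<^sub>R 0 - y2 t *\<^sub>R 0" "1 *\<^sub>R (C2 i - C2 0) = y1 t *\<^sub>R 0 - z1 t *\<^sub>R 0"
      by (simp_all only: y0[OF t] z0 wr[OF tI])
    then show ?thesis by simp
  qed
  define \<phi> \<psi> where "\<phi> x = w x + (y1 x *\<^sub>R C1 0 + y2 x *\<^sub>R C2 0)" and "\<psi> x = w' x + (z1 x *\<^sub>R C1 0 + z2 x *\<^sub>R C2 0)" for x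
  have "slc \<phi> \<psi> h"
    unfolding slc_def
  proof
    have "primitive_on I \<phi> (\<lambda>x. \<omega> x *\<^sub>R w' x + ((\<omega> x * z1 x) *\<^sub>R C1 0 + (\<omega> x * z2 x) *\<^sub>R C2 0))"
      unfolding \<phi>_def by (intro primitive_on_add primitive_on_linear[OF bounded_linear_scaleR_left] 1 2 slcD[OF w])
    then show "primitive_on I \<phi> (\<lambda>x. \<omega> x *\<^sub>R \<psi> x)" by (simp add: \<psi>_def scaleR_add_right)
    have "primitive_on I \<psi> (\<lambda>x. (W x *\<^sub>R w x - R x *\<^sub>R h x) + ((W x * y1 x) *\<^sub>R C1 0 + (W x * y2 x) *\<^sub>R C2 0))"
      unfolding \<psi>_def by (intro primitive_on_add primitive_on_linear[OF bounded_linear_scaleR_left] 1 2 slcD[OF w])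
    then show "primitive_on I \<psi> (\<lambda>x. W x *\<^sub>R \<phi> x - R x *\<^sub>R h x)" by (simp add: \<phi>_def algebra_simps)
  qed
  moreover have "AE x in \<Lambda>. u x = \<phi> x"
  proof -
    have "AE x in lebesgue. \<forall>i. x \<in> {L i..U i} \<longrightarrow> u x = \<phi> x"
    proof (subst AE_all_countable, intro allI)
      fix i
      have "AE x in lebesgue_on {L i..U i}. u x = \<phi> x"
        using C[of i] C0[of i] by (simp add: \<phi>_def add.assoc)
      then show "AE x in lebesgue. x \<in> {L i..U i} \<longrightarrow> u x = \<phi> x" by (simp add: AE_restrict_space_iff)
    qed
    then have "AE x in lebesgue. x \<in> I \<longrightarrow> u x = \<phi> x"
      by eventually_elim (use ul(1) in blast)
    then show ?thesis by (simp add: AE_restrict_space_iff)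
  qed
  ultimately show thesis by (rule that)
qed

end

section \<open>Wronskians of solutions of finite energy near an endpoint\<close>

lemma quadratic_nonneg_discriminant:
  fixes A B C :: real
  assumes "\<And>t. 0 \<le> A * t\<^sup>2 - 2 * B * t + C" and A: "0 \<le> A"
  shows "B\<^sup>2 \<le> A * C"
proof (cases "A = 0")
  case True
  have "B = 0"
  proof (rule ccontr)
    assume "B \<noteq> 0"
    \<comment> \<open>At this t the expression, linear because A = 0, has the value -1.\<close>
    then show False using assms(1)[of "(C + 1) / (2 * B)"] True by (simp add: field_simps)
  qed
  then show ?thesis by (simp add: True)
next
  case False
  then have "0 \<le> A * (A * (B / A)\<^sup>2 - 2 * B * (B / A) + C)" using assms(1)[of "B / A"] A by simp
  also have "\<dots> = A * C - B\<^sup>2" using False by (simp add: power2_eq_square algebra_simps)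
  finally show ?thesis by simp
qed

text \<open>Cauchy-Schwarz for the measure \<omega> dx, obtained from the discriminant of the
  quadratic function \<integral> \<omega> (t - |\<psi>|)^2 of t.\<close>

lemma primitive_increment_bound:
  fixes \<phi> \<psi> :: "real \<Rightarrow> complex" and \<omega> :: "real \<Rightarrow> real"
  assumes \<phi>: "primitive_on (einterval a b) \<phi> (\<lambda>x. \<omega> x *\<^sub>R \<psi> x)" and \<psi>: "continuous_on (einterval a b) \<psi>"
    and \<omega>: "loc_integrable_on (einterval a b) \<omega>" "\<And>x. 0 < \<omega> x"
    and cd: "c \<le> d" "{c..d} \<subseteq> einterval a b"
  shows "(cmod (\<phi> d - \<phi> c))\<^sup>2 \<le> integral {c..d} \<omega> * integral {c..d} (\<lambda>x. \<omega> x * (cmod (\<psi> x))\<^sup>2)"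
proof -
  have i1: "(\<lambda>x. \<omega> x * cmod (\<psi> x)) integrable_on {c..d}"
    by (intro loc_integrable_onD(2)[OF loc_integrable_on_mult cd(2)] \<omega> continuous_intros \<psi>)
  have i2: "(\<lambda>x. \<omega> x * (cmod (\<psi> x))\<^sup>2) integrable_on {c..d}"
    by (intro loc_integrable_onD(2)[OF loc_integrable_on_mult cd(2)] \<omega> continuous_intros \<psi>)
  have i0: "\<omega> integrable_on {c..d}" by (rule loc_integrable_onD(2)[OF \<omega>(1) cd(2)])
  have "0 \<le> integral {c..d} \<omega> * t\<^sup>2 - 2 * integral {c..d} (\<lambda>x. \<omega> x * cmod (\<psi> x)) * t + integral {c..d} (\<lambda>x. \<omega> x * (cmod (\<psi> x))\<^sup>2)" for t
  proof -
    have "0 \<le> integral {c..d} (\<lambda>x. \<omega> x * t\<^sup>2 - \<omega> x * cmod (\<psi> x) * (2 * t) + \<omega> x * (cmod (\<psi> x))\<^sup>2)"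
    proof (rule integral_nonneg)
      show "(\<lambda>x. \<omega> x * t\<^sup>2 - \<omega> x * cmod (\<psi> x) * (2 * t) + \<omega> x * (cmod (\<psi> x))\<^sup>2) integrable_on {c..d}"
        by (intro integrable_add integrable_diff integrable_on_mult_left i0 i1 i2)
      fix x
      have "0 \<le> \<omega> x * (t - cmod (\<psi> x))\<^sup>2" using \<omega>(2)[of x] by simp
      also have "\<dots> = \<omega> x * t\<^sup>2 - \<omega> x * cmod (\<psi> x) * (2 * t) + \<omega> x * (cmod (\<psi> x))\<^sup>2"
        by (simp add: power2_eq_square algebra_simps)
      finally show "0 \<le> \<omega> x * t\<^sup>2 - \<omega> x * cmod (\<psi> x) * (2 * t) + \<omega> x * (cmod (\<psi> x))\<^sup>2" .
    qed
    also have "\<dots> = integral {c..d} \<omega> * t\<^sup>2 - integral {c..d} (\<lambda>x. \<omega> x * cmod (\<psi> x)) * (2 * t) + integral {c..d} (\<lambda>x. \<omega> x * (cmod (\<psi> x))\<^sup>2)"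
      by (simp only: integral_add integral_diff integral_mult_left integrable_on_mult_left integrable_diff i0 i1 i2)
    finally show ?thesis by (simp add: algebra_simps)
  qed
  moreover have "0 \<le> integral {c..d} \<omega>" by (rule integral_nonneg[OF i0]) (use \<omega>(2) less_imp_le in blast)
  ultimately have cs: "(integral {c..d} (\<lambda>x. \<omega> x * cmod (\<psi> x)))\<^sup>2 \<le> integral {c..d} \<omega> * integral {c..d} (\<lambda>x. \<omega> x * (cmod (\<psi> x))\<^sup>2)"
    by (rule quadratic_nonneg_discriminant)
  have "cmod (\<phi> d - \<phi> c) = cmod (integral {c..d} (\<lambda>x. \<omega> x *\<^sub>R \<psi> x))"
    using primitive_onD(2)[OF \<phi> cd] by simp
  also have "\<dots> \<le> integral {c..d} (\<lambda>x. \<omega> x * cmod (\<psi> x))"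
    by (rule Henstock_Kurzweil_Integration.integral_norm_bound_integral[OF primitive_onD(3)[OF \<phi> cd] i1])
      (use \<omega>(2) less_imp_le in \<open>auto simp: abs_of_pos\<close>)
  finally have "(cmod (\<phi> d - \<phi> c))\<^sup>2 \<le> (integral {c..d} (\<lambda>x. \<omega> x * cmod (\<psi> x)))\<^sup>2" by (intro power_mono) auto
  with cs show ?thesis by linarith
qed

lemma wronskian_liminf_right:
  fixes \<phi>1 \<psi>1 \<phi>2 \<psi>2 :: "real \<Rightarrow> complex" and \<omega> :: "real \<Rightarrow> real"
  assumes \<phi>: "primitive_on (einterval a b) \<phi>1 (\<lambda>x. \<omega> x *\<^sub>R \<psi>1 x)" "primitive_on (einterval a b) \<phi>2 (\<lambda>x. \<omega> x *\<^sub>R \<psi>2 x)"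
    and \<psi>: "continuous_on (einterval a b) \<psi>1" "continuous_on (einterval a b) \<psi>2"
    and \<omega>: "loc_integrable_on (einterval a b) \<omega>" "\<And>x. 0 < \<omega> x"
    and c: "c \<in> einterval a b"
    and B: "\<And>x. x \<in> einterval a b \<Longrightarrow> c \<le> x \<Longrightarrow> integral {c..x} (\<lambda>x. \<omega> x * (cmod (\<psi>1 x))\<^sup>2) \<le> B"
      "\<And>x. x \<in> einterval a b \<Longrightarrow> c \<le> x \<Longrightarrow> integral {c..x} (\<lambda>x. \<omega> x * (cmod (\<psi>2 x))\<^sup>2) \<le> B"
    and inf: "\<And>K. \<exists>x\<in>einterval a b. c \<le> x \<and> K < integral {c..x} \<omega>"
    and \<epsilon>: "\<epsilon> > 0"
  obtains x where "x \<in> einterval a b" "c \<le> x" "cmod (\<phi>1 x) * cmod (\<psi>2 x) + cmod (\<psi>1 x) * cmod (\<phi>2 x) < \<epsilon>"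
proof (rule ccontr)
  assume "\<not> thesis"
  with that have ge: "\<epsilon> \<le> cmod (\<phi>1 x) * cmod (\<psi>2 x) + cmod (\<psi>1 x) * cmod (\<phi>2 x)" if "x \<in> einterval a b" "c \<le> x" for x
    using that by (meson not_less)
  let ?I = "einterval a b"
  let ?\<theta> = "\<lambda>x. integral {c..x} \<omega>"
  have i0: "\<omega> integrable_on {u..v}" if "{u..v} \<subseteq> ?I" for u v by (rule loc_integrable_onD(2)[OF \<omega>(1) that])
  have sub: "{c..x} \<subseteq> ?I" if "x \<in> ?I" for x by (rule einterval_Icc_subset[OF c that])
  have \<omega>0: "0 \<le> \<omega> x" for x using \<omega>(2)[of x] by simp
  have \<theta>0: "0 \<le> ?\<theta> x" if "x \<in> ?I" for x
    by (rule integral_nonneg[OF i0[OF sub[OF that]]]) (use \<omega>(2) less_imp_le in blast)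
  have B0: "0 \<le> B" using B(1)[OF c] by simp
  \<comment> \<open>Bounds twice the squared initial values and 2 B at once; the 1 keeps D positive
    when all of them vanish.\<close>
  define D where "D = 2 * (cmod (\<phi>1 c))\<^sup>2 + 2 * (cmod (\<phi>2 c))\<^sup>2 + 2 * B + 1"
  have D0: "D > 0" using B0 by (simp add: D_def add_nonneg_pos)
  have growth: "(cmod (\<phi> x))\<^sup>2 \<le> D * (1 + ?\<theta> x)"
    if x: "x \<in> ?I" "c \<le> x" and p: "primitive_on ?I \<phi> (\<lambda>x. \<omega> x *\<^sub>R \<psi> x)" "continuous_on ?I \<psi>"
      and E: "integral {c..x} (\<lambda>x. \<omega> x * (cmod (\<psi> x))\<^sup>2) \<le> B" and \<phi>c: "\<phi> = \<phi>1 \<or> \<phi> = \<phi>2" for \<phi> \<psi> x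
  proof -
    have "cmod (\<phi> x) \<le> cmod (\<phi> c) + cmod (\<phi> x - \<phi> c)" using norm_triangle_sub by blast
    then have "(cmod (\<phi> x))\<^sup>2 \<le> (cmod (\<phi> c) + cmod (\<phi> x - \<phi> c))\<^sup>2" by (intro power_mono) auto
    also have "\<dots> \<le> 2 * (cmod (\<phi> c))\<^sup>2 + 2 * (cmod (\<phi> x - \<phi> c))\<^sup>2"
      using sum_squares_bound[of "cmod (\<phi> c)" "cmod (\<phi> x - \<phi> c)"] by (simp add: power2_sum)
    also have "(cmod (\<phi> x - \<phi> c))\<^sup>2 \<le> ?\<theta> x * integral {c..x} (\<lambda>x. \<omega> x * (cmod (\<psi> x))\<^sup>2)"
      by (rule primitive_increment_bound[OF p \<omega> x(2) sub[OF x(1)]])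
    also have "\<dots> \<le> ?\<theta> x * B" by (intro mult_left_mono E \<theta>0 x)
    finally have "(cmod (\<phi> x))\<^sup>2 \<le> 2 * (cmod (\<phi> c))\<^sup>2 + 2 * (?\<theta> x * B)" by simp
    also have "\<dots> \<le> D + D * ?\<theta> x"
    proof (rule add_mono)
      show "2 * (cmod (\<phi> c))\<^sup>2 \<le> D" using \<phi>c B0 by (auto simp: D_def)
      have "2 * B \<le> D" by (simp add: D_def)
      then show "2 * (?\<theta> x * B) \<le> D * ?\<theta> x" using mult_right_mono[of "2 * B" D "?\<theta> x"] \<theta>0[OF x(1)] by (simp add: algebra_simps)
    qed
    finally show ?thesis by (simp add: algebra_simps)
  qed
  let ?k = "2 * D / \<epsilon>\<^sup>2"
  \<comment> \<open>Squaring \<epsilon> \<le> |\<phi>1 \<psi>2| + |\<psi>1 \<phi>2| and inserting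
    the growth bound: \<omega>/(1 + \<theta>), the derivative of ln (1 + \<theta>), is at most a
    multiple of the two energy densities.\<close>
  have key: "inverse (1 + ?\<theta> x) * \<omega> x \<le> ?k * (\<omega> x * (cmod (\<psi>1 x))\<^sup>2 + \<omega> x * (cmod (\<psi>2 x))\<^sup>2)" if x: "x \<in> ?I" "c \<le> x" for x
  proof -
    let ?s = "D * (1 + ?\<theta> x)"
    have s: "0 < 1 + ?\<theta> x" using \<theta>0[OF x(1)] by simp
    have g1: "(cmod (\<phi>1 x))\<^sup>2 \<le> ?s" by (rule growth[OF x \<phi>(1) \<psi>(1) B(1)[OF x]]) simp
    have g2: "(cmod (\<phi>2 x))\<^sup>2 \<le> ?s" by (rule growth[OF x \<phi>(2) \<psi>(2) B(2)[OF x]]) simp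
    have "\<epsilon>\<^sup>2 \<le> (cmod (\<phi>1 x) * cmod (\<psi>2 x) + cmod (\<psi>1 x) * cmod (\<phi>2 x))\<^sup>2"
      using ge[OF x] \<epsilon> by (intro power_mono) auto
    also have "\<dots> \<le> 2 * (cmod (\<phi>1 x) * cmod (\<psi>2 x))\<^sup>2 + 2 * (cmod (\<psi>1 x) * cmod (\<phi>2 x))\<^sup>2"
      using sum_squares_bound[of "cmod (\<phi>1 x) * cmod (\<psi>2 x)" "cmod (\<psi>1 x) * cmod (\<phi>2 x)"] by (simp add: power2_sum)
    also have "\<dots> = 2 * ((cmod (\<phi>1 x))\<^sup>2 * (cmod (\<psi>2 x))\<^sup>2) + 2 * ((cmod (\<phi>2 x))\<^sup>2 * (cmod (\<psi>1 x))\<^sup>2)"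
      by (simp add: power_mult_distrib)
    also have "\<dots> \<le> 2 * (?s * (cmod (\<psi>2 x))\<^sup>2) + 2 * (?s * (cmod (\<psi>1 x))\<^sup>2)"
      by (intro add_mono mult_left_mono mult_right_mono g1 g2) auto
    finally have "\<epsilon>\<^sup>2 \<le> 2 * ?s * ((cmod (\<psi>1 x))\<^sup>2 + (cmod (\<psi>2 x))\<^sup>2)" by (simp add: algebra_simps)
    then have "1 \<le> (1 + ?\<theta> x) * (?k * ((cmod (\<psi>1 x))\<^sup>2 + (cmod (\<psi>2 x))\<^sup>2))"
      using \<epsilon> by (simp add: field_simps)
    then have "inverse (1 + ?\<theta> x) \<le> ?k * ((cmod (\<psi>1 x))\<^sup>2 + (cmod (\<psi>2 x))\<^sup>2)"
      using s by (simp add: field_simps)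
    then have "inverse (1 + ?\<theta> x) * \<omega> x \<le> (?k * ((cmod (\<psi>1 x))\<^sup>2 + (cmod (\<psi>2 x))\<^sup>2)) * \<omega> x"
      using \<omega>(2)[of x] by (intro mult_right_mono) auto
    then show ?thesis by (simp add: algebra_simps)
  qed
  \<comment> \<open>The logarithm is differentiated on the open interval (c,b), so the integration
    starts at a point x1 > c.\<close>
  obtain x1 where x1: "x1 \<in> ?I" "c < x1"
  proof -
    obtain x where "x \<in> ?I" "c \<le> x" "0 < ?\<theta> x" using inf[of 0] by blast
    then have "c \<noteq> x" by auto
    then show thesis using that \<open>x \<in> ?I\<close> \<open>c \<le> x\<close> by (metis less_eq_real_def)
  qed
  obtain T where T: "primitive_on ?I T \<omega>" "T c = 0" using primitive_on_exists[OF \<omega>(1) c] by metis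
  have T_eq: "T x = ?\<theta> x" if "x \<in> ?I" "c \<le> x" for x
    using primitive_onD(2)[OF T(1) that(2) sub[OF that(1)]] T(2) by simp
  have ecx: "x \<in> einterval (ereal c) b \<longleftrightarrow> x \<in> ?I \<and> c < x" for x
    using c order.strict_trans[of a "ereal c" "ereal x"] by (auto simp: einterval_iff)
  have ec: "einterval (ereal c) b \<subseteq> ?I" by (auto simp: ecx)
  have ln: "primitive_on (einterval (ereal c) b) (\<lambda>x. ln (1 + T x)) (\<lambda>x. inverse (1 + T x) * \<omega> x)"
  proof (rule primitive_on_compose[OF primitive_on_subset[OF T(1) ec], of "\<lambda>y. ln (1 + y)" "\<lambda>y. inverse (1 + y)"])
    have pos: "0 < 1 + y" if "y \<in> T ` einterval (ereal c) b" for y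
      using that T_eq \<theta>0 ecx by (auto simp: add_pos_nonneg)
    show "((\<lambda>y. ln (1 + y)) has_real_derivative inverse (1 + y)) (at y)" if "y \<in> T ` einterval (ereal c) b" for y
      using pos[OF that] by (auto intro!: derivative_eq_intros simp: inverse_eq_divide)
    show "continuous_on (T ` einterval (ereal c) b) (\<lambda>y. inverse (1 + y))"
      using pos by (intro continuous_intros) force
  qed
  have bound: "ln (1 + ?\<theta> x) \<le> ln (1 + ?\<theta> x1) + ?k * (B + B)" if x: "x \<in> ?I" "x1 \<le> x" for x
  proof -
    have cx: "c \<le> x" using x x1 by simp
    have sub1: "{x1..x} \<subseteq> einterval (ereal c) b" by (rule einterval_Icc_subset) (use ecx x x1 in auto)
    have sub2: "{x1..x} \<subseteq> {c..x}" using x1 by auto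
    have iE: "(\<lambda>x. \<omega> x * (cmod (\<psi> x))\<^sup>2) integrable_on {u..v}" if "{u..v} \<subseteq> ?I" "continuous_on ?I \<psi>" for \<psi> u v
      by (intro loc_integrable_onD(2)[OF loc_integrable_on_mult that(1)] \<omega> continuous_intros that)
    have x1I: "{x1..x} \<subseteq> ?I" by (rule einterval_Icc_subset[OF x1(1) x(1)])
    have E: "integral {x1..x} (\<lambda>x. \<omega> x * (cmod (\<psi> x))\<^sup>2) \<le> integral {c..x} (\<lambda>x. \<omega> x * (cmod (\<psi> x))\<^sup>2)"
      if "continuous_on ?I \<psi>" for \<psi>
      by (rule integral_subset_le[OF sub2 iE[OF x1I that] iE[OF sub[OF x(1)] that]])
        (use \<omega>0 in auto)
    have "ln (1 + T x) - ln (1 + T x1) = integral {x1..x} (\<lambda>x. inverse (1 + T x) * \<omega> x)"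
      using primitive_onD(2)[OF ln x(2) sub1] by simp
    also have "\<dots> \<le> integral {x1..x} (\<lambda>x. ?k * (\<omega> x * (cmod (\<psi>1 x))\<^sup>2 + \<omega> x * (cmod (\<psi>2 x))\<^sup>2))"
    proof (rule integral_le[OF primitive_onD(3)[OF ln x(2) sub1]])
      show "(\<lambda>x. ?k * (\<omega> x * (cmod (\<psi>1 x))\<^sup>2 + \<omega> x * (cmod (\<psi>2 x))\<^sup>2)) integrable_on {x1..x}"
        by (intro integrable_on_mult_right integrable_add iE x1I \<psi>)
      fix t assume "t \<in> {x1..x}"
      then have t: "t \<in> ?I" "c \<le> t" using x1I x1 by auto
      show "inverse (1 + T t) * \<omega> t \<le> ?k * (\<omega> t * (cmod (\<psi>1 t))\<^sup>2 + \<omega> t * (cmod (\<psi>2 t))\<^sup>2)"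
        using key[OF t] T_eq[OF t] by simp
    qed
    also have "\<dots> = ?k * (integral {x1..x} (\<lambda>x. \<omega> x * (cmod (\<psi>1 x))\<^sup>2) + integral {x1..x} (\<lambda>x. \<omega> x * (cmod (\<psi>2 x))\<^sup>2))"
      by (simp only: integral_mult_right integral_add iE[OF x1I \<psi>(1)] iE[OF x1I \<psi>(2)])
    also have "\<dots> \<le> ?k * (B + B)"
      using E[OF \<psi>(1)] E[OF \<psi>(2)] B[OF x(1) cx] D0 by (intro mult_left_mono add_mono) auto
    finally show ?thesis using T_eq[OF x(1) cx] T_eq[of x1] x1 by simp
  qed
  obtain x where x: "x \<in> ?I" "c \<le> x" "exp (ln (1 + ?\<theta> x1) + ?k * (B + B)) < ?\<theta> x" using inf by blast
  \<comment> \<open>The point where \<theta> is large may lie to the left of x1; then x1 itself will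
    do, as \<theta> is increasing.\<close>
  obtain x' where x': "x' \<in> ?I" "x1 \<le> x'" "?\<theta> x \<le> ?\<theta> x'"
  proof (cases "x1 \<le> x")
    case True then show thesis using that x(1) by blast
  next
    case False
    have "?\<theta> x \<le> ?\<theta> x1"
      by (rule integral_subset_le[OF _ i0[OF sub[OF x(1)]] i0[OF sub[OF x1(1)]]]) (use False \<omega>(2) less_imp_le in auto)
    then show thesis using that x1(1) by blast
  qed
  have "exp (ln (1 + ?\<theta> x')) \<le> exp (ln (1 + ?\<theta> x1) + ?k * (B + B))"
    using bound[OF x'(1,2)] by (simp only: exp_le_cancel_iff)
  then have "1 + ?\<theta> x' \<le> exp (ln (1 + ?\<theta> x1) + ?k * (B + B))"
    using \<theta>0[OF x'(1)] by (simp add: exp_ln add_pos_nonneg)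
  then show False using x(3) x'(3) by linarith
qed

lemma uminus_einterval: "uminus ` einterval a b = einterval (- b) (- a)"
proof -
  have "x \<in> uminus ` einterval a b \<longleftrightarrow> - x \<in> einterval a b" for x
    by (metis image_iff minus_minus)
  moreover have "- x \<in> einterval a b \<longleftrightarrow> x \<in> einterval (- b) (- a)" for x :: real
    by (simp add: einterval_iff) (metis ereal_minus_less_minus ereal_uminus_uminus uminus_ereal.simps(1))
  ultimately show ?thesis by blast
qed

text \<open>Reflection reduces this to the right end. The derivative of \<phi>(-x) is -\<omega>(-x)
  \<psi>(-x), and the minus sign goes to \<psi> so that \<omega> stays positive.\<close>

lemma wronskian_liminf_left:
  fixes \<phi>1 \<psi>1 \<phi>2 \<psi>2 :: "real \<Rightarrow> complex" and \<omega> :: "real \<Rightarrow> real"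
  assumes \<phi>: "primitive_on (einterval a b) \<phi>1 (\<lambda>x. \<omega> x *\<^sub>R \<psi>1 x)" "primitive_on (einterval a b) \<phi>2 (\<lambda>x. \<omega> x *\<^sub>R \<psi>2 x)"
    and \<psi>: "continuous_on (einterval a b) \<psi>1" "continuous_on (einterval a b) \<psi>2"
    and \<omega>: "loc_integrable_on (einterval a b) \<omega>" "\<And>x. 0 < \<omega> x"
    and c: "c \<in> einterval a b"
    and B: "\<And>x. x \<in> einterval a b \<Longrightarrow> x \<le> c \<Longrightarrow> integral {x..c} (\<lambda>x. \<omega> x * (cmod (\<psi>1 x))\<^sup>2) \<le> B"
      "\<And>x. x \<in> einterval a b \<Longrightarrow> x \<le> c \<Longrightarrow> integral {x..c} (\<lambda>x. \<omega> x * (cmod (\<psi>2 x))\<^sup>2) \<le> B"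
    and inf: "\<And>K. \<exists>x\<in>einterval a b. x \<le> c \<and> K < integral {x..c} \<omega>"
    and \<epsilon>: "\<epsilon> > 0"
  obtains x where "x \<in> einterval a b" "x \<le> c" "cmod (\<phi>1 x) * cmod (\<psi>2 x) + cmod (\<psi>1 x) * cmod (\<phi>2 x) < \<epsilon>"
proof -
  let ?J = "einterval (- b) (- a)"
  have mem: "x \<in> ?J \<longleftrightarrow> - x \<in> einterval a b" for x
    using uminus_einterval[of a b] by (metis image_iff minus_minus)
  have refl: "integral {- c..x} (\<lambda>x. f (- x)) = integral {- x..c} f" for f :: "real \<Rightarrow> real" and x
    using Henstock_Kurzweil_Integration.integral_reflect_real[where a = "- x" and b = c and f = f] by simp
  have P: "primitive_on ?J (\<lambda>x. \<phi> (- x)) (\<lambda>x. \<omega> (- x) *\<^sub>R (- \<psi> (- x)))"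
    if "primitive_on (einterval a b) \<phi> (\<lambda>x. \<omega> x *\<^sub>R \<psi> x)" for \<phi> \<psi> :: "real \<Rightarrow> complex"
    using primitive_on_reflect[OF that] by (simp add: uminus_einterval)
  have C: "continuous_on ?J (\<lambda>x. - \<psi> (- x))" if "continuous_on (einterval a b) \<psi>" for \<psi> :: "real \<Rightarrow> complex"
    by (intro continuous_on_minus continuous_on_compose2[OF that]) (auto intro!: continuous_intros simp: mem)
  obtain T where "primitive_on (einterval a b) T \<omega>" using primitive_on_exists[OF \<omega>(1) c] by metis
  from primitive_on_loc_integrable[OF primitive_on_reflect[OF this]]
  have "loc_integrable_on ?J (\<lambda>x. - \<omega> (- x))" by (simp add: uminus_einterval)
  from loc_integrable_on_norm[OF this] have \<omega>': "loc_integrable_on ?J (\<lambda>x. \<omega> (- x))"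
    using \<omega>(2) less_imp_le by (simp add: abs_of_pos)
  obtain x where x: "x \<in> ?J" "- c \<le> x"
    "cmod (\<phi>1 (- x)) * cmod (- \<psi>2 (- x)) + cmod (- \<psi>1 (- x)) * cmod (\<phi>2 (- x)) < \<epsilon>"
  proof (rule wronskian_liminf_right[OF P[OF \<phi>(1)] P[OF \<phi>(2)] C[OF \<psi>(1)] C[OF \<psi>(2)] \<omega>' _ _ _ _ _ \<epsilon>, of "- c" B])
    show "- c \<in> ?J" using c by (simp add: mem)
    show "integral {- c..x} (\<lambda>x. \<omega> (- x) * (cmod (- \<psi>1 (- x)))\<^sup>2) \<le> B" if "x \<in> ?J" "- c \<le> x" for x
      using refl[of x "\<lambda>x. \<omega> x * (cmod (\<psi>1 x))\<^sup>2"] B(1)[of "- x"] that by (simp add: mem)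
    show "integral {- c..x} (\<lambda>x. \<omega> (- x) * (cmod (- \<psi>2 (- x)))\<^sup>2) \<le> B" if "x \<in> ?J" "- c \<le> x" for x
      using refl[of x "\<lambda>x. \<omega> x * (cmod (\<psi>2 x))\<^sup>2"] B(2)[of "- x"] that by (simp add: mem)
    show "\<exists>x\<in>?J. - c \<le> x \<and> K < integral {- c..x} (\<lambda>x. \<omega> (- x))" for K
    proof -
      obtain x where "x \<in> einterval a b" "x \<le> c" "K < integral {x..c} \<omega>" using inf by blast
      then show ?thesis using refl[of "- x" \<omega>] by (intro bexI[of _ "- x"]) (auto simp: mem)
    qed
  qed (use \<omega>(2) in auto)
  show thesis by (rule that[of "- x"]) (use x mem in auto)
qed

text \<open>[c0,d0] is the compact part on which W has no prescribed sign. Positivity of \<omega>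
  and R at every point spares exceptional sets; \<open>gauged_sturm_liouville\<close> arranges it by
  changing the coefficients on a null set.\<close>

locale sl_ends = sl_core +
  fixes \<mu> c0 d0 :: real
  assumes pos: "\<And>x. 0 < \<omega> x" "\<And>x. 0 < R x"
    and c0d0: "c0 < d0" "{c0..d0} \<subseteq> einterval a b"
    and W_ge: "\<And>x. x \<in> einterval a b \<Longrightarrow> x \<notin> {c0..d0} \<Longrightarrow> \<mu> * R x \<le> W x"
    and left_inf: "\<And>K c. c \<in> einterval a b \<Longrightarrow> \<exists>x\<in>einterval a b. x \<le> c \<and> K < integral {x..c} \<omega>"
    and right_inf: "\<And>K c. c \<in> einterval a b \<Longrightarrow> \<exists>x\<in>einterval a b. c \<le> x \<and> K < integral {c..x} \<omega>"
begin

lemma nonneg: "0 \<le> \<omega> x" "0 \<le> R x"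
  using pos less_imp_le by auto

lemma energy_integrable:
  assumes "continuous_on I \<psi>" "{c..d} \<subseteq> I"
  shows "(\<lambda>x. \<omega> x * (cmod (\<psi> x))\<^sup>2) absolutely_integrable_on {c..d}"
    "(\<lambda>x. R x * (cmod (\<psi> x))\<^sup>2) absolutely_integrable_on {c..d}"
    "(\<lambda>x. W x * (cmod (\<psi> x))\<^sup>2) absolutely_integrable_on {c..d}"
    "(\<lambda>x. \<omega> x * (cmod (\<psi> x))\<^sup>2) integrable_on {c..d}"
    "(\<lambda>x. R x * (cmod (\<psi> x))\<^sup>2) integrable_on {c..d}"
    "(\<lambda>x. W x * (cmod (\<psi> x))\<^sup>2) integrable_on {c..d}"
proof -
  have "loc_integrable_on I (\<lambda>x. \<omega> x * (cmod (\<psi> x))\<^sup>2)" "loc_integrable_on I (\<lambda>x. R x * (cmod (\<psi> x))\<^sup>2)"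
    "loc_integrable_on I (\<lambda>x. W x * (cmod (\<psi> x))\<^sup>2)"
    by (intro loc_integrable_on_mult \<omega>_loc R_loc W_loc continuous_intros assms(1))+
  note this[THEN loc_integrable_onD(1)] and this[THEN loc_integrable_onD(2)]
  then show "(\<lambda>x. \<omega> x * (cmod (\<psi> x))\<^sup>2) absolutely_integrable_on {c..d}"
    "(\<lambda>x. R x * (cmod (\<psi> x))\<^sup>2) absolutely_integrable_on {c..d}"
    "(\<lambda>x. W x * (cmod (\<psi> x))\<^sup>2) absolutely_integrable_on {c..d}"
    "(\<lambda>x. \<omega> x * (cmod (\<psi> x))\<^sup>2) integrable_on {c..d}"
    "(\<lambda>x. R x * (cmod (\<psi> x))\<^sup>2) integrable_on {c..d}"
    "(\<lambda>x. W x * (cmod (\<psi> x))\<^sup>2) integrable_on {c..d}"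
    using assms(2) by blast+
qed

text \<open>Over the short interval the squared oscillation of \<phi> is at most \<eta> times the
  energy, so the value at x is controlled by the value at any other point y. Averaging over y with
  weight R replaces the latter by the norm.\<close>

lemma sup_bound_short:
  assumes \<phi>: "primitive_on I \<phi> (\<lambda>x. \<omega> x *\<^sub>R \<psi> x)" and \<psi>: "continuous_on I \<psi>"
    and J: "{e..f} \<subseteq> I" "x \<in> {e..f}"
    and \<eta>: "integral {e..f} \<omega> \<le> \<eta>" and \<rho>: "0 < \<rho>" "\<rho> \<le> integral {e..f} R"
  shows "(cmod (\<phi> x))\<^sup>2 \<le> 2 * \<eta> * integral {e..f} (\<lambda>x. \<omega> x * (cmod (\<psi> x))\<^sup>2)
    + 2 / \<rho> * integral {e..f} (\<lambda>x. R x * (cmod (\<phi> x))\<^sup>2)"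
proof -
  let ?E = "integral {e..f} (\<lambda>x. \<omega> x * (cmod (\<psi> x))\<^sup>2)"
  have \<phi>c: "continuous_on I \<phi>" by (rule primitive_on_continuous[OF \<phi>]) simp
  have R_int: "R integrable_on {e..f}" by (rule loc_integrable_onD(2)[OF R_loc J(1)])
  have incr: "(cmod (\<phi> v - \<phi> u))\<^sup>2 \<le> \<eta> * ?E" if uv: "u \<in> {e..f}" "v \<in> {e..f}" "u \<le> v" for u v
  proof -
    have sub: "{u..v} \<subseteq> {e..f}" "{u..v} \<subseteq> I" using uv J(1) by auto
    have "(cmod (\<phi> v - \<phi> u))\<^sup>2 \<le> integral {u..v} \<omega> * integral {u..v} (\<lambda>x. \<omega> x * (cmod (\<psi> x))\<^sup>2)"
      by (rule primitive_increment_bound[OF \<phi> \<psi> \<omega>_loc pos(1) uv(3) sub(2)])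
    also have "\<dots> \<le> \<eta> * ?E"
    proof (rule mult_mono)
      have "integral {u..v} \<omega> \<le> integral {e..f} \<omega>"
        by (rule integral_subset_le[OF sub(1)]) (use loc_integrable_onD(2)[OF \<omega>_loc] sub J nonneg in auto)
      then show "integral {u..v} \<omega> \<le> \<eta>" using \<eta> by simp
      show "integral {u..v} (\<lambda>x. \<omega> x * (cmod (\<psi> x))\<^sup>2) \<le> ?E"
        by (rule integral_subset_le[OF sub(1)]) (use energy_integrable(4)[OF \<psi>] sub J nonneg in auto)
      have "0 \<le> integral {e..f} \<omega>"
        by (rule integral_nonneg) (use loc_integrable_onD(2)[OF \<omega>_loc] J nonneg in auto)
      then show "0 \<le> \<eta>" using \<eta> by simp
      show "0 \<le> integral {u..v} (\<lambda>x. \<omega> x * (cmod (\<psi> x))\<^sup>2)"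
        by (rule integral_nonneg) (use energy_integrable(4)[OF \<psi>] sub J nonneg in auto)
    qed
    finally show ?thesis .
  qed
  have pt: "(cmod (\<phi> x))\<^sup>2 \<le> 2 * (cmod (\<phi> y))\<^sup>2 + 2 * (\<eta> * ?E)" if y: "y \<in> {e..f}" for y
  proof -
    have i: "(cmod (\<phi> x - \<phi> y))\<^sup>2 \<le> \<eta> * ?E"
      using incr[of x y] incr[of y x] y J(2) by (cases "x \<le> y") (auto simp: norm_minus_commute)
    have "cmod (\<phi> x) \<le> cmod (\<phi> y) + cmod (\<phi> x - \<phi> y)" using norm_triangle_sub by blast
    then have "(cmod (\<phi> x))\<^sup>2 \<le> (cmod (\<phi> y) + cmod (\<phi> x - \<phi> y))\<^sup>2" by (intro power_mono) auto
    also have "\<dots> \<le> 2 * (cmod (\<phi> y))\<^sup>2 + 2 * (cmod (\<phi> x - \<phi> y))\<^sup>2"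
      using sum_squares_bound[of "cmod (\<phi> y)" "cmod (\<phi> x - \<phi> y)"] by (simp add: power2_sum)
    finally show ?thesis using i by simp
  qed
  let ?r = "integral {e..f} R" and ?N = "integral {e..f} (\<lambda>x. R x * (cmod (\<phi> x))\<^sup>2)"
  have r: "0 < ?r" using \<rho> by simp
  have N0: "0 \<le> ?N" by (rule integral_nonneg) (use energy_integrable(5)[OF \<phi>c J(1)] nonneg in auto)
  have "(cmod (\<phi> x))\<^sup>2 * ?r = integral {e..f} (\<lambda>y. (cmod (\<phi> x))\<^sup>2 * R y)" by simp
  also have "\<dots> \<le> integral {e..f} (\<lambda>y. 2 * (R y * (cmod (\<phi> y))\<^sup>2) + (2 * (\<eta> * ?E)) * R y)"
  proof (rule integral_le)
    show "(\<lambda>y. (cmod (\<phi> x))\<^sup>2 * R y) integrable_on {e..f}" by (intro integrable_on_mult_right R_int)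
    show "(\<lambda>y. 2 * (R y * (cmod (\<phi> y))\<^sup>2) + (2 * (\<eta> * ?E)) * R y) integrable_on {e..f}"
      by (intro integrable_add integrable_on_mult_right R_int energy_integrable(5)[OF \<phi>c J(1)])
    fix y assume "y \<in> {e..f}"
    from mult_right_mono[OF pt[OF this] nonneg(2)[of y]]
    show "(cmod (\<phi> x))\<^sup>2 * R y \<le> 2 * (R y * (cmod (\<phi> y))\<^sup>2) + (2 * (\<eta> * ?E)) * R y"
      by (simp add: algebra_simps)
  qed
  also have "\<dots> = 2 * ?N + (2 * (\<eta> * ?E)) * ?r"
    by (simp only: integral_add integrable_on_mult_right R_int energy_integrable(5)[OF \<phi>c J(1)] integral_mult_right)
  finally have "(cmod (\<phi> x))\<^sup>2 \<le> 2 * (\<eta> * ?E) + 2 * ?N / ?r" using r by (simp add: field_simps)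
  also have "2 * ?N / ?r \<le> 2 * ?N / \<rho>" using \<rho> N0 by (intro divide_left_mono) auto
  finally show ?thesis by (simp add: field_simps)
qed

text \<open>An interpolation inequality: the factor \<epsilon> of the energy is arbitrary. The
  interval is divided so finely that \<omega> has integral at most \<epsilon>/2 over each piece, by
  uniform continuity of its primitive T.\<close>

lemma sup_bound:
  assumes cd: "c < d" "{c..d} \<subseteq> I" and \<epsilon>: "\<epsilon> > 0"
  obtains C where "C \<ge> 0" "\<And>(\<phi> :: real \<Rightarrow> complex) \<psi> x. primitive_on I \<phi> (\<lambda>x. \<omega> x *\<^sub>R \<psi> x) \<Longrightarrow> continuous_on I \<psi> \<Longrightarrow> x \<in> {c..d} \<Longrightarrow>
    (cmod (\<phi> x))\<^sup>2 \<le> \<epsilon> * integral {c..d} (\<lambda>x. \<omega> x * (cmod (\<psi> x))\<^sup>2) + C * integral {c..d} (\<lambda>x. R x * (cmod (\<phi> x))\<^sup>2)"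
proof -
  have cI: "c \<in> I" using cd by auto
  obtain T where T: "primitive_on I T \<omega>" using primitive_on_exists[OF \<omega>_loc cI] by metis
  have "continuous_on {c..d} T" by (rule continuous_on_subset[OF primitive_on_continuous[OF T] cd(2)]) simp
  then have "uniformly_continuous_on {c..d} T" by (intro compact_uniformly_continuous) auto
  then obtain \<delta> where \<delta>: "\<delta> > 0" "\<And>x y. x \<in> {c..d} \<Longrightarrow> y \<in> {c..d} \<Longrightarrow> dist y x < \<delta> \<Longrightarrow> dist (T y) (T x) < \<epsilon> / 2"
    using \<epsilon> unfolding uniformly_continuous_on_def by (metis half_gt_zero)
  obtain N :: nat where N: "(d - c) / \<delta> < real N" using reals_Archimedean2 by blast
  have N0: "0 < N" using N \<delta>(1) cd(1) by (metis divide_pos_pos diff_gt_0_iff_gt of_nat_0_less_iff order.strict_trans)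
  define h where "h = (d - c) / real N"
  have h: "0 < h" "h < \<delta>" using cd(1) N0 N \<delta>(1) by (auto simp: h_def field_simps)
  define e where "e i = c + real i * h" for i
  have eN: "e N = d" using N0 by (simp add: e_def h_def)
  have e_in: "c \<le> e i" "e i \<le> d" if "i \<le> N" for i
  proof -
    show "c \<le> e i" using h by (simp add: e_def)
    have "e i \<le> e N" using that h unfolding e_def by (intro add_left_mono mult_right_mono) auto
    then show "e i \<le> d" using eN by simp
  qed
  have eS: "e (Suc i) = e i + h" for i by (simp add: e_def algebra_simps)
  have sub: "{e i..e (Suc i)} \<subseteq> {c..d}" if "i < N" for i using e_in[of i] e_in[of "Suc i"] that by auto
  \<comment> \<open>The smallest R-mass of a piece; it is positive and determines the constant
    C.\<close>
  define \<rho> where "\<rho> = Min ((\<lambda>i. integral {e i..e (Suc i)} R) ` {..<N})"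
  have Rpos: "0 < integral {e i..e (Suc i)} R" if i: "i < N" for i
  proof -
    have s: "{e i..e (Suc i)} \<subseteq> I" using sub[OF i] cd(2) by blast
    have ai: "(\<lambda>x. R x * (norm (1::real))\<^sup>2) absolutely_integrable_on {e i..e (Suc i)}"
      using loc_integrable_onD(1)[OF R_loc s] by simp
    have "integral {e i..e (Suc i)} R \<noteq> 0"
    proof
      assume "integral {e i..e (Suc i)} R = 0"
      then have "AE x in lebesgue_on {e i..e (Suc i)}. (1::real) = 0"
        by (intro weighted_norm_zero[OF ai s]) simp
      then have "AE x in lebesgue_on {e i<..<e (Suc i)}. (1::real) = 0"
        by (rule AE_lebesgue_on_subset) auto
      moreover have "e i + h / 2 \<in> {e i<..<e (Suc i)}" using h by (simp add: eS)
      ultimately show False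
        using continuous_AE_zero[of "{e i<..<e (Suc i)}" "\<lambda>_. 1::real" "e i + h / 2"] by simp
    qed
    moreover have "0 \<le> integral {e i..e (Suc i)} R"
      by (rule integral_nonneg) (use loc_integrable_onD(2)[OF R_loc s] nonneg in auto)
    ultimately show ?thesis by simp
  qed
  have \<rho>: "0 < \<rho>" unfolding \<rho>_def using N0 Rpos by (subst Min_gr_iff) auto
  have \<rho>_le: "\<rho> \<le> integral {e i..e (Suc i)} R" if "i < N" for i
    unfolding \<rho>_def using that by (intro Min_le) auto
  show thesis
  proof (rule that[of "2 / \<rho>"])
    show "0 \<le> 2 / \<rho>" using \<rho> by simp
    fix \<phi> \<psi> :: "real \<Rightarrow> complex" and x
    assume \<phi>: "primitive_on I \<phi> (\<lambda>x. \<omega> x *\<^sub>R \<psi> x)" and \<psi>: "continuous_on I \<psi>" and x: "x \<in> {c..d}"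
    have \<phi>c: "continuous_on I \<phi>" by (rule primitive_on_continuous[OF \<phi>]) simp
    obtain i where i: "i < N" "x \<in> {e i..e (Suc i)}"
    \<comment> \<open>The floor would give the index N for x = d, so the last piece is chosen by
      hand.\<close>
    proof (cases "x = d")
      case True
      then show thesis using that[of "N - 1"] N0 eN e_in[of "N - 1"] by simp
    next
      case False
      define i where "i = nat \<lfloor>(x - c) / h\<rfloor>"
      have "0 \<le> (x - c) / h" using x h by simp
      then have fl: "real i \<le> (x - c) / h" "(x - c) / h < real i + 1"
        unfolding i_def by linarith+
      have "(x - c) / h < real N" using x False h N0 by (simp add: h_def field_simps)
      then have "i < N" using fl(1) by linarith
      moreover have "x \<in> {e i..e (Suc i)}" using fl h by (simp add: e_def field_simps)
      ultimately show thesis by (rule that)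
    qed
    have s: "{e i..e (Suc i)} \<subseteq> I" using sub[OF i(1)] cd(2) by blast
    have "dist (T (e (Suc i))) (T (e i)) < \<epsilon> / 2"
      using e_in[of i] e_in[of "Suc i"] i(1) h by (intro \<delta>(2)) (auto simp: eS dist_real_def)
    moreover have "e i \<le> e (Suc i)" using h by (simp add: eS)
    ultimately have \<eta>: "integral {e i..e (Suc i)} \<omega> \<le> \<epsilon> / 2"
      using primitive_onD(2)[OF T _ s] abs_ge_self[of "T (e (Suc i)) - T (e i)"] unfolding dist_real_def by linarith
    have "(cmod (\<phi> x))\<^sup>2 \<le> 2 * (\<epsilon> / 2) * integral {e i..e (Suc i)} (\<lambda>x. \<omega> x * (cmod (\<psi> x))\<^sup>2)
        + 2 / \<rho> * integral {e i..e (Suc i)} (\<lambda>x. R x * (cmod (\<phi> x))\<^sup>2)"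
      by (rule sup_bound_short[OF \<phi> \<psi> s i(2) \<eta> \<rho> \<rho>_le[OF i(1)]])
    also have "\<dots> \<le> 2 * (\<epsilon> / 2) * integral {c..d} (\<lambda>x. \<omega> x * (cmod (\<psi> x))\<^sup>2) + 2 / \<rho> * integral {c..d} (\<lambda>x. R x * (cmod (\<phi> x))\<^sup>2)"
      using \<epsilon> \<rho> nonneg
      by (intro add_mono mult_left_mono integral_subset_le sub i energy_integrable \<phi>c \<psi> s cd) auto
    finally show "(cmod (\<phi> x))\<^sup>2 \<le> \<epsilon> * integral {c..d} (\<lambda>x. \<omega> x * (cmod (\<psi> x))\<^sup>2) + 2 / \<rho> * integral {c..d} (\<lambda>x. R x * (cmod (\<phi> x))\<^sup>2)"
      by simp
  qed
qed

end

section \<open>Coercivity of the form, lower semicontinuity and symmetry\<close>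

context sl_ends
begin

text \<open>The surplus of W over \<mu> R near the ends. It is 0 on [c0,d0], where the difference
  could be negative; there all of W is estimated by \<open>sup_bound\<close> instead.\<close>

definition Wp :: "real \<Rightarrow> real" where
  "Wp x = (if x \<in> {c0..d0} then 0 else W x - \<mu> * R x)"

lemma Wp_nonneg: "x \<in> I \<Longrightarrow> 0 \<le> Wp x"
  using W_ge[of x] by (auto simp: Wp_def)

lemma Wp_meas: "Wp \<in> borel_measurable \<Lambda>"
proof -
  have "{c0..d0} \<inter> space \<Lambda> \<in> sets \<Lambda>" by (simp add: sets_restrict_space_iff)
  then have "(\<lambda>x. if x \<in> {c0..d0} then 0 else W x - \<mu> * R x) \<in> borel_measurable \<Lambda>"
    using meas by (intro measurable_If_set borel_measurable_diff borel_measurable_times) auto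
  then show ?thesis by (simp add: Wp_def[abs_def])
qed

lemma Wp_loc: "loc_integrable_on I Wp"
  unfolding loc_integrable_on_def
proof (intro allI impI)
  fix c d assume cd: "{c..d} \<subseteq> I"
  have "loc_integrable_on I (\<lambda>x. norm (W x - \<mu> * R x))"
    using loc_integrable_on_mult[OF R_loc, of "\<lambda>_. \<mu>"]
    by (intro loc_integrable_on_norm loc_integrable_on_diff W_loc) (simp add: mult.commute)
  from loc_integrable_onD(2)[OF this cd]
  show "Wp absolutely_integrable_on {c..d}"
  proof (rule measurable_bounded_by_integrable_imp_absolutely_integrable[rotated 2])
    show "Wp \<in> borel_measurable (lebesgue_on {c..d})"
      using cd Wp_meas by (metis (no_types, lifting) measurable_restrict_mono)
  qed (auto simp: Wp_def)
qed

definition energy :: "(real \<Rightarrow> complex) \<Rightarrow> real" where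
  "energy \<psi> = (LINT x|\<Lambda>. \<omega> x * (cmod (\<psi> x))\<^sup>2)"

definition potential :: "(real \<Rightarrow> complex) \<Rightarrow> real" where
  "potential \<phi> = (LINT x|\<Lambda>. Wp x * (cmod (\<phi> x))\<^sup>2)"

definition mass :: "(real \<Rightarrow> complex) \<Rightarrow> real" where
  "mass \<phi> = (LINT x|\<Lambda>. R x * (cmod (\<phi> x))\<^sup>2)"

lemma quantities_nonneg: "0 \<le> energy \<psi>" "0 \<le> potential \<psi>" "0 \<le> mass \<psi>"
  unfolding energy_def potential_def mass_def
  by (intro integral_nonneg_AE AE_I2 mult_nonneg_nonneg; simp add: nonneg Wp_nonneg)+

text \<open>On [c0,d0] the integral of |W| |\<phi>|^2 is at most \<open>?w\<close> times the
  supremum of |\<phi>|^2, which by \<open>sup_bound\<close> costs half of the energy and a multiple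
  of the mass. Outside, W \<ge> Wp - |\<mu>| R.\<close>

lemma coercive:
  obtains C where "\<And>\<phi> \<psi> \<kappa> c d. slc \<phi> \<psi> \<kappa> \<Longrightarrow> {c..d} \<subseteq> I \<Longrightarrow> (\<And>x. x \<in> I \<Longrightarrow> x \<notin> {c..d} \<Longrightarrow> \<phi> x = 0) \<Longrightarrow>
      integrable \<Lambda> (\<lambda>x. \<omega> x * (cmod (\<psi> x))\<^sup>2) \<and> integrable \<Lambda> (\<lambda>x. R x * (cmod (\<phi> x))\<^sup>2) \<and>
      integrable \<Lambda> (\<lambda>x. Wp x * (cmod (\<phi> x))\<^sup>2) \<and>
      energy \<psi> / 2 + potential \<phi> + mass \<phi> \<le> Re (LINT x|\<Lambda>. R x *\<^sub>R (cnj (\<phi> x) * \<kappa> x)) + C * mass \<phi>"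
proof -
  let ?w = "integral {c0..d0} (\<lambda>x. \<bar>W x\<bar>)"
  have absW: "(\<lambda>x. \<bar>W x\<bar>) integrable_on {c0..d0}"
    using loc_integrable_onD(2)[OF loc_integrable_on_norm[OF W_loc] c0d0(2)] by simp
  have w: "0 \<le> ?w" by (rule integral_nonneg[OF absW]) simp
  \<comment> \<open>\<open>?w\<close> times this number is at most 1/2; the 1 covers
    \<open>?w = 0\<close>.\<close>
  have \<epsilon>: "0 < 1 / (2 * (?w + 1))" using w by simp
  obtain C where C: "C \<ge> 0" "\<And>(\<phi> :: real \<Rightarrow> complex) \<psi> x. primitive_on I \<phi> (\<lambda>x. \<omega> x *\<^sub>R \<psi> x) \<Longrightarrow> continuous_on I \<psi> \<Longrightarrow> x \<in> {c0..d0} \<Longrightarrow>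
    (cmod (\<phi> x))\<^sup>2 \<le> 1 / (2 * (?w + 1)) * integral {c0..d0} (\<lambda>x. \<omega> x * (cmod (\<psi> x))\<^sup>2) + C * integral {c0..d0} (\<lambda>x. R x * (cmod (\<phi> x))\<^sup>2)"
    by (rule sup_bound[OF c0d0 \<epsilon>]) (rule that; assumption)
  show thesis
  \<comment> \<open>The three terms pay for [c0,d0], for \<mu> R outside of it, and for the mass on
    the left-hand side.\<close>
  proof (rule that[of "?w * C + \<bar>\<mu>\<bar> + 1"])
    fix \<phi> \<psi> \<kappa> c1 d1
    assume s: "slc \<phi> \<psi> \<kappa>" and cd1: "{c1..d1} \<subseteq> I" and supp1: "\<And>x. x \<in> I \<Longrightarrow> x \<notin> {c1..d1} \<Longrightarrow> \<phi> x = 0"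
    have supp1': "\<psi> x = 0" if "x \<in> I" "x \<notin> {c1..d1}" for x by (rule slc_support[OF s supp1 that])
    note \<phi>c = slcD(3)[OF s] and \<psi>c = slcD(4)[OF s]
    have c0I: "c0 \<in> I" "d0 \<in> I" using c0d0 by auto
    \<comment> \<open>The supporting interval is enlarged to contain [c0,d0]; it may also be empty,
      with c1 > d1.\<close>
    define cm dm where "cm = (if c1 \<le> d1 then min c0 c1 else c0)" and "dm = (if c1 \<le> d1 then max d0 d1 else d0)"
    have cm: "cm \<in> I" "dm \<in> I" "cm \<le> c0" "d0 \<le> dm" using c0I cd1 by (auto simp: cm_def dm_def min_def max_def)
    have cm1: "{c1..d1} \<subseteq> {cm..dm}" by (auto simp: cm_def dm_def)
    obtain e where e: "e > 0" "cball cm e \<subseteq> I" using cm(1) by (meson open_contains_cball open_einterval)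
    obtain f where f: "f > 0" "cball dm f \<subseteq> I" using cm(2) by (meson open_contains_cball open_einterval)
    \<comment> \<open>Enlarged once more, so that \<phi> vanishes at c and d and
      \<open>energy_identity\<close> has no boundary terms.\<close>
    define c d where "c = cm - e" and "d = dm + f"
    have cI: "c \<in> I" using e by (auto simp: c_def dist_real_def intro!: subsetD[OF e(2)])
    have dI: "d \<in> I" using f by (auto simp: d_def dist_real_def intro!: subsetD[OF f(2)])
    have cd: "c < cm" "dm < d" "c \<le> d" using e(1) f(1) cm c0d0(1) by (auto simp: c_def d_def)
    have sub: "{c..d} \<subseteq> I" by (rule einterval_Icc_subset[OF cI dI])
    have supp: "\<phi> x = 0" "\<psi> x = 0" if "x \<in> I" "x \<notin> {cm..dm}" for x using supp1 supp1' that cm1 by blast+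
    have supp': "\<phi> x = 0" "\<psi> x = 0" if "x \<in> I" "x \<notin> {c..d}" for x using supp that cd by auto
    have end0: "\<phi> c = 0" "\<phi> d = 0" using supp cI dI cd by auto
    have sub0: "{c0..d0} \<subseteq> {c..d}" using cm cd by auto
    note E = energy_integrable(1)[OF \<psi>c sub] and N = energy_integrable(2)[OF \<phi>c sub] and V = energy_integrable(3)[OF \<phi>c sub]
    note Ei = energy_integrable(4)[OF \<psi>c sub] and Ni = energy_integrable(5)[OF \<phi>c sub] and Vi = energy_integrable(6)[OF \<phi>c sub]
    have "loc_integrable_on I (\<lambda>x. Wp x * (cmod (\<phi> x))\<^sup>2)"
      by (intro loc_integrable_on_mult Wp_loc continuous_intros \<phi>c)
    note P = loc_integrable_onD(1)[OF this sub] and Pi = loc_integrable_onD(2)[OF this sub]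
    have LE: "integrable \<Lambda> (\<lambda>x. \<omega> x * (cmod (\<psi> x))\<^sup>2)" "energy \<psi> = integral {c..d} (\<lambda>x. \<omega> x * (cmod (\<psi> x))\<^sup>2)"
      unfolding energy_def using supported_integral[OF sub, of "\<lambda>x. \<omega> x * (cmod (\<psi> x))\<^sup>2"] E supp' by auto
    have LN: "integrable \<Lambda> (\<lambda>x. R x * (cmod (\<phi> x))\<^sup>2)" "mass \<phi> = integral {c..d} (\<lambda>x. R x * (cmod (\<phi> x))\<^sup>2)"
      unfolding mass_def using supported_integral[OF sub, of "\<lambda>x. R x * (cmod (\<phi> x))\<^sup>2"] N supp' by auto
    have LP: "integrable \<Lambda> (\<lambda>x. Wp x * (cmod (\<phi> x))\<^sup>2)" "potential \<phi> = integral {c..d} (\<lambda>x. Wp x * (cmod (\<phi> x))\<^sup>2)"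
      unfolding potential_def using supported_integral[OF sub, of "\<lambda>x. Wp x * (cmod (\<phi> x))\<^sup>2"] P supp' by auto
    let ?T = "\<lambda>x. \<omega> x * (cmod (\<psi> x))\<^sup>2 + W x * (cmod (\<phi> x))\<^sup>2"
    have Ti: "?T absolutely_integrable_on {c..d}" by (intro set_integral_add(1) E V)
    have bl: "bounded_linear complex_of_real" by (rule bounded_linear_of_real)
    have Tc: "(\<lambda>x. complex_of_real (?T x)) absolutely_integrable_on {c..d}"
      using absolutely_integrable_linear[OF Ti bl] by (simp add: o_def)
    note prim = energy_identity[OF s]
    have Dai: "(\<lambda>x. complex_of_real (?T x) - R x *\<^sub>R (cnj (\<phi> x) * \<kappa> x)) absolutely_integrable_on {c..d}"
      and Dint: "integral {c..d} (\<lambda>x. complex_of_real (?T x) - R x *\<^sub>R (cnj (\<phi> x) * \<kappa> x)) = 0"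
      using primitive_onD(1,2)[OF prim cd(3) sub] end0 by auto
    have Kai: "(\<lambda>x. R x *\<^sub>R (cnj (\<phi> x) * \<kappa> x)) absolutely_integrable_on {c..d}"
      using set_integral_diff(1)[OF Tc Dai] by simp
    have "integral {c..d} (\<lambda>x. complex_of_real (?T x)) = integral {c..d} (\<lambda>x. R x *\<^sub>R (cnj (\<phi> x) * \<kappa> x))"
      using Dint integral_diff[OF set_lebesgue_integral_eq_integral(1)[OF Tc] set_lebesgue_integral_eq_integral(1)[OF Kai]] by simp
    moreover have "integral {c..d} (\<lambda>x. complex_of_real (?T x)) = complex_of_real (integral {c..d} ?T)"
      using integral_linear[OF set_lebesgue_integral_eq_integral(1)[OF Ti] bl] by (simp add: o_def)
    moreover have "(LINT x|\<Lambda>. R x *\<^sub>R (cnj (\<phi> x) * \<kappa> x)) = integral {c..d} (\<lambda>x. R x *\<^sub>R (cnj (\<phi> x) * \<kappa> x))"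
      by (rule supported_integral(2)[OF sub _ Kai]) (use supp' in auto)
    ultimately have "(LINT x|\<Lambda>. R x *\<^sub>R (cnj (\<phi> x) * \<kappa> x)) = complex_of_real (integral {c..d} ?T)"
      by (simp only:)
    then have form: "Re (LINT x|\<Lambda>. R x *\<^sub>R (cnj (\<phi> x) * \<kappa> x)) = integral {c..d} ?T"
      by (simp only: Re_complex_of_real)
    define m where "m = 1 / (2 * (?w + 1)) * integral {c0..d0} (\<lambda>x. \<omega> x * (cmod (\<psi> x))\<^sup>2) + C * integral {c0..d0} (\<lambda>x. R x * (cmod (\<phi> x))\<^sup>2)"
    have m: "(cmod (\<phi> x))\<^sup>2 \<le> m" if "x \<in> {c0..d0}" for x
      unfolding m_def by (rule C(2)[OF slcD(1)[OF s] \<psi>c that])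
    have m_le: "m \<le> 1 / (2 * (?w + 1)) * energy \<psi> + C * mass \<phi>"
      unfolding m_def LE(2) LN(2) using w C(1) nonneg
      by (intro add_mono mult_left_mono integral_subset_le sub0 energy_integrable \<phi>c \<psi>c sub c0d0(2)) auto
    let ?D = "\<lambda>x. if x \<in> {c0..d0} then \<bar>W x\<bar> * m else 0"
    have Di: "?D integrable_on {c..d}" "integral {c..d} ?D = ?w * m"
    proof -
      have i: "(\<lambda>x. \<bar>W x\<bar> * m) integrable_on {c0..d0}" by (intro integrable_on_mult_left absW)
      have eq: "{c0..d0} \<inter> {c..d} = {c0..d0}" using sub0 by blast
      show "?D integrable_on {c..d}"
        using i by (simp only: integrable_restrict_Int eq)
      have "integral {c..d} ?D = integral ({c0..d0} \<inter> {c..d}) (\<lambda>x. \<bar>W x\<bar> * m)"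
        by (rule integral_restrict_Int)
      then show "integral {c..d} ?D = ?w * m" by (simp only: eq integral_mult_left)
    qed
    have "integral {c..d} (\<lambda>x. ((\<omega> x * (cmod (\<psi> x))\<^sup>2 + Wp x * (cmod (\<phi> x))\<^sup>2) - \<bar>\<mu>\<bar> * (R x * (cmod (\<phi> x))\<^sup>2)) - ?D x) \<le> integral {c..d} ?T"
    proof (rule integral_le)
      show "(\<lambda>x. ((\<omega> x * (cmod (\<psi> x))\<^sup>2 + Wp x * (cmod (\<phi> x))\<^sup>2) - \<bar>\<mu>\<bar> * (R x * (cmod (\<phi> x))\<^sup>2)) - ?D x) integrable_on {c..d}"
        by (intro integrable_diff integrable_add Ei Pi Di integrable_on_mult_right Ni)
      show "?T integrable_on {c..d}" by (intro integrable_add Ei Vi)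
      fix x assume "x \<in> {c..d}"
      have Rn: "0 \<le> R x * (cmod (\<phi> x))\<^sup>2" using nonneg by simp
      show "((\<omega> x * (cmod (\<psi> x))\<^sup>2 + Wp x * (cmod (\<phi> x))\<^sup>2) - \<bar>\<mu>\<bar> * (R x * (cmod (\<phi> x))\<^sup>2)) - ?D x \<le> ?T x"
      proof (cases "x \<in> {c0..d0}")
        case True
        have "\<bar>W x * (cmod (\<phi> x))\<^sup>2\<bar> \<le> \<bar>W x\<bar> * m" using m[OF True] by (simp add: abs_mult mult_left_mono)
        moreover have "0 \<le> \<bar>\<mu>\<bar> * (R x * (cmod (\<phi> x))\<^sup>2)" using Rn by simp
        ultimately show ?thesis using True by (simp add: Wp_def abs_le_iff)
      next
        case False
        have "- \<mu> * (R x * (cmod (\<phi> x))\<^sup>2) \<le> \<bar>\<mu>\<bar> * (R x * (cmod (\<phi> x))\<^sup>2)"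
          using Rn by (intro mult_right_mono) auto
        moreover have "Wp x * (cmod (\<phi> x))\<^sup>2 = W x * (cmod (\<phi> x))\<^sup>2 + - \<mu> * (R x * (cmod (\<phi> x))\<^sup>2)"
          unfolding Wp_def if_not_P[OF False] by (simp add: algebra_simps)
        ultimately show ?thesis unfolding if_not_P[OF False] by linarith
      qed
    qed
    also have "integral {c..d} (\<lambda>x. ((\<omega> x * (cmod (\<psi> x))\<^sup>2 + Wp x * (cmod (\<phi> x))\<^sup>2) - \<bar>\<mu>\<bar> * (R x * (cmod (\<phi> x))\<^sup>2)) - ?D x)
        = energy \<psi> + potential \<phi> - \<bar>\<mu>\<bar> * mass \<phi> - ?w * m"
      unfolding LE(2) LN(2) LP(2)
      by (simp only: integral_diff integral_add integrable_diff integrable_add Ei Pi Di integrable_on_mult_right Ni integral_mult_right)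
    finally have 1: "energy \<psi> + potential \<phi> - \<bar>\<mu>\<bar> * mass \<phi> - ?w * m \<le> Re (LINT x|\<Lambda>. R x *\<^sub>R (cnj (\<phi> x) * \<kappa> x))"
      using form by simp
    have "?w * m \<le> ?w * (1 / (2 * (?w + 1)) * energy \<psi> + C * mass \<phi>)" using m_le w by (intro mult_left_mono)
    also have "\<dots> = (?w / (?w + 1)) * (energy \<psi> / 2) + ?w * C * mass \<phi>" using w by (simp add: field_simps)
    also have "(?w / (?w + 1)) * (energy \<psi> / 2) \<le> 1 * (energy \<psi> / 2)"
      using w quantities_nonneg(1)[of \<psi>] by (intro mult_right_mono) auto
    finally have "?w * m \<le> energy \<psi> / 2 + ?w * C * mass \<phi>" by simp
    with 1 have "energy \<psi> / 2 + potential \<phi> + mass \<phi> \<le> Re (LINT x|\<Lambda>. R x *\<^sub>R (cnj (\<phi> x) * \<kappa> x)) + (?w * C + \<bar>\<mu>\<bar> + 1) * mass \<phi>"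
      by (simp add: algebra_simps)
    then show "integrable \<Lambda> (\<lambda>x. \<omega> x * (cmod (\<psi> x))\<^sup>2) \<and> integrable \<Lambda> (\<lambda>x. R x * (cmod (\<phi> x))\<^sup>2) \<and>
      integrable \<Lambda> (\<lambda>x. Wp x * (cmod (\<phi> x))\<^sup>2) \<and>
      energy \<psi> / 2 + potential \<phi> + mass \<phi> \<le> Re (LINT x|\<Lambda>. R x *\<^sub>R (cnj (\<phi> x) * \<kappa> x)) + (?w * C + \<bar>\<mu>\<bar> + 1) * mass \<phi>"
      using LE LN LP by blast
  qed
qed

text \<open>No convergence of the \<psi>n is available. Integration by parts moves the derivative to
  \<psi>, whose density is locally integrable, so convergence of the \<phi>n suffices for that of
  \<integral> \<omega> cnj \<psi> \<psi>n. Young's inequality does the rest.\<close>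

lemma energy_lsc:
  assumes s: "slc \<phi> \<psi> \<kappa>" and n: "\<And>n. slc (\<phi>n n) (\<psi>n n) (\<kappa>n n)"
    and lim: "\<And>x. x \<in> {c..d} \<Longrightarrow> (\<lambda>n. \<phi>n n x) \<longlonglongrightarrow> \<phi> x" and K: "\<And>n x. x \<in> {c..d} \<Longrightarrow> cmod (\<phi>n n x) \<le> K"
    and B: "\<And>n. integral {c..d} (\<lambda>x. \<omega> x * (cmod (\<psi>n n x))\<^sup>2) \<le> B"
    and cd: "c \<le> d" "{c..d} \<subseteq> I"
  shows "integral {c..d} (\<lambda>x. \<omega> x * (cmod (\<psi> x))\<^sup>2) \<le> B"
proof -
  \<comment> \<open>The density of cnj \<psi>.\<close>
  define \<xi> where "\<xi> x = cnj (W x *\<^sub>R \<phi> x - R x *\<^sub>R \<kappa> x)" for x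
  let ?X = "integral {c..d} (\<lambda>x. \<omega> x * (cmod (\<psi> x))\<^sup>2)"
  have prim: "primitive_on I (\<lambda>x. cnj (\<psi> x) * f x) (\<lambda>x. cnj (\<psi> x) * (\<omega> x *\<^sub>R g x) + \<xi> x * f x)"
    if "primitive_on I f (\<lambda>x. \<omega> x *\<^sub>R g x)" for f g
    unfolding \<xi>_def
    by (intro primitive_on_bilinear[OF bounded_bilinear_mult] primitive_on_linear[OF bounded_linear_cnj] slcD(2)[OF s] that)
  have \<xi>loc: "loc_integrable_on I \<xi>"
    using primitive_on_loc_integrable[OF primitive_on_linear[OF bounded_linear_cnj slcD(2)[OF s]]] by (simp add: \<xi>_def[abs_def])
  have \<xi>f: "(\<lambda>x. \<xi> x * f x) absolutely_integrable_on {c..d}" if "continuous_on I f" for f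
    by (rule loc_integrable_onD(1)[OF loc_integrable_on_mult[OF \<xi>loc that] cd(2)])
  have parts: "integral {c..d} (\<lambda>x. cnj (\<psi> x) * (\<omega> x *\<^sub>R g x)) = cnj (\<psi> d) * f d - cnj (\<psi> c) * f c - integral {c..d} (\<lambda>x. \<xi> x * f x)"
    and parts_i: "(\<lambda>x. cnj (\<psi> x) * (\<omega> x *\<^sub>R g x)) integrable_on {c..d}"
    if f: "primitive_on I f (\<lambda>x. \<omega> x *\<^sub>R g x)" for f g
  proof -
    have fc: "continuous_on I f" by (rule primitive_on_continuous[OF f]) simp
    note p = primitive_onD[OF prim[OF f] cd]
    note q = set_lebesgue_integral_eq_integral(1)[OF \<xi>f[OF fc]]
    show i: "(\<lambda>x. cnj (\<psi> x) * (\<omega> x *\<^sub>R g x)) integrable_on {c..d}"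
      using integrable_diff[OF p(3) q] by simp
    show "integral {c..d} (\<lambda>x. cnj (\<psi> x) * (\<omega> x *\<^sub>R g x)) = cnj (\<psi> d) * f d - cnj (\<psi> c) * f c - integral {c..d} (\<lambda>x. \<xi> x * f x)"
      using p(2) integral_add[OF i q] by simp
  qed
  have lim\<xi>: "(\<lambda>n. integral {c..d} (\<lambda>x. \<xi> x * \<phi>n n x)) \<longlonglongrightarrow> integral {c..d} (\<lambda>x. \<xi> x * \<phi> x)"
  proof (rule dominated_convergence(2))
    show "(\<lambda>x. \<xi> x * \<phi>n n x) integrable_on {c..d}" for n
      by (rule set_lebesgue_integral_eq_integral(1)[OF \<xi>f[OF slcD(3)[OF n]]])
    show "(\<lambda>x. norm (\<xi> x) * K) integrable_on {c..d}"
      by (intro integrable_on_mult_left loc_integrable_onD(2)[OF loc_integrable_on_norm[OF \<xi>loc] cd(2)])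
    show "norm (\<xi> x * \<phi>n n x) \<le> norm (\<xi> x) * K" if "x \<in> {c..d}" for n x
      using K[OF that] by (simp add: norm_mult mult_left_mono)
    show "(\<lambda>n. \<xi> x * \<phi>n n x) \<longlonglongrightarrow> \<xi> x * \<phi> x" if "x \<in> {c..d}" for x
      by (intro tendsto_intros lim that)
  qed
  have "(\<lambda>n. integral {c..d} (\<lambda>x. cnj (\<psi> x) * (\<omega> x *\<^sub>R \<psi>n n x))) \<longlonglongrightarrow> integral {c..d} (\<lambda>x. cnj (\<psi> x) * (\<omega> x *\<^sub>R \<psi> x))"
    unfolding parts[OF slcD(1)[OF n]] parts[OF slcD(1)[OF s]]
    by (intro tendsto_intros lim\<xi> lim) (use cd in auto)
  moreover have "integral {c..d} (\<lambda>x. cnj (\<psi> x) * (\<omega> x *\<^sub>R \<psi> x)) = of_real ?X"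
  proof -
    have "(\<lambda>x. cnj (\<psi> x) * (\<omega> x *\<^sub>R \<psi> x)) = (\<lambda>x. complex_of_real (\<omega> x * (cmod (\<psi> x))\<^sup>2))"
      by (simp add: fun_eq_iff scaleR_conv_of_real complex_norm_square algebra_simps del: of_real_power)
    moreover have "bounded_linear complex_of_real" by (rule bounded_linear_of_real)
    ultimately show ?thesis
      using integral_linear[OF energy_integrable(4)[OF slcD(4)[OF s] cd(2)], of complex_of_real] by (simp add: o_def)
  qed
  ultimately have "(\<lambda>n. Re (integral {c..d} (\<lambda>x. cnj (\<psi> x) * (\<omega> x *\<^sub>R \<psi>n n x)))) \<longlonglongrightarrow> ?X"
    using tendsto_Re by fastforce
  \<comment> \<open>By Young's inequality; the limit then gives X \<le> X/2 + B/2 for the energy X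
    of \<psi>.\<close>
  moreover have "Re (integral {c..d} (\<lambda>x. cnj (\<psi> x) * (\<omega> x *\<^sub>R \<psi>n n x))) \<le> ?X / 2 + B / 2" for n
  proof -
    note i1 = energy_integrable(4)[OF slcD(4)[OF s] cd(2)] and i2 = energy_integrable(4)[OF slcD(4)[OF n[of n]] cd(2)]
    have "Re (integral {c..d} (\<lambda>x. cnj (\<psi> x) * (\<omega> x *\<^sub>R \<psi>n n x))) \<le> cmod (integral {c..d} (\<lambda>x. cnj (\<psi> x) * (\<omega> x *\<^sub>R \<psi>n n x)))"
      by (rule complex_Re_le_cmod)
    also have "\<dots> \<le> integral {c..d} (\<lambda>x. \<omega> x * (cmod (\<psi> x))\<^sup>2 / 2 + \<omega> x * (cmod (\<psi>n n x))\<^sup>2 / 2)"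
    proof (rule Henstock_Kurzweil_Integration.integral_norm_bound_integral[OF parts_i[OF slcD(1)[OF n]]])
      show "(\<lambda>x. \<omega> x * (cmod (\<psi> x))\<^sup>2 / 2 + \<omega> x * (cmod (\<psi>n n x))\<^sup>2 / 2) integrable_on {c..d}"
        by (intro integrable_add integrable_on_divide i1 i2)
      fix x
      have "cmod (\<psi> x) * cmod (\<psi>n n x) \<le> (cmod (\<psi> x))\<^sup>2 / 2 + (cmod (\<psi>n n x))\<^sup>2 / 2"
        using sum_squares_bound[of "cmod (\<psi> x)" "cmod (\<psi>n n x)"] by simp
      from mult_left_mono[OF this nonneg(1)[of x]]
      show "norm (cnj (\<psi> x) * (\<omega> x *\<^sub>R \<psi>n n x)) \<le> \<omega> x * (cmod (\<psi> x))\<^sup>2 / 2 + \<omega> x * (cmod (\<psi>n n x))\<^sup>2 / 2"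
        using nonneg(1)[of x] by (simp add: norm_mult algebra_simps)
    qed
    also have "\<dots> = ?X / 2 + integral {c..d} (\<lambda>x. \<omega> x * (cmod (\<psi>n n x))\<^sup>2) / 2"
      by (simp only: integral_add integrable_on_divide i1 i2 integral_divide)
    finally show ?thesis using B[of n] by simp
  qed
  ultimately have "?X \<le> ?X / 2 + B / 2" by (intro LIMSEQ_le_const2) auto
  then show ?thesis by simp
qed

text \<open>The Wronskian is shown to be small only at some points near each end. This suffices
  because the integrand is integrable over (a,b), so its integral is the limit along any exhausting
  sequence of intervals, in particular one ending at such points.\<close>

lemma finite_energy_symmetric:
  assumes 1: "slc \<phi>1 \<psi>1 \<kappa>1" and 2: "slc \<phi>2 \<psi>2 \<kappa>2"
    and E: "integrable \<Lambda> (\<lambda>x. \<omega> x * (cmod (\<psi>1 x))\<^sup>2)" "integrable \<Lambda> (\<lambda>x. \<omega> x * (cmod (\<psi>2 x))\<^sup>2)"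
    and G: "integrable \<Lambda> (\<lambda>x. R x *\<^sub>R (cnj (\<kappa>1 x) * \<phi>2 x - cnj (\<phi>1 x) * \<kappa>2 x))"
  shows "(LINT x|\<Lambda>. R x *\<^sub>R (cnj (\<kappa>1 x) * \<phi>2 x - cnj (\<phi>1 x) * \<kappa>2 x)) = 0"
proof -
  define w where "w x = cnj (\<phi>1 x) * \<psi>2 x - cnj (\<psi>1 x) * \<phi>2 x" for x
  define g where "g x = R x *\<^sub>R (cnj (\<kappa>1 x) * \<phi>2 x - cnj (\<phi>1 x) * \<kappa>2 x)" for x
  have w: "primitive_on I w g" unfolding w_def g_def by (rule lagrange_identity[OF 1 2])
  have gi: "integrable \<Lambda> g" using G by (simp add: g_def[abs_def])
  define B where "B = max (energy \<psi>1) (energy \<psi>2)"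
  have bound: "integral {c..d} (\<lambda>x. \<omega> x * (cmod (\<psi> x))\<^sup>2) \<le> energy \<psi>"
    if \<psi>: "integrable \<Lambda> (\<lambda>x. \<omega> x * (cmod (\<psi> x))\<^sup>2)" "continuous_on I \<psi>" and cd: "{c..d} \<subseteq> I" for \<psi> c d
  proof -
    let ?f = "\<lambda>x. indicator {c..d} x *\<^sub>R (\<omega> x * (cmod (\<psi> x))\<^sup>2)"
    have eq: "integral {c..d} ?f = integral {c..d} (\<lambda>x. \<omega> x * (cmod (\<psi> x))\<^sup>2)" by (rule integral_cong) simp
    have ai: "?f absolutely_integrable_on {c..d}"
      by (rule absolutely_integrable_spike[OF energy_integrable(1)[OF \<psi>(2) cd], of "{}"]) auto
    have "integral {c..d} ?f = (LINT x|\<Lambda>. ?f x)" "integrable \<Lambda> ?f"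
      using supported_integral[OF cd, of ?f] ai by auto
    moreover have "(LINT x|\<Lambda>. ?f x) \<le> energy \<psi>"
      unfolding energy_def by (rule integral_mono[OF \<open>integrable \<Lambda> ?f\<close> \<psi>(1)]) (auto simp: indicator_def nonneg)
    ultimately show ?thesis using eq by simp
  qed
  have le: "cmod (w x) \<le> cmod (\<phi>1 x) * cmod (\<psi>2 x) + cmod (\<psi>1 x) * cmod (\<phi>2 x)" for x
    unfolding w_def by (rule order_trans[OF norm_triangle_ineq4]) (simp add: norm_mult)
  have right: "\<exists>x\<in>I. c \<le> x \<and> cmod (w x) < \<epsilon>" if cI: "c \<in> I" and eps: "\<epsilon> > 0" for c \<epsilon>
  proof -
    obtain x where "x \<in> I" "c \<le> x" "cmod (\<phi>1 x) * cmod (\<psi>2 x) + cmod (\<psi>1 x) * cmod (\<phi>2 x) < \<epsilon>"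
    proof (rule wronskian_liminf_right[OF slcD(1)[OF 1] slcD(1)[OF 2] slcD(4)[OF 1] slcD(4)[OF 2] \<omega>_loc pos(1) cI _ _ _ eps, of B])
      show "integral {c..x} (\<lambda>x. \<omega> x * (cmod (\<psi>1 x))\<^sup>2) \<le> B" if "x \<in> I" for x
        using bound[OF E(1) slcD(4)[OF 1] einterval_Icc_subset[OF \<open>c \<in> I\<close> that]] by (simp add: B_def)
      show "integral {c..x} (\<lambda>x. \<omega> x * (cmod (\<psi>2 x))\<^sup>2) \<le> B" if "x \<in> I" for x
        using bound[OF E(2) slcD(4)[OF 2] einterval_Icc_subset[OF \<open>c \<in> I\<close> that]] by (simp add: B_def)
    qed (use right_inf[OF cI] in blast)+
    then show ?thesis using le[of x] by (intro bexI[of _ x]) auto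
  qed
  have left: "\<exists>x\<in>I. x \<le> c \<and> cmod (w x) < \<epsilon>" if cI: "c \<in> I" and eps: "\<epsilon> > 0" for c \<epsilon>
  proof -
    obtain x where "x \<in> I" "x \<le> c" "cmod (\<phi>1 x) * cmod (\<psi>2 x) + cmod (\<psi>1 x) * cmod (\<phi>2 x) < \<epsilon>"
    proof (rule wronskian_liminf_left[OF slcD(1)[OF 1] slcD(1)[OF 2] slcD(4)[OF 1] slcD(4)[OF 2] \<omega>_loc pos(1) cI _ _ _ eps, of B])
      show "integral {x..c} (\<lambda>x. \<omega> x * (cmod (\<psi>1 x))\<^sup>2) \<le> B" if "x \<in> I" for x
        using bound[OF E(1) slcD(4)[OF 1] einterval_Icc_subset[OF that \<open>c \<in> I\<close>]] by (simp add: B_def)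
      show "integral {x..c} (\<lambda>x. \<omega> x * (cmod (\<psi>2 x))\<^sup>2) \<le> B" if "x \<in> I" for x
        using bound[OF E(2) slcD(4)[OF 2] einterval_Icc_subset[OF that \<open>c \<in> I\<close>]] by (simp add: B_def)
    qed (use left_inf[OF cI] in blast)+
    then show ?thesis using le[of x] by (intro bexI[of _ x]) auto
  qed
  obtain U L where ul: "I = (\<Union>i. {L i .. U i :: real})" "\<And>i::nat. L i < U i" "incseq U" "decseq L"
    by (rule einterval_Icc_approximation[OF ab]) (rule that; assumption)
  have mem: "L i \<in> I" "U i \<in> I" for i using ul(2)[of i] unfolding ul(1) by (auto intro!: exI[of _ i])
  \<comment> \<open>To the left of L i, so that the intervals exhaust (a,b), and with a Wronskian
    below 1/(i+1), so that the boundary terms tend to 0.\<close>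
  have "\<forall>i. \<exists>x\<in>I. x \<le> L i \<and> cmod (w x) < inverse (real (Suc i))" using left mem by simp
  then obtain X where X: "\<And>i. X i \<in> I" "\<And>i. X i \<le> L i" "\<And>i. cmod (w (X i)) < inverse (real (Suc i))" by metis
  have "\<forall>i. \<exists>x\<in>I. U i \<le> x \<and> cmod (w x) < inverse (real (Suc i))" using right mem by simp
  then obtain Y where Y: "\<And>i. Y i \<in> I" "\<And>i. U i \<le> Y i" "\<And>i. cmod (w (Y i)) < inverse (real (Suc i))" by metis
  have XY: "X i \<le> Y i" for i using X(2)[of i] Y(2)[of i] ul(2)[of i] by linarith
  have sub: "{X i..Y i} \<subseteq> I" for i by (rule einterval_Icc_subset[OF X(1) Y(1)])
  let ?g = "\<lambda>i x. indicator {X i..Y i} x *\<^sub>R g x"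
  have int: "(LINT x|\<Lambda>. ?g i x) = w (Y i) - w (X i)" for i
  proof -
    have ai: "?g i absolutely_integrable_on {X i..Y i}"
      by (rule absolutely_integrable_spike[OF primitive_onD(1)[OF w XY sub], of "{}"]) auto
    have "(LINT x|\<Lambda>. ?g i x) = integral {X i..Y i} (?g i)"
      by (rule supported_integral(2)[OF sub _ ai]) simp
    also have "\<dots> = integral {X i..Y i} g" by (rule integral_cong) simp
    finally show ?thesis using primitive_onD(2)[OF w XY sub] by simp
  qed
  have "(\<lambda>i. LINT x|\<Lambda>. ?g i x) \<longlonglongrightarrow> (LINT x|\<Lambda>. g x)"
  proof (rule integral_dominated_convergence)
    show "g \<in> borel_measurable \<Lambda>" using gi by simp
    show "?g i \<in> borel_measurable \<Lambda>" for i
    proof -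
      have "{X i..Y i} \<inter> space \<Lambda> \<in> sets \<Lambda>" by (simp add: sets_restrict_space_iff)
      then have "(indicator {X i..Y i} :: real \<Rightarrow> real) \<in> borel_measurable \<Lambda>" by (rule borel_measurable_indicator_iff[THEN iffD2])
      then show ?thesis using gi by (intro borel_measurable_scaleR) auto
    qed
    show "integrable \<Lambda> (\<lambda>x. norm (g x))" using gi by simp
    show "AE x in \<Lambda>. norm (?g i x) \<le> norm (g x)" for i by (rule AE_I2) (simp add: indicator_def)
    show "AE x in \<Lambda>. (\<lambda>i. ?g i x) \<longlonglongrightarrow> g x"
    proof (rule AE_I2)
      fix x assume "x \<in> space \<Lambda>"
      then have "x \<in> I" by simp
      then obtain i where i: "x \<in> {L i..U i}" unfolding ul(1) by blast
      have "x \<in> {X j..Y j}" if "i \<le> j" for j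
        using i X(2)[of j] Y(2)[of j] incseqD[OF ul(3) that] decseqD[OF ul(4) that] by auto
      then have "eventually (\<lambda>j. ?g j x = g x) sequentially"
        unfolding eventually_sequentially by (intro exI[of _ i]) simp
      then show "(\<lambda>i. ?g i x) \<longlonglongrightarrow> g x" by (rule tendsto_eventually)
    qed
  qed
  then have "(\<lambda>i. w (Y i) - w (X i)) \<longlonglongrightarrow> (LINT x|\<Lambda>. g x)" by (simp only: int)
  moreover have "(\<lambda>i. w (Y i)) \<longlonglongrightarrow> 0" "(\<lambda>i. w (X i)) \<longlonglongrightarrow> 0"
    using X(3) Y(3) less_imp_le
    by (intro Lim_null_comparison[OF _ LIMSEQ_inverse_real_of_nat] always_eventually allI; blast)+
  then have "(\<lambda>i. w (Y i) - w (X i)) \<longlonglongrightarrow> 0 - 0" by (rule tendsto_diff)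
  ultimately have "(LINT x|\<Lambda>. g x) = 0" using LIMSEQ_unique by fastforce
  then show ?thesis by (simp add: g_def)
qed

end

section \<open>The Friedrichs extension of a semibounded operator\<close>

text \<open>Hermitian forms on spaces of functions, not of classes: the form may vanish on nonzero
  functions, so only semidefiniteness can be asked. Instances are the inner product on
  \<open>L2_fun\<close> and the shifted form \<open>tC\<close>.\<close>

locale pos_form =
  fixes D :: "('a \<Rightarrow> complex) set" and B :: "('a \<Rightarrow> complex) \<Rightarrow> ('a \<Rightarrow> complex) \<Rightarrow> complex"
  assumes closed: "f \<in> D \<Longrightarrow> g \<in> D \<Longrightarrow> (\<lambda>x. c * f x + g x) \<in> D"
    and lin: "h \<in> D \<Longrightarrow> f \<in> D \<Longrightarrow> g \<in> D \<Longrightarrow> B h (\<lambda>x. c * f x + g x) = c * B h f + B h g"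
    and herm: "f \<in> D \<Longrightarrow> g \<in> D \<Longrightarrow> B g f = cnj (B f g)"
    and pos: "f \<in> D \<Longrightarrow> 0 \<le> Re (B f f)"
begin

definition q :: "('a \<Rightarrow> complex) \<Rightarrow> real" where "q f = Re (B f f)"

lemma q_nonneg: "f \<in> D \<Longrightarrow> 0 \<le> q f" using pos by (simp add: q_def)

lemma B_self: "f \<in> D \<Longrightarrow> B f f = of_real (q f)"
  using herm[of f f] by (simp add: complex_eq_iff q_def)

lemma lin_left: "h \<in> D \<Longrightarrow> f \<in> D \<Longrightarrow> g \<in> D \<Longrightarrow> B (\<lambda>x. c * f x + g x) h = cnj c * B f h + B g h"
  using herm[of h "\<lambda>x. c * f x + g x"] lin[of h f g c] closed[of f g c] herm[of h f] herm[of h g] by simp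

lemma diff_closed: "f \<in> D \<Longrightarrow> g \<in> D \<Longrightarrow> (\<lambda>x. f x - g x) \<in> D"
  using closed[of g f "-1"] by simp

lemma lin_diff: "h \<in> D \<Longrightarrow> f \<in> D \<Longrightarrow> g \<in> D \<Longrightarrow> B h (\<lambda>x. f x - g x) = B h f - B h g"
  using lin[of h g f "-1"] by simp

lemma zero_closed: "f \<in> D \<Longrightarrow> (\<lambda>x. 0) \<in> D"
  using diff_closed[of f f] by simp

lemma lin_scale: "h \<in> D \<Longrightarrow> f \<in> D \<Longrightarrow> B h (\<lambda>x. c * f x) = c * B h f"
  using lin[of h f "\<lambda>x. 0" c] zero_closed[of f] lin_diff[of h f f] by simp

lemma scale_closed: "f \<in> D \<Longrightarrow> (\<lambda>x. c * f x) \<in> D"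
  using closed[of f "\<lambda>x. 0" c] zero_closed[of f] by simp

lemma expand:
  assumes "f \<in> D" "g \<in> D"
  shows "q (\<lambda>x. c * f x + g x) = (cmod c)\<^sup>2 * q f + 2 * Re (c * B g f) + q g"
proof -
  have "B (\<lambda>x. c * f x + g x) (\<lambda>x. c * f x + g x) = cnj c * (c * B f f + B f g) + (c * B g f + B g g)"
    using assms by (simp add: lin_left lin closed)
  also have "B f g = cnj (B g f)" using herm[OF assms(2,1)] .
  also have "cnj c * (c * B f f + cnj (B g f)) + (c * B g f + B g g)
    = of_real ((cmod c)\<^sup>2 * q f) + (cnj (c * B g f) + c * B g f) + of_real (q g)"
    using assms by (simp add: B_self complex_norm_square algebra_simps del: of_real_power)
  finally show ?thesis unfolding q_def[of "\<lambda>x. c * f x + g x"] by simp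
qed

lemma q_diff: "f \<in> D \<Longrightarrow> g \<in> D \<Longrightarrow> q (\<lambda>x. f x - g x) = q g - 2 * Re (B f g) + q f"
  using expand[of g f "-1"] by simp

text \<open>Written with the midpoint, which stays in D: this is how a minimizing sequence is seen
  to be Cauchy.\<close>

lemma parallelogram:
  assumes "f \<in> D" "g \<in> D"
  shows "q (\<lambda>x. f x - g x) = 2 * q f + 2 * q g - 4 * q (\<lambda>x. (1/2) * (1 * f x + g x))"
proof -
  have s: "(\<lambda>x. 1 * f x + g x) \<in> D" by (rule closed[OF assms])
  have "q (\<lambda>x. (1/2) * (1 * f x + g x)) = (1/4) * q (\<lambda>x. 1 * f x + g x)"
    using expand[OF s zero_closed[OF s], of "1/2"] lin_scale[OF zero_closed[OF s] s, of 0]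
      herm[OF s zero_closed[OF s]] lin_scale[OF s s, of 0] by (simp add: q_def power2_eq_square)
  then show ?thesis using expand[OF assms, of 1] q_diff[OF assms] herm[OF assms] by simp
qed

lemma cauchy_schwarz:
  assumes "f \<in> D" "g \<in> D"
  shows "(cmod (B f g))\<^sup>2 \<le> q f * q g"
proof (rule quadratic_nonneg_discriminant)
  define z where "z = B f g"
  \<comment> \<open>A phase that makes the product with B f g real and nonnegative; it is 0 when B f
    g = 0, hence only cmod e \<le> 1.\<close>
  obtain e where e: "e * z = of_real (cmod z)" "cmod e \<le> 1"
  proof (cases "z = 0")
    case True then show thesis using that[of 0] by simp
  next
    case False
    have "cnj z / of_real (cmod z) * z = of_real (cmod z)"
      using False complex_norm_square[of z] by (simp add: field_simps power2_eq_square)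
    then show thesis using that[of "cnj z / of_real (cmod z)"] False by (simp add: norm_divide)
  qed
  show "0 \<le> q f" by (rule q_nonneg[OF assms(1)])
  fix t :: real
  have eg: "(\<lambda>x. (- e) * g x) \<in> D" by (rule scale_closed[OF assms(2)])
  have "0 \<le> q (\<lambda>x. of_real t * f x + (- e) * g x)" by (rule q_nonneg[OF closed[OF assms(1) eg]])
  also have "\<dots> = t\<^sup>2 * q f + 2 * Re (of_real t * B (\<lambda>x. (- e) * g x) f) + q (\<lambda>x. (- e) * g x)"
    using expand[OF assms(1) eg, of "of_real t"] by simp
  also have "B (\<lambda>x. (- e) * g x) f = - cnj (e * z)"
    using herm[OF assms(1) eg] lin_scale[OF assms, of "- e"] by (simp add: z_def)
  also have "q (\<lambda>x. (- e) * g x) = (cmod e)\<^sup>2 * q g"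
    using expand[OF assms(2) zero_closed[OF assms(2)], of "- e"] lin_scale[OF assms(2,2), of 0]
      herm[OF assms(2) zero_closed[OF assms(2)]] lin_scale[OF zero_closed[OF assms(2)] assms(2), of 0]
    by (simp add: q_def)
  also have "(cmod e)\<^sup>2 * q g \<le> 1 * q g"
    using e(2) q_nonneg[OF assms(2)] by (intro mult_right_mono) (simp_all add: abs_square_le_1)
  finally show "0 \<le> q f * t\<^sup>2 - 2 * cmod (B f g) * t + q g"
    unfolding e(1) by (simp add: z_def algebra_simps)
qed

end

section \<open>Square integrable functions and their classes\<close>

lemma L2_fun_bounded:
  fixes h :: "'a \<Rightarrow> 'b::{banach, second_countable_topology}"
  assumes f: "f \<in> L2_fun M" and g: "g \<in> L2_fun M" and h: "h \<in> borel_measurable M"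
    and le: "\<And>x. norm (h x) \<le> K * ((cmod (f x))\<^sup>2 + (cmod (g x))\<^sup>2)"
  shows "integrable M h"
proof (rule Bochner_Integration.integrable_bound[OF _ h])
  show "integrable M (\<lambda>x. K * ((cmod (f x))\<^sup>2 + (cmod (g x))\<^sup>2))"
    using f g by (auto simp: L2_fun_def)
  show "AE x in M. norm (h x) \<le> norm (K * ((cmod (f x))\<^sup>2 + (cmod (g x))\<^sup>2))"
    using le by (intro AE_I2) (simp add: order_trans[OF _ abs_ge_self])
qed

lemma borel_measurable_cnj:
  "f \<in> borel_measurable M \<Longrightarrow> (\<lambda>x. cnj (f x)) \<in> borel_measurable M"
  by (rule borel_measurable_continuous_on[where f = cnj]) (intro continuous_intros)

lemma L2_inner_integrable:
  assumes "f \<in> L2_fun M" "g \<in> L2_fun M"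
  shows "integrable M (\<lambda>x. cnj (f x) * g x)"
proof (rule L2_fun_bounded[OF assms, of _ 1])
  show "(\<lambda>x. cnj (f x) * g x) \<in> borel_measurable M"
    using assms by (auto simp: L2_fun_def intro!: borel_measurable_times borel_measurable_cnj)
  fix x
  have "2 * cmod (f x) * cmod (g x) \<le> (cmod (f x))\<^sup>2 + (cmod (g x))\<^sup>2" by (rule sum_squares_bound)
  moreover have "0 \<le> cmod (f x) * cmod (g x)" by simp
  ultimately have "cmod (f x) * cmod (g x) \<le> (cmod (f x))\<^sup>2 + (cmod (g x))\<^sup>2" by linarith
  then show "norm (cnj (f x) * g x) \<le> 1 * ((cmod (f x))\<^sup>2 + (cmod (g x))\<^sup>2)" by (simp add: norm_mult)
qed

lemma L2_fun_lincomb: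
  assumes "f \<in> L2_fun M" "g \<in> L2_fun M"
  shows "(\<lambda>x. c * f x + g x) \<in> L2_fun M"
proof -
  have m: "(\<lambda>x. c * f x + g x) \<in> borel_measurable M"
    using assms unfolding L2_fun_def by (auto intro!: borel_measurable_add borel_measurable_times)
  have "integrable M (\<lambda>x. (cmod (c * f x + g x))\<^sup>2)"
  proof (rule L2_fun_bounded[OF assms, of _ "2 * max 1 ((cmod c)\<^sup>2)"])
    show "(\<lambda>x. (cmod (c * f x + g x))\<^sup>2) \<in> borel_measurable M" using m by simp
    fix x
    have "(cmod (c * f x + g x))\<^sup>2 \<le> (cmod (c * f x) + cmod (g x))\<^sup>2" by (intro power_mono norm_triangle_ineq) simp
    also have "\<dots> \<le> 2 * (cmod (c * f x))\<^sup>2 + 2 * (cmod (g x))\<^sup>2"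
      using sum_squares_bound[of "cmod (c * f x)" "cmod (g x)"] by (simp add: power2_sum)
    also have "\<dots> = 2 * ((cmod c)\<^sup>2 * (cmod (f x))\<^sup>2) + 2 * (1 * (cmod (g x))\<^sup>2)" by (simp add: norm_mult power_mult_distrib)
    also have "\<dots> \<le> 2 * (max 1 ((cmod c)\<^sup>2) * (cmod (f x))\<^sup>2) + 2 * (max 1 ((cmod c)\<^sup>2) * (cmod (g x))\<^sup>2)"
      by (intro add_mono mult_left_mono mult_right_mono) auto
    finally show "norm ((cmod (c * f x + g x))\<^sup>2) \<le> 2 * max 1 ((cmod c)\<^sup>2) * ((cmod (f x))\<^sup>2 + (cmod (g x))\<^sup>2)"
      by (simp add: algebra_simps)
  qed
  with m show ?thesis by (simp add: L2_fun_def)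
qed

lemma L2_inner_self: "Re (L2_inner M f f) = (LINT x|M. (cmod (f x))\<^sup>2)"
proof -
  have "L2_inner M f f = (LINT x|M. complex_of_real ((cmod (f x))\<^sup>2))"
    unfolding L2_inner_def by (simp add: complex_norm_square mult.commute del: of_real_power)
  then show ?thesis by (simp add: integral_complex_of_real del: of_real_power)
qed

lemma L2_inner_pos_form: "pos_form (L2_fun M) (L2_inner M)"
proof
  fix f g h :: "'a \<Rightarrow> complex" and c
  show "(\<lambda>x. c * f x + g x) \<in> L2_fun M" if "f \<in> L2_fun M" "g \<in> L2_fun M" using L2_fun_lincomb that .
  show "L2_inner M h (\<lambda>x. c * f x + g x) = c * L2_inner M h f + L2_inner M h g"
    if "h \<in> L2_fun M" "f \<in> L2_fun M" "g \<in> L2_fun M"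
  proof -
    have "L2_inner M h (\<lambda>x. c * f x + g x) = (LINT x|M. c * (cnj (h x) * f x) + cnj (h x) * g x)"
      unfolding L2_inner_def by (simp add: algebra_simps)
    then show ?thesis unfolding L2_inner_def using L2_inner_integrable that by (subst (asm) Bochner_Integration.integral_add) auto
  qed
  show "L2_inner M g f = cnj (L2_inner M f g)"
    unfolding L2_inner_def by (subst Bochner_Integration.integral_cnj[symmetric]) (simp add: mult.commute)
  show "0 \<le> Re (L2_inner M f f)" unfolding L2_inner_self by simp
qed

lemma L2_inner_cong_AE:
  assumes "AE x in M. g x = h x" "f \<in> borel_measurable M" "g \<in> borel_measurable M" "h \<in> borel_measurable M"
  shows "L2_inner M f g = L2_inner M f h" "L2_inner M g f = L2_inner M h f"
  unfolding L2_inner_def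
  by (rule integral_cong_AE; use assms in \<open>auto intro!: borel_measurable_times borel_measurable_cnj\<close>)+

lemma L2_class_eq_iff:
  assumes "f \<in> L2_fun M"
  shows "L2_class M f = L2_class M g \<longleftrightarrow> (AE x in M. f x = g x)"
proof
  assume "L2_class M f = L2_class M g"
  moreover have "f \<in> L2_class M f" using assms by (simp add: L2_class_def)
  ultimately have "f \<in> L2_class M g" by simp
  then show "AE x in M. f x = g x" by (simp add: L2_class_def)
next
  assume *: "AE x in M. f x = g x"
  have "(AE x in M. h x = f x) \<longleftrightarrow> (AE x in M. h x = g x)" for h
  proof (rule eventually_subst)
    show "AE x in M. (h x = f x) = (h x = g x)" using * by eventually_elim simp
  qed
  then show "L2_class M f = L2_class M g" by (simp add: L2_class_def)
qed

text \<open>\<open>T\<close> stands for T_0 and \<open>Tm\<close> for the maximal operator;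
  \<open>green\<close> and \<open>adjoint\<close> together say that T_0^* = T_max, up to null sets.
  The constant C makes the shifted form dominate the squared norm, and \<open>complete\<close>
  supplies Hilbert space limits for the sequences that are Cauchy in that form.\<close>

locale semibounded_operator =
  fixes M :: "'a measure" and D Dm :: "('a \<Rightarrow> complex) set"
    and T Tm :: "('a \<Rightarrow> complex) \<Rightarrow> 'a \<Rightarrow> complex" and C :: real
  assumes D_ne: "D \<noteq> {}" and D_L2: "D \<subseteq> L2_fun M" and T_L2: "f \<in> D \<Longrightarrow> T f \<in> L2_fun M"
    and Dm_L2: "Dm \<subseteq> L2_fun M" and Tm_L2: "f \<in> Dm \<Longrightarrow> Tm f \<in> L2_fun M"
    and D_lin: "f \<in> D \<Longrightarrow> g \<in> D \<Longrightarrow> (\<lambda>x. c * f x + g x) \<in> D"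
    and T_lin: "f \<in> D \<Longrightarrow> g \<in> D \<Longrightarrow> AE x in M. T (\<lambda>x. c * f x + g x) x = c * T f x + T g x"
    and T_sym: "f \<in> D \<Longrightarrow> g \<in> D \<Longrightarrow> L2_inner M f (T g) = L2_inner M (T f) g"
    and bound: "f \<in> D \<Longrightarrow> Re (L2_inner M f f) \<le> Re (L2_inner M f (T f)) + C * Re (L2_inner M f f)"
    and complete: "\<And>\<phi>. (\<And>n. \<phi> n \<in> D) \<Longrightarrow>
      (\<And>\<epsilon>. \<epsilon> > 0 \<Longrightarrow> \<exists>N. \<forall>m\<ge>N. \<forall>n\<ge>N. Re (L2_inner M (\<lambda>x. \<phi> m x - \<phi> n x) (T (\<lambda>x. \<phi> m x - \<phi> n x)))
          + C * Re (L2_inner M (\<lambda>x. \<phi> m x - \<phi> n x) (\<lambda>x. \<phi> m x - \<phi> n x)) < \<epsilon>) \<Longrightarrow>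
      \<exists>u\<in>L2_fun M. (\<lambda>n. LINT x|M. (cmod (\<phi> n x - u x))\<^sup>2) \<longlonglongrightarrow> 0"
    and green: "f \<in> D \<Longrightarrow> g \<in> Dm \<Longrightarrow> L2_inner M (T f) g = L2_inner M f (Tm g)"
    and adjoint: "u \<in> L2_fun M \<Longrightarrow> h \<in> L2_fun M \<Longrightarrow> (\<And>f. f \<in> D \<Longrightarrow> L2_inner M (T f) u = L2_inner M f h) \<Longrightarrow>
      \<exists>g\<in>Dm. (AE x in M. u x = g x) \<and> (AE x in M. h x = Tm g x)"
begin

sublocale L: pos_form "L2_fun M" "L2_inner M"
  by (rule L2_inner_pos_form)

abbreviation "t f g \<equiv> L2_inner M f (T g)"

text \<open>The shift makes the form positive and \<open>B.q\<close> an upper bound of the squared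
  norm. Form convergence then means convergence in the Hilbert space together with the Cauchy
  property for \<open>B.q\<close>.\<close>

definition tC :: "('a \<Rightarrow> complex) \<Rightarrow> ('a \<Rightarrow> complex) \<Rightarrow> complex" where
  "tC f g = t f g + of_real C * L2_inner M f g"

lemma L2: "f \<in> D \<Longrightarrow> f \<in> L2_fun M" using D_L2 by blast

lemma L2_meas: "f \<in> L2_fun M \<Longrightarrow> f \<in> borel_measurable M" by (simp add: L2_fun_def)

lemma t_lin:
  assumes "h \<in> D" "f \<in> D" "g \<in> D"
  shows "t h (\<lambda>x. c * f x + g x) = c * t h f + t h g"
proof -
  have "t h (\<lambda>x. c * f x + g x) = L2_inner M h (\<lambda>x. c * T f x + T g x)"
    by (rule L2_inner_cong_AE(1)[OF T_lin[OF assms(2,3)] L2_meas[OF L2[OF assms(1)]]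
          L2_meas[OF T_L2[OF D_lin[OF assms(2,3)]]] L2_meas[OF L2_fun_lincomb[OF T_L2[OF assms(2)] T_L2[OF assms(3)]]]])
  then show ?thesis using L.lin[OF L2 T_L2 T_L2] assms by simp
qed

sublocale B: pos_form D tC
proof
  fix f g h :: "'a \<Rightarrow> complex" and c
  show "(\<lambda>x. c * f x + g x) \<in> D" if "f \<in> D" "g \<in> D" using D_lin that .
  show "tC h (\<lambda>x. c * f x + g x) = c * tC h f + tC h g" if "h \<in> D" "f \<in> D" "g \<in> D"
    unfolding tC_def using t_lin[OF that] L.lin[OF L2 L2 L2, OF that] by (simp add: algebra_simps)
  show "tC g f = cnj (tC f g)" if "f \<in> D" "g \<in> D"
    unfolding tC_def using T_sym[of g f] that L.herm[OF L2 L2, OF that] L.herm[OF L2[OF that(1)] T_L2[OF that(2)]] by simp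
  show "0 \<le> Re (tC f f)" if "f \<in> D"
    unfolding tC_def using bound[OF that] L.pos[OF L2[OF that]] by simp
qed

lemma mass_le: "f \<in> D \<Longrightarrow> L.q f \<le> B.q f"
  unfolding L.q_def B.q_def tC_def using bound by simp

lemma L_q: "L.q f = (LINT x|M. (cmod (f x))\<^sup>2)"
  by (simp add: L.q_def L2_inner_self)

text \<open>t is tC minus C times the inner product, and both obey Cauchy-Schwarz with norms bounded
  by \<open>B.q\<close>.\<close>

lemma t_bound:
  assumes "f \<in> D" "g \<in> D"
  shows "cmod (t f g) \<le> (1 + \<bar>C\<bar>) * (sqrt (B.q f) * sqrt (B.q g))"
proof -
  have 1: "cmod (tC f g) \<le> sqrt (B.q f) * sqrt (B.q g)"
    using real_sqrt_le_mono[OF B.cauchy_schwarz[OF assms]] by (simp add: real_sqrt_mult)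
  have "cmod (L2_inner M f g) \<le> sqrt (L.q f) * sqrt (L.q g)"
    using real_sqrt_le_mono[OF L.cauchy_schwarz[OF L2 L2, OF assms]] by (simp add: real_sqrt_mult)
  also have "\<dots> \<le> sqrt (B.q f) * sqrt (B.q g)"
    using mass_le[OF assms(1)] mass_le[OF assms(2)] L.q_nonneg[OF L2[OF assms(2)]] B.q_nonneg[OF assms(1)] by (intro mult_mono) auto
  finally have "\<bar>C\<bar> * cmod (L2_inner M f g) \<le> \<bar>C\<bar> * (sqrt (B.q f) * sqrt (B.q g))" by (intro mult_left_mono) auto
  moreover have "t f g = tC f g - of_real C * L2_inner M f g" by (simp add: tC_def)
  then have "cmod (t f g) \<le> cmod (tC f g) + \<bar>C\<bar> * cmod (L2_inner M f g)"
    by (metis norm_triangle_ineq4 norm_mult norm_of_real)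
  ultimately show ?thesis using 1 by (simp add: algebra_simps)
qed

lemma form_convergentD:
  assumes "form_convergent M D t \<phi> f"
  shows "\<phi> n \<in> D" "f \<in> L2_fun M" "(\<lambda>n. L.q (\<lambda>x. \<phi> n x - f x)) \<longlonglongrightarrow> 0"
    "\<And>\<epsilon>. \<epsilon> > 0 \<Longrightarrow> \<exists>N. \<forall>m\<ge>N. \<forall>n\<ge>N. B.q (\<lambda>x. \<phi> m x - \<phi> n x) < \<epsilon>"
proof -
  show D: "\<phi> n \<in> D" for n using assms by (simp add: form_convergent_def)
  show f: "f \<in> L2_fun M" using assms by (simp add: form_convergent_def)
  show lim: "(\<lambda>n. L.q (\<lambda>x. \<phi> n x - f x)) \<longlonglongrightarrow> 0" using assms by (simp add: form_convergent_def L_q)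
  fix \<epsilon> :: real assume \<epsilon>: "\<epsilon> > 0"
  have lim2: "((\<lambda>(m, n). t (\<lambda>x. \<phi> m x - \<phi> n x) (\<lambda>x. \<phi> m x - \<phi> n x)) \<longlongrightarrow> 0) (sequentially \<times>\<^sub>F sequentially)"
    using assms by (simp add: form_convergent_def)
  have "\<forall>\<^sub>F mn in sequentially \<times>\<^sub>F sequentially.
      dist ((\<lambda>(m, n). t (\<lambda>x. \<phi> m x - \<phi> n x) (\<lambda>x. \<phi> m x - \<phi> n x)) mn) 0 < \<epsilon> / 2"
    by (rule tendstoD[OF lim2]) (use \<epsilon> in simp)
  then obtain N1 where N1: "\<And>m n. m \<ge> N1 \<Longrightarrow> n \<ge> N1 \<Longrightarrow> cmod (t (\<lambda>x. \<phi> m x - \<phi> n x) (\<lambda>x. \<phi> m x - \<phi> n x)) < \<epsilon> / 2"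
    unfolding eventually_prod_sequentially by auto
  \<comment> \<open>Chosen so that 4 e (|C| + 1) = \<epsilon>/2.\<close>
  define e where "e = \<epsilon> / (8 * (\<bar>C\<bar> + 1))"
  have e: "e > 0" using \<epsilon> by (simp add: e_def add_nonneg_pos)
  obtain N2 where N2: "\<And>n. n \<ge> N2 \<Longrightarrow> L.q (\<lambda>x. \<phi> n x - f x) < e"
    using order_tendstoD(2)[OF lim e] unfolding eventually_sequentially by blast
  have "B.q (\<lambda>x. \<phi> m x - \<phi> n x) < \<epsilon>" if mn: "m \<ge> max N1 N2" "n \<ge> max N1 N2" for m n
  proof -
    let ?d = "\<lambda>x. \<phi> m x - \<phi> n x" and ?a = "\<lambda>x. \<phi> m x - f x" and ?b = "\<lambda>x. \<phi> n x - f x"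
    have ab: "?a \<in> L2_fun M" "?b \<in> L2_fun M" using L.diff_closed L2 D f by auto
    have "?d = (\<lambda>x. ?a x - ?b x)" by auto
    then have "L.q ?d = 2 * L.q ?a + 2 * L.q ?b - 4 * L.q (\<lambda>x. (1/2) * (1 * ?a x + ?b x))"
      using L.parallelogram[OF ab] by simp
    also have "\<dots> \<le> 2 * L.q ?a + 2 * L.q ?b"
      using L.q_nonneg[OF L.scale_closed[OF L.closed[OF ab, of 1], of "1/2"]] by simp
    also have "\<dots> \<le> 4 * e" using N2[of m] N2[of n] mn by simp
    finally have "\<bar>C\<bar> * L.q ?d \<le> \<bar>C\<bar> * (4 * e)" by (intro mult_left_mono) auto
    also have "\<dots> \<le> (\<bar>C\<bar> + 1) * (4 * e)" using e by (intro mult_right_mono) auto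
    also have "\<dots> = \<epsilon> / 2" by (simp add: e_def field_simps add_nonneg_pos less_imp_neq[THEN not_sym])
    finally have "\<bar>C\<bar> * L.q ?d \<le> \<epsilon> / 2" .
    moreover have "C * L.q ?d \<le> \<bar>C\<bar> * L.q ?d" using L.q_nonneg[OF L2[OF B.diff_closed[OF D D]]] by (intro mult_right_mono) auto
    moreover have "Re (t ?d ?d) < \<epsilon> / 2" using N1[of m n] mn complex_Re_le_cmod[of "t ?d ?d"] by simp
    moreover have "B.q ?d = Re (t ?d ?d) + C * L.q ?d" by (simp add: B.q_def tC_def L.q_def)
    ultimately show ?thesis by linarith
  qed
  then show "\<exists>N. \<forall>m\<ge>N. \<forall>n\<ge>N. B.q (\<lambda>x. \<phi> m x - \<phi> n x) < \<epsilon>" by blast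
qed

lemma form_convergentI:
  assumes D: "\<And>n. \<phi> n \<in> D" and f: "f \<in> L2_fun M" and lim: "(\<lambda>n. L.q (\<lambda>x. \<phi> n x - f x)) \<longlonglongrightarrow> 0"
    and cauchy: "\<And>\<epsilon>. \<epsilon> > 0 \<Longrightarrow> \<exists>N. \<forall>m\<ge>N. \<forall>n\<ge>N. B.q (\<lambda>x. \<phi> m x - \<phi> n x) < \<epsilon>"
  shows "form_convergent M D t \<phi> f"
  unfolding form_convergent_def
proof (intro conjI allI D f)
  show "(\<lambda>n. LINT x|M. (cmod (\<phi> n x - f x))\<^sup>2) \<longlonglongrightarrow> 0" using lim by (simp add: L_q)
  show "((\<lambda>(m, n). t (\<lambda>x. \<phi> m x - \<phi> n x) (\<lambda>x. \<phi> m x - \<phi> n x)) \<longlongrightarrow> 0) (sequentially \<times>\<^sub>F sequentially)"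
  proof (rule tendstoI)
    fix \<epsilon> :: real assume \<epsilon>: "\<epsilon> > 0"
    then have "\<epsilon> / (1 + \<bar>C\<bar>) > 0" by (simp add: add_pos_nonneg)
    from cauchy[OF this] obtain N where N: "\<And>m n. m \<ge> N \<Longrightarrow> n \<ge> N \<Longrightarrow> B.q (\<lambda>x. \<phi> m x - \<phi> n x) < \<epsilon> / (1 + \<bar>C\<bar>)" by blast
    have "cmod (t (\<lambda>x. \<phi> m x - \<phi> n x) (\<lambda>x. \<phi> m x - \<phi> n x)) < \<epsilon>" if "m \<ge> N" "n \<ge> N" for m n
    proof -
      let ?d = "\<lambda>x. \<phi> m x - \<phi> n x"
      have d: "?d \<in> D" by (rule B.diff_closed[OF D D])
      have "cmod (t ?d ?d) \<le> (1 + \<bar>C\<bar>) * B.q ?d" using t_bound[OF d d] B.q_nonneg[OF d] by simp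
      also have "\<dots> < (1 + \<bar>C\<bar>) * (\<epsilon> / (1 + \<bar>C\<bar>))" using N[OF that] by (intro mult_strict_left_mono) auto
      also have "\<dots> = \<epsilon>" by (simp add: add_pos_nonneg less_imp_neq[THEN not_sym])
      finally show ?thesis .
    qed
    then show "\<forall>\<^sub>F x in sequentially \<times>\<^sub>F sequentially. dist (case x of (m, n) \<Rightarrow> t (\<lambda>x. \<phi> m x - \<phi> n x) (\<lambda>x. \<phi> m x - \<phi> n x)) 0 < \<epsilon>"
      unfolding eventually_prod_sequentially by (intro exI[of _ N]) auto
  qed
qed

lemma L_lim:
  assumes \<phi>: "\<And>n. \<phi> n \<in> L2_fun M" and f: "f \<in> L2_fun M" and lim: "(\<lambda>n. L.q (\<lambda>x. \<phi> n x - f x)) \<longlonglongrightarrow> 0" and g: "g \<in> L2_fun M"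
  shows "(\<lambda>n. L2_inner M g (\<phi> n)) \<longlonglongrightarrow> L2_inner M g f" "(\<lambda>n. L2_inner M (\<phi> n) g) \<longlonglongrightarrow> L2_inner M f g"
proof -
  have "(\<lambda>n. sqrt (L.q g * L.q (\<lambda>x. \<phi> n x - f x))) \<longlonglongrightarrow> sqrt (L.q g * 0)" by (intro tendsto_intros lim)
  then have z: "(\<lambda>n. sqrt (L.q g * L.q (\<lambda>x. \<phi> n x - f x))) \<longlonglongrightarrow> 0" by simp
  have "cmod (L2_inner M g (\<phi> n) - L2_inner M g f) \<le> sqrt (L.q g * L.q (\<lambda>x. \<phi> n x - f x))" for n
    using real_sqrt_le_mono[OF L.cauchy_schwarz[OF g L.diff_closed[OF \<phi>[of n] f]]] L.lin_diff[OF g \<phi>[of n] f] by simp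
  then have "(\<lambda>n. L2_inner M g (\<phi> n) - L2_inner M g f) \<longlonglongrightarrow> 0"
    by (intro Lim_null_comparison[OF _ z] always_eventually) auto
  then show 1: "(\<lambda>n. L2_inner M g (\<phi> n)) \<longlonglongrightarrow> L2_inner M g f" by (simp add: LIM_zero_iff)
  have "(\<lambda>n. cnj (L2_inner M g (\<phi> n))) \<longlonglongrightarrow> cnj (L2_inner M g f)" by (intro tendsto_intros 1)
  then show "(\<lambda>n. L2_inner M (\<phi> n) g) \<longlonglongrightarrow> L2_inner M f g"
    using L.herm[OF g \<phi>] L.herm[OF g f] by simp
qed

lemma form_convergent_bounded:
  assumes "form_convergent M D t \<xi> g"
  obtains N K where "0 < K" "\<And>n. n \<ge> N \<Longrightarrow> B.q (\<xi> n) \<le> K"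
proof -
  note c1 = form_convergentD[OF assms]
  obtain N1 where N1: "\<And>m n. m \<ge> N1 \<Longrightarrow> n \<ge> N1 \<Longrightarrow> B.q (\<lambda>x. \<xi> m x - \<xi> n x) < 1" using c1(4)[of 1] by auto
  define K where "K = 2 * B.q (\<xi> N1) + 2"
  have K: "B.q (\<xi> n) \<le> K" if "n \<ge> N1" for n
  proof -
    have d: "(\<lambda>x. \<xi> n x - \<xi> N1 x) \<in> D" by (rule B.diff_closed[OF c1(1) c1(1)])
    have D1: "\<xi> N1 \<in> D" by (rule c1(1))
    have s: "(\<lambda>x. - 1 * \<xi> N1 x) \<in> D" by (rule B.scale_closed[OF D1])
    have "\<xi> n = (\<lambda>x. (\<lambda>x. \<xi> n x - \<xi> N1 x) x - (\<lambda>x. - 1 * \<xi> N1 x) x)" by auto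
    then have "B.q (\<xi> n) \<le> 2 * B.q (\<lambda>x. \<xi> n x - \<xi> N1 x) + 2 * B.q (\<lambda>x. - 1 * \<xi> N1 x)"
      using B.parallelogram[OF d s] B.q_nonneg[OF B.scale_closed[OF B.closed[OF d s, of 1], of "1/2"]] by simp
    moreover have "B.q (\<lambda>x. - 1 * \<xi> N1 x) = B.q (\<xi> N1)"
      using B.lin_scale[OF s D1, of "-1"] B.lin_scale[OF D1 D1, of "-1"] B.herm[OF D1 s] by (simp add: B.q_def)
    ultimately show ?thesis using N1[of n N1] that by (simp add: K_def)
  qed
  have K0: "0 < K" using B.q_nonneg[OF c1(1)[of N1]] by (simp add: K_def)
  show thesis by (rule that[OF K0 K])
qed

text \<open>\<open>B.q (\<xi> n)\<close> is bounded and \<phi> is Cauchy, so replacing \<phi> n by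
  \<phi> m changes \<open>t (\<xi> n) (\<phi> n)\<close> little, uniformly for large n and m. The
  diagonal limit is thus the iterated one, which can be computed by moving the operator to a fixed
  argument.\<close>

lemma double_limit:
  assumes \<chi>: "form_convergent M D t \<xi> g" and \<phi>: "form_convergent M D t \<phi> f"
    and b: "\<And>m. (\<lambda>n. t (\<xi> n) (\<phi> m)) \<longlonglongrightarrow> b m" and z: "b \<longlonglongrightarrow> z"
  shows "(\<lambda>n. t (\<xi> n) (\<phi> n)) \<longlonglongrightarrow> z"
proof (rule LIMSEQ_I)
  fix r :: real assume r: "r > 0"
  note c1 = form_convergentD[OF \<chi>] and c2 = form_convergentD[OF \<phi>]
  obtain N1 K where K: "0 < K" "\<And>n. n \<ge> N1 \<Longrightarrow> B.q (\<xi> n) \<le> K"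
    by (rule form_convergent_bounded[OF \<chi>]) (rule that; assumption)
  note K0 = K(1) and K = K(2)
  \<comment> \<open>Chosen so that (1 + |C|) sqrt (K e) = r/3.\<close>
  define e where "e = (r / (3 * (1 + \<bar>C\<bar>)))\<^sup>2 / K"
  have e: "e > 0" using r K0 by (simp add: e_def add_pos_nonneg less_imp_neq[THEN not_sym])
  obtain N2 where N2: "\<And>m n. m \<ge> N2 \<Longrightarrow> n \<ge> N2 \<Longrightarrow> B.q (\<lambda>x. \<phi> m x - \<phi> n x) < e" using c2(4)[OF e] by auto
  obtain N3 where N3: "\<And>m. m \<ge> N3 \<Longrightarrow> cmod (b m - z) < r / 3" using LIMSEQ_D[OF z, of "r / 3"] r by auto
  define m where "m = max N2 N3"
  obtain N4 where N4: "\<And>n. n \<ge> N4 \<Longrightarrow> cmod (t (\<xi> n) (\<phi> m) - b m) < r / 3" using LIMSEQ_D[OF b[of m], of "r / 3"] r by auto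
  show "\<exists>no. \<forall>n\<ge>no. norm (t (\<xi> n) (\<phi> n) - z) < r"
  proof (intro exI[of _ "max (max N1 N2) N4"] allI impI)
    fix n assume n: "max (max N1 N2) N4 \<le> n"
    let ?d = "\<lambda>x. \<phi> n x - \<phi> m x"
    have d: "?d \<in> D" by (rule B.diff_closed[OF c2(1) c2(1)])
    have "t (\<xi> n) (\<phi> n) - t (\<xi> n) (\<phi> m) = t (\<xi> n) ?d"
      using t_lin[OF c1(1) c2(1) c2(1), of n "-1" m n] by simp
    then have "cmod (t (\<xi> n) (\<phi> n) - t (\<xi> n) (\<phi> m)) \<le> (1 + \<bar>C\<bar>) * (sqrt (B.q (\<xi> n)) * sqrt (B.q ?d))"
      using t_bound[OF c1(1) d] by simp
    also have "\<dots> = (1 + \<bar>C\<bar>) * sqrt (B.q (\<xi> n) * B.q ?d)" by (simp add: real_sqrt_mult)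
    also have "\<dots> \<le> (1 + \<bar>C\<bar>) * sqrt (K * e)"
      using K[of n] N2[of n m] n K0 B.q_nonneg[OF d] by (intro mult_left_mono real_sqrt_le_mono mult_mono) (auto simp: m_def)
    also have "K * e = (r / (3 * (1 + \<bar>C\<bar>)))\<^sup>2" using K0 by (simp add: e_def)
    also have "(1 + \<bar>C\<bar>) * sqrt ((r / (3 * (1 + \<bar>C\<bar>)))\<^sup>2) = r / 3"
    proof -
      have "k * sqrt ((r / (3 * k))\<^sup>2) = r / 3" if "k > 0" for k using that r by simp
      from this[of "1 + \<bar>C\<bar>"] show ?thesis by (simp only: abs_add_one_gt_zero)
    qed
    finally have "cmod (t (\<xi> n) (\<phi> n) - t (\<xi> n) (\<phi> m)) \<le> r / 3" .
    moreover have "cmod (t (\<xi> n) (\<phi> m) - b m) < r / 3" using N4 n by simp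
    moreover have "cmod (b m - z) < r / 3" using N3 by (simp add: m_def)
    moreover have "cmod (t (\<xi> n) (\<phi> n) - z) \<le> cmod (t (\<xi> n) (\<phi> n) - t (\<xi> n) (\<phi> m)) + cmod (t (\<xi> n) (\<phi> m) - b m) + cmod (b m - z)"
      using norm_triangle_ineq[of "t (\<xi> n) (\<phi> n) - t (\<xi> n) (\<phi> m)" "t (\<xi> n) (\<phi> m) - z"]
        norm_triangle_ineq[of "t (\<xi> n) (\<phi> m) - b m" "b m - z"] by simp
    ultimately show "norm (t (\<xi> n) (\<phi> n) - z) < r" by linarith
  qed
qed

lemma t_herm: "f \<in> D \<Longrightarrow> g \<in> D \<Longrightarrow> t g f = cnj (t f g)"
  using T_sym[of g f] L.herm[OF L2 T_L2, of f g] by simp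

text \<open>The mirror image by hermitian symmetry, with the limit in the second argument taken
  first.\<close>

lemma double_limit':
  assumes \<chi>: "form_convergent M D t \<xi> g" and \<phi>: "form_convergent M D t \<phi> f"
    and b: "\<And>n. (\<lambda>m. t (\<xi> n) (\<phi> m)) \<longlonglongrightarrow> b n" and z: "b \<longlonglongrightarrow> z"
  shows "(\<lambda>n. t (\<xi> n) (\<phi> n)) \<longlonglongrightarrow> z"
proof -
  note D = form_convergentD(1)[OF \<chi>] form_convergentD(1)[OF \<phi>]
  have "(\<lambda>n. t (\<phi> n) (\<xi> n)) \<longlonglongrightarrow> cnj z"
  proof (rule double_limit[OF \<phi> \<chi>])
    show "(\<lambda>n. t (\<phi> n) (\<xi> m)) \<longlonglongrightarrow> cnj (b m)" for m
      unfolding t_herm[OF D] by (intro tendsto_intros b)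
    show "(\<lambda>m. cnj (b m)) \<longlonglongrightarrow> cnj z" by (intro tendsto_intros z)
  qed
  then have "(\<lambda>n. cnj (t (\<phi> n) (\<xi> n))) \<longlonglongrightarrow> cnj (cnj z)" by (rule tendsto_cnj)
  then show ?thesis using t_herm[OF D(2,1)] by simp
qed

text \<open>Approximating sequences of f and g exist, so the value described in
  \<open>form_closure\<close> is unique.\<close>

lemma form_closure_eqI:
  assumes f: "f \<in> form_closure_dom M D t" and g: "g \<in> form_closure_dom M D t"
    and lim: "\<And>\<phi> \<xi>. form_convergent M D t \<phi> f \<Longrightarrow> form_convergent M D t \<xi> g \<Longrightarrow> (\<lambda>n. t (\<phi> n) (\<xi> n)) \<longlonglongrightarrow> z"
  shows "form_closure M D t f g = z"
  unfolding form_closure_def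
proof (rule the_equality)
  show "\<forall>\<phi> \<psi>. form_convergent M D t \<phi> f \<and> form_convergent M D t \<psi> g \<longrightarrow> (\<lambda>n. t (\<phi> n) (\<psi> n)) \<longlonglongrightarrow> z"
    using lim by blast
  fix z' assume "\<forall>\<phi> \<psi>. form_convergent M D t \<phi> f \<and> form_convergent M D t \<psi> g \<longrightarrow> (\<lambda>n. t (\<phi> n) (\<psi> n)) \<longlonglongrightarrow> z'"
  then show "z' = z" using f g lim unfolding form_closure_dom_def by (blast intro: LIMSEQ_unique)
qed

lemma D_closure:
  assumes "f \<in> D" shows "f \<in> form_closure_dom M D t"
proof -
  have "B.q (\<lambda>x. 0) = 0" using B.lin_scale[OF B.zero_closed[OF assms] assms, of 0] by (simp add: B.q_def)
  moreover have "L.q (\<lambda>x. 0) = 0" by (simp add: L_q)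
  ultimately have "form_convergent M D t (\<lambda>n. f) f" by (intro form_convergentI) (use assms L2 in auto)
  then show ?thesis by (auto simp: form_closure_dom_def)
qed

lemma closure_cong_AE:
  assumes f: "f \<in> form_closure_dom M D t" and eq: "AE x in M. f x = g x" and g: "g \<in> L2_fun M"
  shows "g \<in> form_closure_dom M D t"
proof -
  obtain \<phi> where \<phi>: "form_convergent M D t \<phi> f" using f by (auto simp: form_closure_dom_def)
  note c = form_convergentD[OF \<phi>]
  have "L.q (\<lambda>x. \<phi> n x - f x) = L.q (\<lambda>x. \<phi> n x - g x)" for n
    unfolding L_q
  proof (rule integral_cong_AE)
    show "AE x in M. (cmod (\<phi> n x - f x))\<^sup>2 = (cmod (\<phi> n x - g x))\<^sup>2" using eq by eventually_elim simp
  qed (use L2_meas[OF L2[OF c(1)]] L2_meas[OF c(2)] L2_meas[OF g] in auto)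
  then have "form_convergent M D t \<phi> g" using c g by (intro form_convergentI) auto
  then show ?thesis by (auto simp: form_closure_dom_def)
qed

text \<open>The quadratic functional J is minimized over D. A minimizing sequence is Cauchy in the
  shifted form by the parallelogram identity, and its limit satisfies the Euler equation tested with
  D, which \<open>adjoint\<close> turns into the equation for \<open>Tm\<close>.\<close>

lemma onto:
  assumes k: "k \<in> L2_fun M"
  obtains u where "u \<in> Dm" "u \<in> form_closure_dom M D t" "AE x in M. Tm u x + of_real C * u x = k x"
proof -
  define J where "J v = B.q v - 2 * Re (L2_inner M k v)" for v
  \<comment> \<open>From |k - v|^2 \<ge> 0, since \<open>B.q v\<close> is at least |v|^2.\<close>
  have J_ge: "- L.q k \<le> J v" if "v \<in> D" for v
    using L.q_nonneg[OF L.diff_closed[OF k L2[OF that]]] L.q_diff[OF k L2[OF that]] mass_le[OF that] by (simp add: J_def)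
  define m where "m = (INF v\<in>D. J v)"
  have bdd: "bdd_below (J ` D)" using J_ge by (intro bdd_belowI2)
  have m_le: "m \<le> J v" if "v \<in> D" for v unfolding m_def by (rule cINF_lower[OF bdd that])
  have "\<exists>v\<in>D. J v < m + inverse (real (Suc n))" for n
    using cINF_less_iff[OF D_ne bdd, of "m + inverse (real (Suc n))"] by (simp add: m_def)
  then obtain v where v: "\<And>n. v n \<in> D" "\<And>n. J (v n) < m + inverse (real (Suc n))" by metis
  have cauchy0: "B.q (\<lambda>x. v i x - v j x) \<le> 2 * inverse (real (Suc i)) + 2 * inverse (real (Suc j))" for i j
  proof -
    define w where "w = (\<lambda>x. (1/2) * (1 * v i x + v j x))"
    have w: "w \<in> D" unfolding w_def by (intro B.scale_closed B.closed v)
    have ipw: "L2_inner M k w = (1/2) * (1 * L2_inner M k (v i) + L2_inner M k (v j))"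
      using L.lin_scale[OF k L.closed[OF L2 L2, OF v(1) v(1), of 1 i j], of "1/2"] L.lin[OF k L2 L2, OF v(1) v(1), of 1 i j]
      unfolding w_def by simp
    have Rew: "2 * Re (L2_inner M k w) = Re (L2_inner M k (v i)) + Re (L2_inner M k (v j))" unfolding ipw by simp
    have "J (v i) = B.q (v i) - 2 * Re (L2_inner M k (v i))" "J (v j) = B.q (v j) - 2 * Re (L2_inner M k (v j))"
      "J w = B.q w - 2 * Re (L2_inner M k w)" by (simp_all only: J_def)
    then have "B.q (\<lambda>x. v i x - v j x) = 2 * J (v i) + 2 * J (v j) - 4 * J w"
      using B.parallelogram[OF v(1)[of i] v(1)[of j], folded w_def] Rew by (simp add: algebra_simps)
    then show ?thesis using v(2)[of i] v(2)[of j] m_le[OF w] by simp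
  qed
  have cauchy: "\<exists>N. \<forall>i\<ge>N. \<forall>j\<ge>N. B.q (\<lambda>x. v i x - v j x) < \<epsilon>" if \<epsilon>: "\<epsilon> > 0" for \<epsilon>
  proof -
    obtain N where N: "inverse (real (Suc N)) < \<epsilon> / 4" using reals_Archimedean[of "\<epsilon> / 4"] \<epsilon> by auto
    have "B.q (\<lambda>x. v i x - v j x) < \<epsilon>" if "i \<ge> N" "j \<ge> N" for i j
    proof -
      have "inverse (real (Suc i)) \<le> inverse (real (Suc N))" "inverse (real (Suc j)) \<le> inverse (real (Suc N))"
        using that by (simp_all add: field_simps)
      then show ?thesis using cauchy0[of i j] N by linarith
    qed
    then show ?thesis by blast
  qed
  obtain u where u: "u \<in> L2_fun M" "(\<lambda>n. LINT x|M. (cmod (v n x - u x))\<^sup>2) \<longlonglongrightarrow> 0"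
    using complete[of v] v(1) cauchy by (auto simp: B.q_def tC_def)
  have conv: "form_convergent M D t v u" by (rule form_convergentI[OF v(1) u(1) _ cauchy]) (use u(2) in \<open>simp_all add: L_q\<close>)
  note limu = L_lim[OF L2[OF v(1)] u(1) form_convergentD(3)[OF conv]]
  have euler: "L2_inner M (T f) u + of_real C * L2_inner M f u = L2_inner M f k" if f: "f \<in> D" for f
  proof -
    \<comment> \<open>The residual of the Euler equation at v n, tested with f.\<close>
    define z where "z n = tC f (v n) - L2_inner M f k" for n
    \<comment> \<open>The length of a descent step from v n along f: s \<open>B.q f\<close> \<le> 1
      keeps the quadratic term below half of the linear gain, so J drops by at least s |z n|^2. As J
      (v n) is within 1/(n+1) of the infimum, z n tends to 0.\<close>
    define s where "s = 1 / (1 + B.q f)"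
    have qf: "0 \<le> B.q f" by (rule B.q_nonneg[OF f])
    have s: "0 < s" "s * B.q f \<le> 1" using qf by (simp_all add: s_def field_simps)
    have "(cmod (z n))\<^sup>2 \<le> (1 + B.q f) * inverse (real (Suc n))" for n
    proof -
      define c where "c = - of_real s * z n"
      have "tC (v n) f = cnj (z n) + L2_inner M k f"
        using B.herm[OF f v(1)[of n]] L.herm[OF L2[OF f] k] by (simp add: z_def)
      then have "c * tC (v n) f = c * cnj (z n) + c * L2_inner M k f" by (simp only: distrib_left)
      then have "Re (c * tC (v n) f) = Re (c * cnj (z n)) + Re (c * L2_inner M k f)" by (simp only: plus_complex.sel)
      moreover have "Re (L2_inner M k (\<lambda>x. c * f x + v n x)) = Re (c * L2_inner M k f) + Re (L2_inner M k (v n))"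
        unfolding L.lin[OF k L2[OF f] L2[OF v(1)[of n]]] by (simp only: plus_complex.sel)
      ultimately have "J (\<lambda>x. c * f x + v n x) = J (v n) + (cmod c)\<^sup>2 * B.q f + 2 * Re (c * cnj (z n))"
        using B.expand[OF f v(1)[of n], of c] unfolding J_def by linarith
      also have "c * cnj (z n) = - of_real (s * (cmod (z n))\<^sup>2)"
        by (simp add: c_def complex_norm_square algebra_simps del: of_real_power)
      also have "(cmod c)\<^sup>2 * B.q f = s * (cmod (z n))\<^sup>2 * (s * B.q f)"
        using s(1) by (simp add: c_def norm_mult power_mult_distrib power2_eq_square)
      also have "\<dots> \<le> s * (cmod (z n))\<^sup>2 * 1" using s by (intro mult_left_mono) auto
      finally have "J (\<lambda>x. c * f x + v n x) \<le> J (v n) - s * (cmod (z n))\<^sup>2" by simp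
      then have "s * (cmod (z n))\<^sup>2 \<le> inverse (real (Suc n))" using m_le[OF B.closed[OF f v(1)[of n], of c]] v(2)[of n] by linarith
      from mult_left_mono[OF this, of "1 + B.q f"] show ?thesis using qf by (simp add: s_def add_pos_nonneg less_imp_neq[THEN not_sym])
    qed
    moreover have "(\<lambda>n. (1 + B.q f) * inverse (real (Suc n))) \<longlonglongrightarrow> 0"
      using tendsto_mult_right_zero[OF LIMSEQ_inverse_real_of_nat] by simp
    ultimately have "(\<lambda>n. (cmod (z n))\<^sup>2) \<longlonglongrightarrow> 0"
      by (intro Lim_null_comparison[of "\<lambda>n. (cmod (z n))\<^sup>2"] always_eventually) auto
    then have "z \<longlonglongrightarrow> 0" by (simp add: tendsto_norm_zero_iff power_tendsto_0_iff)
    moreover have "z = (\<lambda>n. L2_inner M (T f) (v n) + of_real C * L2_inner M f (v n) - L2_inner M f k)"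
      by (simp add: z_def fun_eq_iff tC_def T_sym[OF f v(1)])
    moreover have "(\<lambda>n. L2_inner M (T f) (v n) + of_real C * L2_inner M f (v n) - L2_inner M f k) \<longlonglongrightarrow>
        L2_inner M (T f) u + of_real C * L2_inner M f u - L2_inner M f k"
      by (intro tendsto_intros limu(1) T_L2 L2 f)
    ultimately show ?thesis using LIMSEQ_unique by fastforce
  qed
  let ?h = "\<lambda>x. - of_real C * u x + k x"
  have h: "?h \<in> L2_fun M" by (rule L2_fun_lincomb[OF u(1) k])
  have "L2_inner M (T f) u = L2_inner M f ?h" if "f \<in> D" for f
    unfolding L.lin[OF L2[OF that] u(1) k] by (simp add: euler[OF that, symmetric])
  from adjoint[OF u(1) h this] obtain g where g: "g \<in> Dm" "AE x in M. u x = g x" "AE x in M. ?h x = Tm g x" by blast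
  have "g \<in> form_closure_dom M D t"
    by (rule closure_cong_AE[of u]) (use conv g Dm_L2 in \<open>auto simp: form_closure_dom_def\<close>)
  moreover have "AE x in M. Tm g x + of_real C * g x = k x" using g(2,3) by eventually_elim (simp add: algebra_simps)
  ultimately show thesis using g(1) that by blast
qed

end

text \<open>The Friedrichs extension plus a constant is onto and therefore has no proper symmetric
  extension, so \<open>F\<close> is its domain as soon as \<open>F\<close> contains it and \<open>Tm\<close> is symmetric on \<open>F\<close>.\<close>

locale friedrichs_setting = semibounded_operator +
  fixes F :: "('a \<Rightarrow> complex) set"
  assumes F_Dm: "F \<subseteq> Dm"
    and F_sym: "f \<in> F \<Longrightarrow> g \<in> F \<Longrightarrow> L2_inner M (Tm f) g = L2_inner M f (Tm g)"
    and F_closure: "g \<in> Dm \<Longrightarrow> g \<in> form_closure_dom M D (\<lambda>f g. L2_inner M f (T g)) \<Longrightarrow> g \<in> F"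
begin

text \<open>Put S = Tm + C. Take u in the closure with S u = S f, then v in the closure with S v = f
  - u. Symmetry on F gives |f - u|^2 = <S v, f - u> = <v, S f - S u> = 0.\<close>

lemma F_in_closure:
  assumes f: "f \<in> F"
  shows "f \<in> form_closure_dom M D t"
proof -
  have fm: "f \<in> Dm" using f F_Dm by blast
  have fL: "f \<in> L2_fun M" using fm Dm_L2 by blast
  let ?k = "\<lambda>x. of_real C * f x + Tm f x"
  obtain u where u: "u \<in> Dm" "u \<in> form_closure_dom M D t" "AE x in M. Tm u x + of_real C * u x = ?k x"
    by (rule onto[OF L2_fun_lincomb[OF fL Tm_L2[OF fm]]]) (rule that; assumption)
  have uF: "u \<in> F" by (rule F_closure[OF u(1,2)])
  have uL: "u \<in> L2_fun M" using u(1) Dm_L2 by blast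
  let ?w = "\<lambda>x. f x - u x"
  have wL: "?w \<in> L2_fun M" by (rule L.diff_closed[OF fL uL])
  obtain v where v: "v \<in> Dm" "v \<in> form_closure_dom M D t" "AE x in M. Tm v x + of_real C * v x = ?w x"
    by (rule onto[OF wL]) (rule that; assumption)
  have vF: "v \<in> F" by (rule F_closure[OF v(1,2)])
  have vL: "v \<in> L2_fun M" using v(1) Dm_L2 by blast
  let ?Sv = "\<lambda>x. of_real C * v x + Tm v x" and ?Su = "\<lambda>x. of_real C * u x + Tm u x"
  note TL = Tm_L2[OF fm] Tm_L2[OF u(1)] Tm_L2[OF v(1)]
  have SvL: "?Sv \<in> L2_fun M" by (rule L2_fun_lincomb[OF vL TL(3)])
  have SuL: "?Su \<in> L2_fun M" by (rule L2_fun_lincomb[OF uL TL(2)])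
  have kL: "?k \<in> L2_fun M" by (rule L2_fun_lincomb[OF fL TL(1)])
  have sym: "L2_inner M ?Sv g = L2_inner M v (\<lambda>x. of_real C * g x + Tm g x)" if g: "g \<in> F" for g
  proof -
    have gL: "g \<in> L2_fun M" "Tm g \<in> L2_fun M" using g F_Dm Dm_L2 Tm_L2 by auto
    show ?thesis using L.lin_left[OF gL(1) vL TL(3), of "of_real C"] L.lin[OF vL gL, of "of_real C"] F_sym[OF vF g] by simp
  qed
  have eqv: "AE x in M. ?w x = ?Sv x" using v(3) by eventually_elim (simp add: add.commute)
  have equ: "AE x in M. ?Su x = ?k x" using u(3) by eventually_elim (simp add: add.commute)
  have "L2_inner M ?w ?w = L2_inner M ?Sv ?w"
    by (rule L2_inner_cong_AE(2)[OF eqv L2_meas[OF wL] L2_meas[OF wL] L2_meas[OF SvL]])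
  also have "\<dots> = L2_inner M ?Sv f - L2_inner M ?Sv u" by (rule L.lin_diff[OF SvL fL uL])
  also have "\<dots> = L2_inner M v ?k - L2_inner M v ?Su" by (simp only: sym[OF f] sym[OF uF])
  also have "L2_inner M v ?Su = L2_inner M v ?k"
    by (rule L2_inner_cong_AE(1)[OF equ L2_meas[OF vL] L2_meas[OF SuL] L2_meas[OF kL]])
  finally have "(LINT x|M. (cmod (?w x))\<^sup>2) = 0" using L2_inner_self[of M ?w] by simp
  moreover have "integrable M (\<lambda>x. (cmod (?w x))\<^sup>2)" using wL by (simp add: L2_fun_def)
  ultimately have "AE x in M. (cmod (?w x))\<^sup>2 = 0" by (simp add: integral_nonneg_eq_0_iff_AE)
  then have "AE x in M. u x = f x" by eventually_elim simp
  then show ?thesis by (rule closure_cong_AE[OF u(2) _ fL])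
qed

text \<open>A pair in \<open>form_operator\<close> is tested with D only, which is enough for
  \<open>adjoint\<close> to identify it. Conversely f in F lies in the closure by
  \<open>F_in_closure\<close>, and \<open>green\<close> evaluates the form against it.\<close>

theorem form_operator_eq: "form_operator M D t = {(L2_class M f, L2_class M (Tm f)) | f. f \<in> F}"
proof (rule set_eqI, rule iffI)
  fix p assume "p \<in> form_operator M D t"
  then obtain f h where p: "p = (L2_class M f, L2_class M h)" and f: "f \<in> form_closure_dom M D t" and h: "h \<in> L2_fun M"
    and eq: "\<And>g. g \<in> form_closure_dom M D t \<Longrightarrow> form_closure M D t g f = L2_inner M g h"
    unfolding form_operator_def by blast
  have fL: "f \<in> L2_fun M" using f form_convergentD(2) by (auto simp: form_closure_dom_def)
  have "L2_inner M (T g) f = L2_inner M g h" if g: "g \<in> D" for g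
  proof -
    have "form_closure M D t g f = L2_inner M (T g) f"
    proof (rule form_closure_eqI[OF D_closure[OF g] f])
      fix \<xi> \<phi> assume \<xi>: "form_convergent M D t \<xi> g" and \<phi>: "form_convergent M D t \<phi> f"
      note a = form_convergentD[OF \<xi>] and b = form_convergentD[OF \<phi>]
      show "(\<lambda>n. t (\<xi> n) (\<phi> n)) \<longlonglongrightarrow> L2_inner M (T g) f"
      \<comment> \<open>\<xi> n is sent to g first, while T still acts on \<phi> m in D; then
        symmetry moves T to g.\<close>
      proof (rule double_limit[OF \<xi> \<phi>])
        show "(\<lambda>n. t (\<xi> n) (\<phi> m)) \<longlonglongrightarrow> L2_inner M (T g) (\<phi> m)" for m
          unfolding T_sym[OF g b(1), symmetric]
          by (rule L_lim(2)[OF L2[OF a(1)] L2[OF g] a(3) T_L2[OF b(1)]])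
        show "(\<lambda>m. L2_inner M (T g) (\<phi> m)) \<longlonglongrightarrow> L2_inner M (T g) f"
          by (rule L_lim(1)[OF L2[OF b(1)] fL b(3) T_L2[OF g]])
      qed
    qed
    then show ?thesis using eq[OF D_closure[OF g]] by simp
  qed
  from adjoint[OF fL h this] obtain g where g: "g \<in> Dm" "AE x in M. f x = g x" "AE x in M. h x = Tm g x" by blast
  have "g \<in> form_closure_dom M D t" by (rule closure_cong_AE[OF f g(2)]) (use g Dm_L2 in auto)
  then have "g \<in> F" by (rule F_closure[OF g(1)])
  moreover have "L2_class M f = L2_class M g" "L2_class M h = L2_class M (Tm g)"
    using L2_class_eq_iff[OF fL] L2_class_eq_iff[OF h] g(2,3) by auto
  ultimately show "p \<in> {(L2_class M f, L2_class M (Tm f)) | f. f \<in> F}" using p by auto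
next
  fix p assume "p \<in> {(L2_class M f, L2_class M (Tm f)) | f. f \<in> F}"
  then obtain f where p: "p = (L2_class M f, L2_class M (Tm f))" and f: "f \<in> F" by blast
  have fm: "f \<in> Dm" using f F_Dm by blast
  have fL: "f \<in> L2_fun M" using fm Dm_L2 by blast
  have fQ: "f \<in> form_closure_dom M D t" by (rule F_in_closure[OF f])
  have "form_closure M D t g f = L2_inner M g (Tm f)" if g: "g \<in> form_closure_dom M D t" for g
  proof (rule form_closure_eqI[OF g fQ])
    fix \<xi> \<phi> assume \<xi>: "form_convergent M D t \<xi> g" and \<phi>: "form_convergent M D t \<phi> f"
    note a = form_convergentD[OF \<xi>] and b = form_convergentD[OF \<phi>]
    show "(\<lambda>n. t (\<xi> n) (\<phi> n)) \<longlonglongrightarrow> L2_inner M g (Tm f)"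
    \<comment> \<open>Now g is a general element of the form domain, so \<phi> m is sent to f first
      and \<open>green\<close> moves the operator from \<xi> n to f.\<close>
    proof (rule double_limit'[OF \<xi> \<phi>])
      show "(\<lambda>m. t (\<xi> n) (\<phi> m)) \<longlonglongrightarrow> L2_inner M (\<xi> n) (Tm f)" for n
        unfolding T_sym[OF a(1) b(1)] green[OF a(1) fm, symmetric]
        by (rule L_lim(1)[OF L2[OF b(1)] fL b(3) T_L2[OF a(1)]])
      show "(\<lambda>n. L2_inner M (\<xi> n) (Tm f)) \<longlonglongrightarrow> L2_inner M g (Tm f)"
        by (rule L_lim(2)[OF L2[OF a(1)] a(2) a(3) Tm_L2[OF fm]])
    qed
  qed
  then show "p \<in> form_operator M D t"
    unfolding form_operator_def using p fQ Tm_L2[OF fm] by blast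
qed

end

text \<open>Monotone convergence along exhausting compact intervals.\<close>

lemma integrable_of_local_bound:
  fixes f :: "real \<Rightarrow> real"
  assumes ab: "a < b" and f: "loc_integrable_on (einterval a b) f" "\<And>x. x \<in> einterval a b \<Longrightarrow> 0 \<le> f x"
    and B: "\<And>c d. c \<le> d \<Longrightarrow> {c..d} \<subseteq> einterval a b \<Longrightarrow> integral {c..d} f \<le> B"
  shows "integrable (lebesgue_on (einterval a b)) f"
proof -
  let ?I = "einterval a b" and ?\<Lambda> = "lebesgue_on (einterval a b)"
  obtain U L where ul: "?I = (\<Union>i. {L i .. U i :: real})" "\<And>i::nat. L i < U i" "incseq U" "decseq L"
    by (rule einterval_Icc_approximation[OF ab]) (rule that; assumption)
  have sub: "{L i..U i} \<subseteq> ?I" for i unfolding ul(1) by blast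
  let ?f = "\<lambda>(i::nat) x. indicator {L i..U i} x *\<^sub>R f x"
  have ai: "?f i absolutely_integrable_on {L i..U i}" for i
    by (rule absolutely_integrable_spike[OF loc_integrable_onD(1)[OF f(1) sub], of "{}"]) auto
  have int: "integrable ?\<Lambda> (?f i)" "integral\<^sup>L ?\<Lambda> (?f i) = integral {L i..U i} (?f i)" for i
    using supported_integral[OF sub[of i], of "?f i"] ai by auto
  have le: "integral\<^sup>L ?\<Lambda> (?f i) \<le> B" for i
  proof -
    have "integral {L i..U i} (?f i) = integral {L i..U i} f" by (rule integral_cong) simp
    then show ?thesis using int(2) B[OF less_imp_le[OF ul(2)] sub, of i] by simp
  qed
  have mono: "{L i..U i} \<subseteq> {L j..U j}" if "i \<le> j" for i j
    using incseqD[OF ul(3) that] decseqD[OF ul(4) that] by auto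
  have inc: "?f i x \<le> ?f j x" if "i \<le> j" "x \<in> ?I" for i j x
    using mono[OF that(1)] f(2)[OF that(2)] by (auto simp: indicator_def)
  have "incseq (\<lambda>i. integral\<^sup>L ?\<Lambda> (?f i))"
    unfolding incseq_def
  proof (intro allI impI integral_mono int)
    fix m n :: nat and x assume "m \<le> n" "x \<in> space ?\<Lambda>"
    then show "?f m x \<le> ?f n x" by (intro inc) auto
  qed
  then obtain l where l: "(\<lambda>i. integral\<^sup>L ?\<Lambda> (?f i)) \<longlonglongrightarrow> l"
    using le by (metis (mono_tags, lifting) incseq_convergent)
  show ?thesis
  proof (rule integrable_monotone_convergence[OF int(1) _ _ l])
    show "AE x in ?\<Lambda>. mono (\<lambda>i. ?f i x)" 
    proof (rule AE_I2, rule monoI)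
      fix x and i j :: nat assume "x \<in> space ?\<Lambda>" "i \<le> j"
      then show "?f i x \<le> ?f j x" by (intro inc) auto
    qed
    show "AE x in ?\<Lambda>. (\<lambda>i. ?f i x) \<longlonglongrightarrow> f x"
    proof (rule AE_I2)
      fix x assume "x \<in> space ?\<Lambda>"
      then have "x \<in> ?I" by simp
      then obtain i where i: "x \<in> {L i..U i}" unfolding ul(1) by blast
      then have "x \<in> {L j..U j}" if "i \<le> j" for j using mono[OF that] by blast
      then have "eventually (\<lambda>j. ?f j x = f x) sequentially"
        unfolding eventually_sequentially by (intro exI[of _ i]) simp
      then show "(\<lambda>i. ?f i x) \<longlonglongrightarrow> f x" by (rule tendsto_eventually)
    qed
    show "f \<in> borel_measurable ?\<Lambda>" by (rule loc_integrable_on_measurable[OF f(1) ab])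
  qed
qed

section \<open>Green's identity and completeness of the form norm\<close>

context sl_ends
begin

lemma slc_diff:
  assumes "slc \<phi>1 \<psi>1 \<kappa>1" "slc \<phi>2 \<psi>2 \<kappa>2"
  shows "slc (\<lambda>x. \<phi>1 x - \<phi>2 x) (\<lambda>x. \<psi>1 x - \<psi>2 x) (\<lambda>x. \<kappa>1 x - \<kappa>2 x)"
  using primitive_on_diff[OF slcD(1)[OF assms(1)] slcD(1)[OF assms(2)]]
    primitive_on_diff[OF slcD(2)[OF assms(1)] slcD(2)[OF assms(2)]]
  by (simp add: slc_def algebra_simps)

lemma local_le_global:
  fixes f :: "real \<Rightarrow> real"
  assumes "integrable \<Lambda> f" "\<And>x. x \<in> I \<Longrightarrow> 0 \<le> f x" and cd: "{c..d} \<subseteq> I" and ai: "f absolutely_integrable_on {c..d}"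
  shows "integral {c..d} f \<le> integral\<^sup>L \<Lambda> f"
proof -
  let ?f = "\<lambda>x. indicator {c..d} x *\<^sub>R f x"
  have eq: "integral {c..d} ?f = integral {c..d} f" by (rule integral_cong) simp
  have ai: "?f absolutely_integrable_on {c..d}"
    by (rule absolutely_integrable_spike[OF ai, of "{}"]) auto
  have *: "integral {c..d} ?f = integral\<^sup>L \<Lambda> ?f" "integrable \<Lambda> ?f"
    using supported_integral[OF cd, of ?f] ai by auto
  have "integral\<^sup>L \<Lambda> ?f \<le> integral\<^sup>L \<Lambda> f"
    by (rule integral_mono[OF *(2) assms(1)]) (use assms(2) in \<open>auto simp: indicator_def\<close>)
  with * eq show ?thesis by simp
qed

lemma slc_green:
  assumes 1: "slc \<phi>1 \<psi>1 \<kappa>1" and 2: "slc \<phi>2 \<psi>2 \<kappa>2"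
    and cd: "{c..d} \<subseteq> I" and supp: "\<And>x. x \<in> I \<Longrightarrow> x \<notin> {c..d} \<Longrightarrow> \<phi>1 x = 0"
    and \<kappa>: "\<And>x. x \<in> I \<Longrightarrow> x \<notin> {c..d} \<Longrightarrow> \<kappa>1 x = 0"
  shows "(LINT x|\<Lambda>. R x *\<^sub>R (cnj (\<kappa>1 x) * \<phi>2 x - cnj (\<phi>1 x) * \<kappa>2 x)) = 0"
proof -
  \<comment> \<open>The boundary terms are evaluated strictly outside [c,d]; if c > d, any one-point
    interval will do.\<close>
  obtain u v where uv: "u \<in> I" "v \<in> I" "u \<le> v" "{c..d} \<subseteq> {u<..<v}"
  proof (cases "c \<le> d")
    case True
    then have "c \<in> I" "d \<in> I" using cd by auto
    obtain e where e: "e > 0" "cball c e \<subseteq> I" using \<open>c \<in> I\<close> by (meson open_contains_cball open_einterval)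
    obtain f where f: "f > 0" "cball d f \<subseteq> I" using \<open>d \<in> I\<close> by (meson open_contains_cball open_einterval)
    have "c - e \<in> I" using e by (auto simp: dist_real_def intro!: subsetD[OF e(2)])
    moreover have "d + f \<in> I" using f by (auto simp: dist_real_def intro!: subsetD[OF f(2)])
    moreover have "{c..d} \<subseteq> {c - e<..<d + f}" using e(1) f(1) by auto
    ultimately show thesis using e(1) f(1) True by (intro that[of "c - e" "d + f"]) auto
  next
    case False
    obtain x where "x \<in> I" using einterval_nonempty[OF ab] by blast
    then show thesis using that[of x x] False by auto
  qed
  have sub: "{u..v} \<subseteq> I" by (rule einterval_Icc_subset[OF uv(1,2)])
  have out: "\<phi>1 x = 0" "\<psi>1 x = 0" if "x \<in> I" "x \<notin> {u<..<v}" for x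
  proof -
    have x: "x \<notin> {c..d}" using that(2) uv(4) by blast
    show "\<phi>1 x = 0" by (rule supp[OF that(1) x])
    show "\<psi>1 x = 0" by (rule slc_support[OF 1 supp that(1) x])
  qed
  note p = primitive_onD[OF lagrange_identity[OF 1 2] uv(3) sub]
  have "(LINT x|\<Lambda>. R x *\<^sub>R (cnj (\<kappa>1 x) * \<phi>2 x - cnj (\<phi>1 x) * \<kappa>2 x)) =
      integral {u..v} (\<lambda>x. R x *\<^sub>R (cnj (\<kappa>1 x) * \<phi>2 x - cnj (\<phi>1 x) * \<kappa>2 x))"
  proof (rule supported_integral(2)[OF sub _ p(1)])
    fix x assume x: "x \<in> I" "x \<notin> {u..v}"
    then have "x \<notin> {c..d}" using uv(4) by auto
    then show "R x *\<^sub>R (cnj (\<kappa>1 x) * \<phi>2 x - cnj (\<phi>1 x) * \<kappa>2 x) = 0" using supp \<kappa> x by simp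
  qed
  also have "\<dots> = 0" using p(2) out[of u] out[of v] uv by simp
  finally show ?thesis .
qed

text \<open>\<open>sup_bound\<close> turns the Cauchy condition into locally uniform convergence,
  which produces the limit as a continuous function; Fatou's lemma then gives convergence in the
  weighted norm. The local bounds are there for \<open>energy_lsc\<close>.\<close>

lemma complete:
  assumes s: "\<And>n. slc (\<phi> n) (\<psi> n) (\<kappa> n)"
    and int: "\<And>m n. integrable \<Lambda> (\<lambda>x. \<omega> x * (cmod (\<psi> m x - \<psi> n x))\<^sup>2)"
      "\<And>m n. integrable \<Lambda> (\<lambda>x. R x * (cmod (\<phi> m x - \<phi> n x))\<^sup>2)"
    and cauchy: "\<And>\<epsilon>. \<epsilon> > 0 \<Longrightarrow> \<exists>N. \<forall>m\<ge>N. \<forall>n\<ge>N.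
      energy (\<lambda>x. \<psi> m x - \<psi> n x) + mass (\<lambda>x. \<phi> m x - \<phi> n x) < \<epsilon>"
  obtains f where "continuous_on I f" "\<And>x. x \<in> I \<Longrightarrow> (\<lambda>n. \<phi> n x) \<longlonglongrightarrow> f x"
    "\<And>c d. c < d \<Longrightarrow> {c..d} \<subseteq> I \<Longrightarrow> \<exists>K. \<forall>n. \<forall>x\<in>{c..d}. cmod (\<phi> n x) \<le> K"
    "\<And>n. integrable \<Lambda> (\<lambda>x. R x * (cmod (\<phi> n x - f x))\<^sup>2)"
    "(\<lambda>n. LINT x|\<Lambda>. R x * (cmod (\<phi> n x - f x))\<^sup>2) \<longlonglongrightarrow> 0"
proof -
  note \<phi>c = slcD(3)[OF s] and \<psi>c = slcD(4)[OF s]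
  have unif: "\<exists>N. \<forall>m\<ge>N. \<forall>n\<ge>N. \<forall>x\<in>{c..d}. cmod (\<phi> m x - \<phi> n x) < \<epsilon>"
    if cd: "c < d" "{c..d} \<subseteq> I" and \<epsilon>: "\<epsilon> > 0" for c d \<epsilon>
  proof -
    obtain C where C: "C \<ge> 0" "\<And>(\<phi> :: real \<Rightarrow> complex) \<psi> x. primitive_on I \<phi> (\<lambda>x. \<omega> x *\<^sub>R \<psi> x) \<Longrightarrow> continuous_on I \<psi> \<Longrightarrow> x \<in> {c..d} \<Longrightarrow>
      (cmod (\<phi> x))\<^sup>2 \<le> 1 * integral {c..d} (\<lambda>x. \<omega> x * (cmod (\<psi> x))\<^sup>2) + C * integral {c..d} (\<lambda>x. R x * (cmod (\<phi> x))\<^sup>2)"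
      by (rule sup_bound[OF cd zero_less_one]) (rule that; assumption)
    have "\<epsilon>\<^sup>2 / (1 + C) > 0" using \<epsilon> C(1) by simp
    from cauchy[OF this] obtain N where N: "\<And>m n. m \<ge> N \<Longrightarrow> n \<ge> N \<Longrightarrow>
      energy (\<lambda>x. \<psi> m x - \<psi> n x) + mass (\<lambda>x. \<phi> m x - \<phi> n x) < \<epsilon>\<^sup>2 / (1 + C)" by blast
    have "cmod (\<phi> m x - \<phi> n x) < \<epsilon>" if mn: "m \<ge> N" "n \<ge> N" and x: "x \<in> {c..d}" for m n x
    proof -
      note d = slc_diff[OF s[of m] s[of n]]
      let ?E = "energy (\<lambda>x. \<psi> m x - \<psi> n x)" and ?M = "mass (\<lambda>x. \<phi> m x - \<phi> n x)"
      have "(cmod (\<phi> m x - \<phi> n x))\<^sup>2 \<le> 1 * integral {c..d} (\<lambda>x. \<omega> x * (cmod (\<psi> m x - \<psi> n x))\<^sup>2)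
          + C * integral {c..d} (\<lambda>x. R x * (cmod (\<phi> m x - \<phi> n x))\<^sup>2)"
        by (rule C(2)[OF slcD(1)[OF d] slcD(4)[OF d] x])
      also have "\<dots> \<le> 1 * ?E + C * ?M"
        unfolding energy_def mass_def
        by (intro add_mono mult_left_mono local_le_global int energy_integrable slcD[OF d] cd C(1)) (auto simp: nonneg)
      also have "\<dots> \<le> (1 + C) * (?E + ?M)"
        using C(1) quantities_nonneg(1)[of "\<lambda>x. \<psi> m x - \<psi> n x"] quantities_nonneg(3)[of "\<lambda>x. \<phi> m x - \<phi> n x"]
        by (simp add: algebra_simps)
      also have "\<dots> < (1 + C) * (\<epsilon>\<^sup>2 / (1 + C))" using N[OF mn] C(1) by (intro mult_strict_left_mono) auto
      also have "\<dots> = \<epsilon>\<^sup>2" using C(1) by simp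
      finally show ?thesis by (rule power2_less_imp_less) (use \<epsilon> in simp)
    qed
    then show ?thesis by blast
  qed
  have nbhd: "\<exists>c d. c < x \<and> x < d \<and> {c..d} \<subseteq> I" if "x \<in> I" for x
  proof -
    have "\<exists>e>0. cball x e \<subseteq> I" using that by (simp only: open_contains_cball_eq[OF open_einterval])
    then obtain e where e: "e > 0" "cball x e \<subseteq> I" by (elim exE conjE)
    then have "{x - e..x + e} \<subseteq> I" by (simp only: cball_eq_atLeastAtMost)
    with e(1) show ?thesis by (intro exI[of _ "x - e"] exI[of _ "x + e"]) simp
  qed
  have "\<exists>l. (\<lambda>n. \<phi> n x) \<longlonglongrightarrow> l" if x: "x \<in> I" for x
  proof -
    obtain c d where cd: "c < x" "x < d" "{c..d} \<subseteq> I" using nbhd[OF x] by blast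
    have "Cauchy (\<lambda>n. \<phi> n x)"
    proof (rule CauchyI)
      fix e :: real assume "e > 0"
      have "c < d" using cd by simp
      from unif[OF \<open>c < d\<close> cd(3) \<open>e > 0\<close>] obtain N where "\<forall>m\<ge>N. \<forall>n\<ge>N. \<forall>x\<in>{c..d}. cmod (\<phi> m x - \<phi> n x) < e" by (rule exE)
      moreover have "x \<in> {c..d}" using cd by simp
      ultimately show "\<exists>M. \<forall>m\<ge>M. \<forall>n\<ge>M. norm (\<phi> m x - \<phi> n x) < e" by blast
    qed
    then show ?thesis by (simp add: Cauchy_convergent_iff convergent_def)
  qed
  then obtain f where f: "\<And>x. x \<in> I \<Longrightarrow> (\<lambda>n. \<phi> n x) \<longlonglongrightarrow> f x" by metis
  have ul: "uniform_limit {c..d} \<phi> f sequentially" if cd: "c < d" "{c..d} \<subseteq> I" for c d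
  proof (rule uniform_limitI)
    fix e :: real assume e: "e > 0"
    then have "e / 2 > 0" by simp
    from unif[OF cd this] obtain N where N: "\<And>m n x. m \<ge> N \<Longrightarrow> n \<ge> N \<Longrightarrow> x \<in> {c..d} \<Longrightarrow> cmod (\<phi> m x - \<phi> n x) < e / 2" by blast
    have "dist (\<phi> n x) (f x) < e" if n: "n \<ge> N" and x: "x \<in> {c..d}" for n x
    proof -
      have "(\<lambda>m. cmod (\<phi> n x - \<phi> m x)) \<longlonglongrightarrow> cmod (\<phi> n x - f x)"
        using x cd by (intro tendsto_intros f) auto
      then have "cmod (\<phi> n x - f x) \<le> e / 2"
        by (rule LIMSEQ_le_const2) (use N[OF n _ x] less_imp_le in blast)
      then show ?thesis using e by (simp add: dist_norm)
    qed
    then show "\<forall>\<^sub>F n in sequentially. \<forall>x\<in>{c..d}. dist (\<phi> n x) (f x) < e"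
      unfolding eventually_sequentially by blast
  qed
  have fc: "continuous_on I f"
  proof (rule continuous_at_imp_continuous_on, rule ballI)
    fix x assume "x \<in> I"
    then obtain c d where cd: "c < x" "x < d" "{c..d} \<subseteq> I" using nbhd by blast
    have "continuous_on {c..d} f"
    proof (rule uniform_limit_theorem[OF _ ul])
      show "\<forall>\<^sub>F n in sequentially. continuous_on {c..d} (\<phi> n)"
        using continuous_on_subset[OF \<phi>c cd(3)] by simp
    qed (use cd in auto)
    then have "continuous_on {c<..<d} f" by (rule continuous_on_subset) auto
    then show "isCont f x" using cd by (simp add: continuous_on_eq_continuous_at)
  qed
  have bdd: "\<exists>K. \<forall>n. \<forall>x\<in>{c..d}. cmod (\<phi> n x) \<le> K" if cd: "c < d" "{c..d} \<subseteq> I" for c d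
  proof -
    from unif[OF cd zero_less_one] obtain N where N: "\<And>n x. n \<ge> N \<Longrightarrow> x \<in> {c..d} \<Longrightarrow> cmod (\<phi> n x - \<phi> N x) < 1" by blast
    have "\<exists>K. \<forall>x\<in>{c..d}. cmod (\<phi> n x) \<le> K" for n
    proof -
      have "bounded (\<phi> n ` {c..d})"
        by (intro compact_imp_bounded compact_continuous_image continuous_on_subset[OF \<phi>c cd(2)]) simp
      then show ?thesis unfolding bounded_iff by blast
    qed
    then obtain K where K: "\<And>n x. x \<in> {c..d} \<Longrightarrow> cmod (\<phi> n x) \<le> K n" by metis
    have "cmod (\<phi> n x) \<le> Max (K ` {..N}) + 1" if x: "x \<in> {c..d}" for n x
    proof (cases "n \<le> N")
      case True
      then have "K n \<le> Max (K ` {..N})" by (intro Max_ge) auto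
      then show ?thesis using K[OF x, of n] by linarith
    next
      case False
      have "K N \<le> Max (K ` {..N})" by (intro Max_ge) auto
      moreover have "cmod (\<phi> n x) \<le> cmod (\<phi> N x) + cmod (\<phi> n x - \<phi> N x)" using norm_triangle_sub by blast
      moreover have "cmod (\<phi> N x) \<le> K N" "cmod (\<phi> n x - \<phi> N x) < 1" using K[OF x] N[OF _ x] False by auto
      ultimately show ?thesis by linarith
    qed
    then show ?thesis by blast
  qed
  have meas1: "(\<lambda>x. R x * (cmod (\<phi> n x - g x))\<^sup>2) \<in> borel_measurable \<Lambda>" if "continuous_on I g" for n and g
    using meas(3) continuous_measurable[OF \<phi>c, of n] continuous_measurable[OF that] by measurable
  \<comment> \<open>Fatou's lemma in the index m, with n fixed.\<close>
  have fatou: "integrable \<Lambda> (\<lambda>x. R x * (cmod (\<phi> n x - f x))\<^sup>2) \<and> (LINT x|\<Lambda>. R x * (cmod (\<phi> n x - f x))\<^sup>2) \<le> \<epsilon>"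
    if n: "\<And>m. m \<ge> N \<Longrightarrow> mass (\<lambda>x. \<phi> m x - \<phi> n x) \<le> \<epsilon>" and \<epsilon>: "0 \<le> \<epsilon>" for n N \<epsilon>
  proof -
    have le: "(\<integral>\<^sup>+x. ennreal (R x * (cmod (\<phi> n x - \<phi> m x))\<^sup>2) \<partial>\<Lambda>) \<le> ennreal \<epsilon>" if "m \<ge> N" for m
    proof -
      have "(\<integral>\<^sup>+x. ennreal (R x * (cmod (\<phi> n x - \<phi> m x))\<^sup>2) \<partial>\<Lambda>) = ennreal (LINT x|\<Lambda>. R x * (cmod (\<phi> n x - \<phi> m x))\<^sup>2)"
        by (rule nn_integral_eq_integral[OF int(2)]) (simp add: nonneg)
      then show ?thesis using n[OF that] by (simp add: mass_def norm_minus_commute ennreal_leI)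
    qed
    have "(\<integral>\<^sup>+x. ennreal (R x * (cmod (\<phi> n x - f x))\<^sup>2) \<partial>\<Lambda>) =
        (\<integral>\<^sup>+x. liminf (\<lambda>m. ennreal (R x * (cmod (\<phi> n x - \<phi> m x))\<^sup>2)) \<partial>\<Lambda>)"
    proof (rule nn_integral_cong)
      fix x assume "x \<in> space \<Lambda>"
      then have x: "x \<in> I" by simp
      have "(\<lambda>m. ennreal (R x * (cmod (\<phi> n x - \<phi> m x))\<^sup>2)) \<longlonglongrightarrow> ennreal (R x * (cmod (\<phi> n x - f x))\<^sup>2)"
        by (intro tendsto_ennrealI tendsto_intros f x)
      then show "ennreal (R x * (cmod (\<phi> n x - f x))\<^sup>2) = liminf (\<lambda>m. ennreal (R x * (cmod (\<phi> n x - \<phi> m x))\<^sup>2))"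
        using lim_imp_Liminf[OF sequentially_bot] by metis
    qed
    also have "\<dots> \<le> liminf (\<lambda>m. \<integral>\<^sup>+x. ennreal (R x * (cmod (\<phi> n x - \<phi> m x))\<^sup>2) \<partial>\<Lambda>)"
      by (rule nn_integral_liminf) (use meas1[OF \<phi>c] in measurable)
    also have "\<dots> \<le> limsup (\<lambda>m. \<integral>\<^sup>+x. ennreal (R x * (cmod (\<phi> n x - \<phi> m x))\<^sup>2) \<partial>\<Lambda>)"
      by (rule Liminf_le_Limsup) simp
    also have "\<dots> \<le> ennreal \<epsilon>"
      by (rule Limsup_bounded) (use le in \<open>auto simp: eventually_sequentially\<close>)
    finally have fin: "(\<integral>\<^sup>+x. ennreal (R x * (cmod (\<phi> n x - f x))\<^sup>2) \<partial>\<Lambda>) \<le> ennreal \<epsilon>" .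
    have i: "integrable \<Lambda> (\<lambda>x. R x * (cmod (\<phi> n x - f x))\<^sup>2)"
      by (rule integrableI_nonneg[OF meas1[OF fc]]) (use le_less_trans[OF fin ennreal_less_top] in \<open>auto simp: nonneg\<close>)
    have "ennreal (LINT x|\<Lambda>. R x * (cmod (\<phi> n x - f x))\<^sup>2) = (\<integral>\<^sup>+x. ennreal (R x * (cmod (\<phi> n x - f x))\<^sup>2) \<partial>\<Lambda>)"
      by (rule nn_integral_eq_integral[OF i, symmetric]) (simp add: nonneg)
    with fin have "ennreal (LINT x|\<Lambda>. R x * (cmod (\<phi> n x - f x))\<^sup>2) \<le> ennreal \<epsilon>" by simp
    then show ?thesis using i by (simp add: ennreal_le_iff[OF \<epsilon>])
  qed
  have mass_small: "\<exists>N. \<forall>m\<ge>N. \<forall>n\<ge>N. mass (\<lambda>x. \<phi> m x - \<phi> n x) < \<epsilon>" if "\<epsilon> > 0" for \<epsilon>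
    using cauchy[OF that] quantities_nonneg(1) by (meson le_add_same_cancel2 le_less_trans)
  have lim0: "(\<lambda>n. LINT x|\<Lambda>. R x * (cmod (\<phi> n x - f x))\<^sup>2) \<longlonglongrightarrow> 0"
  proof (rule LIMSEQ_I)
    fix r :: real assume r: "r > 0"
    then obtain N where N: "\<And>m n. m \<ge> N \<Longrightarrow> n \<ge> N \<Longrightarrow> mass (\<lambda>x. \<phi> m x - \<phi> n x) < r / 2" using mass_small[of "r / 2"] by auto
    have "norm ((LINT x|\<Lambda>. R x * (cmod (\<phi> n x - f x))\<^sup>2) - 0) < r" if "n \<ge> N" for n
    proof -
      have "(LINT x|\<Lambda>. R x * (cmod (\<phi> n x - f x))\<^sup>2) \<le> r / 2"
        using fatou[of N n "r / 2"] N that r by (simp add: less_imp_le)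
      moreover have "0 \<le> (LINT x|\<Lambda>. R x * (cmod (\<phi> n x - f x))\<^sup>2)"
        by (intro integral_nonneg_AE AE_I2) (simp add: nonneg)
      ultimately show ?thesis using r by simp
    qed
    then show "\<exists>no. \<forall>n\<ge>no. norm ((LINT x|\<Lambda>. R x * (cmod (\<phi> n x - f x))\<^sup>2) - 0) < r" by blast
  qed
  \<comment> \<open>For every n and not only for large ones: the distance to \<phi> n is bounded
    through a fixed \<phi> N.\<close>
  have intf: "integrable \<Lambda> (\<lambda>x. R x * (cmod (\<phi> n x - f x))\<^sup>2)" for n
  proof -
    obtain N where N: "\<And>m n. m \<ge> N \<Longrightarrow> n \<ge> N \<Longrightarrow> mass (\<lambda>x. \<phi> m x - \<phi> n x) < 1" using mass_small[of 1] by auto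
    have "mass (\<lambda>x. \<phi> m x - \<phi> n x) \<le> 2 * 1 + 2 * mass (\<lambda>x. \<phi> N x - \<phi> n x)" if "m \<ge> N" for m
    proof -
      have "mass (\<lambda>x. \<phi> m x - \<phi> n x) \<le> (LINT x|\<Lambda>. 2 * (R x * (cmod (\<phi> m x - \<phi> N x))\<^sup>2) + 2 * (R x * (cmod (\<phi> N x - \<phi> n x))\<^sup>2))"
        unfolding mass_def
      proof (rule integral_mono)
        show "integrable \<Lambda> (\<lambda>x. R x * (cmod (\<phi> m x - \<phi> n x))\<^sup>2)" by (rule int(2))
        show "integrable \<Lambda> (\<lambda>x. 2 * (R x * (cmod (\<phi> m x - \<phi> N x))\<^sup>2) + 2 * (R x * (cmod (\<phi> N x - \<phi> n x))\<^sup>2))"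
          by (intro Bochner_Integration.integrable_add integrable_mult_right int(2))
        fix x
        have "(cmod (\<phi> m x - \<phi> n x))\<^sup>2 \<le> (cmod (\<phi> m x - \<phi> N x) + cmod (\<phi> N x - \<phi> n x))\<^sup>2"
          using norm_triangle_ineq[of "\<phi> m x - \<phi> N x" "\<phi> N x - \<phi> n x"] by (intro power_mono) auto
        also have "\<dots> \<le> 2 * (cmod (\<phi> m x - \<phi> N x))\<^sup>2 + 2 * (cmod (\<phi> N x - \<phi> n x))\<^sup>2"
          using sum_squares_bound[of "cmod (\<phi> m x - \<phi> N x)" "cmod (\<phi> N x - \<phi> n x)"] by (simp add: power2_sum)
        finally show "R x * (cmod (\<phi> m x - \<phi> n x))\<^sup>2 \<le> 2 * (R x * (cmod (\<phi> m x - \<phi> N x))\<^sup>2) + 2 * (R x * (cmod (\<phi> N x - \<phi> n x))\<^sup>2)"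
          using mult_left_mono[OF _ nonneg(2)[of x]] by (fastforce simp: algebra_simps)
      qed
      also have "\<dots> = 2 * mass (\<lambda>x. \<phi> m x - \<phi> N x) + 2 * mass (\<lambda>x. \<phi> N x - \<phi> n x)"
        unfolding mass_def by (subst Bochner_Integration.integral_add) (auto intro!: int(2))
      finally show ?thesis using N[OF that, of N] by simp
    qed
    from fatou[OF this] show ?thesis using quantities_nonneg(3)[of "\<lambda>x. \<phi> N x - \<phi> n x"] by simp
  qed
  show thesis by (rule that[OF fc f bdd intf lim0])
qed

end

section \<open>Sturm-Liouville operators\<close>

text \<open>Replaces the filter by a point of (a,b), for finite and infinite endpoints
  alike.\<close>

lemma eventually_near_left_end:
  assumes "a < b"
  shows "eventually P (near_left_end a) \<longleftrightarrow> (\<exists>c\<in>einterval a b. \<forall>x. a < ereal x \<and> x < c \<longrightarrow> P x)"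
proof
  assume "eventually P (near_left_end a)"
  then obtain Q where Q: "eventually Q (at_right a)" "\<And>x. Q (ereal x) \<Longrightarrow> P x"
    unfolding near_left_end_def eventually_filtercomap by blast
  from Q(1) obtain e where e: "e > a" "\<And>y. a < y \<Longrightarrow> y < e \<Longrightarrow> Q y"
    using eventually_at_right[OF assms, of Q] by blast
  have "a < min e b" using assms e(1) by simp
  then obtain c where c: "a < ereal c" "ereal c < min e b" using ereal_dense2 by blast
  have "P x" if x: "a < ereal x" "x < c" for x
  proof -
    have "ereal x < e" using x(2) c(2) by (metis ereal_less_eq(3) less_imp_le le_less_trans min_less_iff_conj)
    then show ?thesis using e(2) Q(2) x(1) by blast
  qed
  then show "\<exists>c\<in>einterval a b. \<forall>x. a < ereal x \<and> x < c \<longrightarrow> P x"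
    using c by (intro bexI[of _ c]) (auto simp: einterval_iff)
next
  assume "\<exists>c\<in>einterval a b. \<forall>x. a < ereal x \<and> x < c \<longrightarrow> P x"
  then obtain c where c: "c \<in> einterval a b" "\<And>x. a < ereal x \<Longrightarrow> x < c \<Longrightarrow> P x" by blast
  have "eventually (\<lambda>y. a < y \<and> y < ereal c) (at_right a)"
    unfolding eventually_at_right[OF assms] using c(1) by (intro exI[of _ "ereal c"]) (auto simp: einterval_iff)
  then show "eventually P (near_left_end a)"
    unfolding near_left_end_def eventually_filtercomap using c(2) by (intro exI[of _ "\<lambda>y. a < y \<and> y < ereal c"]) auto
qed

lemma eventually_near_right_end:
  assumes "a < b"
  shows "eventually P (near_right_end b) \<longleftrightarrow> (\<exists>d\<in>einterval a b. \<forall>x. ereal x < b \<and> d < x \<longrightarrow> P x)"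
proof
  assume "eventually P (near_right_end b)"
  then obtain Q where Q: "eventually Q (at_left b)" "\<And>x. Q (ereal x) \<Longrightarrow> P x"
    unfolding near_right_end_def eventually_filtercomap by blast
  from Q(1) obtain e where e: "e < b" "\<And>y. e < y \<Longrightarrow> y < b \<Longrightarrow> Q y"
    using eventually_at_left[OF assms, of Q] by blast
  have "max e a < b" using assms e(1) by simp
  then obtain d where d: "max e a < ereal d" "ereal d < b" using ereal_dense2 by blast
  have "P x" if x: "ereal x < b" "d < x" for x
  proof -
    have "e < ereal x" using x(2) d(1) by (metis ereal_less_eq(3) less_imp_le less_le_trans max_less_iff_conj)
    then show ?thesis using e(2) Q(2) x(1) by blast
  qed
  then show "\<exists>d\<in>einterval a b. \<forall>x. ereal x < b \<and> d < x \<longrightarrow> P x"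
    using d by (intro bexI[of _ d]) (auto simp: einterval_iff)
next
  assume "\<exists>d\<in>einterval a b. \<forall>x. ereal x < b \<and> d < x \<longrightarrow> P x"
  then obtain d where d: "d \<in> einterval a b" "\<And>x. ereal x < b \<Longrightarrow> d < x \<Longrightarrow> P x" by blast
  have "eventually (\<lambda>y. ereal d < y \<and> y < b) (at_left b)"
    unfolding eventually_at_left[OF assms] using d(1) by (intro exI[of _ "ereal d"]) (auto simp: einterval_iff)
  then show "eventually P (near_right_end b)"
    unfolding near_right_end_def eventually_filtercomap using d(2) by (intro exI[of _ "\<lambda>y. ereal d < y \<and> y < b"]) auto
qed

text \<open>Used to assemble \<sigma> from its pieces near a, in the middle and near b. On the
  right-hand piece the density is changed at c only, which is negligible.\<close>

lemma primitive_on_glue: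
  assumes F: "primitive_on (S \<inter> {..c}) F f" and G: "primitive_on (S \<inter> {c..}) G g" and eq: "F c = G c"
  shows "primitive_on S (\<lambda>x. if x \<le> c then F x else G x) (\<lambda>x. if x \<le> c then f x else g x)"
  unfolding primitive_on_def
proof (intro allI impI, elim conjE)
  fix u v :: real assume uv: "u \<le> v" "{u..v} \<subseteq> S"
  let ?H = "\<lambda>x. if x \<le> c then F x else G x" and ?h = "\<lambda>x. if x \<le> c then f x else g x"
  have left: "?h absolutely_integrable_on {u..w} \<and> integral {u..w} ?h = ?H w - ?H u" if w: "u \<le> w" "w \<le> v" "w \<le> c" for w
  proof -
    have "{u..w} \<subseteq> S \<inter> {..c}" using uv(2) w by auto
    note p = primitive_onD[OF F w(1) this]
    have "?h absolutely_integrable_on {u..w}" by (rule absolutely_integrable_spike[OF p(1), of "{}"]) (use w in auto)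
    moreover have "integral {u..w} ?h = integral {u..w} f" by (rule integral_cong) (use w in auto)
    ultimately show ?thesis using p(2) w by simp
  qed
  have right: "?h absolutely_integrable_on {w..v} \<and> integral {w..v} ?h = ?H v - ?H w" if w: "u \<le> w" "w \<le> v" "c \<le> w" for w
  proof -
    have sub: "{w..v} \<subseteq> S \<inter> {c..}" using uv(2) w by auto
    note p = primitive_onD[OF G w(2) sub]
    have "?h absolutely_integrable_on {w..v}" by (rule absolutely_integrable_spike[OF p(1), of "{c}"]) (use w in auto)
    moreover have "integral {w..v} ?h = integral {w..v} g" by (rule integral_spike[of "{c}"]) (use w in auto)
    moreover have H: "?H x = G x" if "c \<le> x" for x using that eq by auto
    ultimately show ?thesis using p(2) by (simp only: H[OF w(3)] H[OF order_trans[OF w(3,2)]])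
  qed
  consider "v \<le> c" | "c \<le> u" | "u \<le> c" "c \<le> v" by linarith
  then show "?h absolutely_integrable_on {u..v} \<and> integral {u..v} ?h = ?H v - ?H u"
  proof cases
    case 1 then show ?thesis using left[of v] uv by simp
  next
    case 2 then show ?thesis using right[of u] uv by simp
  next
    case 3
    have l: "?h absolutely_integrable_on {u..c}" "integral {u..c} ?h = ?H c - ?H u" using left[of c] 3 by auto
    have r: "?h absolutely_integrable_on {c..v}" "integral {c..v} ?h = ?H v - ?H c" using right[of c] 3 by auto
    have "{u..v} = {u..c} \<union> {c..v}" using 3 by auto
    then have ai: "?h absolutely_integrable_on {u..v}" using set_integrable_Un[OF l(1) r(1)] by simp
    then have "?h integrable_on {u..v}" by (rule set_lebesgue_integral_eq_integral(1))
    from Henstock_Kurzweil_Integration.integral_combine[OF 3 this] show ?thesis using ai l(2) r(2) by (simp only:) simp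
  qed
qed

section \<open>The differential equation as a system and the weighted Hilbert space\<close>

context sturm_liouville
begin

abbreviation "I \<equiv> einterval a b"
abbreviation "\<Lambda> \<equiv> lebesgue_on (einterval a b)"

lemma loc: "loc_integrable_on I (\<lambda>x. inverse (p x))" "loc_integrable_on I q" "loc_integrable_on I r" "loc_integrable_on I s"
  using locally_integrable by (simp_all add: L1_loc_iff)

lemma quasi_deriv_works: "f \<in> D_tau \<Longrightarrow> is_quasi_deriv f (quasi_deriv f)"
  using someI_ex[of "is_quasi_deriv f"] by (auto simp: quasi_deriv_def D_tau_def)

lemma quasi_deriv_primitive:
  fixes f :: "real \<Rightarrow> 'a::euclidean_space"
  assumes f: "f \<in> D_tau"
  shows "primitive_on I f (\<lambda>x. inverse (p x) *\<^sub>R quasi_deriv f x - s x *\<^sub>R f x)"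
    and "primitive_on I (quasi_deriv f) (\<lambda>x. vector_derivative (quasi_deriv f) (at x))"
proof -
  have h: "quasi_deriv f \<in> AC_loc a b" "AE x in \<Lambda>. quasi_deriv f x = p x *\<^sub>R (vector_derivative f (at x) + s x *\<^sub>R f x)"
    using quasi_deriv_works[OF f] by (auto simp: is_quasi_deriv_def)
  show "primitive_on I f (\<lambda>x. inverse (p x) *\<^sub>R quasi_deriv f x - s x *\<^sub>R f x)"
  proof (rule primitive_on_cong_AE[OF AC_loc_primitive])
    show "f \<in> AC_loc a b" using f by (simp add: D_tau_def)
    show "AE x in \<Lambda>. vector_derivative f (at x) = inverse (p x) *\<^sub>R quasi_deriv f x - s x *\<^sub>R f x"
      using h(2) p_nonzero by eventually_elim simp
  qed auto
  show "primitive_on I (quasi_deriv f) (\<lambda>x. vector_derivative (quasi_deriv f) (at x))"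
    by (rule AC_loc_primitive[OF h(1)])
qed

text \<open>\<open>quasi_deriv\<close> picks some representative, but continuous functions that
  agree almost everywhere on (a,b) agree everywhere there.\<close>

lemma quasi_deriv_eq:
  fixes f h :: "real \<Rightarrow> 'a::euclidean_space"
  assumes f: "primitive_on I f (\<lambda>x. inverse (p x) *\<^sub>R h x - s x *\<^sub>R f x)" and h: "primitive_on I h h'"
  shows "f \<in> D_tau" "x \<in> I \<Longrightarrow> quasi_deriv f x = h x"
proof -
  have "AE x in \<Lambda>. (f has_vector_derivative inverse (p x) *\<^sub>R h x - s x *\<^sub>R f x) (at x)"
    by (rule primitive_on_open_has_vector_derivative[OF f]) simp
  then have hd: "AE x in \<Lambda>. h x = p x *\<^sub>R (vector_derivative f (at x) + s x *\<^sub>R f x)"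
    using p_nonzero by eventually_elim (simp add: vector_derivative_at)
  then have "is_quasi_deriv f h" using primitive_on_AC_loc[OF h] by (simp add: is_quasi_deriv_def)
  then show D: "f \<in> D_tau" using primitive_on_AC_loc[OF f] by (auto simp: D_tau_def)
  have "AE x in \<Lambda>. quasi_deriv f x = p x *\<^sub>R (vector_derivative f (at x) + s x *\<^sub>R f x)"
    using quasi_deriv_works[OF D] by (simp add: is_quasi_deriv_def)
  with hd have "AE x in \<Lambda>. quasi_deriv f x = h x" by eventually_elim simp
  then show "x \<in> I \<Longrightarrow> quasi_deriv f x = h x"
    by (intro continuous_AE_eq[of I "quasi_deriv f" h x] primitive_on_continuous[OF quasi_deriv_primitive(2)[OF D]]
        primitive_on_continuous[OF h]) auto
qed

text \<open>The equation \<tau> f = k as a pair of integral equations for f and h = f^[1].\<close>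

definition slp :: "(real \<Rightarrow> complex) \<Rightarrow> (real \<Rightarrow> complex) \<Rightarrow> (real \<Rightarrow> complex) \<Rightarrow> bool" where
  "slp f h k \<longleftrightarrow> primitive_on I f (\<lambda>x. inverse (p x) *\<^sub>R h x - s x *\<^sub>R f x) \<and>
     primitive_on I h (\<lambda>x. s x *\<^sub>R h x + q x *\<^sub>R f x - r x *\<^sub>R k x)"

lemma slp_tau:
  assumes "f \<in> D_tau" shows "slp f (quasi_deriv f) (tau f)"
  unfolding slp_def
proof
  show "primitive_on I f (\<lambda>x. inverse (p x) *\<^sub>R quasi_deriv f x - s x *\<^sub>R f x)"
    by (rule quasi_deriv_primitive[OF assms])
  show "primitive_on I (quasi_deriv f) (\<lambda>x. s x *\<^sub>R quasi_deriv f x + q x *\<^sub>R f x - r x *\<^sub>R tau f x)"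
  proof (rule primitive_on_cong_AE[OF quasi_deriv_primitive(2)[OF assms]])
    show "AE x in \<Lambda>. vector_derivative (quasi_deriv f) (at x) = s x *\<^sub>R quasi_deriv f x + q x *\<^sub>R f x - r x *\<^sub>R tau f x"
      using r_pos by eventually_elim (simp add: tau_def)
  qed auto
qed

lemma slp_imp:
  assumes "slp f h k"
  shows "f \<in> D_tau" "AE x in \<Lambda>. tau f x = k x" "\<And>x. x \<in> I \<Longrightarrow> quasi_deriv f x = h x"
proof -
  note p = assms[unfolded slp_def, THEN conjunct1] and q = assms[unfolded slp_def, THEN conjunct2]
  note e = quasi_deriv_eq[OF p q]
  show "f \<in> D_tau" by (rule e(1))
  show eq: "\<And>x. x \<in> I \<Longrightarrow> quasi_deriv f x = h x" by (rule e(2))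
  have "primitive_on I (quasi_deriv f) (\<lambda>x. s x *\<^sub>R h x + q x *\<^sub>R f x - r x *\<^sub>R k x)"
    by (rule primitive_on_cong_AE[OF q]) (auto simp: eq)
  then have "AE x in \<Lambda>. (quasi_deriv f has_vector_derivative s x *\<^sub>R h x + q x *\<^sub>R f x - r x *\<^sub>R k x) (at x)"
    by (rule primitive_on_open_has_vector_derivative) simp
  moreover have "AE x in \<Lambda>. x \<in> I" by (rule AE_I2) simp
  ultimately show "AE x in \<Lambda>. tau f x = k x"
    using r_pos by eventually_elim (simp add: tau_def vector_derivative_at eq)
qed

lemma slp_lincomb:
  assumes "slp f1 h1 k1" "slp f2 h2 k2"
  shows "slp (\<lambda>x. c * f1 x + f2 x) (\<lambda>x. c * h1 x + h2 x) (\<lambda>x. c * k1 x + k2 x)"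
  using primitive_on_add[OF primitive_on_linear[OF bounded_linear_mult_right[of c] assms(1)[unfolded slp_def, THEN conjunct1]]
      assms(2)[unfolded slp_def, THEN conjunct1]]
    primitive_on_add[OF primitive_on_linear[OF bounded_linear_mult_right[of c] assms(1)[unfolded slp_def, THEN conjunct2]]
      assms(2)[unfolded slp_def, THEN conjunct2]]
  by (simp add: slp_def algebra_simps scaleR_conv_of_real)

lemma continuous_measurable: "continuous_on I f \<Longrightarrow> f \<in> borel_measurable \<Lambda>"
  for f :: "real \<Rightarrow> 'b::euclidean_space"
  by (rule continuous_imp_measurable_on_sets_lebesgue) auto

lemma D_tau_continuous:
  fixes f :: "real \<Rightarrow> complex"
  assumes "f \<in> D_tau"
  shows "continuous_on I f" "continuous_on I (quasi_deriv f)"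
  using primitive_on_continuous[OF quasi_deriv_primitive(1)[OF assms]] primitive_on_continuous[OF quasi_deriv_primitive(2)[OF assms]] by auto

lemma tau_measurable:
  assumes "f \<in> D_tau" shows "tau f \<in> borel_measurable \<Lambda>"
proof -
  note m = loc_integrable_on_measurable[OF primitive_on_loc_integrable[OF quasi_deriv_primitive(2)[OF assms]] interval]
    continuous_measurable[OF D_tau_continuous(1)[OF assms]] continuous_measurable[OF D_tau_continuous(2)[OF assms]]
  show ?thesis unfolding tau_def[abs_def]
    by (intro borel_measurable_scaleR borel_measurable_inverse borel_measurable_add borel_measurable_uminus m measurable)
qed

lemma measurable_rmeas: "borel_measurable rmeas = borel_measurable \<Lambda>"
  by (rule measurable_cong_sets) (auto simp: rmeas_def)

text \<open>r > 0 almost everywhere, so the weighted measure has the same null sets.\<close>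

lemma AE_rmeas: "(AE x in rmeas. P x) \<longleftrightarrow> (AE x in \<Lambda>. P x)"
proof -
  have "(AE x in rmeas. P x) \<longleftrightarrow> (AE x in \<Lambda>. 0 < ennreal (r x) \<longrightarrow> P x)"
    unfolding rmeas_def by (rule AE_density) (use measurable(3) in simp)
  also have "\<dots> \<longleftrightarrow> (AE x in \<Lambda>. P x)"
    by (rule eventually_subst) (use r_pos in eventually_elim, simp)
  finally show ?thesis .
qed

lemma r_nonneg: "AE x in \<Lambda>. 0 \<le> r x"
  using r_pos by eventually_elim simp

lemma integrable_rmeas:
  fixes f :: "real \<Rightarrow> 'b::{banach, second_countable_topology}"
  assumes "f \<in> borel_measurable \<Lambda>"
  shows "integrable rmeas f \<longleftrightarrow> integrable \<Lambda> (\<lambda>x. r x *\<^sub>R f x)" "integral\<^sup>L rmeas f = (LINT x|\<Lambda>. r x *\<^sub>R f x)"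
  unfolding rmeas_def
  by (rule integrable_density integral_density; use assms measurable(3) r_nonneg in simp)+

lemma L2_fun_rmeas:
  "f \<in> L2_fun rmeas \<longleftrightarrow> f \<in> borel_measurable \<Lambda> \<and> integrable \<Lambda> (\<lambda>x. r x * (cmod (f x))\<^sup>2)"
proof -
  have "integrable rmeas (\<lambda>x. (cmod (f x))\<^sup>2) \<longleftrightarrow> integrable \<Lambda> (\<lambda>x. r x * (cmod (f x))\<^sup>2)" if "f \<in> borel_measurable \<Lambda>"
    using integrable_rmeas(1)[of "\<lambda>x. (cmod (f x))\<^sup>2"] that by simp
  then show ?thesis unfolding L2_fun_def measurable_rmeas by auto
qed

lemma L2_inner_rmeas:
  assumes "f \<in> borel_measurable \<Lambda>" "g \<in> borel_measurable \<Lambda>"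
  shows "L2_inner rmeas f g = (LINT x|\<Lambda>. r x *\<^sub>R (cnj (f x) * g x))"
  unfolding L2_inner_def
  by (rule integrable_rmeas(2)) (intro borel_measurable_times borel_measurable_cnj assms)

lemma L2_fun_cong_AE:
  assumes "f \<in> L2_fun rmeas" "AE x in \<Lambda>. f x = g x" "g \<in> borel_measurable \<Lambda>"
  shows "g \<in> L2_fun rmeas"
proof -
  have "integrable \<Lambda> (\<lambda>x. r x * (cmod (f x))\<^sup>2) \<longleftrightarrow> integrable \<Lambda> (\<lambda>x. r x * (cmod (g x))\<^sup>2)"
  proof (rule integrable_cong_AE)
    show "AE x in \<Lambda>. r x * (cmod (f x))\<^sup>2 = r x * (cmod (g x))\<^sup>2" using assms(2) by eventually_elim simp
  qed (use assms measurable in \<open>auto simp: L2_fun_rmeas\<close>)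
  then show ?thesis using assms by (simp add: L2_fun_rmeas)
qed

lemma slp_dom_Tmax:
  assumes "slp f h k" "f \<in> L2_fun rmeas" "k \<in> L2_fun rmeas"
  shows "f \<in> dom_Tmax"
proof -
  note i = slp_imp[OF assms(1)]
  have "AE x in \<Lambda>. k x = tau f x" using i(2) by eventually_elim simp
  then have "tau f \<in> L2_fun rmeas" by (rule L2_fun_cong_AE[OF assms(3) _ tau_measurable[OF i(1)]])
  then show ?thesis using i(1) assms(2) by (simp add: dom_Tmax_def)
qed

end

text \<open>The substitution \<open>f = g \<phi>\<close> with \<open>g' = g (\<sigma>/p - s)\<close> removes the coefficient \<open>s\<close>; it
  leads to the system with \<open>\<psi> = g (f\<^sup>[\<^sup>1\<^sup>] - \<sigma> f)\<close>.\<close>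

locale gauged_sturm_liouville = sturm_liouville +
  fixes \<sigma> \<sigma>' g :: "real \<Rightarrow> real" and \<mu> c0 d0 :: real
  assumes p_pos: "AE x in lebesgue_on (einterval a b). p x > 0"
    and \<sigma>: "primitive_on (einterval a b) \<sigma> \<sigma>'"
    and g_pos: "\<And>x. g x > 0"
    and g: "primitive_on (einterval a b) g (\<lambda>x. g x * (inverse (p x) * \<sigma> x - s x))"
    and cd: "c0 < d0" "{c0..d0} \<subseteq> einterval a b"
    and potential_ge: "AE x in lebesgue_on (einterval a b). x \<notin> {c0..d0} \<longrightarrow>
      \<mu> * r x \<le> q x + 2 * s x * \<sigma> x - \<sigma>' x - inverse (p x) * (\<sigma> x)\<^sup>2"
    and left_infinite: "\<And>K c. c \<in> einterval a b \<Longrightarrow>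
      \<exists>x\<in>einterval a b. x \<le> c \<and> K < integral {x..c} (\<lambda>x. inverse (p x) * (inverse (g x))\<^sup>2)"
    and right_infinite: "\<And>K c. c \<in> einterval a b \<Longrightarrow>
      \<exists>x\<in>einterval a b. c \<le> x \<and> K < integral {c..x} (\<lambda>x. inverse (p x) * (inverse (g x))\<^sup>2)"
begin

text \<open>Near a the Riccati equation of \<sigma> reduces this to q - (g_a^[1])'/g_a + s
  g_a^[1]/g_a, and similarly near b: the functions in the last claim of the theorem (see
  \<open>gauge_exists\<close>).\<close>

definition V :: "real \<Rightarrow> real" where
  "V x = q x + 2 * s x * \<sigma> x - \<sigma>' x - inverse (p x) * (\<sigma> x)\<^sup>2"

text \<open>The values where \<open>p \<le> 0\<close>, \<open>r \<le> 0\<close> or the lower bound of the potential fails are changed on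
  a null set, so that the inequalities hold everywhere.\<close>

definition \<omega> :: "real \<Rightarrow> real" where
  "\<omega> x = (if 0 < p x then inverse (p x) * (inverse (g x))\<^sup>2 else 1)"

definition R :: "real \<Rightarrow> real" where
  "R x = (if 0 < r x then r x * (g x)\<^sup>2 else 1)"

definition W :: "real \<Rightarrow> real" where
  "W x = (if x \<in> {c0..d0} then V x * (g x)\<^sup>2 else max (V x * (g x)\<^sup>2) (\<mu> * R x))"

lemma g_continuous: "continuous_on I g" "continuous_on I \<sigma>"
  using primitive_on_continuous[OF g] primitive_on_continuous[OF \<sigma>] by auto

lemma inverse_g_continuous: "continuous_on I (\<lambda>x. inverse (g x))"
  by (rule continuous_on_inverse[OF g_continuous(1)]) (auto simp: g_pos less_imp_neq[OF g_pos, symmetric])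

lemma V_loc: "loc_integrable_on I V"
proof -
  have s\<sigma>: "loc_integrable_on I (\<lambda>x. 2 * s x * \<sigma> x)"
    using loc_integrable_on_mult[OF loc(4), of "\<lambda>x. 2 * \<sigma> x"] g_continuous(2) by (simp add: continuous_intros algebra_simps)
  have p\<sigma>: "loc_integrable_on I (\<lambda>x. inverse (p x) * (\<sigma> x)\<^sup>2)"
    by (intro loc_integrable_on_mult loc(1) continuous_intros g_continuous(2))
  show ?thesis
    unfolding V_def[abs_def]
    by (rule loc_integrable_on_diff[OF loc_integrable_on_diff[OF loc_integrable_on_add[OF loc(2) s\<sigma>]
          primitive_on_loc_integrable[OF \<sigma>]] p\<sigma>])
qed

lemma \<omega>_eq: "AE x in \<Lambda>. inverse (p x) * (inverse (g x))\<^sup>2 = \<omega> x"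
  using p_pos by eventually_elim (simp add: \<omega>_def)

lemma R_eq: "AE x in \<Lambda>. r x * (g x)\<^sup>2 = R x"
  using r_pos by eventually_elim (simp add: R_def)

lemma W_eq: "AE x in \<Lambda>. V x * (g x)\<^sup>2 = W x"
  using potential_ge r_pos
proof eventually_elim
  case (elim x)
  then show ?case using mult_right_mono[of "\<mu> * r x" "V x" "(g x)\<^sup>2"] by (simp add: W_def V_def R_def algebra_simps)
qed

lemma loc_integrable_on_cong_AE:
  assumes "loc_integrable_on I f" "AE x in \<Lambda>. f x = f' x"
  shows "loc_integrable_on I f'"
proof -
  obtain x0 where "x0 \<in> I" using einterval_nonempty[OF interval] by blast
  then obtain F where F: "primitive_on I F f" using primitive_on_exists[OF assms(1)] by blast
  show ?thesis by (rule primitive_on_loc_integrable[OF primitive_on_cong_AE[OF F assms(2)]]) auto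
qed

lemma integral_\<omega>: "{c..d} \<subseteq> I \<Longrightarrow> integral {c..d} \<omega> = integral {c..d} (\<lambda>x. inverse (p x) * (inverse (g x))\<^sup>2)"
  by (rule integral_cong_AE_lebesgue_on[symmetric, OF \<omega>_eq]) auto

lemma \<omega>_loc: "loc_integrable_on I \<omega>"
  by (rule loc_integrable_on_cong_AE[OF loc_integrable_on_mult[OF loc(1)] \<omega>_eq]) (intro continuous_intros inverse_g_continuous)

lemma R_loc: "loc_integrable_on I R"
  by (rule loc_integrable_on_cong_AE[OF loc_integrable_on_mult[OF loc(3)] R_eq]) (intro continuous_intros g_continuous)

lemma W_loc: "loc_integrable_on I W"
  by (rule loc_integrable_on_cong_AE[OF loc_integrable_on_mult[OF V_loc] W_eq]) (intro continuous_intros g_continuous)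

lemma pos: "0 < \<omega> x" "0 < R x"
  using g_pos[of x] by (auto simp: \<omega>_def R_def)

sublocale core: sl_ends a b \<omega> W R \<mu> c0 d0
proof
  show "\<exists>x\<in>einterval a b. x \<le> c \<and> K < integral {x..c} \<omega>" if c: "c \<in> einterval a b" for c K
  proof -
    obtain x where x: "x \<in> I" "x \<le> c" "K < integral {x..c} (\<lambda>x. inverse (p x) * (inverse (g x))\<^sup>2)"
      using left_infinite[OF c] by blast
    then show ?thesis using integral_\<omega>[OF einterval_Icc_subset[OF x(1) c]] by auto
  qed
  show "\<exists>x\<in>einterval a b. c \<le> x \<and> K < integral {c..x} \<omega>" if c: "c \<in> einterval a b" for c K
  proof -
    obtain x where x: "x \<in> I" "c \<le> x" "K < integral {c..x} (\<lambda>x. inverse (p x) * (inverse (g x))\<^sup>2)"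
      using right_infinite[OF c] by blast
    then show ?thesis using integral_\<omega>[OF einterval_Icc_subset[OF c x(1)]] by auto
  qed
qed (use interval \<omega>_loc W_loc R_loc pos cd in \<open>auto simp: W_def\<close>)

lemma inverse_g: "primitive_on I (\<lambda>x. inverse (g x)) (\<lambda>x. - inverse (g x) * (inverse (p x) * \<sigma> x - s x))"
proof -
  have "primitive_on I (\<lambda>x. inverse (g x)) (\<lambda>x. (- (inverse (g x) * inverse (g x))) * (g x * (inverse (p x) * \<sigma> x - s x)))"
  proof (rule primitive_on_compose[OF g])
    show "(inverse has_real_derivative - (inverse y * inverse y)) (at y)" if "y \<in> g ` I" for y
      using that g_pos by (auto intro!: derivative_eq_intros simp: less_imp_neq[symmetric])
    show "continuous_on (g ` I) (\<lambda>y. - (inverse y * inverse y))"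
      using g_pos by (intro continuous_intros) (auto simp: less_imp_neq[symmetric])
  qed
  also have "(\<lambda>x. (- (inverse (g x) * inverse (g x))) * (g x * (inverse (p x) * \<sigma> x - s x)))
      = (\<lambda>x. - inverse (g x) * (inverse (p x) * \<sigma> x - s x))"
    using g_pos by (auto simp: fun_eq_iff less_imp_neq[symmetric])
  finally show ?thesis .
qed

text \<open>In the derivative of g (h - \<sigma> f) the terms with h cancel by the equation for g,
  and V is the coefficient of g f that remains.\<close>

lemma slp_imp_slc:
  assumes "slp f h k"
  shows "core.slc (\<lambda>x. inverse (g x) *\<^sub>R f x) (\<lambda>x. g x *\<^sub>R (h x - \<sigma> x *\<^sub>R f x)) (\<lambda>x. inverse (g x) *\<^sub>R k x)"
  unfolding core.slc_def
proof
  note f = assms[unfolded slp_def, THEN conjunct1] and h = assms[unfolded slp_def, THEN conjunct2]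
  have g0: "g x \<noteq> 0" for x using g_pos[of x] by simp
  have cancel: "complex_of_real (g x) * (inverse (complex_of_real (g x)) * z) = z" for x z using g0[of x] by simp
  show "primitive_on I (\<lambda>x. inverse (g x) *\<^sub>R f x) (\<lambda>x. \<omega> x *\<^sub>R (g x *\<^sub>R (h x - \<sigma> x *\<^sub>R f x)))"
  proof (rule primitive_on_cong_AE[OF primitive_on_bilinear[OF bounded_bilinear_scaleR inverse_g f]])
    show "AE x in \<Lambda>. inverse (g x) *\<^sub>R (inverse (p x) *\<^sub>R h x - s x *\<^sub>R f x)
        + (- inverse (g x) * (inverse (p x) * \<sigma> x - s x)) *\<^sub>R f x = \<omega> x *\<^sub>R (g x *\<^sub>R (h x - \<sigma> x *\<^sub>R f x))"
      using \<omega>_eq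
    proof eventually_elim
      case (elim x)
      then show ?case using g0[of x] by (simp flip: elim add: scaleR_conv_of_real power2_eq_square algebra_simps cancel)
    qed
  qed auto
  show "primitive_on I (\<lambda>x. g x *\<^sub>R (h x - \<sigma> x *\<^sub>R f x))
      (\<lambda>x. W x *\<^sub>R (inverse (g x) *\<^sub>R f x) - R x *\<^sub>R (inverse (g x) *\<^sub>R k x))"
  proof (rule primitive_on_cong_AE[OF primitive_on_bilinear[OF bounded_bilinear_scaleR g primitive_on_diff[OF h
          primitive_on_bilinear[OF bounded_bilinear_scaleR \<sigma> f]]]])
    show "AE x in \<Lambda>. g x *\<^sub>R (s x *\<^sub>R h x + q x *\<^sub>R f x - r x *\<^sub>R k x - (\<sigma> x *\<^sub>R (inverse (p x) *\<^sub>R h x - s x *\<^sub>R f x) + \<sigma>' x *\<^sub>R f x))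
        + (g x * (inverse (p x) * \<sigma> x - s x)) *\<^sub>R (h x - \<sigma> x *\<^sub>R f x)
        = W x *\<^sub>R (inverse (g x) *\<^sub>R f x) - R x *\<^sub>R (inverse (g x) *\<^sub>R k x)"
      using W_eq R_eq
    proof eventually_elim
      case (elim x)
      have 1: "W x *\<^sub>R (inverse (g x) *\<^sub>R f x) = (V x * g x) *\<^sub>R f x" using g0[of x] by (simp flip: elim(1) add: power2_eq_square)
      have 2: "R x *\<^sub>R (inverse (g x) *\<^sub>R k x) = (r x * g x) *\<^sub>R k x" using g0[of x] by (simp flip: elim(2) add: power2_eq_square)
      show ?case unfolding 1 2 V_def by (simp add: scaleR_conv_of_real power2_eq_square algebra_simps cancel)
    qed
  qed auto
qed

lemma slc_imp_slp:
  assumes "core.slc \<phi> \<psi> \<kappa>"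
  shows "slp (\<lambda>x. g x *\<^sub>R \<phi> x) (\<lambda>x. inverse (g x) *\<^sub>R \<psi> x + \<sigma> x *\<^sub>R (g x *\<^sub>R \<phi> x)) (\<lambda>x. g x *\<^sub>R \<kappa> x)"
  unfolding slp_def
proof
  note \<phi> = core.slcD(1)[OF assms] and \<psi> = core.slcD(2)[OF assms]
  have g0: "g x \<noteq> 0" for x using g_pos[of x] by simp
  have cancel: "complex_of_real (g x) * (inverse (complex_of_real (g x)) * z) = z" for x z using g0[of x] by simp
  show "primitive_on I (\<lambda>x. g x *\<^sub>R \<phi> x)
      (\<lambda>x. inverse (p x) *\<^sub>R (inverse (g x) *\<^sub>R \<psi> x + \<sigma> x *\<^sub>R (g x *\<^sub>R \<phi> x)) - s x *\<^sub>R (g x *\<^sub>R \<phi> x))"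
  proof (rule primitive_on_cong_AE[OF primitive_on_bilinear[OF bounded_bilinear_scaleR g \<phi>]])
    show "AE x in \<Lambda>. g x *\<^sub>R (\<omega> x *\<^sub>R \<psi> x) + (g x * (inverse (p x) * \<sigma> x - s x)) *\<^sub>R \<phi> x
        = inverse (p x) *\<^sub>R (inverse (g x) *\<^sub>R \<psi> x + \<sigma> x *\<^sub>R (g x *\<^sub>R \<phi> x)) - s x *\<^sub>R (g x *\<^sub>R \<phi> x)"
      using \<omega>_eq
    proof eventually_elim
      case (elim x)
      then show ?case using g0[of x] by (simp flip: elim add: scaleR_conv_of_real power2_eq_square algebra_simps cancel)
    qed
  qed auto
  show "primitive_on I (\<lambda>x. inverse (g x) *\<^sub>R \<psi> x + \<sigma> x *\<^sub>R (g x *\<^sub>R \<phi> x))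
      (\<lambda>x. s x *\<^sub>R (inverse (g x) *\<^sub>R \<psi> x + \<sigma> x *\<^sub>R (g x *\<^sub>R \<phi> x)) + q x *\<^sub>R (g x *\<^sub>R \<phi> x) - r x *\<^sub>R (g x *\<^sub>R \<kappa> x))"
  proof (rule primitive_on_cong_AE[OF primitive_on_add[OF primitive_on_bilinear[OF bounded_bilinear_scaleR inverse_g \<psi>]
          primitive_on_bilinear[OF bounded_bilinear_scaleR \<sigma> primitive_on_bilinear[OF bounded_bilinear_scaleR g \<phi>]]]])
    show "AE x in \<Lambda>. inverse (g x) *\<^sub>R (W x *\<^sub>R \<phi> x - R x *\<^sub>R \<kappa> x) + (- inverse (g x) * (inverse (p x) * \<sigma> x - s x)) *\<^sub>R \<psi> x
        + (\<sigma> x *\<^sub>R (g x *\<^sub>R (\<omega> x *\<^sub>R \<psi> x) + (g x * (inverse (p x) * \<sigma> x - s x)) *\<^sub>R \<phi> x) + \<sigma>' x *\<^sub>R (g x *\<^sub>R \<phi> x))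
        = s x *\<^sub>R (inverse (g x) *\<^sub>R \<psi> x + \<sigma> x *\<^sub>R (g x *\<^sub>R \<phi> x)) + q x *\<^sub>R (g x *\<^sub>R \<phi> x) - r x *\<^sub>R (g x *\<^sub>R \<kappa> x)"
      using \<omega>_eq W_eq R_eq
    proof eventually_elim
      case (elim x)
      have 1: "inverse (g x) *\<^sub>R (W x *\<^sub>R \<phi> x - R x *\<^sub>R \<kappa> x) = (V x * g x) *\<^sub>R \<phi> x - (r x * g x) *\<^sub>R \<kappa> x"
        using g0[of x] by (simp flip: elim(2,3) add: power2_eq_square scaleR_conv_of_real algebra_simps cancel)
      have 2: "g x *\<^sub>R (\<omega> x *\<^sub>R \<psi> x) = (inverse (p x) * inverse (g x)) *\<^sub>R \<psi> x"
        using g0[of x] by (simp flip: elim(1) add: power2_eq_square)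
      show ?case unfolding 1 2 V_def by (simp add: scaleR_conv_of_real power2_eq_square algebra_simps cancel)
    qed
  qed auto
qed

section \<open>Transfer of the operators to the first-order system\<close>

definition red :: "(real \<Rightarrow> complex) \<Rightarrow> real \<Rightarrow> complex" where
  "red f x = inverse (g x) *\<^sub>R f x"

text \<open>\<open>red f\<close> and \<open>flux f\<close> are the \<phi> and \<psi> of the system
  that belongs to f.\<close>

definition flux :: "(real \<Rightarrow> complex) \<Rightarrow> real \<Rightarrow> complex" where
  "flux f x = g x *\<^sub>R (quasi_deriv f x - \<sigma> x *\<^sub>R f x)"

text \<open>The candidate for the domain of S_F: almost everywhere the integrand is p g^2 |(f/g)'|^2
  (see \<open>end_energy\<close>).\<close>

definition finite_energy :: "(real \<Rightarrow> complex) set" where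
  "finite_energy = {f \<in> dom_Tmax. integrable \<Lambda> (\<lambda>x. \<omega> x * (cmod (flux f x))\<^sup>2)}"

lemma slc_red: "f \<in> D_tau \<Longrightarrow> core.slc (red f) (flux f) (red (tau f))"
  using slp_imp_slc[OF slp_tau, of f] by (simp add: red_def[abs_def] flux_def[abs_def])

lemma red_gauge: "red (\<lambda>x. g x *\<^sub>R f x) = f" "g x *\<^sub>R red f x = f x"
  using g_pos by (auto simp: red_def fun_eq_iff less_imp_neq[symmetric])

lemma g_measurable: "g \<in> borel_measurable \<Lambda>" "(\<lambda>x. inverse (g x)) \<in> borel_measurable \<Lambda>"
  by (rule continuous_measurable g_continuous inverse_g_continuous)+

lemma red_measurable: "f \<in> borel_measurable \<Lambda> \<Longrightarrow> red f \<in> borel_measurable \<Lambda>"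
  unfolding red_def[abs_def] by (intro borel_measurable_scaleR g_measurable)

lemma R_red: "AE x in \<Lambda>. R x * (cmod (red f x))\<^sup>2 = r x * (cmod (f x))\<^sup>2"
  "AE x in \<Lambda>. R x *\<^sub>R (cnj (red f x) * red h x) = r x *\<^sub>R (cnj (f x) * h x)"
proof -
  have g0: "g x \<noteq> 0" for x using g_pos[of x] by simp
  show "AE x in \<Lambda>. R x * (cmod (red f x))\<^sup>2 = r x * (cmod (f x))\<^sup>2"
    using R_eq
  proof eventually_elim
    case (elim x)
    show ?case using g0[of x] by (simp flip: elim add: red_def power_mult_distrib power_inverse)
  qed
  show "AE x in \<Lambda>. R x *\<^sub>R (cnj (red f x) * red h x) = r x *\<^sub>R (cnj (f x) * h x)"
    using R_eq
  proof eventually_elim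
    case (elim x)
    have "g x * (g x * (inverse (g x) * inverse (g x))) = 1" using g0[of x] by (simp add: field_simps)
    then show ?case by (simp flip: elim add: red_def power2_eq_square)
  qed
qed

lemma L2_fun_red:
  assumes "f \<in> borel_measurable \<Lambda>"
  shows "f \<in> L2_fun rmeas \<longleftrightarrow> integrable \<Lambda> (\<lambda>x. R x * (cmod (red f x))\<^sup>2)"
proof -
  have "integrable \<Lambda> (\<lambda>x. R x * (cmod (red f x))\<^sup>2) \<longleftrightarrow> integrable \<Lambda> (\<lambda>x. r x * (cmod (f x))\<^sup>2)"
    by (rule integrable_cong_AE[OF _ _ R_red(1)]) (use assms red_measurable[OF assms] core.meas measurable in \<open>auto\<close>)
  then show ?thesis using assms by (simp add: L2_fun_rmeas)
qed

lemma L2_inner_red: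
  assumes "f \<in> borel_measurable \<Lambda>" "h \<in> borel_measurable \<Lambda>"
  shows "L2_inner rmeas f h = (LINT x|\<Lambda>. R x *\<^sub>R (cnj (red f x) * red h x))"
  unfolding L2_inner_rmeas[OF assms]
proof (rule integral_cong_AE)
  show "AE x in \<Lambda>. r x *\<^sub>R (cnj (f x) * h x) = R x *\<^sub>R (cnj (red f x) * red h x)"
    using R_red(2)[of f h] by eventually_elim simp
qed (use assms[THEN red_measurable] assms core.meas measurable in \<open>auto intro!: borel_measurable_scaleR borel_measurable_times borel_measurable_cnj\<close>)

lemma L2_inner_red_integrable:
  assumes "f \<in> L2_fun rmeas" "h \<in> L2_fun rmeas"
  shows "integrable \<Lambda> (\<lambda>x. R x *\<^sub>R (cnj (red f x) * red h x))"
proof -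
  have m: "f \<in> borel_measurable \<Lambda>" "h \<in> borel_measurable \<Lambda>" using assms by (auto simp: L2_fun_rmeas)
  have "integrable \<Lambda> (\<lambda>x. r x *\<^sub>R (cnj (f x) * h x))"
    using L2_inner_integrable[OF assms] m by (subst (asm) integrable_rmeas) (auto intro!: borel_measurable_times borel_measurable_cnj)
  moreover have "integrable \<Lambda> (\<lambda>x. R x *\<^sub>R (cnj (red f x) * red h x)) \<longleftrightarrow> integrable \<Lambda> (\<lambda>x. r x *\<^sub>R (cnj (f x) * h x))"
    by (rule integrable_cong_AE[OF _ _ R_red(2)])
      (use m[THEN red_measurable] m core.meas measurable in \<open>auto intro!: borel_measurable_scaleR borel_measurable_times borel_measurable_cnj\<close>)
  ultimately show ?thesis by simp
qed

lemma mass_red: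
  assumes "f \<in> borel_measurable \<Lambda>"
  shows "core.mass (red f) = (LINT x|rmeas. (cmod (f x))\<^sup>2)"
proof -
  have "(LINT x|rmeas. (cmod (f x))\<^sup>2) = (LINT x|\<Lambda>. r x * (cmod (f x))\<^sup>2)"
    using integrable_rmeas(2)[of "\<lambda>x. (cmod (f x))\<^sup>2"] assms by simp
  also have "\<dots> = core.mass (red f)"
    unfolding core.mass_def
  proof (rule integral_cong_AE)
    show "AE x in \<Lambda>. r x * (cmod (f x))\<^sup>2 = R x * (cmod (red f x))\<^sup>2" using R_red(1)[of f] by eventually_elim simp
  qed (use assms red_measurable[OF assms] core.meas measurable in auto)
  finally show ?thesis by simp
qed

lemma dom_Tmax_D:
  assumes "f \<in> dom_Tmax"
  shows "f \<in> D_tau" "f \<in> L2_fun rmeas" "tau f \<in> L2_fun rmeas" "f \<in> borel_measurable \<Lambda>" "tau f \<in> borel_measurable \<Lambda>"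
  using assms by (auto simp: dom_Tmax_def L2_fun_rmeas)

lemma dom_T0_support:
  assumes "f \<in> dom_T0"
  obtains c d where "{c..d} \<subseteq> I" "\<And>x. x \<in> I \<Longrightarrow> x \<notin> {c..d} \<Longrightarrow> f x = 0"
proof -
  obtain K where K: "compact K" "K \<subseteq> I" "\<And>x. x \<in> I - K \<Longrightarrow> f x = 0" using assms by (auto simp: dom_T0_def)
  show thesis
  proof (cases "K = {}")
    case True
    \<comment> \<open>\<open>{1..0}\<close> is the empty interval, the support of a function that
      vanishes on (a,b).\<close>
    then show ?thesis using K(3) by (intro that[of 1 0]) auto
  next
    case False
    have b: "bdd_below K" "bdd_above K" using compact_imp_bounded[OF K(1)] bounded_imp_bdd_below bounded_imp_bdd_above by auto
    have cl: "closed K" by (rule compact_imp_closed[OF K(1)])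
    have "Inf K \<in> K" "Sup K \<in> K" using closed_contains_Inf[OF False b(1) cl] closed_contains_Sup[OF False b(2) cl] by auto
    then have "{Inf K..Sup K} \<subseteq> I" using K(2) by (intro einterval_Icc_subset) auto
    moreover have "f x = 0" if "x \<in> I" "x \<notin> {Inf K..Sup K}" for x
      using K(3)[of x] that cInf_lower[OF _ b(1), of x] cSup_upper[OF _ b(2), of x] by auto
    ultimately show ?thesis by (rule that)
  qed
qed

lemma dom_T0_I:
  assumes "f \<in> dom_Tmax" "{c..d} \<subseteq> I" "\<And>x. x \<in> I \<Longrightarrow> x \<notin> {c..d} \<Longrightarrow> f x = 0"
  shows "f \<in> dom_T0"
  using assms by (auto simp: dom_T0_def intro!: exI[of _ "{c..d}"])

text \<open>Pointwise and not only almost everywhere: off the support the quasi-derivative vanishes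
  on an open set, so its \<open>vector_derivative\<close> is 0 at each point there.\<close>

lemma tau_support:
  assumes f: "f \<in> D_tau" and supp: "\<And>x. x \<in> I \<Longrightarrow> x \<notin> {c..d} \<Longrightarrow> f x = 0" and x: "x \<in> I" "x \<notin> {c..d}"
  shows "tau f x = 0"
proof -
  have op: "open (I - {c..d})" by (intro open_Diff) auto
  have "red f y = 0" if "y \<in> I" "y \<notin> {c..d}" for y using supp[OF that] by (simp add: red_def)
  from core.slc_support[OF slc_red[OF f] this]
  have flux: "flux f y = 0" if "y \<in> I - {c..d}" for y using that by auto
  have q: "quasi_deriv f y = 0" if "y \<in> I - {c..d}" for y
  proof -
    have "f y = 0" using supp[of y] that by blast
    then show ?thesis using flux[OF that] g_pos[of y] by (simp add: flux_def)
  qed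
  have "((\<lambda>_. 0) has_vector_derivative 0) (at x)" by simp
  then have "(quasi_deriv f has_vector_derivative 0) (at x)"
    by (rule has_vector_derivative_transform_within_open[OF _ op]) (use x q in auto)
  then show ?thesis using q[of x] supp[OF x] x by (simp add: tau_def vector_derivative_at)
qed

lemma tau_lincomb:
  assumes "f \<in> D_tau" "h \<in> D_tau"
  shows "(\<lambda>x. c * f x + h x) \<in> D_tau" "AE x in \<Lambda>. tau (\<lambda>x. c * f x + h x) x = c * tau f x + tau h x"
    "\<And>x. x \<in> I \<Longrightarrow> flux (\<lambda>x. c * f x + h x) x = c * flux f x + flux h x"
proof -
  note i = slp_imp[OF slp_lincomb[OF assms[THEN slp_tau], of c]]
  show "(\<lambda>x. c * f x + h x) \<in> D_tau" "AE x in \<Lambda>. tau (\<lambda>x. c * f x + h x) x = c * tau f x + tau h x" by (rule i)+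
  show "flux (\<lambda>x. c * f x + h x) x = c * flux f x + flux h x" if "x \<in> I" for x
    using i(3)[OF that] by (simp add: flux_def scaleR_conv_of_real algebra_simps)
qed

lemma dom_Tmax_lincomb:
  assumes f: "f \<in> dom_Tmax" and h: "h \<in> dom_Tmax"
  shows "(\<lambda>x. c * f x + h x) \<in> dom_Tmax"
  by (rule slp_dom_Tmax[OF slp_lincomb[OF slp_tau slp_tau]]; intro L2_fun_lincomb dom_Tmax_D f h)

lemma dom_T0_lincomb:
  assumes f: "f \<in> dom_T0" and h: "h \<in> dom_T0"
  shows "(\<lambda>x. c * f x + h x) \<in> dom_T0"
proof -
  obtain K where K: "compact K" "K \<subseteq> I" "\<And>x. x \<in> I - K \<Longrightarrow> f x = 0" using f by (auto simp: dom_T0_def)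
  obtain L where L: "compact L" "L \<subseteq> I" "\<And>x. x \<in> I - L \<Longrightarrow> h x = 0" using h by (auto simp: dom_T0_def)
  have "(\<lambda>x. c * f x + h x) \<in> dom_Tmax" using f h by (intro dom_Tmax_lincomb) (auto simp: dom_T0_def)
  moreover have "compact (K \<union> L)" using K(1) L(1) by auto
  moreover have "K \<union> L \<subseteq> I" using K(2) L(2) by simp
  moreover have "c * f x + h x = 0" if "x \<in> I - (K \<union> L)" for x using K(3)[of x] L(3)[of x] that by simp
  ultimately show ?thesis unfolding dom_T0_def by blast
qed

lemma L2_inner_lagrange:
  assumes f: "f \<in> dom_Tmax" and h: "h \<in> dom_Tmax"
  shows "integrable \<Lambda> (\<lambda>x. R x *\<^sub>R (cnj (red (tau f) x) * red h x - cnj (red f x) * red (tau h) x))"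
    and "L2_inner rmeas (tau f) h - L2_inner rmeas f (tau h) =
      (LINT x|\<Lambda>. R x *\<^sub>R (cnj (red (tau f) x) * red h x - cnj (red f x) * red (tau h) x))"
proof -
  note F = dom_Tmax_D[OF f] and H = dom_Tmax_D[OF h]
  have int: "integrable \<Lambda> (\<lambda>x. R x *\<^sub>R (cnj (red (tau f) x) * red h x))" "integrable \<Lambda> (\<lambda>x. R x *\<^sub>R (cnj (red f x) * red (tau h) x))"
    by (intro L2_inner_red_integrable F H)+
  show "integrable \<Lambda> (\<lambda>x. R x *\<^sub>R (cnj (red (tau f) x) * red h x - cnj (red f x) * red (tau h) x))"
    unfolding scaleR_diff_right by (intro Bochner_Integration.integrable_diff int)
  show "L2_inner rmeas (tau f) h - L2_inner rmeas f (tau h) =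
      (LINT x|\<Lambda>. R x *\<^sub>R (cnj (red (tau f) x) * red h x - cnj (red f x) * red (tau h) x))"
    unfolding scaleR_diff_right Bochner_Integration.integral_diff[OF int] using F H by (simp add: L2_inner_red)
qed

lemma green:
  assumes f: "f \<in> dom_T0" and h: "h \<in> dom_Tmax"
  shows "L2_inner rmeas (tau f) h = L2_inner rmeas f (tau h)"
proof -
  have fm: "f \<in> dom_Tmax" using f by (simp add: dom_T0_def)
  note F = dom_Tmax_D(1)[OF fm] and H = dom_Tmax_D(1)[OF h]
  obtain c d where cd: "{c..d} \<subseteq> I" "\<And>x. x \<in> I \<Longrightarrow> x \<notin> {c..d} \<Longrightarrow> f x = 0" by (rule dom_T0_support[OF f]) (rule that; assumption)
  have "(LINT x|\<Lambda>. R x *\<^sub>R (cnj (red (tau f) x) * red h x - cnj (red f x) * red (tau h) x)) = 0"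
  proof (rule core.slc_green[OF slc_red[OF F] slc_red[OF H] cd(1)])
    show "red f x = 0" if "x \<in> I" "x \<notin> {c..d}" for x using cd(2)[OF that] by (simp add: red_def)
    show "red (tau f) x = 0" if "x \<in> I" "x \<notin> {c..d}" for x
      using tau_support[OF F cd(2) that] by (simp add: red_def)
  qed
  then show ?thesis using L2_inner_lagrange(2)[OF fm h] by simp
qed

lemma finite_energy_sym:
  assumes f: "f \<in> finite_energy" and h: "h \<in> finite_energy"
  shows "L2_inner rmeas (tau f) h = L2_inner rmeas f (tau h)"
proof -
  have m: "f \<in> dom_Tmax" "h \<in> dom_Tmax" using f h by (auto simp: finite_energy_def)
  have "(LINT x|\<Lambda>. R x *\<^sub>R (cnj (red (tau f) x) * red h x - cnj (red f x) * red (tau h) x)) = 0"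
    using f h L2_inner_lagrange(1)[OF m]
    by (intro core.finite_energy_symmetric[OF slc_red slc_red]) (auto simp: finite_energy_def dom_Tmax_D(1))
  then show ?thesis using L2_inner_lagrange(2)[OF m] by simp
qed

text \<open>A compactly supported \<phi> of the system yields the test function g \<phi> in
  \<open>dom_T0\<close>, so the hypothesis becomes that of
  \<open>core.adjoint_solution\<close>.\<close>

lemma adjoint:
  assumes u: "u \<in> L2_fun rmeas" and h: "h \<in> L2_fun rmeas"
    and test: "\<And>f. f \<in> dom_T0 \<Longrightarrow> L2_inner rmeas (tau f) u = L2_inner rmeas f h"
  shows "\<exists>v\<in>dom_Tmax. (AE x in rmeas. u x = v x) \<and> (AE x in rmeas. h x = tau v x)"
proof -
  have m: "u \<in> borel_measurable \<Lambda>" "h \<in> borel_measurable \<Lambda>" using u h by (auto simp: L2_fun_rmeas)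
  obtain \<phi> \<psi> where s: "core.slc \<phi> \<psi> (red h)" "AE x in \<Lambda>. red u x = \<phi> x"
  proof (rule core.adjoint_solution)
    show "red u \<in> borel_measurable \<Lambda>" "red h \<in> borel_measurable \<Lambda>" using m by (auto intro: red_measurable)
    show "integrable \<Lambda> (\<lambda>x. R x * (cmod (red u x))\<^sup>2)" "integrable \<Lambda> (\<lambda>x. R x * (cmod (red h x))\<^sup>2)"
      using u h m by (simp_all add: L2_fun_red)
    fix \<phi> \<psi> k c d
    assume s: "core.slc \<phi> \<psi> k" and cd: "{c..d} \<subseteq> I" and supp: "\<And>x. x \<in> I \<Longrightarrow> x \<notin> {c..d} \<Longrightarrow> \<phi> x = 0"
      and k: "k \<in> borel_measurable \<Lambda>" "integrable \<Lambda> (\<lambda>x. R x * (cmod (k x))\<^sup>2)"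
    define f k' where "f x = g x *\<^sub>R \<phi> x" and "k' x = g x *\<^sub>R k x" for x
    have rf: "red f = \<phi>" "red k' = k" using red_gauge(1) by (simp_all add: f_def[abs_def] k'_def[abs_def])
    obtain h' where p: "slp f h' k'" using slc_imp_slp[OF s] unfolding f_def k'_def by blast
    have fm: "f \<in> borel_measurable \<Lambda>" unfolding f_def
      by (intro borel_measurable_scaleR g_measurable core.continuous_measurable[OF core.slcD(3)[OF s]])
    have km: "k' \<in> borel_measurable \<Lambda>" unfolding k'_def by (intro borel_measurable_scaleR g_measurable k)
    have "integrable \<Lambda> (\<lambda>x. R x * (cmod (\<phi> x))\<^sup>2)"
    proof (subst supported_integral(1)[OF cd])
      show "R x * (cmod (\<phi> x))\<^sup>2 = 0" if "x \<in> I" "x \<notin> {c..d}" for x using supp[OF that] by simp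
      show "(\<lambda>x. R x * (cmod (\<phi> x))\<^sup>2) absolutely_integrable_on {c..d}"
        by (rule core.energy_integrable(2)[OF core.slcD(3)[OF s] cd])
    qed
    then have fL: "f \<in> L2_fun rmeas" using L2_fun_red[OF fm] by (simp add: rf)
    have kL: "k' \<in> L2_fun rmeas" using L2_fun_red[OF km] k(2) by (simp add: rf)
    have f0: "f \<in> dom_T0" by (rule dom_T0_I[OF slp_dom_Tmax[OF p fL kL] cd]) (simp add: f_def supp)
    note i = slp_imp[OF p]
    have "L2_inner rmeas k' u = L2_inner rmeas (tau f) u"
      by (rule L2_inner_cong_AE(2)) (use i km tau_measurable m in \<open>auto simp: AE_rmeas measurable_rmeas elim!: eventually_mono\<close>)
    also have "\<dots> = L2_inner rmeas f h" by (rule test[OF f0])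
    finally show "(LINT x|\<Lambda>. R x *\<^sub>R (cnj (k x) * red u x)) = (LINT x|\<Lambda>. R x *\<^sub>R (cnj (\<phi> x) * red h x))"
      by (simp add: L2_inner_red fm km m rf)
  qed
  define v where "v x = g x *\<^sub>R \<phi> x" for x
  have p: "slp v (\<lambda>x. inverse (g x) *\<^sub>R \<psi> x + \<sigma> x *\<^sub>R v x) h"
    using slc_imp_slp[OF s(1)] by (simp add: v_def[abs_def] red_gauge(2))
  have uv: "AE x in \<Lambda>. u x = v x" using s(2)
  proof eventually_elim
    case (elim x)
    then show ?case using red_gauge(2)[of x u] by (simp add: v_def)
  qed
  have vm: "v \<in> borel_measurable \<Lambda>" unfolding v_def
    by (intro borel_measurable_scaleR g_measurable core.continuous_measurable[OF core.slcD(3)[OF s(1)]])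
  have "v \<in> dom_Tmax" by (rule slp_dom_Tmax[OF p L2_fun_cong_AE[OF u uv vm] h])
  moreover have "AE x in \<Lambda>. h x = tau v x" using slp_imp(2)[OF p] by eventually_elim simp
  ultimately show ?thesis using uv by (auto simp: AE_rmeas)
qed

lemma mass_red_inner: "f \<in> borel_measurable \<Lambda> \<Longrightarrow> core.mass (red f) = Re (L2_inner rmeas f f)"
  by (simp add: mass_red L2_inner_self)

lemma dom_T0_D: "f \<in> dom_T0 \<Longrightarrow> f \<in> dom_Tmax"
  by (simp add: dom_T0_def)

lemma form_bound:
  obtains C where "\<And>f. f \<in> dom_T0 \<Longrightarrow> integrable \<Lambda> (\<lambda>x. \<omega> x * (cmod (flux f x))\<^sup>2)"
    "\<And>f. f \<in> dom_T0 \<Longrightarrow> integrable \<Lambda> (\<lambda>x. core.Wp x * (cmod (red f x))\<^sup>2)"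
    "\<And>f. f \<in> dom_T0 \<Longrightarrow> core.energy (flux f) / 2 + core.potential (red f) + core.mass (red f)
      \<le> Re (L2_inner rmeas f (tau f)) + C * Re (L2_inner rmeas f f)"
proof (rule core.coercive)
  fix C assume C: "\<And>\<phi> \<psi> \<kappa> c d. core.slc \<phi> \<psi> \<kappa> \<Longrightarrow> {c..d} \<subseteq> I \<Longrightarrow> (\<And>x. x \<in> I \<Longrightarrow> x \<notin> {c..d} \<Longrightarrow> \<phi> x = 0) \<Longrightarrow>
      integrable \<Lambda> (\<lambda>x. \<omega> x * (cmod (\<psi> x))\<^sup>2) \<and> integrable \<Lambda> (\<lambda>x. R x * (cmod (\<phi> x))\<^sup>2) \<and>
      integrable \<Lambda> (\<lambda>x. core.Wp x * (cmod (\<phi> x))\<^sup>2) \<and>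
      core.energy \<psi> / 2 + core.potential \<phi> + core.mass \<phi> \<le> Re (LINT x|\<Lambda>. R x *\<^sub>R (cnj (\<phi> x) * \<kappa> x)) + C * core.mass \<phi>"
  have *: "integrable \<Lambda> (\<lambda>x. \<omega> x * (cmod (flux f x))\<^sup>2) \<and> integrable \<Lambda> (\<lambda>x. R x * (cmod (red f x))\<^sup>2) \<and>
      integrable \<Lambda> (\<lambda>x. core.Wp x * (cmod (red f x))\<^sup>2) \<and>
      core.energy (flux f) / 2 + core.potential (red f) + core.mass (red f)
      \<le> Re (LINT x|\<Lambda>. R x *\<^sub>R (cnj (red f x) * red (tau f) x)) + C * core.mass (red f)" if f: "f \<in> dom_T0" for f
  proof -
    obtain c d where cd: "{c..d} \<subseteq> I" "\<And>x. x \<in> I \<Longrightarrow> x \<notin> {c..d} \<Longrightarrow> f x = 0" by (rule dom_T0_support[OF f]) (rule that; assumption)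
    show ?thesis by (rule C[OF slc_red[OF dom_Tmax_D(1)[OF dom_T0_D[OF f]]] cd(1)]) (simp add: red_def cd(2))
  qed
  show thesis
  proof (rule that[of C])
    fix f assume f: "f \<in> dom_T0"
    note F = dom_Tmax_D[OF dom_T0_D[OF f]]
    show "integrable \<Lambda> (\<lambda>x. \<omega> x * (cmod (flux f x))\<^sup>2)" "integrable \<Lambda> (\<lambda>x. core.Wp x * (cmod (red f x))\<^sup>2)"
      using *[OF f] by auto
    show "core.energy (flux f) / 2 + core.potential (red f) + core.mass (red f)
      \<le> Re (L2_inner rmeas f (tau f)) + C * Re (L2_inner rmeas f f)"
      using *[OF f] by (simp add: L2_inner_red[OF F(4,5)] mass_red_inner[OF F(4), symmetric])
  qed
qed

lemma diff_simps:
  shows "f \<in> dom_T0 \<Longrightarrow> h \<in> dom_T0 \<Longrightarrow> (\<lambda>x. f x - h x) \<in> dom_T0"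
    and "f \<in> D_tau \<Longrightarrow> h \<in> D_tau \<Longrightarrow> x \<in> I \<Longrightarrow> flux (\<lambda>x. f x - h x) x = flux f x - flux h x"
    and "red (\<lambda>x. f x - h x) x = red f x - red h x"
  using dom_T0_lincomb[of h f "-1"] tau_lincomb(3)[of h f x "-1"] by (simp_all add: red_def scaleR_diff_right)

text \<open>\<open>core.complete\<close> pulled back through f = g \<phi>. It serves both the
  completeness condition of \<open>semibounded_operator\<close> and the description of the form
  closure.\<close>

lemma form_limit:
  assumes \<phi>: "\<And>n. \<phi> n \<in> dom_T0"
    and fin: "\<And>f. f \<in> dom_T0 \<Longrightarrow> integrable \<Lambda> (\<lambda>x. \<omega> x * (cmod (flux f x))\<^sup>2)"
    and cauchy: "\<And>\<epsilon>. \<epsilon> > 0 \<Longrightarrow> \<exists>N. \<forall>m\<ge>N. \<forall>n\<ge>N.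
      core.energy (flux (\<lambda>x. \<phi> m x - \<phi> n x)) + core.mass (red (\<lambda>x. \<phi> m x - \<phi> n x)) < \<epsilon>"
  obtains v where "continuous_on I v" "\<And>x. x \<in> I \<Longrightarrow> (\<lambda>n. red (\<phi> n) x) \<longlonglongrightarrow> red v x"
    "\<And>c d. c < d \<Longrightarrow> {c..d} \<subseteq> I \<Longrightarrow> \<exists>K. \<forall>n. \<forall>x\<in>{c..d}. cmod (red (\<phi> n) x) \<le> K"
    "v \<in> L2_fun rmeas" "(\<lambda>n. LINT x|rmeas. (cmod (\<phi> n x - v x))\<^sup>2) \<longlonglongrightarrow> 0"
proof -
  note D = dom_Tmax_D[OF dom_T0_D[OF \<phi>]]
  have flux: "flux (\<lambda>x. \<phi> m x - \<phi> n x) x = flux (\<phi> m) x - flux (\<phi> n) x" if "x \<in> I" for m n x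
    by (rule diff_simps(2)[OF D(1) D(1) that])
  have energy: "core.energy (\<lambda>x. flux (\<phi> m) x - flux (\<phi> n) x) = core.energy (flux (\<lambda>x. \<phi> m x - \<phi> n x))" for m n
    unfolding core.energy_def by (rule Bochner_Integration.integral_cong) (simp_all add: flux)
  have mass: "core.mass (\<lambda>x. red (\<phi> m) x - red (\<phi> n) x) = core.mass (red (\<lambda>x. \<phi> m x - \<phi> n x))" for m n
    by (simp add: diff_simps(3)[abs_def])
  obtain f where f: "continuous_on I f" "\<And>x. x \<in> I \<Longrightarrow> (\<lambda>n. red (\<phi> n) x) \<longlonglongrightarrow> f x"
    "\<And>c d. c < d \<Longrightarrow> {c..d} \<subseteq> I \<Longrightarrow> \<exists>K. \<forall>n. \<forall>x\<in>{c..d}. cmod (red (\<phi> n) x) \<le> K"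
    "\<And>n. integrable \<Lambda> (\<lambda>x. R x * (cmod (red (\<phi> n) x - f x))\<^sup>2)"
    "(\<lambda>n. LINT x|\<Lambda>. R x * (cmod (red (\<phi> n) x - f x))\<^sup>2) \<longlonglongrightarrow> 0"
  proof (rule core.complete)
    show "core.slc (red (\<phi> n)) (flux (\<phi> n)) (red (tau (\<phi> n)))" for n by (rule slc_red[OF D(1)])
    show "integrable \<Lambda> (\<lambda>x. \<omega> x * (cmod (flux (\<phi> m) x - flux (\<phi> n) x))\<^sup>2)" for m n
    proof -
      have "integrable \<Lambda> (\<lambda>x. \<omega> x * (cmod (flux (\<lambda>x. \<phi> m x - \<phi> n x) x))\<^sup>2)" by (rule fin[OF diff_simps(1)[OF \<phi> \<phi>]])
      then show ?thesis by (subst Bochner_Integration.integrable_cong[OF refl]) (simp_all add: flux)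
    qed
    show "integrable \<Lambda> (\<lambda>x. R x * (cmod (red (\<phi> m) x - red (\<phi> n) x))\<^sup>2)" for m n
    proof -
      note d = dom_Tmax_D[OF dom_T0_D[OF diff_simps(1)[OF \<phi>[of m] \<phi>[of n]]]]
      show ?thesis using L2_fun_red[OF d(4)] d(2) by (simp add: diff_simps(3))
    qed
    show "\<exists>N. \<forall>m\<ge>N. \<forall>n\<ge>N. core.energy (\<lambda>x. flux (\<phi> m) x - flux (\<phi> n) x) + core.mass (\<lambda>x. red (\<phi> m) x - red (\<phi> n) x) < \<epsilon>"
      if "\<epsilon> > 0" for \<epsilon> unfolding energy mass by (rule cauchy[OF that])
  qed (rule that; assumption)
  define v where "v x = g x *\<^sub>R f x" for x
  have rv: "red v = f" unfolding v_def by (rule red_gauge(1))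
  have vc: "continuous_on I v" unfolding v_def by (intro continuous_intros g_continuous f(1))
  have dm: "(\<lambda>x. \<phi> n x - v x) \<in> borel_measurable \<Lambda>" for n
    by (intro borel_measurable_diff D(4) continuous_measurable[OF vc])
  have dL: "(\<lambda>x. \<phi> n x - v x) \<in> L2_fun rmeas" for n
    using L2_fun_red[OF dm] f(4) by (simp add: diff_simps(3) rv)
  have "(\<lambda>x. - 1 * (\<phi> 0 x - v x) + \<phi> 0 x) \<in> L2_fun rmeas" by (rule L2_fun_lincomb[OF dL D(2)])
  then have vL: "v \<in> L2_fun rmeas" by simp
  have "(LINT x|rmeas. (cmod (\<phi> n x - v x))\<^sup>2) = (LINT x|\<Lambda>. R x * (cmod (red (\<phi> n) x - f x))\<^sup>2)" for n
    using mass_red[OF dm[of n]] by (simp add: core.mass_def diff_simps(3) rv)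
  then show thesis using that[OF vc _ f(3) vL] f(2,5) by (simp add: rv)
qed

text \<open>The bound B passes to the limit on each compact interval, for the energy by
  \<open>energy_lsc\<close> and for the potential by dominated convergence. As it does not depend on
  the interval, both integrals over (a,b) are finite.\<close>

lemma closure_element_finite:
  assumes f: "f \<in> dom_Tmax" and \<phi>: "\<And>n. \<phi> n \<in> dom_T0"
    and lim: "\<And>x. x \<in> I \<Longrightarrow> (\<lambda>n. red (\<phi> n) x) \<longlonglongrightarrow> red f x"
    and bdd: "\<And>c d. c < d \<Longrightarrow> {c..d} \<subseteq> I \<Longrightarrow> \<exists>K. \<forall>n. \<forall>x\<in>{c..d}. cmod (red (\<phi> n) x) \<le> K"
    and int: "\<And>n. integrable \<Lambda> (\<lambda>x. \<omega> x * (cmod (flux (\<phi> n) x))\<^sup>2)" "\<And>n. integrable \<Lambda> (\<lambda>x. core.Wp x * (cmod (red (\<phi> n) x))\<^sup>2)"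
    and B: "\<And>n. core.energy (flux (\<phi> n)) \<le> B" "\<And>n. core.potential (red (\<phi> n)) \<le> B"
  shows "integrable \<Lambda> (\<lambda>x. \<omega> x * (cmod (flux f x))\<^sup>2)" "integrable \<Lambda> (\<lambda>x. core.Wp x * (cmod (red f x))\<^sup>2)"
proof -
  note s = slc_red[OF dom_Tmax_D(1)[OF f]] and sn = slc_red[OF dom_Tmax_D(1)[OF dom_T0_D[OF \<phi>]]]
  have B0: "0 \<le> B" using core.quantities_nonneg(1) B(1)[of 0] order_trans by blast
  have wloc: "loc_integrable_on I (\<lambda>x. core.Wp x * (cmod (h x))\<^sup>2)" if "continuous_on I h" for h :: "real \<Rightarrow> complex"
    by (intro loc_integrable_on_mult core.Wp_loc continuous_intros that)
  show "integrable \<Lambda> (\<lambda>x. \<omega> x * (cmod (flux f x))\<^sup>2)"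
  proof (rule integrable_of_local_bound[OF interval])
    show "loc_integrable_on I (\<lambda>x. \<omega> x * (cmod (flux f x))\<^sup>2)"
      by (intro loc_integrable_on_mult \<omega>_loc continuous_intros core.slcD(4)[OF s])
    show "0 \<le> \<omega> x * (cmod (flux f x))\<^sup>2" for x using core.nonneg(1)[of x] by simp
    fix c d assume cd: "c \<le> d" "{c..d} \<subseteq> I"
    show "integral {c..d} (\<lambda>x. \<omega> x * (cmod (flux f x))\<^sup>2) \<le> B"
    proof (cases "c = d")
      case True then show ?thesis using B0 by simp
    next
      case False
      then obtain K where K: "\<And>n x. x \<in> {c..d} \<Longrightarrow> cmod (red (\<phi> n) x) \<le> K" using bdd[OF _ cd(2)] cd(1) by force
      show ?thesis
      proof (rule core.energy_lsc[OF s sn lim K _ cd])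
        show "integral {c..d} (\<lambda>x. \<omega> x * (cmod (flux (\<phi> n) x))\<^sup>2) \<le> B" for n
          using core.local_le_global[OF int(1)[of n] _ cd(2) core.energy_integrable(1)[OF core.slcD(4)[OF sn] cd(2)]] B(1)[of n]
          by (simp add: core.nonneg core.energy_def)
      qed (use cd in auto)
    qed
  qed
  show "integrable \<Lambda> (\<lambda>x. core.Wp x * (cmod (red f x))\<^sup>2)"
  proof (rule integrable_of_local_bound[OF interval wloc[OF core.slcD(3)[OF s]]])
    show "0 \<le> core.Wp x * (cmod (red f x))\<^sup>2" if "x \<in> I" for x using core.Wp_nonneg[OF that] by simp
    fix c d assume cd: "c \<le> d" "{c..d} \<subseteq> I"
    show "integral {c..d} (\<lambda>x. core.Wp x * (cmod (red f x))\<^sup>2) \<le> B"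
    proof (cases "c = d")
      case True then show ?thesis using B0 by simp
    next
      case False
      then obtain K where K: "\<And>n x. x \<in> {c..d} \<Longrightarrow> cmod (red (\<phi> n) x) \<le> K" using bdd[OF _ cd(2)] cd(1) by force
      have "(\<lambda>n. integral {c..d} (\<lambda>x. core.Wp x * (cmod (red (\<phi> n) x))\<^sup>2)) \<longlonglongrightarrow> integral {c..d} (\<lambda>x. core.Wp x * (cmod (red f x))\<^sup>2)"
      proof (rule dominated_convergence(2))
        show "(\<lambda>x. core.Wp x * (cmod (red (\<phi> n) x))\<^sup>2) integrable_on {c..d}" for n
          by (rule loc_integrable_onD(2)[OF wloc[OF core.slcD(3)[OF sn]] cd(2)])
        show "(\<lambda>x. core.Wp x * K\<^sup>2) integrable_on {c..d}"
          by (intro integrable_on_mult_left loc_integrable_onD(2)[OF core.Wp_loc cd(2)])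
        show "norm (core.Wp x * (cmod (red (\<phi> n) x))\<^sup>2) \<le> core.Wp x * K\<^sup>2" if "x \<in> {c..d}" for n x
        proof -
          have "0 \<le> core.Wp x" by (rule core.Wp_nonneg) (use that cd(2) in blast)
          then show ?thesis using mult_left_mono[OF power_mono[OF K[OF that], of n 2]] by simp
        qed
        show "(\<lambda>n. core.Wp x * (cmod (red (\<phi> n) x))\<^sup>2) \<longlonglongrightarrow> core.Wp x * (cmod (red f x))\<^sup>2" if "x \<in> {c..d}" for x
          by (intro tendsto_intros lim) (use that cd in auto)
      qed
      then show ?thesis
      proof (rule LIMSEQ_le_const2, intro exI allI impI)
        fix n
        have "integral {c..d} (\<lambda>x. core.Wp x * (cmod (red (\<phi> n) x))\<^sup>2) \<le> core.potential (red (\<phi> n))"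
          unfolding core.potential_def
          by (rule core.local_le_global[OF int(2) _ cd(2) loc_integrable_onD(1)[OF wloc[OF core.slcD(3)[OF sn]] cd(2)]])
            (simp add: core.Wp_nonneg)
        then show "integral {c..d} (\<lambda>x. core.Wp x * (cmod (red (\<phi> n) x))\<^sup>2) \<le> B" using B(2)[of n] by simp
      qed
    qed
  qed
qed

theorem friedrichs_ext_eq:
  "friedrichs_ext = {(L2_class rmeas f, L2_class rmeas (tau f)) | f. f \<in> finite_energy}"
  "f \<in> finite_energy \<Longrightarrow> integrable \<Lambda> (\<lambda>x. core.Wp x * (cmod (red f x))\<^sup>2)"
proof -
  obtain C where C: "\<And>f. f \<in> dom_T0 \<Longrightarrow> integrable \<Lambda> (\<lambda>x. \<omega> x * (cmod (flux f x))\<^sup>2)"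
    "\<And>f. f \<in> dom_T0 \<Longrightarrow> integrable \<Lambda> (\<lambda>x. core.Wp x * (cmod (red f x))\<^sup>2)"
    "\<And>f. f \<in> dom_T0 \<Longrightarrow> core.energy (flux f) / 2 + core.potential (red f) + core.mass (red f)
      \<le> Re (L2_inner rmeas f (tau f)) + C * Re (L2_inner rmeas f f)"
    by (rule form_bound) (rule that; assumption)
  \<comment> \<open>Coercivity makes a sequence that is Cauchy in the shifted form Cauchy in energy
    and mass; \<epsilon>/2 compensates the factor 1/2 of the energy.\<close>
  have limit: "\<exists>N. \<forall>m\<ge>N. \<forall>n\<ge>N. core.energy (flux (\<lambda>x. \<phi> m x - \<phi> n x)) + core.mass (red (\<lambda>x. \<phi> m x - \<phi> n x)) < \<epsilon>"
    if \<phi>: "\<And>n. \<phi> n \<in> dom_T0" and \<epsilon>: "\<epsilon> > 0" and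
      c: "\<And>\<epsilon>. \<epsilon> > 0 \<Longrightarrow> \<exists>N. \<forall>m\<ge>N. \<forall>n\<ge>N. Re (L2_inner rmeas (\<lambda>x. \<phi> m x - \<phi> n x) (tau (\<lambda>x. \<phi> m x - \<phi> n x)))
          + C * Re (L2_inner rmeas (\<lambda>x. \<phi> m x - \<phi> n x) (\<lambda>x. \<phi> m x - \<phi> n x)) < \<epsilon>" for \<phi> \<epsilon>
  proof -
    have "\<epsilon> / 2 > 0" using \<epsilon> by simp
    from c[OF this] obtain N where N: "\<And>m n. m \<ge> N \<Longrightarrow> n \<ge> N \<Longrightarrow>
      Re (L2_inner rmeas (\<lambda>x. \<phi> m x - \<phi> n x) (tau (\<lambda>x. \<phi> m x - \<phi> n x)))
          + C * Re (L2_inner rmeas (\<lambda>x. \<phi> m x - \<phi> n x) (\<lambda>x. \<phi> m x - \<phi> n x)) < \<epsilon> / 2" by blast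
    have "core.energy (flux (\<lambda>x. \<phi> m x - \<phi> n x)) + core.mass (red (\<lambda>x. \<phi> m x - \<phi> n x)) < \<epsilon>" if mn: "m \<ge> N" "n \<ge> N" for m n
      using N[OF mn] C(3)[OF diff_simps(1)[OF \<phi>[of m] \<phi>[of n]]] core.quantities_nonneg(2)[of "red (\<lambda>x. \<phi> m x - \<phi> n x)"]
        core.quantities_nonneg(3)[of "red (\<lambda>x. \<phi> m x - \<phi> n x)"] by linarith
    then show ?thesis by blast
  qed
  interpret semibounded_operator rmeas dom_T0 dom_Tmax tau tau C
  proof
    have "slp (\<lambda>x. 0) (\<lambda>x. 0) (\<lambda>x. 0)" using primitive_on_const[of I "0::complex"] by (simp add: slp_def)
    moreover have "(\<lambda>x. 0) \<in> L2_fun rmeas" by (simp add: L2_fun_def)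
    ultimately have "(\<lambda>x. 0) \<in> dom_Tmax" by (rule slp_dom_Tmax) (simp add: L2_fun_def)
    then have "(\<lambda>x. 0) \<in> dom_T0" using dom_T0_I[of "\<lambda>x. 0" 1 0] by simp
    then show "dom_T0 \<noteq> {}" by blast
    show "dom_T0 \<subseteq> L2_fun rmeas" "dom_Tmax \<subseteq> L2_fun rmeas" using dom_Tmax_D dom_T0_D by blast+
    show "tau f \<in> L2_fun rmeas" if "f \<in> dom_T0" for f using dom_Tmax_D(3)[OF dom_T0_D[OF that]] .
    show "tau f \<in> L2_fun rmeas" if "f \<in> dom_Tmax" for f using dom_Tmax_D(3)[OF that] .
    show "(\<lambda>x. c * f x + h x) \<in> dom_T0" if "f \<in> dom_T0" "h \<in> dom_T0" for f h c using dom_T0_lincomb[OF that] .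
    show "AE x in rmeas. tau (\<lambda>x. c * f x + h x) x = c * tau f x + tau h x" if "f \<in> dom_T0" "h \<in> dom_T0" for f h c
      unfolding AE_rmeas by (intro tau_lincomb dom_Tmax_D dom_T0_D that)
    show "L2_inner rmeas f (tau h) = L2_inner rmeas (tau f) h" if "f \<in> dom_T0" "h \<in> dom_T0" for f h
      using green[OF that(1) dom_T0_D[OF that(2)]] by simp
    show "L2_inner rmeas (tau f) h = L2_inner rmeas f (tau h)" if "f \<in> dom_T0" "h \<in> dom_Tmax" for f h
      using green[OF that] .
    show "Re (L2_inner rmeas f f) \<le> Re (L2_inner rmeas f (tau f)) + C * Re (L2_inner rmeas f f)" if "f \<in> dom_T0" for f
      using C(3)[OF that] core.quantities_nonneg(1)[of "flux f"] core.quantities_nonneg(2)[of "red f"]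
        mass_red_inner[OF dom_Tmax_D(4)[OF dom_T0_D[OF that]]] by linarith
    show "\<exists>v\<in>dom_Tmax. (AE x in rmeas. u x = v x) \<and> (AE x in rmeas. h x = tau v x)"
      if "u \<in> L2_fun rmeas" "h \<in> L2_fun rmeas" "\<And>f. f \<in> dom_T0 \<Longrightarrow> L2_inner rmeas (tau f) u = L2_inner rmeas f h" for u h
      using adjoint[OF that] .
    fix \<phi> :: "nat \<Rightarrow> real \<Rightarrow> complex"
    assume \<phi>: "\<And>n. \<phi> n \<in> dom_T0" and
      c: "\<And>\<epsilon>. \<epsilon> > 0 \<Longrightarrow> \<exists>N. \<forall>m\<ge>N. \<forall>n\<ge>N. Re (L2_inner rmeas (\<lambda>x. \<phi> m x - \<phi> n x) (tau (\<lambda>x. \<phi> m x - \<phi> n x)))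
          + C * Re (L2_inner rmeas (\<lambda>x. \<phi> m x - \<phi> n x) (\<lambda>x. \<phi> m x - \<phi> n x)) < \<epsilon>"
    show "\<exists>u\<in>L2_fun rmeas. (\<lambda>n. LINT x|rmeas. (cmod (\<phi> n x - u x))\<^sup>2) \<longlonglongrightarrow> 0"
      by (rule form_limit[OF \<phi> C(1) limit[OF \<phi> _ c]]) auto
  qed
  have closure: "integrable \<Lambda> (\<lambda>x. \<omega> x * (cmod (flux f x))\<^sup>2) \<and> integrable \<Lambda> (\<lambda>x. core.Wp x * (cmod (red f x))\<^sup>2)"
    if f: "f \<in> dom_Tmax" and cl: "f \<in> form_closure_dom rmeas dom_T0 t" for f
  proof -
    obtain \<phi> where conv: "form_convergent rmeas dom_T0 t \<phi> f" using cl by (auto simp: form_closure_dom_def)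
    note D = form_convergentD[OF conv]
    have D4: "\<exists>N. \<forall>m\<ge>N. \<forall>n\<ge>N. Re (L2_inner rmeas (\<lambda>x. \<phi> m x - \<phi> n x) (tau (\<lambda>x. \<phi> m x - \<phi> n x)))
          + C * Re (L2_inner rmeas (\<lambda>x. \<phi> m x - \<phi> n x) (\<lambda>x. \<phi> m x - \<phi> n x)) < \<epsilon>" if "\<epsilon> > 0" for \<epsilon>
      using D(4)[OF that] by (simp add: B.q_def tC_def)
    have cau: "\<exists>N. \<forall>m\<ge>N. \<forall>n\<ge>N. core.energy (flux (\<lambda>x. \<phi> m x - \<phi> n x)) + core.mass (red (\<lambda>x. \<phi> m x - \<phi> n x)) < \<epsilon>"
      if "\<epsilon> > 0" for \<epsilon> by (rule limit[OF D(1) that D4])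
    obtain v where v: "continuous_on I v" "\<And>x. x \<in> I \<Longrightarrow> (\<lambda>n. red (\<phi> n) x) \<longlonglongrightarrow> red v x"
      "\<And>c d. c < d \<Longrightarrow> {c..d} \<subseteq> I \<Longrightarrow> \<exists>K. \<forall>n. \<forall>x\<in>{c..d}. cmod (red (\<phi> n) x) \<le> K"
      "v \<in> L2_fun rmeas" "(\<lambda>n. LINT x|rmeas. (cmod (\<phi> n x - v x))\<^sup>2) \<longlonglongrightarrow> 0"
      by (rule form_limit[OF D(1) C(1) cau]) (assumption | (rule that; assumption))+
    have fc: "continuous_on I f" by (rule D_tau_continuous(1)[OF dom_Tmax_D(1)[OF f]])
    \<comment> \<open>f and v are both limits of \<phi> in the Hilbert space.\<close>
    have "AE x in rmeas. f x = v x"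
    proof -
      have "L.q (\<lambda>x. f x - v x) \<le> 2 * L.q (\<lambda>x. \<phi> n x - v x) + 2 * L.q (\<lambda>x. \<phi> n x - f x)" for n
      proof -
        have m: "(\<lambda>x. \<phi> n x - v x) \<in> L2_fun rmeas" "(\<lambda>x. \<phi> n x - f x) \<in> L2_fun rmeas"
          by (intro L.diff_closed L2 D(1,2) v(4))+
        have "L.q (\<lambda>x. (\<phi> n x - v x) - (\<phi> n x - f x)) \<le> 2 * L.q (\<lambda>x. \<phi> n x - v x) + 2 * L.q (\<lambda>x. \<phi> n x - f x)"
          using L.parallelogram[OF m] L.q_nonneg[OF L.scale_closed[OF L.closed[OF m, of 1], of "1/2"]] by simp
        then show ?thesis by simp
      qed
      moreover have "(\<lambda>n. 2 * L.q (\<lambda>x. \<phi> n x - v x) + 2 * L.q (\<lambda>x. \<phi> n x - f x)) \<longlonglongrightarrow> 2 * 0 + 2 * 0"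
        by (intro tendsto_intros D(3)) (use v(5) in \<open>simp add: L_q\<close>)
      ultimately have "L.q (\<lambda>x. f x - v x) \<le> 0" by (intro LIMSEQ_le_const) auto
      then have "L.q (\<lambda>x. f x - v x) = 0" using L.q_nonneg[OF L.diff_closed[OF D(2) v(4)]] by simp
      then have "(LINT x|rmeas. (cmod (f x - v x))\<^sup>2) = 0" by (simp add: L_q)
      moreover have "integrable rmeas (\<lambda>x. (cmod (f x - v x))\<^sup>2)" using L.diff_closed[OF D(2) v(4)] by (simp add: L2_fun_def)
      ultimately have "AE x in rmeas. (cmod (f x - v x))\<^sup>2 = 0" by (subst (asm) integral_nonneg_eq_0_iff_AE) auto
      then show ?thesis by eventually_elim simp
    qed
    \<comment> \<open>Both are continuous, so almost everywhere becomes everywhere;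
      \<open>closure_element_finite\<close> asks for pointwise limits.\<close>
    then have "f x = v x" if "x \<in> I" for x
      using continuous_AE_eq[OF fc v(1) open_einterval _ that] by (simp add: AE_rmeas)
    then have lim: "(\<lambda>n. red (\<phi> n) x) \<longlonglongrightarrow> red f x" if "x \<in> I" for x using v(2)[OF that] that by (simp add: red_def)
    \<comment> \<open>The shifted form is bounded from the index N on, so the sequence is shifted by
      N. The bound 2 * K below undoes the factor 1/2 of the energy.\<close>
    obtain N K where K: "0 < K" "\<And>n. n \<ge> N \<Longrightarrow> B.q (\<phi> n) \<le> K" by (rule form_convergent_bounded[OF conv]) (rule that; assumption)
    have bd: "core.energy (flux (\<phi> (n + N))) \<le> 2 * K" "core.potential (red (\<phi> (n + N))) \<le> 2 * K" for n
      using C(3)[OF D(1)[of "n + N"]] K(1) K(2)[of "n + N"] core.quantities_nonneg(1)[of "flux (\<phi> (n + N))"]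
        core.quantities_nonneg(2,3)[of "red (\<phi> (n + N))"] by (simp_all add: B.q_def tC_def)
    have bdd: "\<exists>K. \<forall>n. \<forall>x\<in>{c..d}. cmod (red (\<phi> (n + N)) x) \<le> K" if cd: "c < d" "{c..d} \<subseteq> I" for c d
      using v(3)[OF cd] by blast
    note fin = closure_element_finite[of f "\<lambda>n. \<phi> (n + N)", OF f D(1) LIMSEQ_ignore_initial_segment[OF lim] bdd C(1,2)[OF D(1)] bd]
    show ?thesis by (rule conjI; rule fin; assumption)
  qed
  interpret friedrichs_setting rmeas dom_T0 dom_Tmax tau tau C finite_energy
    by unfold_locales (use finite_energy_sym closure in \<open>auto simp: finite_energy_def\<close>)
  have "T0_form = t" by (simp add: fun_eq_iff T0_form_def)
  then show "friedrichs_ext = {(L2_class rmeas f, L2_class rmeas (tau f)) | f. f \<in> finite_energy}"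
    using form_operator_eq by (simp add: friedrichs_ext_def)
  show "integrable \<Lambda> (\<lambda>x. core.Wp x * (cmod (red f x))\<^sup>2)" if "f \<in> finite_energy"
    using closure[OF _ F_in_closure[OF that]] that by (simp add: finite_energy_def)
qed

end

section \<open>Integrals near the endpoints\<close>

lemma set_nn_integral_lebesgue_on:
  "S \<in> sets lebesgue \<Longrightarrow> (\<integral>\<^sup>+x\<in>S. f x \<partial>lebesgue) = (\<integral>\<^sup>+x. f x \<partial>lebesgue_on S)"
  by (simp add: nn_integral_restrict_space)

text \<open>E plays the role of an integrand of the theorem and e that of its integrable counterpart
  for the system; an inequality almost everywhere is all that connects them.\<close>

lemma set_nn_integral_finite:
  fixes e E :: "real \<Rightarrow> real"
  assumes S: "S \<in> sets lebesgue" and e: "integrable (lebesgue_on S) e" and le: "AE x in lebesgue_on S. E x \<le> e x"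
  shows "(\<integral>\<^sup>+x\<in>S. ennreal (E x) \<partial>lebesgue) < \<infinity>"
proof -
  have "(\<integral>\<^sup>+x. ennreal (E x) \<partial>lebesgue_on S) \<le> (\<integral>\<^sup>+x. ennreal (norm (e x)) \<partial>lebesgue_on S)"
  proof (rule nn_integral_mono_AE)
    show "AE x in lebesgue_on S. ennreal (E x) \<le> ennreal (norm (e x))"
      using le by eventually_elim (auto intro!: ennreal_leI)
  qed
  also have "\<dots> < \<infinity>" using e by (simp add: integrable_iff_bounded)
  finally show ?thesis by (simp only: set_nn_integral_lebesgue_on[OF S])
qed

lemma integrable_of_set_nn_integral_finite:
  fixes e E :: "real \<Rightarrow> real"
  assumes S: "S \<in> sets lebesgue" and e: "e \<in> borel_measurable (lebesgue_on S)" "\<And>x. 0 \<le> e x"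
    and eq: "AE x in lebesgue_on S. E x = e x" and fin: "(\<integral>\<^sup>+x\<in>S. ennreal (E x) \<partial>lebesgue) < \<infinity>"
  shows "integrable (lebesgue_on S) e"
proof (rule integrableI_nonneg[OF e(1)])
  have "(\<integral>\<^sup>+x. ennreal (e x) \<partial>lebesgue_on S) = (\<integral>\<^sup>+x. ennreal (E x) \<partial>lebesgue_on S)"
    by (rule nn_integral_cong_AE) (use eq in eventually_elim, simp)
  then show "(\<integral>\<^sup>+x. ennreal (e x) \<partial>lebesgue_on S) < \<infinity>" using fin by (simp only: set_nn_integral_lebesgue_on[OF S])
qed (use e(2) in simp)

lemma integrable_lebesgue_on_subset:
  fixes e :: "real \<Rightarrow> real"
  assumes "integrable (lebesgue_on S) e" "T \<subseteq> S" "S \<in> sets lebesgue" "T \<in> sets lebesgue"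
  shows "integrable (lebesgue_on T) e"
  using set_integrable_subset[of lebesgue S e T] assms by (simp add: absolutely_integrable_on_iff_integrable)

lemma einterval_tails_subset:
  assumes "c \<in> einterval a b"
  shows "einterval a c \<subseteq> einterval a b" "einterval c b \<subseteq> einterval a b"
  using assms order.strict_trans[of _ "ereal c" b] order.strict_trans[of a "ereal c"]
  by (auto simp: einterval_def)

lemma integrable_of_ends:
  fixes e :: "real \<Rightarrow> real"
  assumes e: "loc_integrable_on (einterval a b) e" and cd: "c \<in> einterval a b" "d \<in> einterval a b" "c \<le> d"
    and ends: "integrable (lebesgue_on (einterval a c)) e" "integrable (lebesgue_on (einterval d b)) e"
  shows "integrable (lebesgue_on (einterval a b)) e"
proof -
  have "e absolutely_integrable_on {c..d}" by (rule loc_integrable_onD(1)[OF e einterval_Icc_subset[OF cd(1,2)]])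
  moreover have "e absolutely_integrable_on einterval a c" "e absolutely_integrable_on einterval d b"
    using ends by (simp_all add: absolutely_integrable_on_iff_integrable)
  ultimately have "e absolutely_integrable_on (einterval a c \<union> {c..d} \<union> einterval d b)"
    by (intro set_integrable_Un) auto
  moreover have "einterval a c \<union> {c..d} \<union> einterval d b = einterval a b"
  proof (intro equalityI subsetI)
    fix x assume "x \<in> einterval a c \<union> {c..d} \<union> einterval d b"
    then show "x \<in> einterval a b"
      using einterval_tails_subset[OF cd(1)] einterval_tails_subset[OF cd(2)] einterval_Icc_subset[OF cd(1,2)] by blast
  qed (auto simp: einterval_iff)
  ultimately show ?thesis by (simp add: absolutely_integrable_on_iff_integrable)
qed

text \<open>If the integrals of f over compact intervals were bounded, f would be integrable over
  (u,v), and the integral of h would be finite.\<close>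

lemma nn_integral_infinite_unbounded:
  fixes f h :: "real \<Rightarrow> real"
  assumes f: "loc_integrable_on (einterval a b) f" "\<And>x. 0 \<le> f x"
    and uv: "u < v" "einterval u v \<subseteq> einterval a b"
    and h: "\<And>x. x \<in> einterval u v \<Longrightarrow> h x \<le> k * f x"
    and inf: "(\<integral>\<^sup>+x\<in>einterval u v. ennreal (h x) \<partial>lebesgue) = \<infinity>"
  shows "\<exists>c d. c \<le> d \<and> {c..d} \<subseteq> einterval u v \<and> B < integral {c..d} f"
proof (rule ccontr)
  assume "\<not> ?thesis"
  then have "integral {c..d} f \<le> B" if "c \<le> d" "{c..d} \<subseteq> einterval u v" for c d using that not_less by blast
  then have "integrable (lebesgue_on (einterval u v)) f"
    by (intro integrable_of_local_bound[OF uv(1) loc_integrable_on_subset[OF f(1) uv(2)] f(2)])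
  then have "integrable (lebesgue_on (einterval u v)) (\<lambda>x. k * f x)" by simp
  then have "(\<integral>\<^sup>+x\<in>einterval u v. ennreal (h x) \<partial>lebesgue) < \<infinity>"
    by (rule set_nn_integral_finite[rotated]) (use h in auto)
  then show False using inf by simp
qed

lemma integral_enlarge:
  fixes f :: "real \<Rightarrow> real"
  assumes f: "loc_integrable_on S f" "\<And>x. 0 \<le> f x" and "x \<le> u" "u \<le> v" "v \<le> y" "{x..y} \<subseteq> S" and z: "x \<le> z" "z \<le> y"
  shows "integral {u..v} f \<le> integral {x..z} f + integral {z..y} f"
proof -
  note i = loc_integrable_onD(2)[OF f(1)]
  have "integral {u..v} f \<le> integral {x..y} f"
    by (rule integral_subset_le) (use assms in \<open>auto intro!: i\<close>)
  also have "\<dots> = integral {x..z} f + integral {z..y} f"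
    using Henstock_Kurzweil_Integration.integral_combine[OF z i[OF assms(6)]] by simp
  finally show ?thesis .
qed

lemma left_unbounded:
  fixes f h :: "real \<Rightarrow> real"
  assumes f: "loc_integrable_on (einterval a b) f" "\<And>x. 0 \<le> f x" and c1: "c1 \<in> einterval a b"
    and h: "\<And>x. x \<in> einterval a c1 \<Longrightarrow> h x \<le> k * f x"
    and inf: "(\<integral>\<^sup>+x\<in>einterval a c1. ennreal (h x) \<partial>lebesgue) = \<infinity>" and c: "c \<in> einterval a b"
  shows "\<exists>x\<in>einterval a b. x \<le> c \<and> K < integral {x..c} f"
proof -
  have sub: "einterval a c1 \<subseteq> einterval a b" by (rule einterval_tails_subset[OF c1])
  have "a < ereal c1" using c1 by (simp add: einterval_iff)
  \<comment> \<open>The interval found may extend to the right of c; what [c, c1] can contribute is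
    therefore added to K in advance.\<close>
  from nn_integral_infinite_unbounded[OF f this sub h inf, of "K + integral {c..max c c1} f"]
  obtain u v where uv: "u \<le> v" "{u..v} \<subseteq> einterval a c1" "K + integral {c..max c c1} f < integral {u..v} f" by blast
  have v: "v \<le> c1" "u \<in> einterval a b" using uv(1,2) sub by (auto simp: einterval_iff subset_iff dest!: spec[of _ v])
  have x: "min u c \<in> einterval a b" "max c c1 \<in> einterval a b" using v(2) c c1 by (auto simp: min_def max_def)
  have "integral {u..v} f \<le> integral {min u c..c} f + integral {c..max c c1} f"
    by (rule integral_enlarge[OF f]) (use uv(1) v x einterval_Icc_subset[OF x] in auto)
  then show ?thesis using uv(3) x(1) by (intro bexI[of _ "min u c"]) auto
qed

lemma right_unbounded:
  fixes f h :: "real \<Rightarrow> real"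
  assumes f: "loc_integrable_on (einterval a b) f" "\<And>x. 0 \<le> f x" and d1: "d1 \<in> einterval a b"
    and h: "\<And>x. x \<in> einterval d1 b \<Longrightarrow> h x \<le> k * f x"
    and inf: "(\<integral>\<^sup>+x\<in>einterval d1 b. ennreal (h x) \<partial>lebesgue) = \<infinity>" and c: "c \<in> einterval a b"
  shows "\<exists>x\<in>einterval a b. c \<le> x \<and> K < integral {c..x} f"
proof -
  have sub: "einterval d1 b \<subseteq> einterval a b" by (rule einterval_tails_subset[OF d1])
  have "ereal d1 < b" using d1 by (simp add: einterval_iff)
  from nn_integral_infinite_unbounded[OF f this sub h inf, of "K + integral {min c d1..c} f"]
  obtain u v where uv: "u \<le> v" "{u..v} \<subseteq> einterval d1 b" "K + integral {min c d1..c} f < integral {u..v} f" by blast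
  have v: "d1 \<le> u" "v \<in> einterval a b" using uv(1,2) sub by (auto simp: einterval_iff subset_iff dest!: spec[of _ u])
  have x: "min c d1 \<in> einterval a b" "max v c \<in> einterval a b" using v(2) c d1 by (auto simp: min_def max_def)
  have "integral {u..v} f \<le> integral {min c d1..c} f + integral {c..max v c} f"
    by (rule integral_enlarge[OF f]) (use uv(1) v x einterval_Icc_subset[OF x] in auto)
  then show ?thesis using uv(3) x(2) by (intro bexI[of _ "max v c"]) auto
qed

section \<open>The Riccati equation\<close>

context sturm_liouville
begin

text \<open>Since f' = f^[1]/p - s f, the quotient f^[1]/f solves a Riccati equation. The first
  formula explains V, the second the equation imposed on g.\<close>

lemma log_derivative:
  fixes f :: "real \<Rightarrow> real"
  assumes f: "f \<in> D_tau" and J: "einterval u v \<subseteq> I" and pos: "\<And>x. x \<in> einterval u v \<Longrightarrow> 0 < f x"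
  shows "primitive_on (einterval u v) (\<lambda>x. quasi_deriv f x / f x)
      (\<lambda>x. vector_derivative (quasi_deriv f) (at x) / f x - inverse (p x) * (quasi_deriv f x / f x)\<^sup>2 + s x * (quasi_deriv f x / f x))"
    and "primitive_on (einterval u v) (\<lambda>x. ln (f x)) (\<lambda>x. inverse (p x) * (quasi_deriv f x / f x) - s x)"
proof -
  let ?h = "quasi_deriv f" and ?J = "einterval u v"
  have f': "primitive_on ?J f (\<lambda>x. inverse (p x) * ?h x - s x * f x)"
    using primitive_on_subset[OF quasi_deriv_primitive(1)[OF f] J] by simp
  have h': "primitive_on ?J ?h (\<lambda>x. vector_derivative ?h (at x))"
    by (rule primitive_on_subset[OF quasi_deriv_primitive(2)[OF f] J])
  have pos': "0 < y" if "y \<in> f ` ?J" for y using that pos by auto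
  have cont: "continuous_on (f ` ?J) inverse" using pos' by (intro continuous_intros) force
  have "primitive_on ?J (\<lambda>x. ln (f x)) (\<lambda>x. inverse (f x) * (inverse (p x) * ?h x - s x * f x))"
    by (rule primitive_on_compose[OF f' _ cont]) (use pos' in \<open>auto intro!: derivative_eq_intros simp: inverse_eq_divide\<close>)
  then show "primitive_on ?J (\<lambda>x. ln (f x)) (\<lambda>x. inverse (p x) * (?h x / f x) - s x)"
  proof (rule primitive_on_cong_AE)
    show "AE x in lebesgue_on ?J. inverse (f x) * (inverse (p x) * ?h x - s x * f x) = inverse (p x) * (?h x / f x) - s x"
      by (rule AE_I2) (use pos in \<open>force simp: field_simps\<close>)
  qed auto
  have "primitive_on ?J (\<lambda>x. inverse (f x)) (\<lambda>x. (- (inverse (f x) * inverse (f x))) * (inverse (p x) * ?h x - s x * f x))"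
  proof (rule primitive_on_compose[OF f'])
    show "(inverse has_real_derivative - (inverse y * inverse y)) (at y)" if "y \<in> f ` ?J" for y
      using pos'[OF that] by (auto intro!: derivative_eq_intros)
    show "continuous_on (f ` ?J) (\<lambda>y. - (inverse y * inverse y))" by (intro continuous_intros cont)
  qed
  from primitive_on_bilinear[OF bounded_bilinear_mult h' this]
  show "primitive_on ?J (\<lambda>x. ?h x / f x)
      (\<lambda>x. vector_derivative ?h (at x) / f x - inverse (p x) * (?h x / f x)\<^sup>2 + s x * (?h x / f x))"
  proof (rule primitive_on_cong_AE)
    show "AE x in lebesgue_on ?J. ?h x * ((- (inverse (f x) * inverse (f x))) * (inverse (p x) * ?h x - s x * f x)) +
        vector_derivative ?h (at x) * inverse (f x)
        = vector_derivative ?h (at x) / f x - inverse (p x) * (?h x / f x)\<^sup>2 + s x * (?h x / f x)"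
    proof (rule AE_I2)
      fix x assume "x \<in> space (lebesgue_on ?J)"
      then have "f x \<noteq> 0" using pos[of x] by auto
      then have "inverse (f x) * (f x * y) = y" for y by simp
      then show "?h x * ((- (inverse (f x) * inverse (f x))) * (inverse (p x) * ?h x - s x * f x)) +
        vector_derivative ?h (at x) * inverse (f x)
        = vector_derivative ?h (at x) / f x - inverse (p x) * (?h x / f x)\<^sup>2 + s x * (?h x / f x)"
        by (simp add: divide_inverse power2_eq_square algebra_simps)
    qed
  qed (auto simp: divide_inverse)
qed

end

section \<open>Energy and potential near the endpoints\<close>

context gauged_sturm_liouville
begin

text \<open>f/h is k times \<open>red f\<close>, whose derivative is \<omega> times the flux, and p
  g^2 \<omega> = 1, so the constant k cancels.\<close>

lemma end_energy:
  assumes f: "f \<in> D_tau" and J: "einterval u v \<subseteq> I" and k: "k > 0" and h: "\<And>x. x \<in> einterval u v \<Longrightarrow> g x = k * h x"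
  shows "AE x in lebesgue_on (einterval u v).
    p x * (h x)\<^sup>2 * (cmod (vector_derivative (\<lambda>y. f y / of_real (h y)) (at x)))\<^sup>2 = \<omega> x * (cmod (flux f x))\<^sup>2"
proof -
  let ?J = "einterval u v"
  have "AE x in lebesgue_on ?J. (red f has_vector_derivative \<omega> x *\<^sub>R flux f x) (at x)"
    by (rule primitive_on_open_has_vector_derivative[OF primitive_on_subset[OF core.slcD(1)[OF slc_red[OF f]] J]]) simp
  moreover have "AE x in lebesgue_on ?J. inverse (p x) * (inverse (g x))\<^sup>2 = \<omega> x" "AE x in lebesgue_on ?J. 0 < p x"
    by (rule AE_lebesgue_on_subset[OF \<omega>_eq J] AE_lebesgue_on_subset[OF p_pos J]; simp)+
  moreover have "AE x in lebesgue_on ?J. x \<in> ?J" by (rule AE_I2) simp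
  ultimately show ?thesis
  proof eventually_elim
    case (elim x)
    have "((\<lambda>y. k *\<^sub>R red f y) has_vector_derivative k *\<^sub>R (\<omega> x *\<^sub>R flux f x)) (at x)"
      using elim(1) by (auto intro!: derivative_eq_intros)
    then have "((\<lambda>y. f y / of_real (h y)) has_vector_derivative k *\<^sub>R (\<omega> x *\<^sub>R flux f x)) (at x)"
    proof (rule has_vector_derivative_transform_within_open[OF _ open_einterval elim(4)])
      fix y assume y: "y \<in> ?J"
      then show "k *\<^sub>R red f y = f y / of_real (h y)"
        using h[OF y] k by (simp add: red_def scaleR_conv_of_real field_simps)
    qed
    then have "vector_derivative (\<lambda>y. f y / of_real (h y)) (at x) = k *\<^sub>R (\<omega> x *\<^sub>R flux f x)"
      by (rule vector_derivative_at)
    then have "p x * (h x)\<^sup>2 * (cmod (vector_derivative (\<lambda>y. f y / of_real (h y)) (at x)))\<^sup>2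
        = (p x * (k * h x)\<^sup>2 * \<omega> x) * (\<omega> x * (cmod (flux f x))\<^sup>2)"
      using k pos(1)[of x] by (simp add: power_mult_distrib power2_eq_square abs_of_pos algebra_simps)
    also have "p x * (k * h x)\<^sup>2 * \<omega> x = 1"
    proof -
      have "p x * (y * y) * (inverse (p x) * (inverse y * inverse y)) = 1" if "0 < y" for y
        using elim(3) that by (simp add: field_simps)
      from this[OF g_pos[of x]] show ?thesis by (simp flip: h[OF elim(4)] elim(2) add: power2_eq_square)
    qed
    finally show ?case by simp
  qed
qed

text \<open>Off [c0,d0] one has |W| \<le> Wp + |\<mu>| R. The first term has a finite integral
  against |\<phi>|^2 by \<open>friedrichs_ext_eq\<close>, the second because f is square
  integrable.\<close>

lemma end_potential:
  assumes f: "f \<in> finite_energy" and J: "einterval u v \<subseteq> I" "einterval u v \<inter> {c0..d0} = {}"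
    and E: "AE x in lebesgue_on (einterval u v). E x = \<bar>V x\<bar> * (cmod (f x))\<^sup>2"
  shows "(\<integral>\<^sup>+x\<in>einterval u v. ennreal (E x) \<partial>lebesgue) < \<infinity>"
proof (rule set_nn_integral_finite)
  let ?J = "einterval u v" and ?e = "\<lambda>x. core.Wp x * (cmod (red f x))\<^sup>2 + \<bar>\<mu>\<bar> * (R x * (cmod (red f x))\<^sup>2)"
  have fm: "f \<in> dom_Tmax" using f by (simp add: finite_energy_def)
  have "integrable \<Lambda> (\<lambda>x. R x * (cmod (red f x))\<^sup>2)" using L2_fun_red[of f] dom_Tmax_D[OF fm] by simp
  then have "integrable \<Lambda> ?e" using friedrichs_ext_eq(2)[OF f] by simp
  then show "integrable (lebesgue_on ?J) ?e" by (rule integrable_lebesgue_on_subset) (use J in auto)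
  have "AE x in lebesgue_on ?J. V x * (g x)\<^sup>2 = W x" by (rule AE_lebesgue_on_subset[OF W_eq J(1)]) auto
  moreover have "AE x in lebesgue_on ?J. x \<in> ?J" by (rule AE_I2) simp
  ultimately show "AE x in lebesgue_on ?J. E x \<le> ?e x" using E
  proof eventually_elim
    case (elim x)
    have "cmod (f x) = g x * cmod (red f x)" using red_gauge(2)[of x f] g_pos[of x] by (metis abs_of_pos norm_scaleR)
    then have "E x = \<bar>V x * (g x)\<^sup>2\<bar> * (cmod (red f x))\<^sup>2" using elim(3) by (simp add: power_mult_distrib abs_mult)
    also have "\<dots> = \<bar>W x\<bar> * (cmod (red f x))\<^sup>2" using elim(1) by simp
    also have "\<dots> \<le> (core.Wp x + \<bar>\<mu>\<bar> * R x) * (cmod (red f x))\<^sup>2"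
    proof (rule mult_right_mono)
      have x: "x \<in> I" "x \<notin> {c0..d0}" using elim(2) J by blast+
      have "core.Wp x = W x - \<mu> * R x" "0 \<le> core.Wp x" using x core.Wp_nonneg by (auto simp: core.Wp_def)
      moreover have "\<bar>\<mu> * R x\<bar> = \<bar>\<mu>\<bar> * R x" using pos(2)[of x] by (simp add: abs_mult)
      ultimately show "\<bar>W x\<bar> \<le> core.Wp x + \<bar>\<mu>\<bar> * R x" by linarith
    qed simp
    finally show ?case by (simp add: algebra_simps)
  qed
qed auto

lemma flux_energy_loc:
  assumes "f \<in> D_tau"
  shows "loc_integrable_on I (\<lambda>x. \<omega> x * (cmod (flux f x))\<^sup>2)"
  by (intro loc_integrable_on_mult \<omega>_loc continuous_intros core.slcD(4)[OF slc_red[OF assms]])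

end

section \<open>Construction of the gauge function\<close>

context sturm_liouville
begin

text \<open>Only the logarithmic derivative \<sigma> is glued, by a linear function on [c0,d0]; g is
  then an exponential and positive everywhere. The gaps between c0 and cL and between dR and d0 put
  c0 and d0 inside the regions where \<open>ga\<close> and \<open>gb\<close> are positive.\<close>

lemma gauge_exists:
  fixes ga gb :: "real \<Rightarrow> real"
  assumes p_pos: "AE x in \<Lambda>. p x > 0"
    and cd: "c0 \<in> I" "d0 \<in> I" "c0 < d0" and cL: "c0 < cL" "cL \<in> I" and dR: "dR < d0" "dR \<in> I"
    and ga: "ga \<in> D_tau" "\<And>x. x \<in> einterval a cL \<Longrightarrow> 0 < ga x"
      "(\<integral>\<^sup>+x\<in>einterval a c0. ennreal (1 / (p x * (ga x)\<^sup>2)) \<partial>lebesgue) = \<infinity>"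
      "AE x in lebesgue_on (einterval a cL).
        q x \<ge> \<mu> * r x - s x * (quasi_deriv ga x / ga x) + vector_derivative (quasi_deriv ga) (at x) / ga x"
    and gb: "gb \<in> D_tau" "\<And>x. x \<in> einterval dR b \<Longrightarrow> 0 < gb x"
      "(\<integral>\<^sup>+x\<in>einterval d0 b. ennreal (1 / (p x * (gb x)\<^sup>2)) \<partial>lebesgue) = \<infinity>"
      "AE x in lebesgue_on (einterval dR b).
        q x \<ge> \<mu> * r x - s x * (quasi_deriv gb x / gb x) + vector_derivative (quasi_deriv gb) (at x) / gb x"
  obtains \<sigma> \<sigma>' g ka kb where "gauged_sturm_liouville a b p q r s \<sigma> \<sigma>' g \<mu> c0 d0" "0 < ka" "0 < kb"
    "\<And>x. x \<in> einterval a c0 \<Longrightarrow> g x = ka * ga x" "\<And>x. x \<in> einterval d0 b \<Longrightarrow> g x = kb * gb x"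
    "\<And>x. x \<in> einterval a c0 \<Longrightarrow> q x + 2 * s x * \<sigma> x - \<sigma>' x - inverse (p x) * (\<sigma> x)\<^sup>2
      = q x - vector_derivative (quasi_deriv ga) (at x) / ga x + s x * (quasi_deriv ga x / ga x)"
    "\<And>x. x \<in> einterval d0 b \<Longrightarrow> q x + 2 * s x * \<sigma> x - \<sigma>' x - inverse (p x) * (\<sigma> x)\<^sup>2
      = q x - vector_derivative (quasi_deriv gb) (at x) / gb x + s x * (quasi_deriv gb x / gb x)"
proof -
  define ua ub where "ua x = quasi_deriv ga x / ga x" and "ub x = quasi_deriv gb x / gb x" for x
  define va vb where "va x = vector_derivative (quasi_deriv ga) (at x) / ga x"
    and "vb x = vector_derivative (quasi_deriv gb) (at x) / gb x" for x
  \<comment> \<open>The slope that joins ua c0 to ub d0.\<close>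
  define m where "m = (ub d0 - ua c0) / (d0 - c0)"
  define \<sigma> where "\<sigma> x = (if x \<le> c0 then ua x else if x \<le> d0 then ua c0 + m * (x - c0) else ub x)" for x
  define \<sigma>' where "\<sigma>' x = (if x \<le> c0 then va x - inverse (p x) * (ua x)\<^sup>2 + s x * ua x
    else if x \<le> d0 then m else vb x - inverse (p x) * (ub x)\<^sup>2 + s x * ub x)" for x
  have La: "einterval a cL \<subseteq> I" and Rb: "einterval dR b \<subseteq> I"
    by (rule einterval_tails_subset[OF cL(2)] einterval_tails_subset[OF dR(2)])+
  have left: "x \<in> einterval a cL" if "x \<in> I" "x \<le> c0" for x using that cL(1) by (auto simp: einterval_iff)
  have right: "x \<in> einterval dR b" if "x \<in> I" "d0 \<le> x" for x using that dR(1) by (auto simp: einterval_iff)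
  note lda = log_derivative[OF ga(1) La ga(2), folded ua_def va_def]
    and ldb = log_derivative[OF gb(1) Rb gb(2), folded ub_def vb_def]
  have \<sigma>: "primitive_on I \<sigma> \<sigma>'"
    unfolding \<sigma>_def[abs_def] \<sigma>'_def[abs_def]
  proof (rule primitive_on_glue)
    show "primitive_on (I \<inter> {..c0}) ua (\<lambda>x. va x - inverse (p x) * (ua x)\<^sup>2 + s x * ua x)"
      by (rule primitive_on_subset[OF lda(1)]) (use left in auto)
    show "primitive_on (I \<inter> {c0..}) (\<lambda>x. if x \<le> d0 then ua c0 + m * (x - c0) else ub x)
        (\<lambda>x. if x \<le> d0 then m else vb x - inverse (p x) * (ub x)\<^sup>2 + s x * ub x)"
    proof (rule primitive_on_glue)
      have "primitive_on I (\<lambda>x. ua c0 + m * (x - c0)) (\<lambda>x. m)"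
        by (auto simp: primitive_on_def algebra_simps)
      then show "primitive_on (I \<inter> {c0..} \<inter> {..d0}) (\<lambda>x. ua c0 + m * (x - c0)) (\<lambda>x. m)"
        by (rule primitive_on_subset) auto
      show "primitive_on (I \<inter> {c0..} \<inter> {d0..}) ub (\<lambda>x. vb x - inverse (p x) * (ub x)\<^sup>2 + s x * ub x)"
        by (rule primitive_on_subset[OF ldb(1)]) (use right in auto)
      show "ua c0 + m * (d0 - c0) = ub d0" using cd(3) by (simp add: m_def)
    qed
    show "ua c0 = (if c0 \<le> d0 then ua c0 + m * (c0 - c0) else ub c0)" using cd(3) by simp
  qed
  have \<sigma>c: "continuous_on I \<sigma>" by (rule primitive_on_continuous[OF \<sigma>]) simp
  obtain l where l: "primitive_on I l (\<lambda>x. inverse (p x) * \<sigma> x - s x)"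
    using primitive_on_exists[OF loc_integrable_on_diff[OF loc_integrable_on_mult[OF loc(1) \<sigma>c] loc(4)] cd(1)] by metis
  define g where "g x = exp (l x)" for x
  have g: "primitive_on I g (\<lambda>x. g x * (inverse (p x) * \<sigma> x - s x))"
    unfolding g_def by (rule primitive_on_compose[OF l]) (auto intro!: derivative_eq_intros continuous_intros)
  have g_pos: "0 < g x" for x by (simp add: g_def)
  have sub: "{x..c0} \<subseteq> I" "{x..c0} \<subseteq> einterval a cL" if "x \<in> einterval a c0" for x
  proof -
    have "x \<in> I" using that einterval_tails_subset[OF cd(1)] by blast
    then show *: "{x..c0} \<subseteq> I" by (rule einterval_Icc_subset[OF _ cd(1)])
    show "{x..c0} \<subseteq> einterval a cL" using * left by auto
  qed
  have sub': "{d0..x} \<subseteq> I" "{d0..x} \<subseteq> einterval dR b" if "x \<in> einterval d0 b" for x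
  proof -
    have "x \<in> I" using that einterval_tails_subset[OF cd(2)] by blast
    then show *: "{d0..x} \<subseteq> I" by (rule einterval_Icc_subset[OF cd(2)])
    show "{d0..x} \<subseteq> einterval dR b" using * right by auto
  qed
  \<comment> \<open>Near each end ln g and the logarithm of \<open>ga\<close> or \<open>gb\<close>
    have the same derivative, so they differ by a constant, which is read off at c0 or d0.\<close>
  define ka kb where "ka = g c0 / ga c0" and "kb = g d0 / gb d0"
  have end_pos: "0 < ga c0" "0 < gb d0" using ga(2) gb(2) left[OF cd(1)] right[OF cd(2)] by auto
  have k: "0 < ka" "0 < kb" using end_pos g_pos by (auto simp: ka_def kb_def)
  have g_left: "g x = ka * ga x" if x: "x \<in> einterval a c0" for x
  proof -
    have xc: "x \<le> c0" using x by (simp add: einterval_iff)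
    have "ln (ga c0) - ln (ga x) = integral {x..c0} (\<lambda>y. inverse (p y) * ua y - s y)"
      using primitive_onD(2)[OF lda(2) xc sub(2)[OF x]] by simp
    also have "\<dots> = integral {x..c0} (\<lambda>y. inverse (p y) * \<sigma> y - s y)" by (rule integral_cong) (simp add: \<sigma>_def)
    also have "\<dots> = l c0 - l x" by (rule primitive_onD(2)[OF l xc sub(1)[OF x]])
    finally have "exp (ln (ga c0) - ln (ga x)) = exp (l c0 - l x)" by simp
    moreover have "0 < ga x" using ga(2)[of x] sub(2)[OF x] xc by auto
    ultimately show ?thesis using end_pos by (simp add: exp_diff ka_def g_def field_simps)
  qed
  have g_right: "g x = kb * gb x" if x: "x \<in> einterval d0 b" for x
  proof -
    have xd: "d0 \<le> x" using x by (simp add: einterval_iff)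
    have "ln (gb x) - ln (gb d0) = integral {d0..x} (\<lambda>y. inverse (p y) * ub y - s y)"
      using primitive_onD(2)[OF ldb(2) xd sub'(2)[OF x]] by simp
    also have "\<dots> = integral {d0..x} (\<lambda>y. inverse (p y) * \<sigma> y - s y)"
      by (rule integral_spike[of "{d0}"]) (use cd(3) in \<open>auto simp: \<sigma>_def\<close>)
    also have "\<dots> = l x - l d0" by (rule primitive_onD(2)[OF l xd sub'(1)[OF x]])
    finally have "exp (ln (gb x) - ln (gb d0)) = exp (l x - l d0)" by simp
    moreover have "0 < gb x" using gb(2)[of x] sub'(2)[OF x] xd by auto
    ultimately show ?thesis using end_pos by (simp add: exp_diff kb_def g_def field_simps)
  qed
  have V_left: "q x + 2 * s x * \<sigma> x - \<sigma>' x - inverse (p x) * (\<sigma> x)\<^sup>2 = q x - va x + s x * ua x" if "x \<le> c0" for x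
    using that by (simp add: \<sigma>_def \<sigma>'_def algebra_simps)
  have V_right: "q x + 2 * s x * \<sigma> x - \<sigma>' x - inverse (p x) * (\<sigma> x)\<^sup>2 = q x - vb x + s x * ub x" if "d0 < x" for x
    using that cd(3) by (simp add: \<sigma>_def \<sigma>'_def algebra_simps)
  \<comment> \<open>p may fail to be positive on a null set; the absolute value gives a density that
    is nonnegative everywhere, as \<open>left_unbounded\<close> and \<open>right_unbounded\<close>
    require.\<close>
  define f where "f x = \<bar>inverse (p x) * (inverse (g x))\<^sup>2\<bar>" for x
  have gc: "continuous_on I (\<lambda>x. inverse (g x))"
    by (rule continuous_on_inverse[OF primitive_on_continuous[OF g]]) (auto simp: g_def)
  have "loc_integrable_on I (\<lambda>x. inverse (p x) * (inverse (g x))\<^sup>2)"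
    by (intro loc_integrable_on_mult loc continuous_intros gc)
  from loc_integrable_on_norm[OF this] have f: "loc_integrable_on I f" by (simp only: f_def[abs_def] real_norm_def)
  have f_eq: "integral {c..d} f = integral {c..d} (\<lambda>x. inverse (p x) * (inverse (g x))\<^sup>2)" if "{c..d} \<subseteq> I" for c d
  proof (rule integral_cong_AE_lebesgue_on[OF _ that])
    show "AE x in \<Lambda>. f x = inverse (p x) * (inverse (g x))\<^sup>2"
      using p_pos by eventually_elim (simp add: f_def abs_mult)
  qed simp
  \<comment> \<open>The divergence assumptions concern \<open>ga\<close> and \<open>gb\<close>; near
    an end, where g is a multiple of one of them, this turns them into divergence of the integral of
    1/(p g^2).\<close>
  have fh: "1 / (p x * h\<^sup>2) \<le> k\<^sup>2 * f x" if "g x = k * h" "0 < k" for x h k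
  proof -
    have "1 / (p x * h\<^sup>2) = k\<^sup>2 * (inverse (p x) * (inverse (g x))\<^sup>2)"
      using that by (simp add: divide_inverse power_mult_distrib power_inverse)
    also have "\<dots> \<le> k\<^sup>2 * f x" unfolding f_def by (intro mult_left_mono) auto
    finally show ?thesis .
  qed
  have "gauged_sturm_liouville a b p q r s \<sigma> \<sigma>' g \<mu> c0 d0"
  proof
    show "AE x in lebesgue_on (einterval a b). p x > 0" by (rule p_pos)
    show "primitive_on (einterval a b) \<sigma> \<sigma>'" by (rule \<sigma>)
    show "0 < g x" for x by (rule g_pos)
    show "primitive_on (einterval a b) g (\<lambda>x. g x * (inverse (p x) * \<sigma> x - s x))" by (rule g)
    show "c0 < d0" by (rule cd)
    show "{c0..d0} \<subseteq> einterval a b" by (rule einterval_Icc_subset[OF cd(1,2)])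
    have "AE x in lebesgue. x \<in> einterval a cL \<longrightarrow> q x \<ge> \<mu> * r x - s x * ua x + va x"
      using ga(4) by (simp add: AE_restrict_space_iff ua_def va_def)
    moreover have "AE x in lebesgue. x \<in> einterval dR b \<longrightarrow> q x \<ge> \<mu> * r x - s x * ub x + vb x"
      using gb(4) by (simp add: AE_restrict_space_iff ub_def vb_def)
    ultimately have "AE x in lebesgue. x \<in> I \<longrightarrow> x \<notin> {c0..d0} \<longrightarrow>
        \<mu> * r x \<le> q x + 2 * s x * \<sigma> x - \<sigma>' x - inverse (p x) * (\<sigma> x)\<^sup>2"
    proof eventually_elim
      case (elim x)
      show ?case
      proof (intro impI)
        assume x: "x \<in> I" "x \<notin> {c0..d0}"
        then consider "x < c0" | "d0 < x" by fastforce
        then show "\<mu> * r x \<le> q x + 2 * s x * \<sigma> x - \<sigma>' x - inverse (p x) * (\<sigma> x)\<^sup>2"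
        proof cases
          case 1
          then show ?thesis using elim(1) left[OF x(1)] V_left[of x] by simp
        next
          case 2
          then show ?thesis using elim(2) right[OF x(1)] V_right[of x] by simp
        qed
      qed
    qed
    then show "AE x in lebesgue_on (einterval a b). x \<notin> {c0..d0} \<longrightarrow>
        \<mu> * r x \<le> q x + 2 * s x * \<sigma> x - \<sigma>' x - inverse (p x) * (\<sigma> x)\<^sup>2" by (simp add: AE_restrict_space_iff)
    fix K c assume c: "c \<in> einterval a b"
    have "\<exists>x\<in>I. x \<le> c \<and> K < integral {x..c} f"
      by (rule left_unbounded[OF f _ cd(1) _ ga(3) c, of "ka\<^sup>2"]) (use fh g_left k in \<open>auto simp: f_def\<close>)
    then obtain x where x: "x \<in> I" "x \<le> c" "K < integral {x..c} f" by blast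
    then show "\<exists>x\<in>einterval a b. x \<le> c \<and> K < integral {x..c} (\<lambda>x. inverse (p x) * (inverse (g x))\<^sup>2)"
      using f_eq[OF einterval_Icc_subset[OF x(1) c]] by auto
    have "\<exists>x\<in>I. c \<le> x \<and> K < integral {c..x} f"
      by (rule right_unbounded[OF f _ cd(2) _ gb(3) c, of "kb\<^sup>2"]) (use fh g_right k in \<open>auto simp: f_def\<close>)
    then obtain x where x: "x \<in> I" "c \<le> x" "K < integral {c..x} f" by blast
    then show "\<exists>x\<in>einterval a b. c \<le> x \<and> K < integral {c..x} (\<lambda>x. inverse (p x) * (inverse (g x))\<^sup>2)"
      using f_eq[OF einterval_Icc_subset[OF c x(1)]] by auto
  qed
  then show thesis
    by (rule that[OF _ k g_left g_right]) (use V_left V_right in \<open>auto simp: einterval_iff ua_def ub_def va_def vb_def\<close>)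
qed

end

section \<open>Characterization of the Friedrichs extension\<close>

theorem theorem11p17:
  fixes a b :: ereal and p q r s g\<^sub>a g\<^sub>b :: "real \<Rightarrow> real" and \<gamma>\<^sub>0 \<mu> :: real
  defines "M \<equiv> sturm_liouville.rmeas a b r"
    and "\<tau> \<equiv> sturm_liouville.tau a b p q r s"
    and "qda \<equiv> sturm_liouville.quasi_deriv a b p s g\<^sub>a"
    and "qdb \<equiv> sturm_liouville.quasi_deriv a b p s g\<^sub>b"
    and "S_F \<equiv> sturm_liouville.friedrichs_ext a b p q r s"
  assumes "sturm_liouville a b p q r s"
    and "AE x in lebesgue_on (einterval a b). p x > 0"
    and "sturm_liouville.T0_bounded_below a b p q r s \<gamma>\<^sub>0"
    and "g\<^sub>a \<in> sturm_liouville.D_tau a b p s"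
    and "g\<^sub>b \<in> sturm_liouville.D_tau a b p s"
    and "\<forall>\<^sub>F x in near_left_end a. g\<^sub>a x > 0"
    and "\<forall>\<^sub>F x in near_right_end b. g\<^sub>b x > 0"
    and "\<forall>\<^sub>F c in near_left_end a.
           (\<integral>\<^sup>+x\<in>einterval a c. ennreal (1 / (p x * (g\<^sub>a x)\<^sup>2)) \<partial>lebesgue) = \<infinity>"
    and "\<forall>\<^sub>F d in near_right_end b.
           (\<integral>\<^sup>+x\<in>einterval d b. ennreal (1 / (p x * (g\<^sub>b x)\<^sup>2)) \<partial>lebesgue) = \<infinity>"
    and "\<forall>\<^sub>F c in near_left_end a. AE x in lebesgue_on (einterval a c).
           q x \<ge> \<mu> * r x - s x * (qda x / g\<^sub>a x) + vector_derivative qda (at x) / g\<^sub>a x"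
    and "\<forall>\<^sub>F d in near_right_end b. AE x in lebesgue_on (einterval d b).
           q x \<ge> \<mu> * r x - s x * (qdb x / g\<^sub>b x) + vector_derivative qdb (at x) / g\<^sub>b x"
  shows
    "S_F = {(L2_class M g, L2_class M (\<tau> g)) | g.
       g \<in> sturm_liouville.dom_Tmax a b p q r s \<and>
       (\<forall>\<^sub>F c in near_left_end a.
          (\<integral>\<^sup>+x\<in>einterval a c. ennreal (p x * (g\<^sub>a x)\<^sup>2 *
             (cmod (vector_derivative (\<lambda>y. g y / of_real (g\<^sub>a y)) (at x)))\<^sup>2) \<partial>lebesgue) < \<infinity>) \<and>
       (\<forall>\<^sub>F d in near_right_end b.
          (\<integral>\<^sup>+x\<in>einterval d b. ennreal (p x * (g\<^sub>b x)\<^sup>2 *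
             (cmod (vector_derivative (\<lambda>y. g y / of_real (g\<^sub>b y)) (at x)))\<^sup>2) \<partial>lebesgue) < \<infinity>)}
     \<and>
     (\<forall>f\<in>L2_fun M. L2_class M f \<in> Domain S_F \<longrightarrow>
       (\<forall>\<^sub>F c in near_left_end a.
          (\<integral>\<^sup>+x\<in>einterval a c. ennreal (\<bar>q x - vector_derivative qda (at x) / g\<^sub>a x
             + s x * (qda x / g\<^sub>a x)\<bar> * (cmod (f x))\<^sup>2) \<partial>lebesgue) < \<infinity>) \<and>
       (\<forall>\<^sub>F d in near_right_end b.
          (\<integral>\<^sup>+x\<in>einterval d b. ennreal (\<bar>q x - vector_derivative qdb (at x) / g\<^sub>b x
             + s x * (qdb x / g\<^sub>b x)\<bar> * (cmod (f x))\<^sup>2) \<partial>lebesgue) < \<infinity>))"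
proof -
  interpret SL: sturm_liouville a b p q r s by fact
  note near_left = eventually_near_left_end[OF SL.interval] and near_right = eventually_near_right_end[OF SL.interval]
  from assms(11,13,15)[unfolded near_left]
  obtain c1 c2 c3 where c: "c1 \<in> einterval a b" "\<And>x. a < ereal x \<Longrightarrow> x < c1 \<Longrightarrow> g\<^sub>a x > 0"
    "c2 \<in> einterval a b" "\<And>c. a < ereal c \<Longrightarrow> c < c2 \<Longrightarrow> (\<integral>\<^sup>+x\<in>einterval a c. ennreal (1 / (p x * (g\<^sub>a x)\<^sup>2)) \<partial>lebesgue) = \<infinity>"
    "c3 \<in> einterval a b" "\<And>c. a < ereal c \<Longrightarrow> c < c3 \<Longrightarrow> AE x in lebesgue_on (einterval a c).
           q x \<ge> \<mu> * r x - s x * (qda x / g\<^sub>a x) + vector_derivative qda (at x) / g\<^sub>a x" by blast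
  from assms(12,14,16)[unfolded near_right]
  obtain d1 d2 d3 where d: "d1 \<in> einterval a b" "\<And>x. ereal x < b \<Longrightarrow> d1 < x \<Longrightarrow> g\<^sub>b x > 0"
    "d2 \<in> einterval a b" "\<And>d. ereal d < b \<Longrightarrow> d2 < d \<Longrightarrow> (\<integral>\<^sup>+x\<in>einterval d b. ennreal (1 / (p x * (g\<^sub>b x)\<^sup>2)) \<partial>lebesgue) = \<infinity>"
    "d3 \<in> einterval a b" "\<And>d. ereal d < b \<Longrightarrow> d3 < d \<Longrightarrow> AE x in lebesgue_on (einterval d b).
           q x \<ge> \<mu> * r x - s x * (qdb x / g\<^sub>b x) + vector_derivative qdb (at x) / g\<^sub>b x" by blast
  have below: "\<exists>y\<in>einterval a b. y < x" if x: "x \<in> einterval a b" for x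
  proof -
    obtain y where y: "a < ereal y" "ereal y < ereal x" using x ereal_dense2[of a "ereal x"] by (auto simp: einterval_iff)
    then have "y \<in> einterval a x" by (simp add: einterval_iff)
    then show ?thesis using y einterval_tails_subset[OF x] by auto
  qed
  have above: "\<exists>y\<in>einterval a b. x < y" if x: "x \<in> einterval a b" for x
  proof -
    obtain y where y: "ereal x < ereal y" "ereal y < b" using x ereal_dense2[of "ereal x" b] by (auto simp: einterval_iff)
    then have "y \<in> einterval x b" by (simp add: einterval_iff)
    then show ?thesis using y einterval_tails_subset[OF x] by auto
  qed
  \<comment> \<open>Beyond cL and dR all three conditions of the respective end hold. c0 and d0 are
    taken strictly further out, with d0 also to the right of c0.\<close>
  have "min c1 (min c2 c3) \<in> einterval a b" "max d1 (max d2 d3) \<in> einterval a b" using c d by (auto simp: min_def max_def)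
  then obtain cL dR where cL: "cL \<in> einterval a b" "cL < min c1 (min c2 c3)" and dR: "dR \<in> einterval a b" "max d1 (max d2 d3) < dR"
    using below above by meson
  obtain c0 where c0: "c0 \<in> einterval a b" "c0 < cL" using below[OF cL(1)] by blast
  have "max c0 dR \<in> einterval a b" using c0 dR by (auto simp: max_def)
  then obtain d0 where d0: "d0 \<in> einterval a b" "max c0 dR < d0" using above by blast
  have ends: "a < ereal cL" "a < ereal c0" "ereal dR < b" "ereal d0 < b" using cL c0 dR d0 by (auto simp: einterval_iff)
  obtain \<sigma> \<sigma>' g ka kb where gauge: "gauged_sturm_liouville a b p q r s \<sigma> \<sigma>' g \<mu> c0 d0" and k: "0 < ka" "0 < kb"
    and g: "\<And>x. x \<in> einterval a c0 \<Longrightarrow> g x = ka * g\<^sub>a x" "\<And>x. x \<in> einterval d0 b \<Longrightarrow> g x = kb * g\<^sub>b x"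
    and V: "\<And>x. x \<in> einterval a c0 \<Longrightarrow> q x + 2 * s x * \<sigma> x - \<sigma>' x - inverse (p x) * (\<sigma> x)\<^sup>2
      = q x - vector_derivative qda (at x) / g\<^sub>a x + s x * (qda x / g\<^sub>a x)"
    "\<And>x. x \<in> einterval d0 b \<Longrightarrow> q x + 2 * s x * \<sigma> x - \<sigma>' x - inverse (p x) * (\<sigma> x)\<^sup>2
      = q x - vector_derivative qdb (at x) / g\<^sub>b x + s x * (qdb x / g\<^sub>b x)"
  proof (rule SL.gauge_exists[OF assms(7) c0(1) d0(1) _ c0(2) cL(1) _ dR(1) assms(9) _ _ _ assms(10)])
    show "c0 < d0" "dR < d0" using d0(2) by auto
    show "0 < g\<^sub>a x" if "x \<in> einterval a cL" for x using c(2)[of x] cL(2) that by (auto simp: einterval_iff)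
    show "0 < g\<^sub>b x" if "x \<in> einterval dR b" for x using d(2)[of x] dR(2) that by (auto simp: einterval_iff)
    show "(\<integral>\<^sup>+x\<in>einterval a c0. ennreal (1 / (p x * (g\<^sub>a x)\<^sup>2)) \<partial>lebesgue) = \<infinity>"
      by (rule c(4)[OF ends(2)]) (use c0(2) cL(2) in auto)
    show "(\<integral>\<^sup>+x\<in>einterval d0 b. ennreal (1 / (p x * (g\<^sub>b x)\<^sup>2)) \<partial>lebesgue) = \<infinity>"
      by (rule d(4)[OF ends(4)]) (use d0(2) dR(2) in auto)
    show "AE x in lebesgue_on (einterval a cL). q x \<ge> \<mu> * r x - s x * (SL.quasi_deriv g\<^sub>a x / g\<^sub>a x)
        + vector_derivative (SL.quasi_deriv g\<^sub>a) (at x) / g\<^sub>a x"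
      using c(6)[OF ends(1)] cL(2) by (simp add: qda_def)
    show "AE x in lebesgue_on (einterval dR b). q x \<ge> \<mu> * r x - s x * (SL.quasi_deriv g\<^sub>b x / g\<^sub>b x)
        + vector_derivative (SL.quasi_deriv g\<^sub>b) (at x) / g\<^sub>b x"
      using d(6)[OF ends(3)] dR(2) by (simp add: qdb_def)
  qed (auto simp: qda_def qdb_def that)
  interpret G: gauged_sturm_liouville a b p q r s \<sigma> \<sigma>' g \<mu> c0 d0 by (rule gauge)
  have subL: "einterval a c \<subseteq> einterval a b" "einterval a c \<subseteq> einterval a c0" if "a < ereal c" "c \<le> c0" for c
  proof -
    show *: "einterval a c \<subseteq> einterval a c0" using that by (auto simp: einterval_iff)
    show "einterval a c \<subseteq> einterval a b" using * einterval_tails_subset[OF c0(1)] by blast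
  qed
  have subR: "einterval d b \<subseteq> einterval a b" "einterval d b \<subseteq> einterval d0 b" if "ereal d < b" "d0 \<le> d" for d
  proof -
    show *: "einterval d b \<subseteq> einterval d0 b" using that by (auto simp: einterval_iff)
    show "einterval d b \<subseteq> einterval a b" using * einterval_tails_subset[OF d0(1)] by blast
  qed
  \<comment> \<open>The integrand of the domain condition; k is the function given at the respective
    end.\<close>
  define E where "E k h x = p x * (k x)\<^sup>2 * (cmod (vector_derivative (\<lambda>y. h y / of_real (k y)) (at x)))\<^sup>2"
    for k :: "real \<Rightarrow> real" and h :: "real \<Rightarrow> complex" and x
  \<comment> \<open>The energy density is locally integrable, so it is integrable over (a,b) as soon
    as it is near both ends, where it agrees with E almost everywhere.\<close>
  have finite_energy: "h \<in> G.finite_energy \<longleftrightarrow>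
      (\<forall>\<^sub>F c in near_left_end a. (\<integral>\<^sup>+x\<in>einterval a c. ennreal (E g\<^sub>a h x) \<partial>lebesgue) < \<infinity>) \<and>
      (\<forall>\<^sub>F d in near_right_end b. (\<integral>\<^sup>+x\<in>einterval d b. ennreal (E g\<^sub>b h x) \<partial>lebesgue) < \<infinity>)"
    (is "_ \<longleftrightarrow> eventually ?P _ \<and> eventually ?Q _") if h: "h \<in> SL.dom_Tmax" for h
  proof -
    let ?e = "\<lambda>x. G.\<omega> x * (cmod (G.flux h x))\<^sup>2"
    note D = G.dom_Tmax_D(1)[OF h]
    note eloc = G.flux_energy_loc[OF D]
    have e0: "0 \<le> ?e x" for x using G.core.nonneg(1)[of x] by simp
    have meas: "?e \<in> borel_measurable (lebesgue_on (einterval u v))" if "einterval u v \<subseteq> einterval a b" for u v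
      using measurable_restrict_mono[OF _ that] loc_integrable_on_measurable[OF eloc SL.interval] by blast
    have eqL: "AE x in lebesgue_on (einterval a c). E g\<^sub>a h x = ?e x"
      if c: "a < ereal c" "c \<le> c0" for c
      unfolding E_def by (rule G.end_energy[OF D subL(1)[OF c] k(1)]) (use g(1) subL(2)[OF c] in blast)
    have eqR: "AE x in lebesgue_on (einterval d b). E g\<^sub>b h x = ?e x"
      if d: "ereal d < b" "d0 \<le> d" for d
      unfolding E_def by (rule G.end_energy[OF D subR(1)[OF d] k(2)]) (use g(2) subR(2)[OF d] in blast)
    show ?thesis
    proof
      assume "h \<in> G.finite_energy"
      then have int: "integrable (lebesgue_on (einterval a b)) ?e" by (simp add: G.finite_energy_def)
      have "?P c" if "a < ereal c" "c < c0" for c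
      proof (rule set_nn_integral_finite)
        show "integrable (lebesgue_on (einterval a c)) ?e"
          by (rule integrable_lebesgue_on_subset[OF int subL(1)]) (use that in auto)
        show "AE x in lebesgue_on (einterval a c). E g\<^sub>a h x \<le> ?e x"
          using eqL[of c] that by (auto elim!: eventually_mono)
      qed simp
      moreover have "?Q d" if "ereal d < b" "d0 < d" for d
      proof (rule set_nn_integral_finite)
        show "integrable (lebesgue_on (einterval d b)) ?e"
          by (rule integrable_lebesgue_on_subset[OF int subR(1)]) (use that in auto)
        show "AE x in lebesgue_on (einterval d b). E g\<^sub>b h x \<le> ?e x"
          using eqR[of d] that by (auto elim!: eventually_mono)
      qed simp
      ultimately show "eventually ?P (near_left_end a) \<and> eventually ?Q (near_right_end b)"
        unfolding near_left near_right using c0(1) d0(1) by blast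
    next
      assume "eventually ?P (near_left_end a) \<and> eventually ?Q (near_right_end b)"
      then obtain c' d' where c': "c' \<in> einterval a b" "\<And>c. a < ereal c \<Longrightarrow> c < c' \<Longrightarrow> ?P c"
        and d': "d' \<in> einterval a b" "\<And>d. ereal d < b \<Longrightarrow> d' < d \<Longrightarrow> ?Q d"
        unfolding near_left near_right by blast
      have "min c' c0 \<in> einterval a b" "max d' d0 \<in> einterval a b" using c' d' c0 d0 by (auto simp: min_def max_def)
      then obtain c d where cd: "c \<in> einterval a b" "c < min c' c0" "d \<in> einterval a b" "max d' d0 < d" using below above by meson
      have cd': "a < ereal c" "ereal d < b" "c \<le> c0" "d0 \<le> d" using cd by (auto simp: einterval_iff)
      have "integrable (lebesgue_on (einterval a b)) ?e"
      proof (rule integrable_of_ends[OF eloc cd(1,3)])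
        show "c \<le> d" using cd' d0(2) by simp
        show "integrable (lebesgue_on (einterval a c)) ?e"
          by (rule integrable_of_set_nn_integral_finite[OF _ meas[OF subL(1)] e0 eqL]) (use cd' cd c' in auto)
        show "integrable (lebesgue_on (einterval d b)) ?e"
          by (rule integrable_of_set_nn_integral_finite[OF _ meas[OF subR(1)] e0 eqR]) (use cd' cd d' in auto)
      qed
      then show "h \<in> G.finite_energy" using h by (simp add: G.finite_energy_def)
    qed
  qed
  have S_F: "S_F = {(L2_class M h, L2_class M (\<tau> h)) | h. h \<in> G.finite_energy}"
    unfolding S_F_def M_def \<tau>_def by (rule G.friedrichs_ext_eq(1))
  \<comment> \<open>The last claim allows any representative f of its class; it agrees almost
    everywhere with a function of finite energy, which leaves the integrals unchanged.\<close>
  have dom: "\<exists>h\<in>G.finite_energy. AE x in lebesgue_on (einterval a b). f x = h x"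
    if f: "f \<in> L2_fun M" "L2_class M f \<in> Domain S_F" for f
  proof -
    obtain h where h: "h \<in> G.finite_energy" "L2_class M f = L2_class M h" using f(2) unfolding S_F by blast
    then show ?thesis using L2_class_eq_iff[OF f(1), of h] unfolding M_def SL.AE_rmeas by blast
  qed
  have potential: "(\<integral>\<^sup>+x\<in>einterval u v. ennreal (\<bar>U x\<bar> * (cmod (f x))\<^sup>2) \<partial>lebesgue) < \<infinity>"
    if f: "f \<in> L2_fun M" "L2_class M f \<in> Domain S_F" and J: "einterval u v \<subseteq> einterval a b" "einterval u v \<inter> {c0..d0} = {}"
      and U: "\<And>x. x \<in> einterval u v \<Longrightarrow> G.V x = U x" for f u v U
  proof -
    obtain h where h: "h \<in> G.finite_energy" "AE x in lebesgue_on (einterval a b). f x = h x" using dom[OF f] by blast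
    show ?thesis
    proof (rule G.end_potential[OF h(1) J])
      have "AE x in lebesgue_on (einterval u v). f x = h x" by (rule AE_lebesgue_on_subset[OF h(2) J(1)]) auto
      moreover have "AE x in lebesgue_on (einterval u v). x \<in> einterval u v" by (rule AE_I2) simp
      ultimately show "AE x in lebesgue_on (einterval u v). \<bar>U x\<bar> * (cmod (f x))\<^sup>2 = \<bar>G.V x\<bar> * (cmod (h x))\<^sup>2"
        by eventually_elim (simp add: U)
    qed
  qed
  show ?thesis
  proof (intro conjI ballI impI, goal_cases)
    case 1
    have "h \<in> G.finite_energy \<longleftrightarrow> h \<in> SL.dom_Tmax \<and> h \<in> G.finite_energy" for h by (auto simp: G.finite_energy_def)
    then show ?case unfolding S_F using finite_energy[unfolded E_def] by (intro Collect_cong ex_cong1) blast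
  next
    case (2 f)
    show ?case
      unfolding near_left
    proof (intro bexI[OF _ c0(1)] allI impI potential 2; elim conjE)
      fix c assume c: "a < ereal c" "c < c0"
      show "einterval a c \<subseteq> einterval a b" "einterval a c \<inter> {c0..d0} = {}"
        using subL(1)[of c] c by (auto simp: einterval_iff)
      show "G.V x = q x - vector_derivative qda (at x) / g\<^sub>a x + s x * (qda x / g\<^sub>a x)" if "x \<in> einterval a c" for x
        unfolding G.V_def by (rule V(1)) (use that subL(2)[of c] c in auto)
    qed
  next
    case (3 f)
    show ?case
      unfolding near_right
    proof (intro bexI[OF _ d0(1)] allI impI potential 3; elim conjE)
      fix d assume d: "ereal d < b" "d0 < d"
      show "einterval d b \<subseteq> einterval a b" "einterval d b \<inter> {c0..d0} = {}"
        using subR(1)[of d] d by (auto simp: einterval_iff)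
      show "G.V x = q x - vector_derivative qdb (at x) / g\<^sub>b x + s x * (qdb x / g\<^sub>b x)" if "x \<in> einterval d b" for x
        unfolding G.V_def by (rule V(2)) (use that subR(2)[of d] d in auto)
    qed
  qed
qed

end
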